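(* Let $k\ge 0$ be an integer and let $T\subset\mathbb R^3$ be a polyhedron. The bilinear forms $(\cdot,\cdot)_{\mathbf{grad},T}$ on $\underline X_{\mathbf{grad},T}^k$, $(\cdot,\cdot)_{\mathbf{curl},T}$ on $\underline{\mathbf X}_{\mathbf{curl},T}^k$ and $(\cdot,\cdot)_{\mathrm{div},T}$ on $\underline{\mathbf X}_{\mathrm{div},T}^k$ are positive definite. Additionally, they satisfy the following consistency properties: $$(\underline I_{\mathbf{grad},T}^kq,\underline I_{\mathbf{grad},T}^kr)_{\mathbf{grad},T}=(q,r)_{L^2(T)}\qquad\forall q,r\in\mathcal P^{k+1}(T),$$ $$(\underline{\mathbf I}_{\mathbf{curl},T}^k\mathbf v,\underline{\mathbf I}_{\mathbf{curl},T}^k\mathbf w)_{\mathbf{curl},T}=(\mathbf v,\mathbf w)_{L^2(T)^3}\qquad\forall\mathbf v,\mathbf w\in\mathcal P^k(T)^3,$$ $$(\underline{\mathbf I}_{\mathrm{div},T}^k\mathbf v,\underline{\mathbf I}_{\mathrm{div},T}^k\mathbf w)_{\mathrm{div},T}=(\mathbf v,\mathbf w)_{L^2(T)^3}\qquad\forall\mathbf v,\mathbf w\in\mathcal P^k(T)^3.$$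
   Context: Geometry. A polyhedron $T$ is a connected set that is the interior of a finite union of tetrahedra; $T$ is assumed simply connected with connected Lipschitz-continuous boundary. $\mathcal F_T$, $\mathcal E_T$, $\mathcal V_T$ are its sets of planar polygonal faces, edges and vertices; $\partial^2T=\bigcup_{E\in\mathcal E_T}\overline E$; each edge is shared by exactly two faces; $h_T$ is the diameter of $T$. Each face $F$ is a polygon (connected interior, in its plane, of a finite union of triangles), simply connected with connected Lipschitz boundary, with edges $\mathcal E_F$, vertices $\mathcal V_F$ and a fixed unit normal $\mathbf n_F$; $\omega_{TF}=1$ if $\mathbf n_F$ points out of $T$, $-1$ otherwise. Tangent fields on $F$ are regarded as $\mathbb R^2$-valued. Each edge $E$ has a fixed unit tangent $\mathbf t_E$. For $E\in\mathcal E_F$, $\mathbf n_{FE}$ is the unit normal to $E$ in the plane of $F$ such that $(\mathbf t_E,\mathbf n_{FE},\mathbf n_F)$ is right-handed; $\partial F$ is oriented counter-clockwise with respect to $\mathbf n_F$ and $\omega_{FE}=1$ if $\mathbf t_E$ is opposite to the orientation of $\partial F$, $-1$ otherwise (so $\omega_{FE}\mathbf n_{FE}$ points out of $F$). $\mathbf x_V$ is the coordinate vector of the vertex $V$. Polynomials. $\mathcal P^\ell(X)$: restrictions to $X$ (edge, face, polyhedron) of polynomials of total degree $\le\ell$, $\mathcal P^{-1}(X)=\{0\}$; $\mathcal P^{0,\ell}(X)$: its zero-average subspace; $\pi_{\mathcal P,X}^\ell$: $L^2$-orthogonal projector on $\mathcal P^\ell(X)$. $\mathcal P^\ell(\mathcal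 F_T)$, $\mathcal P^\ell(\mathcal E_T)$, $\mathcal P^\ell(\mathcal E_F)$: functions on $\partial T$, $\partial^2T$, $\partial F$ that are in $\mathcal P^\ell$ on each face (resp. edge), without continuity; $\mathcal P_c^\ell(\partial^2T)=\mathcal P^\ell(\mathcal E_T)\cap C^0(\partial^2T)$, $\mathcal P_c^\ell(\partial F)=\mathcal P^\ell(\mathcal E_F)\cap C^0(\partial F)$. $\mathbf{grad}_F$: tangential gradient on $F$; $\mathbf{rot}_Fr=\varrho_{-\pi/2}(\mathbf{grad}_Fr)$ with $\varrho_{-\pi/2}$ the rotation of angle $-\pi/2$ in the oriented plane of $F$. $\boldsymbol{\mathcal R}^\ell(F)=\mathbf{rot}_F\mathcal P^{\ell+1}(F)$, $\boldsymbol{\mathcal R}^\ell(T)=\mathbf{curl}\,\mathcal P^{\ell+1}(T)^3$, $\boldsymbol{\mathcal G}^\ell(T)=\mathbf{grad}\,\mathcal P^{\ell+1}(T)$; $\boldsymbol{\mathcal R}^\ell(F)^\perp$, $\boldsymbol{\mathcal R}^\ell(T)^\perp$, $\boldsymbol{\mathcal G}^\ell(T)^\perp$ are their $L^2$-orthogonal complements in $\mathcal P^\ell(F)^2$, $\mathcal P^\ell(T)^3$, $\mathcal P^\ell(T)^3$. The $L^2$-orthogonal projectors on $\boldsymbol{\mathcal R}^\ell(X)$, $\boldsymbol{\mathcal R}^\ell(X)^\perp$, $\boldsymbol{\mathcal G}^\ell(T)$, $\boldsymbol{\mathcal G}^\ell(T)^\perp$ are $\boldsymbol\pi_{\mathcal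 R,X}^\ell$, $\boldsymbol\pi_{\mathcal R,X}^{\perp,\ell}$, $\boldsymbol\pi_{\mathcal G,T}^\ell$, $\boldsymbol\pi_{\mathcal G,T}^{\perp,\ell}$. Spaces. $\underline X_{\mathbf{grad},T}^k=\mathcal P^{k-1}(T)\times\mathcal P^{k-1}(\mathcal F_T)\times\mathcal P_c^{k+1}(\partial^2T)$, elements $\underline q_T=(q_T,q_{\partial T},q_{\partial^2T})$, $q_F=(q_{\partial T})_{|F}$, $q_E=(q_{\partial^2T})_{|E}$. $\underline{\mathbf X}_{\mathbf{curl},T}^k=\big(\boldsymbol{\mathcal R}^{k-1}(T)\oplus\boldsymbol{\mathcal R}^k(T)^\perp\big)\times\prod_{F\in\mathcal F_T}\big(\boldsymbol{\mathcal R}^{k-1}(F)\oplus\boldsymbol{\mathcal R}^k(F)^\perp\big)\times\mathcal P^k(\mathcal E_T)$, elements $\underline{\mathbf v}_T=(\mathbf v_T=\mathbf v_{\mathcal R,T}+\mathbf v_{\mathcal R,T}^\perp,(\mathbf v_F=\mathbf v_{\mathcal R,F}+\mathbf v_{\mathcal R,F}^\perp)_{F\in\mathcal F_T},v_{\partial^2T})$. $\underline{\mathbf X}_{\mathrm{div},T}^k=\big(\boldsymbol{\mathcal G}^{k-1}(T)\oplus\boldsymbol{\mathcal G}^k(T)^\perp\big)\times\mathcal P^k(\mathcal F_T)$, elements $\underline{\mathbf v}_T=(\mathbf v_T=\mathbf v_{\mathcal G,T}+\mathbf v_{\mathcal G,T}^\perp,v_{\partial T})$, $v_F=(v_{\partial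 T})_{|F}$. Face spaces: $\underline X_{\mathbf{grad},F}^k=\mathcal P^{k-1}(F)\times\mathcal P_c^{k+1}(\partial F)$, elements $\underline q_F=(q_F,q_{\partial F})$; $\underline{\mathbf X}_{\mathrm{rot},F}^k=(\boldsymbol{\mathcal R}^{k-1}(F)\oplus\boldsymbol{\mathcal R}^k(F)^\perp)\times\mathcal P^k(\mathcal E_F)$, elements $\underline{\mathbf v}_F=(\mathbf v_F=\mathbf v_{\mathcal R,F}+\mathbf v_{\mathcal R,F}^\perp,v_{\partial F})$. The restrictions of $\underline q_T$ and $\underline{\mathbf v}_T\in\underline{\mathbf X}_{\mathbf{curl},T}^k$ to a face $F$ are $\underline q_F=(q_F,(q_{\partial^2T})_{|\partial F})$ and $\underline{\mathbf v}_F=(\mathbf v_F,(v_{\partial^2T})_{|\partial F})$. Interpolators. For $q\in C^0(\overline T)$, $\underline I_{\mathbf{grad},T}^kq=(q_T,q_{\partial T},q_{\partial^2T})$ with $q_T=\pi_{\mathcal P,T}^{k-1}q$, $q_F=\pi_{\mathcal P,F}^{k-1}q_{|F}$ for all $F\in\mathcal F_T$, $\pi_{\mathcal P,E}^{k-1}q_E=\pi_{\mathcal P,E}^{k-1}q_{|E}$ for all $E\in\mathcal E_T$, $q_{\partial^2T}(\mathbf x_V)=q(\mathbf x_V)$ for all $V\in\mathcal V_T$. For $q\in C^0(\overline F)$, $\underline I_{\mathbf{grad},F}^kq=(q_F,q_{\partial F})$ with $q_F=\pi_{\mathcal P,F}^{k-1}q$, $\pi_{\mathcal P,E}^{k-1}(q_{\partial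 F})_{|E}=\pi_{\mathcal P,E}^{k-1}q_{|E}$ for all $E\in\mathcal E_F$, $q_{\partial F}(\mathbf x_V)=q(\mathbf x_V)$ for all $V\in\mathcal V_F$. For $\mathbf v\in C^0(\overline T)^3$, with $\mathbf v_{\tau,F}=\mathbf n_F\times(\mathbf v_{|F}\times\mathbf n_F)$, $\underline{\mathbf I}_{\mathbf{curl},T}^k\mathbf v=\big(\boldsymbol\pi_{\mathcal R,T}^{k-1}\mathbf v+\boldsymbol\pi_{\mathcal R,T}^{\perp,k}\mathbf v,(\boldsymbol\pi_{\mathcal R,F}^{k-1}\mathbf v_{\tau,F}+\boldsymbol\pi_{\mathcal R,F}^{\perp,k}\mathbf v_{\tau,F})_{F\in\mathcal F_T},(\pi_{\mathcal P,E}^k(\mathbf v\cdot\mathbf t_E))_{E\in\mathcal E_T}\big)$ and $\underline{\mathbf I}_{\mathrm{div},T}^k\mathbf v=\big(\boldsymbol\pi_{\mathcal G,T}^{k-1}\mathbf v+\boldsymbol\pi_{\mathcal G,T}^{\perp,k}\mathbf v,(\pi_{\mathcal P,F}^k(\mathbf v\cdot\mathbf n_F))_{F\in\mathcal F_T}\big)$. Face operators. Face curl $C_F^k\underline{\mathbf v}_F\in\mathcal P^k(F)$: $\int_FC_F^k\underline{\mathbf v}_F\,r_F=\int_F\mathbf v_{\mathcal R,F}\cdot\mathbf{rot}_Fr_F-\sum_{E\in\mathcal E_F}\omega_{FE}\int_Ev_{\partial F}r_F$ for all $r_F\in\mathcal P^k(F)$. Scalar traces: for each $F$, $\gamma_F^{k+1}:\underline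 X_{\mathbf{grad},F}^k\to\mathcal P^{k+1}(F)$ is any fixed linear operator such that $\gamma_F^{k+1}(\underline I_{\mathbf{grad},F}^kq)=q$ for all $q\in\mathcal P^{k+1}(F)$ and $\pi_{\mathcal P,F}^{k-1}(\gamma_F^{k+1}\underline q_F)=q_F$ for all $\underline q_F$. Tangential traces: $\boldsymbol\gamma_{\mathrm t,F}^k\underline{\mathbf v}_F\in\mathcal P^k(F)^2$ is the unique polynomial such that $\int_F\boldsymbol\gamma_{\mathrm t,F}^k\underline{\mathbf v}_F\cdot\mathbf{rot}_Fr_F=\int_FC_F^k\underline{\mathbf v}_F\,r_F+\sum_{E\in\mathcal E_F}\omega_{FE}\int_Ev_{\partial F}r_F$ for all $r_F\in\mathcal P^{0,k+1}(F)$ and $\int_F\boldsymbol\gamma_{\mathrm t,F}^k\underline{\mathbf v}_F\cdot\mathbf w_F=\int_F\mathbf v_{\mathcal R,F}^\perp\cdot\mathbf w_F$ for all $\mathbf w_F\in\boldsymbol{\mathcal R}^k(F)^\perp$. Volume operators. Full gradient $\mathring{\mathbf G}_T^k\underline q_T\in\mathcal P^k(T)^3$, extended below by the same formula only as a fixed polynomial: $\int_T\mathring{\mathbf G}_T^k\underline q_T\cdot\mathbf v_T=-\int_Tq_T\,\mathrm{div}\,\mathbf v_T+\sum_{F\in\mathcal F_T}\omega_{TF}\int_F\gamma_F^{k+1}\underline q_F(\mathbf v_T\cdot\mathbf n_F)$ for all $\mathbf v_T\in\mathcal P^k(T)^3$. Full curl $\mathring{\mathbf C}_T^k\underline{\mathbf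 v}_T\in\mathcal P^k(T)^3$: $\int_T\mathring{\mathbf C}_T^k\underline{\mathbf v}_T\cdot\mathbf w_T=\int_T\mathbf v_T\cdot\mathbf{curl}\,\mathbf w_T+\sum_{F\in\mathcal F_T}\omega_{TF}\int_F\boldsymbol\gamma_{\mathrm t,F}^k\underline{\mathbf v}_F\cdot(\mathbf w_T\times\mathbf n_F)$ for all $\mathbf w_T\in\mathcal P^k(T)^3$. Divergence $D_T^k\underline{\mathbf v}_T\in\mathcal P^k(T)$: $\int_TD_T^k\underline{\mathbf v}_T\,q_T=-\int_T\mathbf v_T\cdot\mathbf{grad}\,q_T+\sum_{F\in\mathcal F_T}\omega_{TF}\int_Fv_Fq_T$ for all $q_T\in\mathcal P^k(T)$. Potentials (each uniquely defined by the stated relations). $P_{\mathbf{grad},T}^{k+1}\underline q_T\in\mathcal P^{k+1}(T)$: $\int_TP_{\mathbf{grad},T}^{k+1}\underline q_T\,\mathrm{div}\,\mathbf v_T=-\int_T\mathring{\mathbf G}_T^k\underline q_T\cdot\mathbf v_T+\sum_{F\in\mathcal F_T}\omega_{TF}\int_F\gamma_F^{k+1}\underline q_F(\mathbf v_T\cdot\mathbf n_F)$ for all $\mathbf v_T\in\boldsymbol{\mathcal R}^{k+2}(T)^\perp$. $\mathbf P_{\mathbf{curl},T}^k\underline{\mathbf v}_T\in\mathcal P^k(T)^3$: $\int_T\mathbf P_{\mathbf{curl},T}^k\underline{\mathbf v}_T\cdot\mathbf{curl}\,\mathbf w_T=\int_T\mathring{\mathbf C}_T^k\underline{\mathbf v}_T\cdot\mathbf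 w_T-\sum_{F\in\mathcal F_T}\omega_{TF}\int_F\boldsymbol\gamma_{\mathrm t,F}^k\underline{\mathbf v}_F\cdot(\mathbf w_T\times\mathbf n_F)$ for all $\mathbf w_T\in\boldsymbol{\mathcal G}^{k+1}(T)^\perp$, and $\int_T\mathbf P_{\mathbf{curl},T}^k\underline{\mathbf v}_T\cdot\mathbf w_T=\int_T\mathbf v_{\mathcal R,T}^\perp\cdot\mathbf w_T$ for all $\mathbf w_T\in\boldsymbol{\mathcal R}^k(T)^\perp$. $\mathbf P_{\mathrm{div},T}^k\underline{\mathbf v}_T\in\mathcal P^k(T)^3$: $\int_T\mathbf P_{\mathrm{div},T}^k\underline{\mathbf v}_T\cdot\mathbf{grad}\,q_T=-\int_TD_T^k\underline{\mathbf v}_T\,q_T+\sum_{F\in\mathcal F_T}\omega_{TF}\int_Fv_Fq_T$ for all $q_T\in\mathcal P^{0,k+1}(T)$, and $\int_T\mathbf P_{\mathrm{div},T}^k\underline{\mathbf v}_T\cdot\mathbf w_T=\int_T\mathbf v_{\mathcal G,T}^\perp\cdot\mathbf w_T$ for all $\mathbf w_T\in\boldsymbol{\mathcal G}^k(T)^\perp$. Bilinear forms. (i) With $(\delta_T\underline q_T,(\delta_F\underline q_T)_{F\in\mathcal F_T},(\delta_E\underline q_T)_{E\in\mathcal E_T})=\underline I_{\mathbf{grad},T}^k(P_{\mathbf{grad},T}^{k+1}\underline q_T)-\underline q_T$ (volume, face and edge components), $$(\underline q_T,\underline r_T)_{\mathbf{grad},T}=\int_TP_{\mathbf{grad},T}^{k+1}\underline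 q_T\,P_{\mathbf{grad},T}^{k+1}\underline r_T+\int_T\delta_T\underline q_T\,\delta_T\underline r_T+\sum_{F\in\mathcal F_T}h_T\int_F\delta_F\underline q_T\,\delta_F\underline r_T+\sum_{E\in\mathcal E_T}h_T^2\int_E\delta_E\underline q_T\,\delta_E\underline r_T.$$ (ii) With $(\boldsymbol\delta_T\underline{\mathbf v}_T+\boldsymbol\delta_T^\perp\underline{\mathbf v}_T,(\boldsymbol\delta_F\underline{\mathbf v}_T+\boldsymbol\delta_F^\perp\underline{\mathbf v}_T)_{F\in\mathcal F_T},(\delta_E\underline{\mathbf v}_T)_{E\in\mathcal E_T})=\underline{\mathbf I}_{\mathbf{curl},T}^k(\mathbf P_{\mathbf{curl},T}^k\underline{\mathbf v}_T)-\underline{\mathbf v}_T$, where $\boldsymbol\delta_X\in\boldsymbol{\mathcal R}^{k-1}(X)$ and $\boldsymbol\delta_X^\perp\in\boldsymbol{\mathcal R}^k(X)^\perp$ for $X=T,F$, $$\begin{aligned}(\underline{\mathbf v}_T,\underline{\mathbf w}_T)_{\mathbf{curl},T}={}&\int_T\mathbf P_{\mathbf{curl},T}^k\underline{\mathbf v}_T\cdot\mathbf P_{\mathbf{curl},T}^k\underline{\mathbf w}_T+\int_T\boldsymbol\delta_T\underline{\mathbf v}_T\cdot\boldsymbol\delta_T\underline{\mathbf w}_T\\&+\sum_{F\in\mathcal F_T}h_T\int_F\big(\boldsymbol\delta_F\underline{\mathbf v}_T\cdot\boldsymbol\delta_F\underline{\mathbf w}_T+\boldsymbol\delta_F^\perp\underline{\mathbf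 v}_T\cdot\boldsymbol\delta_F^\perp\underline{\mathbf w}_T\big)+\sum_{E\in\mathcal E_T}h_T^2\int_E\delta_E\underline{\mathbf v}_T\,\delta_E\underline{\mathbf w}_T.\end{aligned}$$ (iii) With $\delta_{\mathrm{div},F}^k\underline{\mathbf v}_T=\mathbf P_{\mathrm{div},T}^k\underline{\mathbf v}_T\cdot\mathbf n_F-v_F$ on each $F\in\mathcal F_T$, $$(\underline{\mathbf v}_T,\underline{\mathbf w}_T)_{\mathrm{div},T}=\int_T\mathbf P_{\mathrm{div},T}^k\underline{\mathbf v}_T\cdot\mathbf P_{\mathrm{div},T}^k\underline{\mathbf w}_T+\sum_{F\in\mathcal F_T}h_T\int_F\delta_{\mathrm{div},F}^k\underline{\mathbf v}_T\,\delta_{\mathrm{div},F}^k\underline{\mathbf w}_T.$$ *)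

theory Defs
  imports "HOL-Analysis.Analysis" "HOL-Library.Function_Algebras"
begin

section \<open>Functions as a real vector space\<close>

instantiation "fun" :: (type, scaleR) scaleR
begin

definition scaleR_fun :: "real \<Rightarrow> ('a \<Rightarrow> 'b) \<Rightarrow> 'a \<Rightarrow> 'b"
  where "scaleR_fun c f = (\<lambda>x. c *\<^sub>R f x)"

instance ..

end

instance "fun" :: (type, real_vector) real_vector
  by standard (simp_all add: scaleR_fun_def fun_eq_iff scaleR_add_right scaleR_add_left)

text \<open>The elements of the discrete spaces below are tuples of functions, so that the pointwise
  operations give their linear structure; a bilinear form is only meaningful on the carrier \<open>X\<close>.\<close>

definition pos_def_form_on :: "'a::real_vector set \<Rightarrow> ('a \<Rightarrow> 'a \<Rightarrow> real) \<Rightarrow> bool" where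
  "pos_def_form_on X B \<longleftrightarrow>
     (\<forall>x\<in>X. \<forall>y\<in>X. \<forall>z\<in>X. \<forall>a b.
        B (a *\<^sub>R x + b *\<^sub>R y) z = a * B x z + b * B y z \<and>
        B z (a *\<^sub>R x + b *\<^sub>R y) = a * B z x + b * B z y) \<and>
     (\<forall>x\<in>X. \<forall>y\<in>X. B x y = B y x) \<and>
     (\<forall>x\<in>X. x \<noteq> 0 \<longrightarrow> 0 < B x x)"


section \<open>Geometry\<close>

type_synonym pt = "real ^ 3"

text \<open>Relative to its affine hull, \<open>S\<close> lies locally on one side of the graph of a Lipschitz
  function. The argument of \<open>\<phi>\<close> is the component of \<open>y - x\<close> orthogonal to the direction \<open>e\<close>.\<close>

definition lipschitz_boundary :: "'a::euclidean_space set \<Rightarrow> bool" where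
  "lipschitz_boundary S \<longleftrightarrow>
     (\<forall>x\<in>rel_frontier S. \<exists>e \<phi> L r.
        norm e = 1 \<and> x + e \<in> affine hull S \<and> L-lipschitz_on UNIV (\<phi> :: 'a \<Rightarrow> real) \<and> 0 < r \<and>
        (\<forall>y \<in> ball x r \<inter> affine hull S.
           y \<in> S \<longleftrightarrow> (y - x) \<bullet> e < \<phi> (y - x - ((y - x) \<bullet> e) *\<^sub>R e)))"

definition polyhedral_domain :: "pt set \<Rightarrow> bool" where
  "polyhedral_domain T \<longleftrightarrow>
     T \<noteq> {} \<and> connected T \<and>
     (\<exists>\<K>. finite \<K> \<and> (\<forall>K\<in>\<K>. 3 simplex K) \<and> T = interior (\<Union>\<K>)) \<and>
     simply_connected T \<and> connected (frontier T) \<and> lipschitz_boundary T"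

definition polygonal_domain :: "pt set \<Rightarrow> bool" where
  "polygonal_domain F \<longleftrightarrow>
     F \<noteq> {} \<and> connected F \<and>
     (\<exists>\<K>. finite \<K> \<and> (\<forall>K\<in>\<K>. 2 simplex K) \<and> aff_dim (\<Union>\<K>) = 2 \<and> F = rel_interior (\<Union>\<K>)) \<and>
     simply_connected F \<and> connected (rel_frontier F) \<and> lipschitz_boundary F"

text \<open>Faces are relatively open polygons, edges are open segments. Coplanar neighbouring faces and
  collinear neighbouring edges are allowed.\<close>

record polyhedral_cell =
  cell :: "pt set"
  faces :: "pt set set"
  edges :: "pt set set"
  vertices :: "pt set"
  fnormal :: "pt set \<Rightarrow> pt"
  etangent :: "pt set \<Rightarrow> pt"

definition edges_of :: "polyhedral_cell \<Rightarrow> pt set \<Rightarrow> pt set set" where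
  "edges_of M F = {E \<in> edges M. E \<subseteq> rel_frontier F}"

definition vertices_of :: "polyhedral_cell \<Rightarrow> pt set \<Rightarrow> pt set" where
  "vertices_of M F = vertices M \<inter> rel_frontier F"

definition is_polyhedron :: "polyhedral_cell \<Rightarrow> bool" where
  "is_polyhedron M \<longleftrightarrow>
     polyhedral_domain (cell M) \<and>
     finite (faces M) \<and> (\<forall>F\<in>faces M. polygonal_domain F) \<and>
     pairwise disjnt (faces M) \<and> frontier (cell M) = (\<Union>F\<in>faces M. closure F) \<and>
     finite (edges M) \<and> pairwise disjnt (edges M) \<and>
     (\<forall>E\<in>edges M. \<exists>a\<in>vertices M. \<exists>b\<in>vertices M. a \<noteq> b \<and> E = open_segment a b) \<and>
     (\<forall>V\<in>vertices M. (\<exists>E\<in>edges M. V \<in> closure E) \<and> V \<notin> \<Union>(edges M)) \<and>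
     (\<forall>F\<in>faces M. rel_frontier F = (\<Union>E\<in>edges_of M F. closure E)) \<and>
     (\<forall>E\<in>edges M. card {F \<in> faces M. E \<in> edges_of M F} = 2) \<and>
     (\<forall>F\<in>faces M. norm (fnormal M F) = 1 \<and> (\<forall>x\<in>F. \<forall>y\<in>F. (y - x) \<bullet> fnormal M F = 0)) \<and>
     (\<forall>E\<in>edges M. \<exists>a b. a \<noteq> b \<and> E = open_segment a b \<and> etangent M E = sgn (b - a))"

definition points_out :: "pt \<Rightarrow> pt set \<Rightarrow> pt set \<Rightarrow> bool" where
  "points_out v S X \<longleftrightarrow>
     (\<forall>x\<in>X. \<exists>\<epsilon>>0. \<forall>s. 0 < s \<and> s < \<epsilon> \<longrightarrow> x - s *\<^sub>R v \<in> S \<and> x + s *\<^sub>R v \<notin> S)"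

definition omega_TF :: "polyhedral_cell \<Rightarrow> pt set \<Rightarrow> real" where
  "omega_TF M F = (if points_out (fnormal M F) (cell M) F then 1 else -1)"

text \<open>\<open>(t, n\<^sub>F \<times> t, n\<^sub>F)\<close> is right-handed.\<close>

definition normal_FE :: "polyhedral_cell \<Rightarrow> pt set \<Rightarrow> pt set \<Rightarrow> pt" where
  "normal_FE M F E = cross3 (fnormal M F) (etangent M E)"

text \<open>The tangent \<open>t\<close> runs counter-clockwise around \<open>F\<close> when \<open>F\<close> lies to its left, that is, when
  \<open>n\<^sub>F \<times> t\<close> points into \<open>F\<close>; it is opposite to that orientation when \<open>n\<^sub>F \<times> t\<close> points out of \<open>F\<close>.\<close>

definition omega_FE :: "polyhedral_cell \<Rightarrow> pt set \<Rightarrow> pt set \<Rightarrow> real" where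
  "omega_FE M F E = (if points_out (normal_FE M F E) F E then 1 else -1)"


section \<open>Integration on the cell, its faces and its edges\<close>

definition vol_measure :: "polyhedral_cell \<Rightarrow> pt measure" where
  "vol_measure M = restrict_space lborel (cell M)"

text \<open>Lebesgue measure of the plane of \<open>F\<close>, transported by a Cartesian coordinate system of that
  plane; it depends neither on the origin \<open>x\<^sub>0\<close> nor on the orthonormal frame.\<close>

definition area_measure :: "polyhedral_cell \<Rightarrow> pt set \<Rightarrow> pt measure" where
  "area_measure M F =
     (let n = fnormal M F; x\<^sub>0 = (SOME x. x \<in> F); a = (SOME a. norm a = 1 \<and> a \<bullet> n = 0); b = cross3 n a
      in restrict_space
           (distr (lborel :: (real \<times> real) measure) borel (\<lambda>(s, t). x\<^sub>0 + s *\<^sub>R a + t *\<^sub>R b)) F)"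

definition length_measure :: "polyhedral_cell \<Rightarrow> pt set \<Rightarrow> pt measure" where
  "length_measure M E =
     (let x\<^sub>0 = (SOME x. x \<in> E)
      in restrict_space (distr (lborel :: real measure) borel (\<lambda>s. x\<^sub>0 + s *\<^sub>R etangent M E)) E)"

definition int_T :: "polyhedral_cell \<Rightarrow> (pt \<Rightarrow> real) \<Rightarrow> real" where
  "int_T M f = (\<integral>x. f x \<partial>vol_measure M)"

definition int_F :: "polyhedral_cell \<Rightarrow> pt set \<Rightarrow> (pt \<Rightarrow> real) \<Rightarrow> real" where
  "int_F M F f = (\<integral>x. f x \<partial>area_measure M F)"

definition int_E :: "polyhedral_cell \<Rightarrow> pt set \<Rightarrow> (pt \<Rightarrow> real) \<Rightarrow> real" where
  "int_E M E f = (\<integral>x. f x \<partial>length_measure M E)"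

definition l2_proj :: "pt measure \<Rightarrow> (pt \<Rightarrow> 'b::real_inner) set \<Rightarrow> (pt \<Rightarrow> 'b) \<Rightarrow> pt \<Rightarrow> 'b" where
  "l2_proj \<mu> S f = (THE g. g \<in> S \<and> (\<forall>h\<in>S. (\<integral>x. (f x - g x) \<bullet> h x \<partial>\<mu>) = 0))"

definition l2_compl ::
  "pt measure \<Rightarrow> (pt \<Rightarrow> 'b::real_inner) set \<Rightarrow> (pt \<Rightarrow> 'b) set \<Rightarrow> (pt \<Rightarrow> 'b) set" where
  "l2_compl \<mu> A S = {v \<in> A. \<forall>w\<in>S. (\<integral>x. v x \<bullet> w x \<partial>\<mu>) = 0}"


section \<open>Polynomial spaces\<close>

text \<open>The degree is an integer; degree \<open>-1\<close> gives the zero space.\<close>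

definition polys :: "int \<Rightarrow> (pt \<Rightarrow> real) set" where
  "polys l = span {(\<lambda>x. \<Prod>i\<in>UNIV. (x $ i) ^ \<alpha> i) |\<alpha> :: 3 \<Rightarrow> nat. int (\<Sum>i\<in>UNIV. \<alpha> i) \<le> l}"

definition vpolys :: "int \<Rightarrow> (pt \<Rightarrow> pt) set" where
  "vpolys l = {v. \<forall>i. (\<lambda>x. v x $ i) \<in> polys l}"

text \<open>The open set \<open>T\<close> is nonempty, so a polynomial on \<open>T\<close> is identified with the polynomial on the
  whole space that it determines: the spaces \<open>polys l\<close> and \<open>vpolys l\<close> play the role of
  \<open>P\<^sup>l(T)\<close> and \<open>P\<^sup>l(T)\<^sup>3\<close>, and the traces on faces and edges need no extension operator. A
  polynomial on a face or an edge, in contrast, is a genuine restriction, extended by zero so that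
  equality of functions means equality on \<open>X\<close>.\<close>

definition restr :: "pt set \<Rightarrow> (pt \<Rightarrow> 'b::zero) \<Rightarrow> pt \<Rightarrow> 'b" where
  "restr X f = (\<lambda>x. if x \<in> X then f x else 0)"

definition polys_on :: "int \<Rightarrow> pt set \<Rightarrow> (pt \<Rightarrow> real) set" where
  "polys_on l X = restr X ` polys l"

text \<open>Tangential polynomial fields on \<open>F\<close>; the coordinates in an orthonormal frame of the plane of
  \<open>F\<close> identify this space with \<open>P\<^sup>l(F)\<^sup>2\<close>.\<close>

definition tpolys_on :: "polyhedral_cell \<Rightarrow> int \<Rightarrow> pt set \<Rightarrow> (pt \<Rightarrow> pt) set" where
  "tpolys_on M l F = {v \<in> restr F ` vpolys l. \<forall>x\<in>F. v x \<bullet> fnormal M F = 0}"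

definition skeleton :: "pt set set \<Rightarrow> pt set" where
  "skeleton \<E> = (\<Union>E\<in>\<E>. closure E)"

definition polys_c :: "int \<Rightarrow> pt set set \<Rightarrow> (pt \<Rightarrow> real) set" where
  "polys_c l \<E> = {q. continuous_on (skeleton \<E>) q \<and> (\<forall>x. x \<notin> skeleton \<E> \<longrightarrow> q x = 0) \<and>
                    (\<forall>E\<in>\<E>. restr E q \<in> polys_on l E)}"

definition polys_family :: "int \<Rightarrow> pt set set \<Rightarrow> (pt set \<Rightarrow> pt \<Rightarrow> real) set" where
  "polys_family l \<X> = {q. (\<forall>X\<in>\<X>. q X \<in> polys_on l X) \<and> (\<forall>X. X \<notin> \<X> \<longrightarrow> q X = 0)}"

definition grad :: "(pt \<Rightarrow> real) \<Rightarrow> pt \<Rightarrow> pt" where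
  "grad q x = (\<chi> i. frechet_derivative q (at x) (axis i 1))"

definition dvg :: "(pt \<Rightarrow> pt) \<Rightarrow> pt \<Rightarrow> real" where
  "dvg v x = (\<Sum>i\<in>UNIV. frechet_derivative v (at x) (axis i 1) $ i)"

definition curl :: "(pt \<Rightarrow> pt) \<Rightarrow> pt \<Rightarrow> pt" where
  "curl v x = (let D = (\<lambda>i j. frechet_derivative v (at x) (axis i 1) $ j)
               in vector [D 2 3 - D 3 2, D 3 1 - D 1 3, D 1 2 - D 2 1])"

text \<open>Applied to a polynomial on the whole space, these give, at the points of \<open>F\<close>, the tangential
  gradient of its restriction to \<open>F\<close> and the rotated gradient: on tangent vectors,
  \<open>g \<mapsto> g \<times> n\<close> is the rotation of angle \<open>-\<pi>/2\<close> in the plane oriented by \<open>n\<close>.\<close>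

definition grad_F :: "polyhedral_cell \<Rightarrow> pt set \<Rightarrow> (pt \<Rightarrow> real) \<Rightarrow> pt \<Rightarrow> pt" where
  "grad_F M F r x = grad r x - (grad r x \<bullet> fnormal M F) *\<^sub>R fnormal M F"

definition rot_F :: "polyhedral_cell \<Rightarrow> pt set \<Rightarrow> (pt \<Rightarrow> real) \<Rightarrow> pt \<Rightarrow> pt" where
  "rot_F M F r x = cross3 (grad_F M F r x) (fnormal M F)"

definition R_F :: "polyhedral_cell \<Rightarrow> int \<Rightarrow> pt set \<Rightarrow> (pt \<Rightarrow> pt) set" where
  "R_F M l F = (\<lambda>r. restr F (rot_F M F r)) ` polys (l + 1)"

definition R_T :: "int \<Rightarrow> (pt \<Rightarrow> pt) set" where
  "R_T l = curl ` vpolys (l + 1)"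

definition G_T :: "int \<Rightarrow> (pt \<Rightarrow> pt) set" where
  "G_T l = grad ` polys (l + 1)"

definition R_F_perp :: "polyhedral_cell \<Rightarrow> int \<Rightarrow> pt set \<Rightarrow> (pt \<Rightarrow> pt) set" where
  "R_F_perp M l F = l2_compl (area_measure M F) (tpolys_on M l F) (R_F M l F)"

definition R_T_perp :: "polyhedral_cell \<Rightarrow> int \<Rightarrow> (pt \<Rightarrow> pt) set" where
  "R_T_perp M l = l2_compl (vol_measure M) (vpolys l) (R_T l)"

definition G_T_perp :: "polyhedral_cell \<Rightarrow> int \<Rightarrow> (pt \<Rightarrow> pt) set" where
  "G_T_perp M l = l2_compl (vol_measure M) (vpolys l) (G_T l)"

definition dsum :: "'a::plus set \<Rightarrow> 'a set \<Rightarrow> 'a set" where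
  "dsum A B = {a + b |a b. a \<in> A \<and> b \<in> B}"

definition dsum_fst :: "'a::plus set \<Rightarrow> 'a set \<Rightarrow> 'a \<Rightarrow> 'a" where
  "dsum_fst A B v = (THE a. a \<in> A \<and> (\<exists>b\<in>B. v = a + b))"

definition dsum_snd :: "'a::plus set \<Rightarrow> 'a set \<Rightarrow> 'a \<Rightarrow> 'a" where
  "dsum_snd A B v = (THE b. b \<in> B \<and> (\<exists>a\<in>A. v = a + b))"


section \<open>Discrete spaces\<close>

type_synonym grad_T_dofs = "(pt \<Rightarrow> real) \<times> (pt set \<Rightarrow> pt \<Rightarrow> real) \<times> (pt \<Rightarrow> real)"
type_synonym curl_T_dofs = "(pt \<Rightarrow> pt) \<times> (pt set \<Rightarrow> pt \<Rightarrow> pt) \<times> (pt set \<Rightarrow> pt \<Rightarrow> real)"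
type_synonym div_T_dofs = "(pt \<Rightarrow> pt) \<times> (pt set \<Rightarrow> pt \<Rightarrow> real)"
type_synonym grad_F_dofs = "(pt \<Rightarrow> real) \<times> (pt \<Rightarrow> real)"
type_synonym rot_F_dofs = "(pt \<Rightarrow> pt) \<times> (pt set \<Rightarrow> pt \<Rightarrow> real)"

definition X_grad_T :: "polyhedral_cell \<Rightarrow> nat \<Rightarrow> grad_T_dofs set" where
  "X_grad_T M k =
     polys (int k - 1) \<times> polys_family (int k - 1) (faces M) \<times> polys_c (int k + 1) (edges M)"

definition X_curl_T :: "polyhedral_cell \<Rightarrow> nat \<Rightarrow> curl_T_dofs set" where
  "X_curl_T M k =
     dsum (R_T (int k - 1)) (R_T_perp M k) \<times>
     {v. (\<forall>F\<in>faces M. v F \<in> dsum (R_F M (int k - 1) F) (R_F_perp M k F)) \<and>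
         (\<forall>F. F \<notin> faces M \<longrightarrow> v F = 0)} \<times>
     polys_family k (edges M)"

definition X_div_T :: "polyhedral_cell \<Rightarrow> nat \<Rightarrow> div_T_dofs set" where
  "X_div_T M k = dsum (G_T (int k - 1)) (G_T_perp M k) \<times> polys_family k (faces M)"

definition X_grad_F :: "polyhedral_cell \<Rightarrow> nat \<Rightarrow> pt set \<Rightarrow> grad_F_dofs set" where
  "X_grad_F M k F = polys_on (int k - 1) F \<times> polys_c (int k + 1) (edges_of M F)"

definition grad_to_face :: "pt set \<Rightarrow> grad_T_dofs \<Rightarrow> grad_F_dofs" where
  "grad_to_face F = (\<lambda>(qT, qF, qE). (qF F, restr (rel_frontier F) qE))"

definition curl_to_face :: "polyhedral_cell \<Rightarrow> pt set \<Rightarrow> curl_T_dofs \<Rightarrow> rot_F_dofs" where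
  "curl_to_face M F = (\<lambda>(vT, vF, vE). (vF F, \<lambda>E. if E \<in> edges_of M F then vE E else 0))"

definition R_part_T :: "polyhedral_cell \<Rightarrow> nat \<Rightarrow> (pt \<Rightarrow> pt) \<Rightarrow> pt \<Rightarrow> pt" where
  "R_part_T M k = dsum_fst (R_T (int k - 1)) (R_T_perp M k)"

definition R_perp_part_T :: "polyhedral_cell \<Rightarrow> nat \<Rightarrow> (pt \<Rightarrow> pt) \<Rightarrow> pt \<Rightarrow> pt" where
  "R_perp_part_T M k = dsum_snd (R_T (int k - 1)) (R_T_perp M k)"

definition G_perp_part_T :: "polyhedral_cell \<Rightarrow> nat \<Rightarrow> (pt \<Rightarrow> pt) \<Rightarrow> pt \<Rightarrow> pt" where
  "G_perp_part_T M k = dsum_snd (G_T (int k - 1)) (G_T_perp M k)"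

definition R_part_F :: "polyhedral_cell \<Rightarrow> nat \<Rightarrow> pt set \<Rightarrow> (pt \<Rightarrow> pt) \<Rightarrow> pt \<Rightarrow> pt" where
  "R_part_F M k F = dsum_fst (R_F M (int k - 1) F) (R_F_perp M k F)"

definition R_perp_part_F :: "polyhedral_cell \<Rightarrow> nat \<Rightarrow> pt set \<Rightarrow> (pt \<Rightarrow> pt) \<Rightarrow> pt \<Rightarrow> pt" where
  "R_perp_part_F M k F = dsum_snd (R_F M (int k - 1) F) (R_F_perp M k F)"


section \<open>Interpolators\<close>

definition interp_skeleton ::
  "polyhedral_cell \<Rightarrow> nat \<Rightarrow> pt set set \<Rightarrow> pt set \<Rightarrow> (pt \<Rightarrow> real) \<Rightarrow> pt \<Rightarrow> real" where
  "interp_skeleton M k \<E> \<V> q =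
     (THE p. p \<in> polys_c (int k + 1) \<E> \<and>
        (\<forall>E\<in>\<E>. l2_proj (length_measure M E) (polys_on (int k - 1) E) (restr E p)
               = l2_proj (length_measure M E) (polys_on (int k - 1) E) (restr E q)) \<and>
        (\<forall>V\<in>\<V>. p V = q V))"

definition I_grad_T :: "polyhedral_cell \<Rightarrow> nat \<Rightarrow> (pt \<Rightarrow> real) \<Rightarrow> grad_T_dofs" where
  "I_grad_T M k q =
     (l2_proj (vol_measure M) (polys (int k - 1)) q,
      \<lambda>F. if F \<in> faces M
          then l2_proj (area_measure M F) (polys_on (int k - 1) F) (restr F q) else 0,
      interp_skeleton M k (edges M) (vertices M) q)"

definition I_grad_F :: "polyhedral_cell \<Rightarrow> nat \<Rightarrow> pt set \<Rightarrow> (pt \<Rightarrow> real) \<Rightarrow> grad_F_dofs" where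
  "I_grad_F M k F q =
     (l2_proj (area_measure M F) (polys_on (int k - 1) F) (restr F q),
      interp_skeleton M k (edges_of M F) (vertices_of M F) q)"

definition tangential_trace :: "polyhedral_cell \<Rightarrow> pt set \<Rightarrow> (pt \<Rightarrow> pt) \<Rightarrow> pt \<Rightarrow> pt" where
  "tangential_trace M F v =
     restr F (\<lambda>x. cross3 (fnormal M F) (cross3 (v x) (fnormal M F)))"

definition I_curl_T :: "polyhedral_cell \<Rightarrow> nat \<Rightarrow> (pt \<Rightarrow> pt) \<Rightarrow> curl_T_dofs" where
  "I_curl_T M k v =
     (l2_proj (vol_measure M) (R_T (int k - 1)) v + l2_proj (vol_measure M) (R_T_perp M k) v,
      \<lambda>F. if F \<in> faces M
          then l2_proj (area_measure M F) (R_F M (int k - 1) F) (tangential_trace M F v)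
             + l2_proj (area_measure M F) (R_F_perp M k F) (tangential_trace M F v)
          else 0,
      \<lambda>E. if E \<in> edges M
          then l2_proj (length_measure M E) (polys_on k E) (restr E (\<lambda>x. v x \<bullet> etangent M E))
          else 0)"

definition I_div_T :: "polyhedral_cell \<Rightarrow> nat \<Rightarrow> (pt \<Rightarrow> pt) \<Rightarrow> div_T_dofs" where
  "I_div_T M k v =
     (l2_proj (vol_measure M) (G_T (int k - 1)) v + l2_proj (vol_measure M) (G_T_perp M k) v,
      \<lambda>F. if F \<in> faces M
          then l2_proj (area_measure M F) (polys_on k F) (restr F (\<lambda>x. v x \<bullet> fnormal M F))
          else 0)"


section \<open>Face operators\<close>

definition face_curl :: "polyhedral_cell \<Rightarrow> nat \<Rightarrow> pt set \<Rightarrow> rot_F_dofs \<Rightarrow> pt \<Rightarrow> real" where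
  "face_curl M k F = (\<lambda>(v, vE).
     THE c. c \<in> polys_on k F \<and>
       (\<forall>r\<in>polys k.
          int_F M F (\<lambda>x. c x * r x) =
            int_F M F (\<lambda>x. R_part_F M k F v x \<bullet> rot_F M F r x)
            - (\<Sum>E\<in>edges_of M F. omega_FE M F E * int_E M E (\<lambda>x. vE E x * r x))))"

definition scalar_trace ::
  "polyhedral_cell \<Rightarrow> nat \<Rightarrow> (pt set \<Rightarrow> grad_F_dofs \<Rightarrow> pt \<Rightarrow> real) \<Rightarrow> bool" where
  "scalar_trace M k \<gamma> \<longleftrightarrow>
     (\<forall>F\<in>faces M.
        (\<forall>q\<in>X_grad_F M k F. \<gamma> F q \<in> polys_on (int k + 1) F) \<and>
        (\<forall>q\<in>X_grad_F M k F. \<forall>r\<in>X_grad_F M k F. \<forall>a b.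
           \<gamma> F (a *\<^sub>R q + b *\<^sub>R r) = a *\<^sub>R \<gamma> F q + b *\<^sub>R \<gamma> F r) \<and>
        (\<forall>q\<in>polys (int k + 1). \<gamma> F (I_grad_F M k F q) = restr F q) \<and>
        (\<forall>q\<in>X_grad_F M k F.
           l2_proj (area_measure M F) (polys_on (int k - 1) F) (\<gamma> F q) = fst q))"

definition tangential_reconstruction ::
  "polyhedral_cell \<Rightarrow> nat \<Rightarrow> pt set \<Rightarrow> rot_F_dofs \<Rightarrow> pt \<Rightarrow> pt" where
  "tangential_reconstruction M k F = (\<lambda>(v, vE).
     THE g. g \<in> tpolys_on M k F \<and>
       (\<forall>r\<in>polys (int k + 1). int_F M F r = 0 \<longrightarrow>
          int_F M F (\<lambda>x. g x \<bullet> rot_F M F r x) =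
            int_F M F (\<lambda>x. face_curl M k F (v, vE) x * r x)
            + (\<Sum>E\<in>edges_of M F. omega_FE M F E * int_E M E (\<lambda>x. vE E x * r x))) \<and>
       (\<forall>w\<in>R_F_perp M k F.
          int_F M F (\<lambda>x. g x \<bullet> w x) = int_F M F (\<lambda>x. R_perp_part_F M k F v x \<bullet> w x)))"


section \<open>Volume operators and potentials\<close>

definition full_gradient ::
  "polyhedral_cell \<Rightarrow> nat \<Rightarrow> (pt set \<Rightarrow> grad_F_dofs \<Rightarrow> pt \<Rightarrow> real) \<Rightarrow> grad_T_dofs \<Rightarrow> pt \<Rightarrow> pt" where
  "full_gradient M k \<gamma> q =
     (THE g. g \<in> vpolys k \<and>
       (\<forall>v\<in>vpolys k.
          int_T M (\<lambda>x. g x \<bullet> v x) =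
            - int_T M (\<lambda>x. fst q x * dvg v x)
            + (\<Sum>F\<in>faces M. omega_TF M F *
                int_F M F (\<lambda>x. \<gamma> F (grad_to_face F q) x * (v x \<bullet> fnormal M F)))))"

definition full_curl :: "polyhedral_cell \<Rightarrow> nat \<Rightarrow> curl_T_dofs \<Rightarrow> pt \<Rightarrow> pt" where
  "full_curl M k v =
     (THE c. c \<in> vpolys k \<and>
       (\<forall>w\<in>vpolys k.
          int_T M (\<lambda>x. c x \<bullet> w x) =
            int_T M (\<lambda>x. fst v x \<bullet> curl w x)
            + (\<Sum>F\<in>faces M. omega_TF M F *
                int_F M F (\<lambda>x. tangential_reconstruction M k F (curl_to_face M F v) x
                               \<bullet> cross3 (w x) (fnormal M F)))))"

definition divergence :: "polyhedral_cell \<Rightarrow> nat \<Rightarrow> div_T_dofs \<Rightarrow> pt \<Rightarrow> real" where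
  "divergence M k v =
     (THE d. d \<in> polys k \<and>
       (\<forall>q\<in>polys k.
          int_T M (\<lambda>x. d x * q x) =
            - int_T M (\<lambda>x. fst v x \<bullet> grad q x)
            + (\<Sum>F\<in>faces M. omega_TF M F * int_F M F (\<lambda>x. snd v F x * q x))))"

definition P_grad_T ::
  "polyhedral_cell \<Rightarrow> nat \<Rightarrow> (pt set \<Rightarrow> grad_F_dofs \<Rightarrow> pt \<Rightarrow> real) \<Rightarrow> grad_T_dofs \<Rightarrow> pt \<Rightarrow> real" where
  "P_grad_T M k \<gamma> q =
     (THE p. p \<in> polys (int k + 1) \<and>
       (\<forall>v\<in>R_T_perp M (int k + 2).
          int_T M (\<lambda>x. p x * dvg v x) =
            - int_T M (\<lambda>x. full_gradient M k \<gamma> q x \<bullet> v x)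
            + (\<Sum>F\<in>faces M. omega_TF M F *
                int_F M F (\<lambda>x. \<gamma> F (grad_to_face F q) x * (v x \<bullet> fnormal M F)))))"

definition P_curl_T :: "polyhedral_cell \<Rightarrow> nat \<Rightarrow> curl_T_dofs \<Rightarrow> pt \<Rightarrow> pt" where
  "P_curl_T M k v =
     (THE p. p \<in> vpolys k \<and>
       (\<forall>w\<in>G_T_perp M (int k + 1).
          int_T M (\<lambda>x. p x \<bullet> curl w x) =
            int_T M (\<lambda>x. full_curl M k v x \<bullet> w x)
            - (\<Sum>F\<in>faces M. omega_TF M F *
                int_F M F (\<lambda>x. tangential_reconstruction M k F (curl_to_face M F v) x
                               \<bullet> cross3 (w x) (fnormal M F)))) \<and>
       (\<forall>w\<in>R_T_perp M k.
          int_T M (\<lambda>x. p x \<bullet> w x) = int_T M (\<lambda>x. R_perp_part_T M k (fst v) x \<bullet> w x)))"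

definition P_div_T :: "polyhedral_cell \<Rightarrow> nat \<Rightarrow> div_T_dofs \<Rightarrow> pt \<Rightarrow> pt" where
  "P_div_T M k v =
     (THE p. p \<in> vpolys k \<and>
       (\<forall>q\<in>polys (int k + 1). int_T M q = 0 \<longrightarrow>
          int_T M (\<lambda>x. p x \<bullet> grad q x) =
            - int_T M (\<lambda>x. divergence M k v x * q x)
            + (\<Sum>F\<in>faces M. omega_TF M F * int_F M F (\<lambda>x. snd v F x * q x))) \<and>
       (\<forall>w\<in>G_T_perp M k.
          int_T M (\<lambda>x. p x \<bullet> w x) = int_T M (\<lambda>x. G_perp_part_T M k (fst v) x \<bullet> w x)))"


section \<open>Bilinear forms\<close>

definition delta_grad ::
  "polyhedral_cell \<Rightarrow> nat \<Rightarrow> (pt set \<Rightarrow> grad_F_dofs \<Rightarrow> pt \<Rightarrow> real) \<Rightarrow> grad_T_dofs \<Rightarrow> grad_T_dofs" where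
  "delta_grad M k \<gamma> q = I_grad_T M k (P_grad_T M k \<gamma> q) - q"

definition delta_curl :: "polyhedral_cell \<Rightarrow> nat \<Rightarrow> curl_T_dofs \<Rightarrow> curl_T_dofs" where
  "delta_curl M k v = I_curl_T M k (P_curl_T M k v) - v"

definition form_grad ::
  "polyhedral_cell \<Rightarrow> nat \<Rightarrow> (pt set \<Rightarrow> grad_F_dofs \<Rightarrow> pt \<Rightarrow> real)
     \<Rightarrow> grad_T_dofs \<Rightarrow> grad_T_dofs \<Rightarrow> real" where
  "form_grad M k \<gamma> q r =
     (let h = diameter (cell M);
          (\<delta>Tq, \<delta>Fq, \<delta>Eq) = delta_grad M k \<gamma> q;
          (\<delta>Tr, \<delta>Fr, \<delta>Er) = delta_grad M k \<gamma> r
      in int_T M (\<lambda>x. P_grad_T M k \<gamma> q x * P_grad_T M k \<gamma> r x)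
         + int_T M (\<lambda>x. \<delta>Tq x * \<delta>Tr x)
         + (\<Sum>F\<in>faces M. h * int_F M F (\<lambda>x. \<delta>Fq F x * \<delta>Fr F x))
         + (\<Sum>E\<in>edges M. h\<^sup>2 * int_E M E (\<lambda>x. \<delta>Eq x * \<delta>Er x)))"

definition form_curl :: "polyhedral_cell \<Rightarrow> nat \<Rightarrow> curl_T_dofs \<Rightarrow> curl_T_dofs \<Rightarrow> real" where
  "form_curl M k v w =
     (let h = diameter (cell M);
          (\<delta>Tv, \<delta>Fv, \<delta>Ev) = delta_curl M k v;
          (\<delta>Tw, \<delta>Fw, \<delta>Ew) = delta_curl M k w
      in int_T M (\<lambda>x. P_curl_T M k v x \<bullet> P_curl_T M k w x)
         + int_T M (\<lambda>x. R_part_T M k \<delta>Tv x \<bullet> R_part_T M k \<delta>Tw x)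
         + (\<Sum>F\<in>faces M. h * int_F M F (\<lambda>x.
              R_part_F M k F (\<delta>Fv F) x \<bullet> R_part_F M k F (\<delta>Fw F) x
              + R_perp_part_F M k F (\<delta>Fv F) x \<bullet> R_perp_part_F M k F (\<delta>Fw F) x))
         + (\<Sum>E\<in>edges M. h\<^sup>2 * int_E M E (\<lambda>x. \<delta>Ev E x * \<delta>Ew E x)))"

definition delta_div :: "polyhedral_cell \<Rightarrow> nat \<Rightarrow> div_T_dofs \<Rightarrow> pt set \<Rightarrow> pt \<Rightarrow> real" where
  "delta_div M k v F x = P_div_T M k v x \<bullet> fnormal M F - snd v F x"

definition form_div :: "polyhedral_cell \<Rightarrow> nat \<Rightarrow> div_T_dofs \<Rightarrow> div_T_dofs \<Rightarrow> real" where
  "form_div M k v w =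
     int_T M (\<lambda>x. P_div_T M k v x \<bullet> P_div_T M k w x)
     + (\<Sum>F\<in>faces M. diameter (cell M) *
          int_F M F (\<lambda>x. delta_div M k v F x * delta_div M k w F x))"

end

(*
  Everything rests on two facts about polynomials and one about integrals.  The Euler operators
  c p + x . grad p with c > 0 are bijective on polynomials of bounded degree; they turn the Koszul
  homotopies into potentials, so grad, curl, div is exact on polynomials, and the test spaces
  R^(k+2)(T)^perp, G^(k+1)(T)^perp and P^(0,k+1) are mapped bijectively onto the ranges of div,
  curl and grad.  Hence every reconstruction is a Riesz representation in a finite-dimensional L^2
  space.  The divergence theorem on T and Stokes' theorem on the faces are obtained from Fubini and
  the fundamental theorem of calculus on lines: the Lipschitz condition makes T locally a half
  space at the points of a face, so almost every line crosses the boundary in finitely many simple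
  jumps.

  Integration by parts shows that the potentials reproduce interpolated polynomials, hence that the
  difference terms of the forms vanish on them: this is consistency.  If a form vanishes at
  an element of the discrete space, then its potential is zero, hence so are the complement
  components, and the difference terms then give back all other components.  For div the volume term
  is not penalised: P_div = 0 and zero face components force D = 0 by testing with D, and the
  definition of D then kills the gradient component.
*)

theory Submission
  imports Defs "HOL-Computational_Algebra.Polynomial"
begin

section \<open>Polynomials in three variables\<close>

text \<open>Every operator is a \<open>THE\<close>, so nothing can be said about it before its
  relations are known to have exactly one solution, and bilinearity of the forms then needs
  linearity of that solution in the degrees of freedom. Both are settled abstractly for a linear
  test map \<tau>. What remains in each case is that the right-hand side vanishes on the kernel of
  \<tau>. On the cell this kernel is trivial. On a face it is not: a spatial polynomial can vanish
  on the face without vanishing in space, so the boundary terms on the edges have to be checked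
  against it as well.

  Integration by parts uses no triangulation. Its obstacle is the signs: \<open>omega_TF\<close> and
  \<open>omega_FE\<close> are defined by a pointwise condition, with -1 for everything that does not
  satisfy it. That the default really means pointing inwards, uniformly along a face or an edge, has
  to be extracted from the Lipschitz condition and connectedness.

  Spatial polynomials represent functions on faces and edges, and zero extensions of them are
  discontinuous; integrands are therefore only required to agree on the set of integration with a
  function that is continuous in space.\<close>

inductive monom_of :: "nat \<Rightarrow> (pt \<Rightarrow> real) \<Rightarrow> bool" where
  one: "monom_of 0 (\<lambda>x. 1)"
| times: "monom_of n m \<Longrightarrow> monom_of (Suc n) (\<lambda>x. x $ i * m x)"

lemma monom_of_prod: "monom_of (\<Sum>i\<in>UNIV. \<alpha> i) (\<lambda>x. \<Prod>i\<in>UNIV. (x $ i) ^ \<alpha> i)"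
proof (induction "\<Sum>i\<in>UNIV. \<alpha> i" arbitrary: \<alpha>)
  case 0
  then have "\<alpha> = (\<lambda>i. 0)" by auto
  then show ?case using one by simp
next
  case (Suc n)
  have "\<exists>i. \<alpha> i \<noteq> 0"
  proof (rule ccontr)
    assume "\<not> (\<exists>i. \<alpha> i \<noteq> 0)"
    then have "(\<Sum>i\<in>UNIV. \<alpha> i) = 0" by simp
    with Suc show False by simp
  qed
  then obtain i where i: "\<alpha> i \<noteq> 0" by blast
  \<comment> \<open>Lowering one positive exponent by one peels a single factor \<open>x $ i\<close>
    off the monomial.\<close>
  define \<beta> where "\<beta> = \<alpha>(i := \<alpha> i - 1)"
  have \<alpha>: "\<alpha> i = Suc (\<beta> i)" "\<And>j. j \<noteq> i \<Longrightarrow> \<beta> j = \<alpha> j" using i by (auto simp: \<beta>_def)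
  have "(\<Sum>j\<in>UNIV. \<alpha> j) = \<alpha> i + (\<Sum>j\<in>UNIV - {i}. \<alpha> j)" by (rule sum.remove) auto
  also have "(\<Sum>j\<in>UNIV - {i}. \<alpha> j) = (\<Sum>j\<in>UNIV - {i}. \<beta> j)"
    by (rule sum.cong) (auto simp: \<alpha>)
  also have "\<alpha> i + \<dots> = Suc (\<beta> i + (\<Sum>j\<in>UNIV - {i}. \<beta> j))" by (simp add: \<alpha>(1))
  also have "\<beta> i + (\<Sum>j\<in>UNIV - {i}. \<beta> j) = (\<Sum>j\<in>UNIV. \<beta> j)"
    by (rule sum.remove[symmetric]) auto
  finally have s: "(\<Sum>j\<in>UNIV. \<alpha> j) = Suc (\<Sum>j\<in>UNIV. \<beta> j)" .
  have "(\<Prod>j\<in>UNIV. (x $ j) ^ \<alpha> j) = x $ i * (\<Prod>j\<in>UNIV. (x $ j) ^ \<beta> j)" for x :: pt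
  proof -
    have "(\<Prod>j\<in>UNIV. (x $ j) ^ \<alpha> j) = (x $ i) ^ \<alpha> i * (\<Prod>j\<in>UNIV - {i}. (x $ j) ^ \<alpha> j)"
      by (rule prod.remove) auto
    also have "(\<Prod>j\<in>UNIV - {i}. (x $ j) ^ \<alpha> j) = (\<Prod>j\<in>UNIV - {i}. (x $ j) ^ \<beta> j)"
      by (rule prod.cong) (auto simp: \<alpha>)
    also have "(x $ i) ^ \<alpha> i * \<dots> = x $ i * ((x $ i) ^ \<beta> i * (\<Prod>j\<in>UNIV - {i}. (x $ j) ^ \<beta> j))"
      by (simp add: \<alpha>(1))
    also have "(x $ i) ^ \<beta> i * (\<Prod>j\<in>UNIV - {i}. (x $ j) ^ \<beta> j) = (\<Prod>j\<in>UNIV. (x $ j) ^ \<beta> j)"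
      by (rule prod.remove[symmetric]) auto
    finally show ?thesis .
  qed
  then have "(\<lambda>x::pt. \<Prod>j\<in>UNIV. (x $ j) ^ \<alpha> j) = (\<lambda>x. x $ i * (\<Prod>j\<in>UNIV. (x $ j) ^ \<beta> j))"
    by auto
  then show ?case using times[OF Suc(1)[of \<beta>], of i] s Suc(2) by simp
qed

lemma monom_ofE:
  assumes "monom_of n m"
  shows "\<exists>\<alpha>. m = (\<lambda>x. \<Prod>i\<in>UNIV. (x $ i) ^ \<alpha> i) \<and> n = (\<Sum>i\<in>UNIV. \<alpha> i)"
  using assms
proof induction
  case one
  show ?case by (rule exI[of _ "\<lambda>i. 0"]) simp
next
  case (times n m i)
  then obtain \<alpha> where \<alpha>: "m = (\<lambda>x. \<Prod>i\<in>UNIV. (x $ i) ^ \<alpha> i)" "n = (\<Sum>i\<in>UNIV. \<alpha> i)" by blast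
  define \<beta> where "\<beta> = \<alpha>(i := Suc (\<alpha> i))"
  have "x $ i * (\<Prod>j\<in>UNIV. (x $ j) ^ \<alpha> j) = (\<Prod>j\<in>UNIV. (x $ j) ^ \<beta> j)" for x :: pt
  proof -
    have "(\<Prod>j\<in>UNIV. (x $ j) ^ \<beta> j) = (\<Prod>j\<in>UNIV. (x $ j) ^ \<alpha> j * (if j = i then x $ i else 1))"
      by (rule prod.cong) (auto simp: \<beta>_def)
    then show ?thesis by (simp add: prod.distrib)
  qed
  moreover have "(\<Sum>j\<in>UNIV. \<beta> j) = (\<Sum>j\<in>UNIV. \<alpha> j + (if j = i then 1 else 0))"
    by (rule sum.cong) (auto simp: \<beta>_def)
  ultimately show ?case unfolding \<alpha> by (intro exI[of _ \<beta>]) (simp add: sum.distrib)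
qed

text \<open>Exchanges products of powers for monomials built up by one coordinate factor at a time;
  facts about polynomials can then be proved by rule induction on \<open>monom_of\<close> followed
  by linear combination.\<close>

lemma polys_eq_span_monom_of: "polys l = span {m. \<exists>n. monom_of n m \<and> int n \<le> l}"
proof -
  have "{(\<lambda>x. \<Prod>i\<in>UNIV. (x $ i) ^ \<alpha> i) |\<alpha> :: 3 \<Rightarrow> nat. int (\<Sum>i\<in>UNIV. \<alpha> i) \<le> l}
      = {m. \<exists>n. monom_of n m \<and> int n \<le> l}"
    using monom_of_prod monom_ofE by fastforce
  then show ?thesis unfolding polys_def by simp
qed

lemma subspace_polys [simp]: "subspace (polys l)"
  unfolding polys_def by (rule subspace_span)

lemma polys_0 [simp]: "(\<lambda>x. 0) \<in> polys l"
  using subspace_0[OF subspace_polys] by (simp add: zero_fun_def)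

lemma polys_add [intro]: "p \<in> polys l \<Longrightarrow> q \<in> polys l \<Longrightarrow> (\<lambda>x. p x + q x) \<in> polys l"
  using subspace_add[OF subspace_polys] by (simp add: plus_fun_def)

lemma polys_diff [intro]: "p \<in> polys l \<Longrightarrow> q \<in> polys l \<Longrightarrow> (\<lambda>x. p x - q x) \<in> polys l"
  using subspace_diff[OF subspace_polys] by (simp add: fun_diff_def)

lemma polys_cmult [intro]: "p \<in> polys l \<Longrightarrow> (\<lambda>x. c * p x) \<in> polys l"
  using subspace_scale[OF subspace_polys, of p l c] by (simp add: scaleR_fun_def)

lemma polys_multc [intro]: "p \<in> polys l \<Longrightarrow> (\<lambda>x. p x * c) \<in> polys l"
  using polys_cmult[of p l c] by (simp add: mult.commute)

lemma polys_sum [intro]: "(\<And>i. i \<in> I \<Longrightarrow> p i \<in> polys l) \<Longrightarrow> (\<lambda>x. \<Sum>i\<in>I. p i x) \<in> polys l"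
  by (induction I rule: infinite_finite_induct) auto

lemma polys_mono: "p \<in> polys l \<Longrightarrow> l \<le> l' \<Longrightarrow> p \<in> polys l'"
  unfolding polys_def by (rule subsetD[OF span_mono]) auto

lemma monom_of_in_polys: "monom_of n m \<Longrightarrow> int n \<le> l \<Longrightarrow> m \<in> polys l"
  unfolding polys_eq_span_monom_of by (rule span_base) auto

lemma polys_const [simp]: "0 \<le> l \<Longrightarrow> (\<lambda>x. c) \<in> polys l"
  using polys_cmult[OF monom_of_in_polys[OF one], of l c] by simp

text \<open>The remainder \<open>q\<close> in the step is known to lie in \<open>polys l\<close>
  again, so differentiability and degree bounds are at hand there.\<close>

lemma polys_induct [consumes 1, case_names zero add]:
  assumes "p \<in> polys l" and "P (\<lambda>x. 0)"
    and "\<And>c n m q. monom_of n m \<Longrightarrow> int n \<le> l \<Longrightarrow> q \<in> polys l \<Longrightarrow> P q \<Longrightarrow> P (\<lambda>x. c * m x + q x)"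
  shows "P p"
proof -
  have "p \<in> polys l \<and> P p"
    using assms(1)[unfolded polys_eq_span_monom_of]
  proof (induction rule: span_induct_alt)
    case base
    then show ?case using assms(2) by (simp add: zero_fun_def)
  next
    case (step c x y)
    then obtain n where n: "monom_of n x" "int n \<le> l" by auto
    have "c *\<^sub>R x + y = (\<lambda>a. c * x a + y a)" by (simp add: scaleR_fun_def plus_fun_def)
    moreover have "(\<lambda>a. c * x a + y a) \<in> polys l"
      using monom_of_in_polys[OF n] step by (intro polys_add polys_cmult) auto
    ultimately show ?case using assms(3)[OF n] step by auto
  qed
  then show ?thesis by blast
qed

lemma polys_coord: "(\<lambda>x. x $ i) \<in> polys 1"
  using monom_of_in_polys[OF times[OF one, of i], of 1] by simp

lemma polys_times_coord: "p \<in> polys l \<Longrightarrow> (\<lambda>x. x $ i * p x) \<in> polys (l + 1)"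
proof (induction rule: polys_induct)
  case (add c n m q)
  then have "(\<lambda>x. c * (x $ i * m x) + x $ i * q x) \<in> polys (l + 1)"
    by (intro polys_add polys_cmult monom_of_in_polys[OF times[OF add(1)]]) auto
  then show ?case by (simp add: algebra_simps)
qed auto

lemma monom_of_mult: "monom_of n m \<Longrightarrow> q \<in> polys l \<Longrightarrow> (\<lambda>x. m x * q x) \<in> polys (int n + l)"
proof (induction rule: monom_of.induct)
  case (times n m i)
  then have "(\<lambda>x. x $ i * (m x * q x)) \<in> polys (int n + l + 1)" by (intro polys_times_coord) auto
  then show ?case by (simp add: algebra_simps)
qed simp

lemma polys_mult: "p \<in> polys l \<Longrightarrow> q \<in> polys l' \<Longrightarrow> (\<lambda>x. p x * q x) \<in> polys (l + l')"
proof (induction rule: polys_induct)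
  case (add c n m p)
  then have "(\<lambda>x. c * (m x * q x) + p x * q x) \<in> polys (l + l')"
    by (intro polys_add polys_cmult polys_mono[OF monom_of_mult[OF add(1)]]) auto
  then show ?case by (simp add: algebra_simps)
qed auto

text \<open>A bound on the sum of the exponents bounds each of them, so there are finitely many
  monomials. All finite dimensionality, and with it the existence of every Riesz representative,
  goes back to this.\<close>

lemma polys_span_finite: "\<exists>B. finite B \<and> B \<subseteq> polys l \<and> polys l \<subseteq> span B"
proof -
  have "finite {\<alpha> :: 3 \<Rightarrow> nat. int (\<Sum>i\<in>UNIV. \<alpha> i) \<le> l}"
  proof (rule finite_subset)
    show "{\<alpha> :: 3 \<Rightarrow> nat. int (\<Sum>i\<in>UNIV. \<alpha> i) \<le> l} \<subseteq> (UNIV \<rightarrow>\<^sub>E {..nat l})"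
    proof
      fix \<alpha> :: "3 \<Rightarrow> nat"
      assume "\<alpha> \<in> {\<alpha>. int (\<Sum>i\<in>UNIV. \<alpha> i) \<le> l}"
      then have l: "(\<Sum>i\<in>UNIV. int (\<alpha> i)) \<le> l" by simp
      have "\<alpha> i \<le> nat l" for i
      proof -
        have "int (\<alpha> i) \<le> (\<Sum>i\<in>UNIV. int (\<alpha> i))" by (rule member_le_sum) auto
        with l show ?thesis by linarith
      qed
      then show "\<alpha> \<in> (UNIV \<rightarrow>\<^sub>E {..nat l})" by (intro PiE_I) auto
    qed
    show "finite ((UNIV :: 3 set) \<rightarrow>\<^sub>E {..nat l})" by (intro finite_PiE) auto
  qed
  then have "finite {(\<lambda>x::pt. \<Prod>i\<in>UNIV. (x $ i) ^ \<alpha> i) |\<alpha> :: 3 \<Rightarrow> nat. int (\<Sum>i\<in>UNIV. \<alpha> i) \<le> l}"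
    by (simp add: setcompr_eq_image)
  then show ?thesis unfolding polys_def by (meson span_superset subset_refl)
qed

subsection \<open>Partial derivatives\<close>

definition pd :: "3 \<Rightarrow> (pt \<Rightarrow> real) \<Rightarrow> pt \<Rightarrow> real" where
  "pd i f x = frechet_derivative f (at x) (axis i 1)"

lemma pd_eqI: "(f has_derivative D) (at x) \<Longrightarrow> pd i f x = D (axis i 1)"
  unfolding pd_def by (metis frechet_derivative_at)

lemma coord_differentiable [simp]: "(\<lambda>x::pt. x $ i) differentiable F"
  by (intro bounded_linear_imp_differentiable bounded_linear_vec_nth)

lemma monom_of_differentiable: "monom_of n m \<Longrightarrow> m differentiable (at x)"
  by (induction rule: monom_of.induct) (auto intro: differentiable_mult)

lemma polys_differentiable: "p \<in> polys l \<Longrightarrow> p differentiable (at x)"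
proof (induction rule: polys_induct)
  case (add c n m q)
  then show ?case using monom_of_differentiable[OF add(1)]
    by (intro differentiable_add differentiable_mult) auto
qed simp

lemma polys_has_derivative:
  "p \<in> polys l \<Longrightarrow> (p has_derivative frechet_derivative p (at x)) (at x)"
  using polys_differentiable frechet_derivative_works by blast

lemma polys_continuous_on: "p \<in> polys l \<Longrightarrow> continuous_on S p"
  by (meson continuous_at_imp_continuous_on differentiable_imp_continuous_within polys_differentiable)

lemma pd_const [simp]: "pd i (\<lambda>x. c) x = 0"
  by (simp add: pd_def)

lemma pd_coord: "pd i (\<lambda>x. x $ j) x = (if i = j then 1 else 0)"
proof -
  have "((\<lambda>x::pt. x $ j) has_derivative (\<lambda>x. x $ j)) (at x)"
    by (intro bounded_linear_imp_has_derivative bounded_linear_vec_nth)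
  then show ?thesis using pd_eqI by (fastforce simp: axis_def)
qed

lemma pd_add:
  assumes "f differentiable (at x)" "g differentiable (at x)"
  shows "pd i (\<lambda>x. f x + g x) x = pd i f x + pd i g x"
proof -
  from assms have "((\<lambda>x. f x + g x) has_derivative
      (\<lambda>h. frechet_derivative f (at x) h + frechet_derivative g (at x) h)) (at x)"
    by (intro has_derivative_add) (auto simp: frechet_derivative_works)
  then show ?thesis by (subst pd_eqI, assumption) (simp add: pd_def)
qed

lemma pd_mult:
  assumes "f differentiable (at x)" "g differentiable (at x)"
  shows "pd i (\<lambda>x. f x * g x) x = f x * pd i g x + pd i f x * g x"
proof -
  from assms have "((\<lambda>x. f x * g x) has_derivative
      (\<lambda>h. f x * frechet_derivative g (at x) h + frechet_derivative f (at x) h * g x)) (at x)"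
    by (intro has_derivative_mult) (auto simp: frechet_derivative_works)
  then show ?thesis by (subst pd_eqI, assumption) (simp add: pd_def)
qed

lemma pd_cmult: "f differentiable (at x) \<Longrightarrow> pd i (\<lambda>x. c * f x) x = c * pd i f x"
  using pd_mult[of "\<lambda>x. c" x f i] by simp

lemma pd_diff:
  assumes "f differentiable (at x)" "g differentiable (at x)"
  shows "pd i (\<lambda>x. f x - g x) x = pd i f x - pd i g x"
proof -
  have "(\<lambda>x. (-1) * g x) differentiable (at x)" using assms(2) by (intro derivative_intros) auto
  then show ?thesis using pd_add[of f x "\<lambda>x. (-1) * g x" i] pd_cmult[of g x i "-1"] assms by simp
qed

lemma pd_sum:
  assumes "\<And>j. j \<in> I \<Longrightarrow> f j differentiable (at x)"
  shows "pd i (\<lambda>x. \<Sum>j\<in>I. f j x) x = (\<Sum>j\<in>I. pd i (f j) x)"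
  using assms
proof (induction I rule: infinite_finite_induct)
  case (insert j I)
  have "(\<lambda>x. \<Sum>j\<in>I. f j x) differentiable (at x)"
    using insert by (intro differentiable_sum) auto
  then show ?case using insert pd_add[of "f j" x "\<lambda>x. \<Sum>j\<in>I. f j x" i] by simp
qed auto

lemma monom_of_pd: "monom_of n m \<Longrightarrow> pd i m \<in> polys (int n - 1)"
proof (induction rule: monom_of.induct)
  case one
  have "pd i (\<lambda>x. 1) = (\<lambda>x. 0)" by auto
  then show ?case by simp
next
  case (times n m j)
  have "pd i (\<lambda>x. x $ j * m x) = (\<lambda>x. x $ j * pd i m x + (if i = j then 1 else 0) * m x)"
    by (rule ext, subst pd_mult)
      (auto simp: pd_coord intro: monom_of_differentiable[OF times(1)]
        bounded_linear_imp_differentiable bounded_linear_vec_nth)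
  also have "\<dots> \<in> polys (int n - 1 + 1)"
    by (intro polys_add polys_times_coord times polys_cmult monom_of_in_polys[OF times(1)]) auto
  finally show ?case by simp
qed

lemma polys_pd: "p \<in> polys l \<Longrightarrow> pd i p \<in> polys (l - 1)"
proof (induction rule: polys_induct)
  case zero
  have "pd i (\<lambda>x. 0) = (\<lambda>x. 0)" by auto
  then show ?case by simp
next
  case (add c n m q)
  have "pd i (\<lambda>x. c * m x + q x) = (\<lambda>x. c * pd i m x + pd i q x)"
    using monom_of_differentiable[OF add(1)] polys_differentiable[OF add(3)]
    by (intro ext) (simp add: pd_add pd_cmult differentiable_mult)
  also have "\<dots> \<in> polys (l - 1)"
    by (intro polys_add polys_cmult polys_mono[OF monom_of_pd[OF add(1)]] add) (use add in auto)
  finally show ?case .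
qed

text \<open>Symmetry of second derivatives by algebra alone: applying the product rule twice to
  \<open>x $ k * m x\<close> gives terms symmetric in \<open>i\<close> and \<open>j\<close>, apart
  from the second derivatives of \<open>m\<close>, which commute by induction.\<close>

lemma monom_of_pd_commute: "monom_of n m \<Longrightarrow> pd i (pd j m) x = pd j (pd i m) x"
proof (induction arbitrary: x rule: monom_of.induct)
  case one
  have "pd i (\<lambda>x. 1) = (\<lambda>x. 0)" for i by auto
  then show ?case by simp
next
  case (times n m k)
  have c: "(\<lambda>x::pt. x $ k) differentiable (at x)" for x
    by (intro bounded_linear_imp_differentiable bounded_linear_vec_nth)
  have d: "m differentiable (at x)" "pd i m differentiable (at x)" for x i
    using monom_of_differentiable[OF times(1)] polys_differentiable[OF monom_of_pd[OF times(1)]]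
    by auto
  have e: "pd i (\<lambda>x. x $ k * m x) = (\<lambda>x. x $ k * pd i m x + (if i = k then 1 else 0) * m x)" for i
    by (rule ext, subst pd_mult) (use c d in \<open>auto simp: pd_coord\<close>)
  have "pd i (pd j (\<lambda>x. x $ k * m x)) x = x $ k * pd i (pd j m) x
      + (if i = k then 1 else 0) * pd j m x + (if j = k then 1 else 0) * pd i m x" for i j
    unfolding e by (simp add: pd_add pd_mult pd_coord c d differentiable_mult)
  then show ?case using times(2) by simp
qed

lemma polys_pd_commute: "p \<in> polys l \<Longrightarrow> pd i (pd j p) x = pd j (pd i p) x"
proof (induction arbitrary: x rule: polys_induct)
  case zero
  have "pd i (\<lambda>x. 0) = (\<lambda>x. 0)" for i by auto
  then show ?case by simp
next
  case (add c n m q)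
  have d: "m differentiable (at x)" "pd i m differentiable (at x)"
    "q differentiable (at x)" "pd i q differentiable (at x)" for x i
    using monom_of_differentiable[OF add(1)] polys_differentiable[OF monom_of_pd[OF add(1)]]
      polys_differentiable[OF add(3)] polys_differentiable[OF polys_pd[OF add(3)]] by auto
  have e: "pd i (\<lambda>x. c * m x + q x) = (\<lambda>x. c * pd i m x + pd i q x)" for i
    by (intro ext) (simp add: pd_add pd_cmult d differentiable_mult)
  have "pd i (pd j (\<lambda>x. c * m x + q x)) x = c * pd i (pd j m) x + pd i (pd j q) x" for i j
    unfolding e by (simp add: pd_add pd_cmult d differentiable_mult)
  then show ?case using add monom_of_pd_commute[OF add(1)] by simp
qed

lemma frechet_derivative_polys:
  assumes "p \<in> polys l"
  shows "frechet_derivative p (at x) h = (\<Sum>i\<in>UNIV. h $ i * pd i p x)"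
proof -
  have lin: "linear (frechet_derivative p (at x))"
    using polys_has_derivative[OF assms] has_derivative_linear by blast
  have "frechet_derivative p (at x) h = frechet_derivative p (at x) (\<Sum>i\<in>UNIV. h $ i *s axis i 1)"
    by (simp add: basis_expansion)
  also have "\<dots> = (\<Sum>i\<in>UNIV. h $ i * pd i p x)"
    by (simp add: linear_sum[OF lin] scalar_mult_eq_scaleR linear_scale[OF lin] pd_def)
  finally show ?thesis .
qed

lemma polys_linear_form: "(\<lambda>x. (x - a) \<bullet> t) \<in> polys 1"
proof -
  have "(x - a) \<bullet> t = (\<Sum>i\<in>UNIV. t $ i * x $ i) - a \<bullet> t" for x
    by (subst inner_diff_left) (simp add: inner_vec_def mult.commute)
  then have "(\<lambda>x::pt. (x - a) \<bullet> t) = (\<lambda>x. (\<Sum>i\<in>UNIV. t $ i * x $ i) - a \<bullet> t)" by blast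
  also have "\<dots> \<in> polys 1" by (intro polys_diff polys_sum polys_cmult polys_coord polys_const) auto
  finally show ?thesis .
qed

lemma polys_power: "p \<in> polys l \<Longrightarrow> (\<lambda>x. p x ^ n) \<in> polys (int n * l)"
proof (induction n)
  case (Suc n)
  then have "(\<lambda>x. p x * p x ^ n) \<in> polys (l + int n * l)" by (intro polys_mult) auto
  then show ?case by (simp add: algebra_simps)
qed simp

text \<open>Extends a polynomial in the arc length of an edge to a polynomial in space. The guard
  \<open>P \<noteq> 0\<close> accounts for \<open>degree 0 = 0\<close>: the zero polynomial is
  allowed for negative \<open>l\<close> too.\<close>

lemma poly_linear_form_in_polys:
  assumes "P \<noteq> 0 \<Longrightarrow> int (degree P) \<le> l"
  shows "(\<lambda>x. poly P ((x - a) \<bullet> t)) \<in> polys l"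
proof (cases "P = 0")
  case False
  then have l: "int i \<le> l" if "i \<le> degree P" for i using assms that by linarith
  have "(\<lambda>x. \<Sum>i\<le>degree P. coeff P i * ((x - a) \<bullet> t) ^ i) \<in> polys l"
    by (intro polys_sum polys_cmult polys_mono[OF polys_power[OF polys_linear_form]]) (use l in auto)
  then show ?thesis by (simp add: poly_altdef)
qed simp

lemma monom_of_along_line:
  "monom_of n m \<Longrightarrow> \<exists>P. degree P \<le> n \<and> (\<forall>t::real. m (x + t *\<^sub>R y) = poly P t)"
proof (induction rule: monom_of.induct)
  case one
  show ?case by (rule exI[of _ 1]) simp
next
  case (times n m i)
  then obtain P where P: "degree P \<le> n" "\<And>t::real. m (x + t *\<^sub>R y) = poly P t" by blast
  have "degree ([:x $ i, y $ i:] * P) \<le> Suc n"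
    by (rule order_trans[OF degree_mult_le]) (use P in simp)
  then show ?case using P(2) by (intro exI[of _ "[:x $ i, y $ i:] * P"]) (simp add: algebra_simps)
qed

text \<open>On a line a spatial polynomial becomes a univariate one of no larger degree, which opens
  the way to counting roots and splitting off linear factors.\<close>

lemma polys_along_line:
  "p \<in> polys l \<Longrightarrow> \<exists>P. (P \<noteq> 0 \<longrightarrow> int (degree P) \<le> l) \<and> (\<forall>t::real. p (x + t *\<^sub>R y) = poly P t)"
proof (induction rule: polys_induct)
  case zero
  show ?case by (rule exI[of _ 0]) simp
next
  case (add c n m q)
  obtain P where P: "degree P \<le> n" "\<And>t::real. m (x + t *\<^sub>R y) = poly P t"
    using monom_of_along_line[OF add(1)] by blast
  obtain Q where Q: "Q \<noteq> 0 \<longrightarrow> int (degree Q) \<le> l" "\<And>t::real. q (x + t *\<^sub>R y) = poly Q t"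
    using add by blast
  have "int (degree (smult c P + Q)) \<le> l"
  proof -
    have "degree (smult c P + Q) \<le> nat l"
      by (rule degree_add_le) (use P Q add(2) in \<open>auto intro: order_trans[OF degree_smult_le]\<close>)
    then show ?thesis using add(2) by linarith
  qed
  then show ?case using P Q by (intro exI[of _ "smult c P + Q"]) simp
qed

text \<open>On the line from a point of \<open>S\<close> to an arbitrary \<open>y\<close> there are
  infinitely many zeros near the starting point, so the polynomial vanishes on the whole line. This
  is what permits identifying polynomials on the cell with polynomials on space.\<close>

lemma polys_eq_zero:
  assumes "p \<in> polys l" "open S" "S \<noteq> {}" "\<And>x. x \<in> S \<Longrightarrow> p x = 0"
  shows "p = (\<lambda>x. 0)"
proof
  fix y
  obtain x where x: "x \<in> S" using assms by auto
  obtain P where P: "\<And>t::real. p (x + t *\<^sub>R (y - x)) = poly P t"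
    using polys_along_line[OF assms(1), of x "y - x"] by blast
  have "open ((\<lambda>t::real. x + t *\<^sub>R (y - x)) -` S)"
    by (intro open_vimage assms continuous_intros)
  moreover have "0 \<in> (\<lambda>t::real. x + t *\<^sub>R (y - x)) -` S" using x by simp
  ultimately obtain e where e: "e > 0" "ball 0 e \<subseteq> (\<lambda>t::real. x + t *\<^sub>R (y - x)) -` S"
    using open_contains_ball by blast
  have "ball 0 e \<subseteq> {t. poly P t = 0}"
  proof
    fix t :: real assume "t \<in> ball 0 e"
    then have "x + t *\<^sub>R (y - x) \<in> S" using e by blast
    then show "t \<in> {t. poly P t = 0}" using assms(4) P by (metis mem_Collect_eq)
  qed
  moreover have "infinite (ball (0::real) e)"
    using e(1) uncountable_ball uncountable_infinite by blast
  ultimately have "P = 0" using poly_roots_finite finite_subset by blast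
  then show "p y = 0" using P[of 1] by simp
qed

subsection \<open>Vector fields with polynomial components\<close>

lemma vpolys_comp: "v \<in> vpolys l \<Longrightarrow> (\<lambda>x. v x $ i) \<in> polys l"
  by (simp add: vpolys_def)

lemma vpolysI: "(\<And>i. (\<lambda>x. v x $ i) \<in> polys l) \<Longrightarrow> v \<in> vpolys l"
  by (simp add: vpolys_def)

lemma vpolys_add [intro]: "v \<in> vpolys l \<Longrightarrow> w \<in> vpolys l \<Longrightarrow> (\<lambda>x. v x + w x) \<in> vpolys l"
  by (simp add: vpolys_def polys_add)

lemma vpolys_diff [intro]: "v \<in> vpolys l \<Longrightarrow> w \<in> vpolys l \<Longrightarrow> (\<lambda>x. v x - w x) \<in> vpolys l"
  by (simp add: vpolys_def polys_diff)

lemma vpolys_scaleR [intro]: "v \<in> vpolys l \<Longrightarrow> (\<lambda>x. c *\<^sub>R v x) \<in> vpolys l"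
  by (simp add: vpolys_def polys_cmult)

lemma vpolys_0 [simp]: "(\<lambda>x. 0) \<in> vpolys l"
  by (simp add: vpolys_def)

lemma vpolys_const [simp]: "0 \<le> l \<Longrightarrow> (\<lambda>x. c) \<in> vpolys l"
  by (simp add: vpolys_def)

lemma vpolys_mono: "v \<in> vpolys l \<Longrightarrow> l \<le> l' \<Longrightarrow> v \<in> vpolys l'"
  by (auto simp: vpolys_def intro: polys_mono)

lemma subspace_vpolys [simp]: "subspace (vpolys l)"
  by (rule subspaceI)
    (auto simp: zero_fun_def plus_fun_def scaleR_fun_def intro: vpolys_add vpolys_scaleR)

lemma vpolys_continuous_on: "v \<in> vpolys l \<Longrightarrow> continuous_on S v"
  by (subst continuous_on_componentwise) (auto simp: Basis_vec_def inner_axis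
    intro: polys_continuous_on vpolys_comp)

lemma vpolys_smult: "p \<in> polys l \<Longrightarrow> v \<in> vpolys l' \<Longrightarrow> (\<lambda>x. p x *\<^sub>R v x) \<in> vpolys (l + l')"
  by (simp add: vpolys_def polys_mult)

lemma vpolys_inner: "v \<in> vpolys l \<Longrightarrow> w \<in> vpolys l' \<Longrightarrow> (\<lambda>x. v x \<bullet> w x) \<in> polys (l + l')"
  unfolding inner_vec_def inner_real_def by (intro polys_sum polys_mult vpolys_comp)

lemma vpolys_inner_const: "v \<in> vpolys l \<Longrightarrow> (\<lambda>x. v x \<bullet> n) \<in> polys l"
  using vpolys_inner[of v l "\<lambda>x. n" 0] by simp

lemma cross3_comp:
  "cross3 x y $ 1 = x $ 2 * y $ 3 - x $ 3 * y $ 2"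
  "cross3 x y $ 2 = x $ 3 * y $ 1 - x $ 1 * y $ 3"
  "cross3 x y $ 3 = x $ 1 * y $ 2 - x $ 2 * y $ 1"
  by (simp_all add: cross3_def)

lemma vpolys_cross3: "v \<in> vpolys l \<Longrightarrow> w \<in> vpolys l' \<Longrightarrow> (\<lambda>x. cross3 (v x) (w x)) \<in> vpolys (l + l')"
  unfolding vpolys_def mem_Collect_eq forall_3 cross3_comp
  by (intro conjI polys_diff polys_mult) auto

lemma vpolys_cross3_const: "v \<in> vpolys l \<Longrightarrow> (\<lambda>x. cross3 (v x) n) \<in> vpolys l"
  "v \<in> vpolys l \<Longrightarrow> (\<lambda>x. cross3 n (v x)) \<in> vpolys l"
  using vpolys_cross3[of v l "\<lambda>x. n" 0] vpolys_cross3[of "\<lambda>x. n" 0 v l] by simp_all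

lemma frechet_derivative_vpolys:
  assumes "v \<in> vpolys l"
  shows "frechet_derivative v (at x) (axis i 1) $ j = pd i (\<lambda>x. v x $ j) x"
proof -
  have "(v has_derivative (\<lambda>h. \<chi> j. frechet_derivative (\<lambda>x. v x $ j) (at x) h)) (at x)"
    by (subst has_derivative_componentwise_within)
      (auto simp: Basis_vec_def inner_axis intro: polys_has_derivative vpolys_comp[OF assms])
  then have "frechet_derivative v (at x) = (\<lambda>h. \<chi> j. frechet_derivative (\<lambda>x. v x $ j) (at x) h)"
    by (metis frechet_derivative_at)
  then show ?thesis by (simp add: pd_def)
qed

lemma grad_comp: "grad q x $ i = pd i q x"
  by (simp add: grad_def pd_def)

lemma dvg_eq: "v \<in> vpolys l \<Longrightarrow> dvg v x = (\<Sum>i\<in>UNIV. pd i (\<lambda>x. v x $ i) x)"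
  by (simp add: dvg_def frechet_derivative_vpolys)

lemma curl_comp:
  assumes "v \<in> vpolys l"
  shows "curl v x $ 1 = pd 2 (\<lambda>x. v x $ 3) x - pd 3 (\<lambda>x. v x $ 2) x"
    "curl v x $ 2 = pd 3 (\<lambda>x. v x $ 1) x - pd 1 (\<lambda>x. v x $ 3) x"
    "curl v x $ 3 = pd 1 (\<lambda>x. v x $ 2) x - pd 2 (\<lambda>x. v x $ 1) x"
  by (simp_all add: curl_def Let_def frechet_derivative_vpolys[OF assms])

lemma grad_vpolys: "q \<in> polys l \<Longrightarrow> grad q \<in> vpolys (l - 1)"
  unfolding vpolys_def using polys_pd by (simp add: grad_comp)

lemma dvg_polys:
  assumes "v \<in> vpolys l"
  shows "dvg v \<in> polys (l - 1)"
proof -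
  have "dvg v = (\<lambda>x. \<Sum>i\<in>UNIV. pd i (\<lambda>x. v x $ i) x)" by (auto simp: dvg_eq[OF assms])
  then show ?thesis by (auto intro!: polys_pd vpolys_comp[OF assms])
qed

lemma curl_vpolys: "v \<in> vpolys l \<Longrightarrow> curl v \<in> vpolys (l - 1)"
  unfolding vpolys_def[of "l - 1"] mem_Collect_eq forall_3 
  by (simp only: curl_comp) (intro conjI polys_diff polys_pd vpolys_comp; assumption)

lemma grad_add_scaleR:
  "q \<in> polys l \<Longrightarrow> r \<in> polys l \<Longrightarrow> grad (\<lambda>x. a * q x + b * r x) = (\<lambda>x. a *\<^sub>R grad q x + b *\<^sub>R grad r x)"
  by (intro ext, simp add: vec_eq_iff grad_comp)
    (simp add: pd_add pd_cmult polys_differentiable differentiable_mult)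

lemma dvg_add_scaleR:
  assumes "v \<in> vpolys l" "w \<in> vpolys l"
  shows "dvg (\<lambda>x. a *\<^sub>R v x + b *\<^sub>R w x) = (\<lambda>x. a * dvg v x + b * dvg w x)"
proof -
  have "(\<lambda>x. a *\<^sub>R v x + b *\<^sub>R w x) \<in> vpolys l" using assms by auto
  note e = dvg_eq[OF this] dvg_eq[OF assms(1)] dvg_eq[OF assms(2)]
  have "pd i (\<lambda>x. a * v x $ i + b * w x $ i) x = a * pd i (\<lambda>x. v x $ i) x + b * pd i (\<lambda>x. w x $ i) x" for i x
    by (simp add: pd_add pd_cmult polys_differentiable[OF vpolys_comp[OF assms(1)]]
        polys_differentiable[OF vpolys_comp[OF assms(2)]] differentiable_mult)
  then show ?thesis unfolding fun_eq_iff e by (simp add: sum.distrib sum_distrib_left)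
qed

lemma curl_add_scaleR:
  assumes "v \<in> vpolys l" "w \<in> vpolys l"
  shows "curl (\<lambda>x. a *\<^sub>R v x + b *\<^sub>R w x) = (\<lambda>x. a *\<^sub>R curl v x + b *\<^sub>R curl w x)"
proof -
  have "(\<lambda>x. a *\<^sub>R v x + b *\<^sub>R w x) \<in> vpolys l" using assms by auto
  note e = curl_comp[OF this] curl_comp[OF assms(1)] curl_comp[OF assms(2)]
  have "pd i (\<lambda>x. a * v x $ j + b * w x $ j) x = a * pd i (\<lambda>x. v x $ j) x + b * pd i (\<lambda>x. w x $ j) x" for i j x
    by (simp add: pd_add pd_cmult polys_differentiable[OF vpolys_comp[OF assms(1)]]
        polys_differentiable[OF vpolys_comp[OF assms(2)]] differentiable_mult)
  then show ?thesis unfolding fun_eq_iff vec_eq_iff forall_3 vector_add_component vector_scaleR_component e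
    by (simp add: algebra_simps)
qed

lemma dvg_smult:
  assumes "q \<in> polys l" "v \<in> vpolys l'"
  shows "dvg (\<lambda>x. q x *\<^sub>R v x) x = q x * dvg v x + v x \<bullet> grad q x"
proof -
  have "pd i (\<lambda>x. q x * v x $ i) x = q x * pd i (\<lambda>x. v x $ i) x + v x $ i * pd i q x" for i
    by (simp add: pd_mult polys_differentiable[OF assms(1)] polys_differentiable[OF vpolys_comp[OF assms(2)]])
  then show ?thesis
    by (simp add: dvg_eq[OF vpolys_smult[OF assms]] dvg_eq[OF assms(2)] inner_vec_def grad_comp
        sum.distrib sum_distrib_left)
qed

lemma dvg_cross3:
  assumes "v \<in> vpolys l" "w \<in> vpolys l'"
  shows "dvg (\<lambda>x. cross3 (v x) (w x)) x = curl v x \<bullet> w x - v x \<bullet> curl w x"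
proof -
  note d = polys_differentiable[OF vpolys_comp[OF assms(1)]] polys_differentiable[OF vpolys_comp[OF assms(2)]]
  show ?thesis
    unfolding dvg_eq[OF vpolys_cross3[OF assms]] inner_vec_def sum_3 cross3_comp
      curl_comp[OF assms(1)] curl_comp[OF assms(2)]
    by (simp add: pd_diff pd_mult d differentiable_mult algebra_simps)
qed

lemma curl_smult:
  assumes "q \<in> polys l" "v \<in> vpolys l'"
  shows "curl (\<lambda>x. q x *\<^sub>R v x) x = q x *\<^sub>R curl v x + cross3 (grad q x) (v x)"
proof -
  note d = polys_differentiable[OF assms(1)] polys_differentiable[OF vpolys_comp[OF assms(2)]]
  show ?thesis
    unfolding vec_eq_iff forall_3 vector_add_component vector_scaleR_component cross3_comp
      curl_comp[OF vpolys_smult[OF assms]] curl_comp[OF assms(2)] grad_comp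
    by (simp add: pd_mult d algebra_simps)
qed

lemma dvg_curl:
  assumes "v \<in> vpolys l"
  shows "dvg (curl v) x = 0"
proof -
  have e: "(\<lambda>x. curl v x $ 1) = (\<lambda>x. pd 2 (\<lambda>x. v x $ 3) x - pd 3 (\<lambda>x. v x $ 2) x)"
    "(\<lambda>x. curl v x $ 2) = (\<lambda>x. pd 3 (\<lambda>x. v x $ 1) x - pd 1 (\<lambda>x. v x $ 3) x)"
    "(\<lambda>x. curl v x $ 3) = (\<lambda>x. pd 1 (\<lambda>x. v x $ 2) x - pd 2 (\<lambda>x. v x $ 1) x)"
    by (simp_all add: curl_comp[OF assms])
  show ?thesis unfolding dvg_eq[OF curl_vpolys[OF assms]] sum_3 e
    by (simp add: pd_diff polys_differentiable[OF polys_pd[OF vpolys_comp[OF assms]]])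
      (simp add: polys_pd_commute[OF vpolys_comp[OF assms], of 2 1]
        polys_pd_commute[OF vpolys_comp[OF assms], of 3 1] polys_pd_commute[OF vpolys_comp[OF assms], of 3 2])
qed

lemma curl_grad: "q \<in> polys l \<Longrightarrow> curl (grad q) = (\<lambda>x. 0)"
  unfolding fun_eq_iff vec_eq_iff forall_3 curl_comp[OF grad_vpolys] grad_comp zero_index
  by (simp add: polys_pd_commute[of q l 2 1] polys_pd_commute[of q l 3 1] polys_pd_commute[of q l 3 2])

lemma grad_eq_0:
  assumes "q \<in> polys l" "\<And>x. grad q x = 0"
  shows "q x = q y"
proof -
  have "frechet_derivative q (at x) = (\<lambda>h. 0)" for x
    using assms(2)[of x] unfolding vec_eq_iff grad_comp
    by (intro ext) (simp add: frechet_derivative_polys[OF assms(1)])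
  then have "(q has_derivative (\<lambda>h. 0)) (at x)" for x
    using polys_has_derivative[OF assms(1), of x] by simp
  then show ?thesis using has_derivative_zero_unique[of UNIV q x y] by simp
qed

subsection \<open>Exactness of the polynomial de Rham sequence\<close>

text \<open>The potentials are those of the Koszul homotopy; the operator below is multiplication
  by \<open>c + n\<close> on homogeneous polynomials of degree \<open>n\<close>.\<close>

definition euler_op :: "nat \<Rightarrow> (pt \<Rightarrow> real) \<Rightarrow> pt \<Rightarrow> real" where
  "euler_op c p x = real c * p x + (\<Sum>i\<in>UNIV. x $ i * pd i p x)"

lemma euler_op_monom_of: "monom_of n m \<Longrightarrow> euler_op c m x = real (c + n) * m x"
proof (induction rule: monom_of.induct)
  case (times n m i)
  note d = monom_of_differentiable[OF times(1)]
  have "(\<Sum>j\<in>UNIV. x $ j * pd j (\<lambda>x. x $ i * m x) x)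
      = (\<Sum>j\<in>UNIV. x $ i * (x $ j * pd j m x) + (if j = i then x $ j * m x else 0))"
    by (intro sum.cong) (auto simp: pd_mult pd_coord d algebra_simps)
  also have "\<dots> = x $ i * (\<Sum>j\<in>UNIV. x $ j * pd j m x) + x $ i * m x"
    by (simp add: sum.distrib sum_distrib_left)
  finally show ?case using times(2) unfolding euler_op_def by (simp add: algebra_simps)
qed (simp add: euler_op_def)

lemma euler_op_add_cmult:
  assumes "f differentiable (at x)" "g differentiable (at x)"
  shows "euler_op c (\<lambda>x. a * f x + b * g x) x = a * euler_op c f x + b * euler_op c g x"
  unfolding euler_op_def using assms
  by (simp add: pd_add pd_cmult differentiable_mult algebra_simps sum.distrib sum_distrib_left)

text \<open>A monomial of degree \<open>n\<close> is multiplied by \<open>c + n\<close>, and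
  \<open>0 < c\<close> keeps this factor nonzero even for constants.\<close>

lemma euler_op_surj:
  assumes "p \<in> polys l" "0 < c"
  shows "\<exists>q\<in>polys l. \<forall>x. euler_op c q x = p x"
  using assms(1)
proof (induction rule: polys_induct)
  case zero
  show ?case by (rule bexI[of _ "\<lambda>x. 0"]) (auto simp: euler_op_def)
next
  case (add a n m q)
  then obtain r where r: "r \<in> polys l" "\<And>x. euler_op c r x = q x" by blast
  have "euler_op c (\<lambda>x. (a / real (c + n)) * m x + 1 * r x) x = a * m x + q x" for x
    by (subst euler_op_add_cmult)
      (use assms(2) r in \<open>auto simp: monom_of_differentiable[OF add(1)] polys_differentiable
        euler_op_monom_of[OF add(1)]\<close>)
  moreover have "(\<lambda>x. (a / real (c + n)) * m x + 1 * r x) \<in> polys l"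
    by (intro polys_add polys_cmult r monom_of_in_polys[OF add(1,2)])
  ultimately show ?case by blast
qed

text \<open>The derivative of \<open>s ^ c * q (s *\<^sub>R x)\<close> in \<open>s\<close> is
  \<open>s ^ (c - 1)\<close> times the Euler operator of \<open>q\<close> at
  \<open>s *\<^sub>R x\<close>, so this function of \<open>s\<close> is constant. It is 0 at
  \<open>s = 0\<close> because \<open>0 < c\<close>, and \<open>q x\<close> at
  \<open>s = 1\<close>.\<close>

lemma euler_op_inj:
  assumes q: "q \<in> polys l" and "0 < c" and 0: "\<And>x. euler_op c q x = 0"
  shows "q x = 0"
proof -
  obtain n where n: "c = Suc n" using assms(2) gr0_conv_Suc by blast
  have "((\<lambda>s. s ^ c * q (s *\<^sub>R x)) has_real_derivative 0) (at s)" for s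
  proof -
    have "((\<lambda>s. q (s *\<^sub>R x)) has_derivative (\<lambda>h. frechet_derivative q (at (s *\<^sub>R x)) (h *\<^sub>R x))) (at s)"
      by (rule has_derivative_compose[where g = q, OF _ polys_has_derivative[OF q]])
        (auto intro!: derivative_eq_intros)
    also have "(\<lambda>h. frechet_derivative q (at (s *\<^sub>R x)) (h *\<^sub>R x))
        = (*) (\<Sum>i\<in>UNIV. x $ i * pd i q (s *\<^sub>R x))"
      by (auto simp: frechet_derivative_polys[OF q] sum_distrib_left sum_distrib_right algebra_simps)
    finally have "((\<lambda>s. q (s *\<^sub>R x)) has_real_derivative (\<Sum>i\<in>UNIV. x $ i * pd i q (s *\<^sub>R x))) (at s)"
      by (simp add: has_field_derivative_def)
    then have "((\<lambda>s. s ^ c * q (s *\<^sub>R x)) has_real_derivative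
        real c * s ^ (c - 1) * q (s *\<^sub>R x) + (\<Sum>i\<in>UNIV. x $ i * pd i q (s *\<^sub>R x)) * s ^ c) (at s)"
      by (auto intro!: derivative_eq_intros)
    moreover have "real c * s ^ (c - 1) * q (s *\<^sub>R x) + (\<Sum>i\<in>UNIV. x $ i * pd i q (s *\<^sub>R x)) * s ^ c
        = s ^ n * euler_op c q (s *\<^sub>R x)"
      unfolding n euler_op_def by (simp add: algebra_simps sum_distrib_left)
    ultimately show ?thesis using 0 by simp
  qed
  then have "1 ^ c * q (1 *\<^sub>R x) = 0 ^ c * q (0 *\<^sub>R x)"
    using DERIV_isconst_all[of "\<lambda>s. s ^ c * q (s *\<^sub>R x)" 1 0] by blast
  then show ?thesis using assms(2) by simp
qed

text \<open>Differentiation lowers the degree by one, so the constant rises by one to keep the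
  factor \<open>c + n\<close>.\<close>

lemma pd_euler_op:
  assumes "p \<in> polys l"
  shows "pd i (euler_op c p) x = euler_op (Suc c) (pd i p) x"
proof -
  note d = polys_differentiable[OF assms] polys_differentiable[OF polys_pd[OF assms]]
  have "pd i (euler_op c p) x = real c * pd i p x + (\<Sum>j\<in>UNIV. pd i (\<lambda>x. x $ j * pd j p x) x)"
    unfolding euler_op_def[abs_def]
    by (simp add: pd_add pd_cmult pd_sum d differentiable_mult differentiable_sum)
  also have "(\<Sum>j\<in>UNIV. pd i (\<lambda>x. x $ j * pd j p x) x)
      = (\<Sum>j\<in>UNIV. x $ j * pd j (pd i p) x + (if j = i then pd j p x else 0))"
    by (intro sum.cong) (auto simp: pd_mult pd_coord d polys_pd_commute[OF assms, of i])
  finally have "pd i (euler_op c p) x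
      = real c * pd i p x + ((\<Sum>j\<in>UNIV. x $ j * pd j (pd i p) x) + pd i p x)"
    by (simp add: sum.distrib)
  then show ?thesis unfolding euler_op_def[of "Suc c"] by (simp add: algebra_simps)
qed

lemma euler_op_vpolys_surj:
  assumes "v \<in> vpolys l" "0 < c"
  shows "\<exists>u\<in>vpolys l. \<forall>i x. euler_op c (\<lambda>x. u x $ i) x = v x $ i"
proof -
  have "\<forall>i. \<exists>q. q \<in> polys l \<and> (\<forall>x. euler_op c q x = v x $ i)"
    using euler_op_surj[OF vpolys_comp[OF assms(1)] assms(2)] by blast
  then obtain q where q: "\<And>i. q i \<in> polys l" "\<And>i x. euler_op c (q i) x = v x $ i" by metis
  show ?thesis by (rule bexI[of _ "\<lambda>x. \<chi> i. q i x"]) (auto simp: vpolys_def q)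
qed

lemma dvg_surj:
  assumes "p \<in> polys l"
  shows "\<exists>v\<in>vpolys (l + 1). \<forall>x. dvg v x = p x"
proof -
  \<comment> \<open>The constant is the divergence of the identity field: a radial field
    \<open>u x *\<^sub>R x\<close> has divergence \<open>3 * u x\<close> plus the radial derivative
    of \<open>u\<close>.\<close>
  obtain u where u: "u \<in> polys l" "\<And>x. euler_op 3 u x = p x" using euler_op_surj[OF assms, of 3] by auto
  have id: "(\<lambda>x. x) \<in> vpolys 1" by (simp add: vpolys_def polys_coord)
  have "dvg (\<lambda>x. u x *\<^sub>R x) x = p x" for x
    unfolding dvg_smult[OF u(1) id] u(2)[symmetric]
    by (simp add: dvg_eq[OF id] pd_coord euler_op_def inner_vec_def grad_comp)
  then show ?thesis using vpolys_smult[OF u(1) id] by blast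
qed

text \<open>The potential is \<open>x \<bullet> u x\<close>, where \<open>u\<close> is obtained from
  \<open>v\<close> by inverting the Euler operator with constant 1. Differentiating gives
  \<open>u x $ i\<close> plus the sum of \<open>x $ j\<close> times the derivative of
  \<open>u x $ j\<close> in direction \<open>i\<close>; if \<open>u\<close> is curl-free, the
  indices may be exchanged and the result is the Euler operator of the component, that is,
  \<open>v x $ i\<close>.\<close>

lemma exists_grad_potential:
  assumes v: "v \<in> vpolys l" and 0: "\<And>x. curl v x = 0"
  shows "\<exists>q\<in>polys (l + 1). \<forall>x. grad q x = v x"
proof -
  obtain u where u: "u \<in> vpolys l" "\<And>i x. euler_op 1 (\<lambda>x. u x $ i) x = v x $ i"
    using euler_op_vpolys_surj[OF v, of 1] by auto
  note uc = vpolys_comp[OF u(1)]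
  have ue: "euler_op 1 (\<lambda>x. u x $ i) = (\<lambda>x. v x $ i)" for i using u(2) by auto
  \<comment> \<open>Closedness passes from \<open>v\<close> to \<open>u\<close>: derivatives turn
    constant 1 into constant 2, and the operator with constant 2 is injective.\<close>
  have sym: "pd i (\<lambda>x. u x $ j) x = pd j (\<lambda>x. u x $ i) x" for i j x
  proof -
    have v0: "pd i (\<lambda>x. v x $ j) x = pd j (\<lambda>x. v x $ i) x" for x
      using 0[of x] exhaust_3[of i] exhaust_3[of j]
      unfolding vec_eq_iff forall_3 curl_comp[OF v] by auto
    have "euler_op 2 (\<lambda>x. 1 * pd i (\<lambda>x. u x $ j) x + (-1) * pd j (\<lambda>x. u x $ i) x) x = 0" for x
    proof -
      have "euler_op 2 (pd i (\<lambda>x. u x $ j)) x = pd i (\<lambda>x. v x $ j) x" for i j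
        unfolding ue[symmetric] pd_euler_op[OF uc] by (simp add: numeral_2_eq_2)
      then show ?thesis
        by (subst euler_op_add_cmult) (simp_all add: v0 polys_differentiable[OF polys_pd[OF uc]])
    qed
    then have "1 * pd i (\<lambda>x. u x $ j) x + (-1) * pd j (\<lambda>x. u x $ i) x = 0"
      by (intro euler_op_inj[where l = "l - 1" and c = 2
            and q = "\<lambda>x. 1 * pd i (\<lambda>x. u x $ j) x + (-1) * pd j (\<lambda>x. u x $ i) x"]
          polys_add polys_cmult polys_pd uc) auto
    then show ?thesis by simp
  qed
  define q where "q = (\<lambda>x. \<Sum>j\<in>UNIV. x $ j * u x $ j)"
  have "pd i q x = v x $ i" for i x
  proof -
    have "pd i q x = (\<Sum>j\<in>UNIV. pd i (\<lambda>x. x $ j * u x $ j) x)"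
      unfolding q_def by (rule pd_sum) (simp add: differentiable_mult polys_differentiable[OF uc])
    also have "\<dots> = (\<Sum>j\<in>UNIV. x $ j * pd j (\<lambda>x. u x $ i) x + (if j = i then u x $ j else 0))"
      by (intro sum.cong) (auto simp: pd_mult pd_coord polys_differentiable[OF uc] sym[of i])
    also have "\<dots> = euler_op 1 (\<lambda>x. u x $ i) x" by (simp add: euler_op_def sum.distrib)
    finally show ?thesis using u(2) by simp
  qed
  moreover have "q \<in> polys (l + 1)" unfolding q_def by (intro polys_sum polys_times_coord uc)
  ultimately show ?thesis by (auto simp: vec_eq_iff grad_comp)
qed

text \<open>The curl of \<open>cross3 (u x) x\<close> is \<open>2 * u\<close> plus the radial
  derivative of \<open>u\<close> minus \<open>x\<close> times the divergence of \<open>u\<close>.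
  Inverting the Euler operator with constant 2 thus gives the potential, once \<open>u\<close> is
  divergence-free; that follows from injectivity with constant 3, since the derivatives of
  \<open>u\<close> carry a constant larger by one.\<close>

lemma exists_curl_potential:
  assumes v: "v \<in> vpolys l" and 0: "\<And>x. dvg v x = 0"
  shows "\<exists>w\<in>vpolys (l + 1). \<forall>x. curl w x = v x"
proof -
  obtain u where u: "u \<in> vpolys l" "\<And>i x. euler_op 2 (\<lambda>x. u x $ i) x = v x $ i"
    using euler_op_vpolys_surj[OF v, of 2] by auto
  note uc = vpolys_comp[OF u(1)]
  have ue: "euler_op 2 (\<lambda>x. u x $ i) = (\<lambda>x. v x $ i)" for i using u(2) by auto
  have "euler_op 3 (dvg u) x = 0" for x
  proof -
    have "dvg u = (\<lambda>x. 1 * (1 * pd 1 (\<lambda>x. u x $ 1) x + 1 * pd 2 (\<lambda>x. u x $ 2) x) + 1 * pd 3 (\<lambda>x. u x $ 3) x)"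
      by (auto simp: dvg_eq[OF u(1)] sum_3)
    moreover have "dvg v x = (\<Sum>i\<in>UNIV. euler_op 3 (pd i (\<lambda>x. u x $ i)) x)"
      unfolding dvg_eq[OF v] ue[symmetric] pd_euler_op[OF uc] by (simp add: numeral_3_eq_3 numeral_2_eq_2)
    ultimately show ?thesis
      using 0[of x] by (simp only:) (simp add: euler_op_def pd_add differentiable_add
          polys_differentiable[OF polys_pd[OF uc]] sum_3 algebra_simps)
  qed
  then have div0: "dvg u x = 0" for x
    by (intro euler_op_inj[OF dvg_polys[OF u(1)], of 3]) auto
  have id: "(\<lambda>x. x) \<in> vpolys 1" by (simp add: vpolys_def polys_coord)
  have w: "(\<lambda>x. cross3 (u x) x) \<in> vpolys (l + 1)" by (rule vpolys_cross3[OF u(1) id])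
  have "curl (\<lambda>x. cross3 (u x) x) x = v x" for x
  proof -
    note d = polys_differentiable[OF uc]
    have "pd 1 (\<lambda>x. u x $ 1) x + pd 2 (\<lambda>x. u x $ 2) x + pd 3 (\<lambda>x. u x $ 3) x = 0"
      using div0[of x] by (simp add: dvg_eq[OF u(1)] sum_3)
    then have s: "pd 3 (\<lambda>x. u x $ 3) x = - pd 1 (\<lambda>x. u x $ 1) x - pd 2 (\<lambda>x. u x $ 2) x" by simp
    show ?thesis
      unfolding vec_eq_iff forall_3 curl_comp[OF w] cross3_comp u(2)[symmetric] euler_op_def sum_3
      by (simp add: pd_diff pd_mult pd_coord d differentiable_mult s algebra_simps)
  qed
  then show ?thesis using w by blast
qed

section \<open>Linear algebra\<close>

text \<open>Linearity is relative to a carrier because the operators given by a \<open>THE\<close>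
  are meaningful only on the discrete spaces.\<close>

definition lin_on :: "'a::real_vector set \<Rightarrow> ('a \<Rightarrow> 'b::real_vector) \<Rightarrow> bool" where
  "lin_on S f \<longleftrightarrow> (\<forall>x\<in>S. \<forall>y\<in>S. \<forall>a b. f (a *\<^sub>R x + b *\<^sub>R y) = a *\<^sub>R f x + b *\<^sub>R f y)"

lemma lin_onI:
  "(\<And>x y a b. x \<in> S \<Longrightarrow> y \<in> S \<Longrightarrow> f (a *\<^sub>R x + b *\<^sub>R y) = a *\<^sub>R f x + b *\<^sub>R f y) \<Longrightarrow> lin_on S f"
  by (simp add: lin_on_def)

lemma lin_onD:
  "lin_on S f \<Longrightarrow> x \<in> S \<Longrightarrow> y \<in> S \<Longrightarrow> f (a *\<^sub>R x + b *\<^sub>R y) = a *\<^sub>R f x + b *\<^sub>R f y"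
  by (simp add: lin_on_def)

lemma lin_on_add: "lin_on S f \<Longrightarrow> x \<in> S \<Longrightarrow> y \<in> S \<Longrightarrow> f (x + y) = f x + f y"
  using lin_onD[of S f x y 1 1] by simp

lemma lin_on_diff: "lin_on S f \<Longrightarrow> x \<in> S \<Longrightarrow> y \<in> S \<Longrightarrow> f (x - y) = f x - f y"
  using lin_onD[of S f x y 1 "-1"] by simp

lemma lin_on_scale: "lin_on S f \<Longrightarrow> x \<in> S \<Longrightarrow> f (a *\<^sub>R x) = a *\<^sub>R f x"
  using lin_onD[of S f x x a 0] by simp

lemma lin_on_0: "lin_on S f \<Longrightarrow> subspace S \<Longrightarrow> f 0 = 0"
  using lin_on_scale[of S f 0 0] subspace_0 by force

lemma lin_on_subset: "lin_on S f \<Longrightarrow> A \<subseteq> S \<Longrightarrow> lin_on A f"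
  unfolding lin_on_def by (meson subsetD)

lemma lin_on_comp: "lin_on S f \<Longrightarrow> lin_on T g \<Longrightarrow> f ` S \<subseteq> T \<Longrightarrow> lin_on S (\<lambda>x. g (f x))"
  unfolding lin_on_def by (simp add: image_subset_iff)

lemma lin_on_add_fun: "lin_on S f \<Longrightarrow> lin_on S g \<Longrightarrow> lin_on S (\<lambda>x. f x + g x)"
  unfolding lin_on_def by (simp add: algebra_simps)

lemma lin_on_diff_fun: "lin_on S f \<Longrightarrow> lin_on S g \<Longrightarrow> lin_on S (\<lambda>x. f x - g x)"
  unfolding lin_on_def by (simp add: algebra_simps)

lemma lin_on_scale_fun: "lin_on S f \<Longrightarrow> lin_on S (\<lambda>x. c *\<^sub>R f x)"
  unfolding lin_on_def by (simp add: algebra_simps)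

lemma lin_on_sum_fun: "(\<And>i. i \<in> I \<Longrightarrow> lin_on S (f i)) \<Longrightarrow> lin_on S (\<lambda>x. \<Sum>i\<in>I. f i x)"
  unfolding lin_on_def by (simp add: sum.distrib scaleR_sum_right)

lemma subspace_lin_comb: "subspace S \<Longrightarrow> x \<in> S \<Longrightarrow> y \<in> S \<Longrightarrow> a *\<^sub>R x + b *\<^sub>R y \<in> S"
  by (simp add: subspace_add subspace_scale)

lemma subspace_lin_on_image: "subspace S \<Longrightarrow> lin_on S f \<Longrightarrow> subspace (f ` S)"
  by (rule subspaceI)
    (auto simp: lin_on_0[symmetric] lin_on_add[symmetric] lin_on_scale[symmetric]
      subspace_0 subspace_add subspace_scale intro!: imageI)

text \<open>The span induction has to carry membership in \<open>S\<close> along, since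
  \<open>f\<close> is linear nowhere else.\<close>

lemma lin_on_image_span:
  assumes "subspace S" "lin_on S f" "B \<subseteq> S" "S \<subseteq> span B"
  shows "f ` S \<subseteq> span (f ` B)"
proof -
  have "f x \<in> span (f ` B) \<and> x \<in> S" if "x \<in> span B" for x
    using that
  proof (induction rule: span_induct_alt)
    case base
    then show ?case using lin_on_0[OF assms(2,1)] subspace_0[OF assms(1)] by (simp add: span_zero)
  next
    case (step c x y)
    have x: "x \<in> S" "f x \<in> span (f ` B)" using step(1) assms(3) by (auto intro: span_base)
    have "f (c *\<^sub>R x + 1 *\<^sub>R y) = c *\<^sub>R f x + 1 *\<^sub>R f y"
      by (rule lin_onD[OF assms(2) x(1)]) (use step in blast)
    then have "f (c *\<^sub>R x + y) = c *\<^sub>R f x + f y" by simp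
    then show ?case using step(2) x subspace_lin_comb[OF assms(1) x(1), of y c 1]
      by (simp add: span_add span_scale)
  qed
  then show ?thesis using assms(4) by auto
qed

definition finitely_spanned :: "'a::real_vector set \<Rightarrow> bool" where
  "finitely_spanned S \<longleftrightarrow> (\<exists>B. finite B \<and> B \<subseteq> S \<and> S \<subseteq> span B)"

lemma finitely_spanned_image:
  assumes "finitely_spanned S" "subspace S" "lin_on S f"
  shows "finitely_spanned (f ` S)"
proof -
  obtain B where B: "finite B" "B \<subseteq> S" "S \<subseteq> span B"
    using assms(1) by (auto simp: finitely_spanned_def)
  show ?thesis unfolding finitely_spanned_def
    by (rule exI[of _ "f ` B"]) (use B lin_on_image_span[OF assms(2,3) B(2,3)] in auto)
qed

text \<open>A maximal independent subset of \<open>A\<close> lies in the span of the finite set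
  \<open>B\<close>, hence is finite by the exchange bound.\<close>

lemma finitely_spanned_subspace:
  assumes "finitely_spanned S" "subspace A" "A \<subseteq> S"
  shows "finitely_spanned A"
proof -
  obtain B where B: "finite B" "S \<subseteq> span B" using assms(1) by (auto simp: finitely_spanned_def)
  obtain C where C: "C \<subseteq> A" "independent C" "A \<subseteq> span C" using maximal_independent_subset by metis
  have "C \<subseteq> span B" using C B assms by blast
  then have "finite C" using independent_span_bound[OF B(1) C(2)] by blast
  then show ?thesis using C by (auto simp: finitely_spanned_def)
qed

lemma dsum_eq_sums: "dsum A B = {x + y |x y. x \<in> A \<and> y \<in> B}"
  by (simp add: dsum_def)

lemma subspace_dsum: "subspace A \<Longrightarrow> subspace B \<Longrightarrow> subspace (dsum A B)"
  unfolding dsum_eq_sums by (rule subspace_sums)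

text \<open>Trivial intersection is what makes the \<open>THE\<close> in \<open>dsum_fst\<close> and
  \<open>dsum_snd\<close> well defined. In the applications \<open>B\<close> is the complement of a
  space of degree \<open>k\<close> and \<open>A\<close> the smaller space of degree
  \<open>k - 1\<close>, so the sum is direct but need not fill the ambient polynomial space.\<close>

locale direct_sum =
  fixes A B :: "'a::real_vector set"
  assumes subspace_A: "subspace A" and subspace_B: "subspace B" and disj: "A \<inter> B \<subseteq> {0}"
begin

lemma unique:
  assumes "a \<in> A" "b \<in> B" "a' \<in> A" "b' \<in> B" "a + b = a' + b'"
  shows "a = a'" "b = b'"
proof -
  have "a - a' = b' - b" using assms(5) by (simp add: algebra_simps)
  moreover have "a - a' \<in> A" "b' - b \<in> B" using assms subspace_A subspace_B by (auto simp: subspace_diff)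
  ultimately have "a - a' = 0" using disj by auto
  then show "a = a'" "b = b'" using assms(5) by auto
qed

lemma dsum_fst_eq: "a \<in> A \<Longrightarrow> b \<in> B \<Longrightarrow> dsum_fst A B (a + b) = a"
  unfolding dsum_fst_def by (rule the_equality) (use unique in blast)+

lemma dsum_snd_eq: "a \<in> A \<Longrightarrow> b \<in> B \<Longrightarrow> dsum_snd A B (a + b) = b"
  unfolding dsum_snd_def by (rule the_equality) (use unique in blast)+

lemma dsum_fst_snd: "v \<in> dsum A B \<Longrightarrow> dsum_fst A B v + dsum_snd A B v = v"
  and dsum_fst_in: "v \<in> dsum A B \<Longrightarrow> dsum_fst A B v \<in> A"
  and dsum_snd_in: "v \<in> dsum A B \<Longrightarrow> dsum_snd A B v \<in> B"
  by (auto simp: dsum_def dsum_fst_eq dsum_snd_eq)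

lemma lin_on_dsum_fst: "lin_on (dsum A B) (dsum_fst A B)"
  and lin_on_dsum_snd: "lin_on (dsum A B) (dsum_snd A B)"
proof -
  have *: "dsum_fst A B (s *\<^sub>R x + t *\<^sub>R y) = s *\<^sub>R dsum_fst A B x + t *\<^sub>R dsum_fst A B y \<and>
      dsum_snd A B (s *\<^sub>R x + t *\<^sub>R y) = s *\<^sub>R dsum_snd A B x + t *\<^sub>R dsum_snd A B y"
    if xy: "x \<in> dsum A B" "y \<in> dsum A B" for x y s t
  proof -
    obtain a b where e1: "x = a + b" "a \<in> A" "b \<in> B" using xy(1) unfolding dsum_def by blast
    obtain a' b' where e2: "y = a' + b'" "a' \<in> A" "b' \<in> B" using xy(2) unfolding dsum_def by blast
    note e = e1 e2
    have eq: "s *\<^sub>R x + t *\<^sub>R y = (s *\<^sub>R a + t *\<^sub>R a') + (s *\<^sub>R b + t *\<^sub>R b')"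
      unfolding e by (simp add: algebra_simps)
    show ?thesis
      unfolding eq using e subspace_lin_comb[OF subspace_A] subspace_lin_comb[OF subspace_B]
      by (simp add: dsum_fst_eq dsum_snd_eq)
  qed
  show "lin_on (dsum A B) (dsum_fst A B)" "lin_on (dsum A B) (dsum_snd A B)"
    using * by (simp_all add: lin_on_def)
qed

end

section \<open>Integration against flat measures\<close>

text \<open>The class of admissible integrands: it is closed under products, looks at
  \<open>f\<close> on \<open>X\<close> only, and so contains zero extensions
  \<open>restr X p\<close>, which are in general discontinuous in space.\<close>

definition cont_ext_on :: "pt set \<Rightarrow> (pt \<Rightarrow> 'b::topological_space) \<Rightarrow> bool" where
  "cont_ext_on X f \<longleftrightarrow> (\<exists>g. continuous_on UNIV g \<and> (\<forall>x\<in>X. f x = g x))"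

lemma cont_ext_on_continuous: "continuous_on UNIV f \<Longrightarrow> cont_ext_on X f"
  by (auto simp: cont_ext_on_def)

lemma cont_ext_on_polys: "f \<in> polys l \<Longrightarrow> cont_ext_on X f"
  by (rule cont_ext_on_continuous[OF polys_continuous_on])

lemma cont_ext_on_vpolys: "v \<in> vpolys l \<Longrightarrow> cont_ext_on X v"
  by (rule cont_ext_on_continuous[OF vpolys_continuous_on])

lemma cont_ext_on_const: "cont_ext_on X (\<lambda>x. c)"
  by (rule cont_ext_on_continuous) auto

lemma cont_ext_on_cong: "(\<And>x. x \<in> X \<Longrightarrow> f x = g x) \<Longrightarrow> cont_ext_on X f \<longleftrightarrow> cont_ext_on X g"
  by (auto simp: cont_ext_on_def)

lemma cont_ext_on_restr: "cont_ext_on X f \<Longrightarrow> cont_ext_on X (restr X f)"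
  by (subst cont_ext_on_cong[where g = f]) (auto simp: restr_def)

lemma cont_ext_on_compose2:
  assumes "cont_ext_on X f" "cont_ext_on X g" "continuous_on UNIV (\<lambda>(x, y). h x y)"
  shows "cont_ext_on X (\<lambda>x. h (f x) (g x))"
proof -
  obtain f' g' where e: "continuous_on UNIV f'" "\<And>x. x \<in> X \<Longrightarrow> f x = f' x"
    "continuous_on UNIV g'" "\<And>x. x \<in> X \<Longrightarrow> g x = g' x"
    using assms(1,2) by (auto simp: cont_ext_on_def)
  have "continuous_on UNIV (\<lambda>x. (\<lambda>(x, y). h x y) (f' x, g' x))"
    by (rule continuous_on_compose2[OF assms(3)]) (auto intro!: continuous_on_Pair e)
  then show ?thesis using e unfolding cont_ext_on_def by (intro exI[of _ "\<lambda>x. h (f' x) (g' x)"]) auto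
qed

lemma cont_ext_on_add:
  fixes f :: "pt \<Rightarrow> 'b::real_normed_vector"
  shows "cont_ext_on X f \<Longrightarrow> cont_ext_on X g \<Longrightarrow> cont_ext_on X (\<lambda>x. f x + g x)"
  by (erule cont_ext_on_compose2) (auto intro!: continuous_intros simp: case_prod_beta)

lemma cont_ext_on_diff:
  fixes f :: "pt \<Rightarrow> 'b::real_normed_vector"
  shows "cont_ext_on X f \<Longrightarrow> cont_ext_on X g \<Longrightarrow> cont_ext_on X (\<lambda>x. f x - g x)"
  by (erule cont_ext_on_compose2) (auto intro!: continuous_intros simp: case_prod_beta)

lemma cont_ext_on_mult:
  fixes f :: "pt \<Rightarrow> real"
  shows "cont_ext_on X f \<Longrightarrow> cont_ext_on X g \<Longrightarrow> cont_ext_on X (\<lambda>x. f x * g x)"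
  by (erule cont_ext_on_compose2) (auto intro!: continuous_intros simp: case_prod_beta)

lemma cont_ext_on_inner:
  fixes f :: "pt \<Rightarrow> 'b::real_inner"
  shows "cont_ext_on X f \<Longrightarrow> cont_ext_on X g \<Longrightarrow> cont_ext_on X (\<lambda>x. f x \<bullet> g x)"
  by (erule cont_ext_on_compose2) (auto intro!: continuous_intros simp: case_prod_beta)

lemma cont_ext_on_scaleR:
  fixes g :: "pt \<Rightarrow> 'b::real_normed_vector"
  shows "cont_ext_on X f \<Longrightarrow> cont_ext_on X g \<Longrightarrow> cont_ext_on X (\<lambda>x. f x *\<^sub>R g x)"
  by (erule cont_ext_on_compose2) (auto intro!: continuous_intros simp: case_prod_beta)

text \<open>The facts about integration that the Hilbert space arguments rest on, common to the
  cell, its faces and its edges. The last assumption is the strict positivity that turns vanishing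
  integrals into pointwise statements.\<close>

locale flat_measure =
  fixes \<mu> :: "pt measure" and X :: "pt set"
  assumes space_eq: "space \<mu> = X"
    and integrable_cont: "\<And>f :: pt \<Rightarrow> real. cont_ext_on X f \<Longrightarrow> integrable \<mu> f"
    and integral_nonneg_eq_0: "\<And>f x. cont_ext_on X f \<Longrightarrow> (\<And>x. x \<in> X \<Longrightarrow> 0 \<le> f x) \<Longrightarrow>
      (\<integral>x. f x \<partial>\<mu>) = 0 \<Longrightarrow> x \<in> X \<Longrightarrow> f x = (0::real)"
begin

lemma integral_cong: "(\<And>x. x \<in> X \<Longrightarrow> f x = g x) \<Longrightarrow> (\<integral>x. f x \<partial>\<mu>) = (\<integral>x. g x \<partial>\<mu>)"
  by (intro Bochner_Integration.integral_cong) (auto simp: space_eq)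

lemma integral_nonneg: "(\<And>x. x \<in> X \<Longrightarrow> 0 \<le> f x) \<Longrightarrow> 0 \<le> (\<integral>x. f x \<partial>\<mu> :: real)"
  by (intro Bochner_Integration.integral_nonneg_AE AE_I2) (auto simp: space_eq)

lemma integral_add:
  fixes f g :: "pt \<Rightarrow> real"
  shows "cont_ext_on X f \<Longrightarrow> cont_ext_on X g \<Longrightarrow> (\<integral>x. f x + g x \<partial>\<mu>) = (\<integral>x. f x \<partial>\<mu>) + (\<integral>x. g x \<partial>\<mu>)"
  by (intro Bochner_Integration.integral_add integrable_cont)

lemma integral_diff:
  fixes f g :: "pt \<Rightarrow> real"
  shows "cont_ext_on X f \<Longrightarrow> cont_ext_on X g \<Longrightarrow> (\<integral>x. f x - g x \<partial>\<mu>) = (\<integral>x. f x \<partial>\<mu>) - (\<integral>x. g x \<partial>\<mu>)"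
  by (intro Bochner_Integration.integral_diff integrable_cont)

lemma integral_inner_lin:
  fixes f g h :: "pt \<Rightarrow> 'b::real_inner"
  assumes "cont_ext_on X f" "cont_ext_on X g" "cont_ext_on X h"
  shows "(\<integral>x. (a *\<^sub>R f x + b *\<^sub>R g x) \<bullet> h x \<partial>\<mu>) = a * (\<integral>x. f x \<bullet> h x \<partial>\<mu>) + b * (\<integral>x. g x \<bullet> h x \<partial>\<mu>)"
    "(\<integral>x. h x \<bullet> (a *\<^sub>R f x + b *\<^sub>R g x) \<partial>\<mu>) = a * (\<integral>x. h x \<bullet> f x \<partial>\<mu>) + b * (\<integral>x. h x \<bullet> g x \<partial>\<mu>)"
proof -
  have "(\<integral>x. a * (f x \<bullet> h x) + b * (g x \<bullet> h x) \<partial>\<mu>) = a * (\<integral>x. f x \<bullet> h x \<partial>\<mu>) + b * (\<integral>x. g x \<bullet> h x \<partial>\<mu>)"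
    by (simp add: integral_add cont_ext_on_mult cont_ext_on_const cont_ext_on_inner assms)
  then show "(\<integral>x. (a *\<^sub>R f x + b *\<^sub>R g x) \<bullet> h x \<partial>\<mu>) = a * (\<integral>x. f x \<bullet> h x \<partial>\<mu>) + b * (\<integral>x. g x \<bullet> h x \<partial>\<mu>)"
    by (simp add: inner_add_left)
  then show "(\<integral>x. h x \<bullet> (a *\<^sub>R f x + b *\<^sub>R g x) \<partial>\<mu>) = a * (\<integral>x. h x \<bullet> f x \<partial>\<mu>) + b * (\<integral>x. h x \<bullet> g x \<partial>\<mu>)"
    by (simp add: inner_commute)
qed

end

text \<open>Cell, faces and edges are isometric images of bounded open sets of dimension 3, 2 and 1.
  For strict positivity, the points of \<open>U\<close> where the continuous extension is nonzero
  form an open null set, and such a set is empty.\<close>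

lemma flat_measure_image:
  fixes \<phi> :: "'c::euclidean_space \<Rightarrow> pt"
  assumes iso: "\<And>u v. dist (\<phi> u) (\<phi> v) = dist u v" and U: "open U" "bounded U"
    and \<mu>: "\<mu> = restrict_space (distr lborel borel \<phi>) (\<phi> ` U)"
  shows "flat_measure \<mu> (\<phi> ` U)"
    and "cont_ext_on (\<phi> ` U) f \<Longrightarrow> (\<integral>x. f x \<partial>\<mu> :: real) = (\<integral>u. indicator U u * f (\<phi> u) \<partial>lborel)"
proof -
  have inj: "inj \<phi>" using iso by (metis dist_eq_0_iff injI)
  have contphi: "continuous_on S \<phi>" for S
    unfolding continuous_on_iff using iso by metis
  then have [measurable]: "\<phi> \<in> borel_measurable borel" by (intro borel_measurable_continuous_onI)
  \<comment> \<open>For faces and edges the image is not open in space, but it is a countable union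
    of compact images.\<close>
  have borel: "\<phi> ` U \<in> sets borel"
  proof -
    obtain C where C: "\<And>n::nat. compact (C n)" "(\<Union>n. C n) = U"
      by (rule open_Union_compact_subsets[OF U(1)]) blast
    have "\<phi> ` C n \<in> sets borel" for n
      using compact_continuous_image[OF contphi C(1)] compact_imp_closed borel_closed by blast
    moreover have "\<phi> ` U = (\<Union>n. \<phi> ` C n)" using C(2) by auto
    ultimately show ?thesis by auto
  qed
  have sp: "space \<mu> = \<phi> ` U" by (simp add: \<mu> space_restrict_space)
  have ind: "indicator (\<phi> ` U) (\<phi> u) = (indicator U u :: real)" for u
    using inj by (auto simp: indicator_def inj_image_mem_iff)
  have int: "integrable \<mu> f \<longleftrightarrow> integrable lborel (\<lambda>u. indicator U u * f (\<phi> u))"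
    if [measurable]: "f \<in> borel_measurable borel" for f :: "pt \<Rightarrow> real"
    unfolding \<mu> using borel
    by (subst integrable_restrict_space) (simp_all add: integrable_distr_eq ind)
  have bint: "integrable lborel (\<lambda>u. indicator U u * f (\<phi> u))"
    if "continuous_on UNIV f" for f :: "pt \<Rightarrow> real"
  proof -
    have "compact (closure U)" using U by simp
    moreover have "continuous_on (closure U) (\<lambda>u. f (\<phi> u))"
      by (rule continuous_on_compose2[OF that contphi]) auto
    ultimately have "integrable lborel (\<lambda>u. indicator (closure U) u *\<^sub>R f (\<phi> u))"
      by (rule borel_integrable_compact)
    then have "integrable lborel (\<lambda>u. indicator U u *\<^sub>R (indicator (closure U) u *\<^sub>R f (\<phi> u)))"
      by (rule integrable_mult_indicator[rotated]) (use U in auto)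
    moreover have "indicator U u *\<^sub>R (indicator (closure U) u *\<^sub>R f (\<phi> u)) = indicator U u * f (\<phi> u)" for u
      using closure_subset[of U] by (auto simp: indicator_def)
    ultimately show ?thesis by (simp only: real_scaleR_def)
  qed
  have cong: "integrable \<mu> f \<longleftrightarrow> integrable \<mu> g" "(\<integral>x. f x \<partial>\<mu>) = (\<integral>x. g x \<partial>\<mu>)"
    if "\<And>x. x \<in> \<phi> ` U \<Longrightarrow> f x = g x" for f g :: "pt \<Rightarrow> real"
    using that by (auto intro!: Bochner_Integration.integrable_cong Bochner_Integration.integral_cong simp: sp)
  have ieq: "(\<integral>x. f x \<partial>\<mu>) = (\<integral>u. indicator U u * f (\<phi> u) \<partial>lborel)"
    if [measurable]: "f \<in> borel_measurable borel" for f :: "pt \<Rightarrow> real"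
    unfolding \<mu> using borel
    by (subst integral_restrict_space) (simp_all add: integral_distr ind)
  show "(\<integral>x. f x \<partial>\<mu> :: real) = (\<integral>u. indicator U u * f (\<phi> u) \<partial>lborel)"
    if ce: "cont_ext_on (\<phi> ` U) f"
  proof -
    obtain g where g: "continuous_on UNIV g" "\<And>x. x \<in> \<phi> ` U \<Longrightarrow> f x = g x"
      using ce by (auto simp: cont_ext_on_def)
    have "(\<integral>x. f x \<partial>\<mu>) = (\<integral>u. indicator U u * g (\<phi> u) \<partial>lborel)"
      using cong(2)[OF g(2)] ieq[OF borel_measurable_continuous_onI[OF g(1)]] by simp
    also have "\<dots> = (\<integral>u. indicator U u * f (\<phi> u) \<partial>lborel)"
      using g(2) by (intro Bochner_Integration.integral_cong) (auto simp: indicator_def)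
    finally show ?thesis .
  qed
  show "flat_measure \<mu> (\<phi> ` U)"
  proof
    show "space \<mu> = \<phi> ` U" by fact
  next
    fix f :: "pt \<Rightarrow> real"
    assume "cont_ext_on (\<phi> ` U) f"
    then obtain g where g: "continuous_on UNIV g" "\<And>x. x \<in> \<phi> ` U \<Longrightarrow> f x = g x"
      by (auto simp: cont_ext_on_def)
    have "integrable \<mu> g" using bint[OF g(1)] int[OF borel_measurable_continuous_onI[OF g(1)]] by simp
    then show "integrable \<mu> f" using cong(1)[OF g(2)] by simp
  next
    fix f :: "pt \<Rightarrow> real" and x
    assume "cont_ext_on (\<phi> ` U) f" and pos: "\<And>x. x \<in> \<phi> ` U \<Longrightarrow> 0 \<le> f x"
      and 0: "(\<integral>x. f x \<partial>\<mu>) = 0" and x: "x \<in> \<phi> ` U"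
    then obtain g where g: "continuous_on UNIV g" "\<And>x. x \<in> \<phi> ` U \<Longrightarrow> f x = g x"
      by (auto simp: cont_ext_on_def)
    have "(\<integral>u. indicator U u * g (\<phi> u) \<partial>lborel) = 0"
      using 0 cong(2)[OF g(2)] ieq[OF borel_measurable_continuous_onI[OF g(1)]] by simp
    moreover have "0 \<le> indicator U u * g (\<phi> u)" for u
      using pos g(2) by (auto simp: indicator_def)
    ultimately have "AE u in lborel. indicator U u * g (\<phi> u) = 0"
      using integral_nonneg_eq_0_iff_AE[OF bint[OF g(1)]] by simp
    then have ae: "AE u in lborel. u \<in> U \<longrightarrow> g (\<phi> u) = 0"
      by eventually_elim (auto simp: indicator_def)
    obtain u where u: "u \<in> U" "x = \<phi> u" using x by blast
    have "g (\<phi> u) = 0"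
    proof (rule ccontr)
      assume n0: "g (\<phi> u) \<noteq> 0"
      have "continuous_on UNIV (\<lambda>u. g (\<phi> u))" by (rule continuous_on_compose2[OF g(1) contphi]) auto
      then have "open ((\<lambda>u. g (\<phi> u)) -` (- {0}))"
        by (intro open_vimage) auto
      then have op: "open (U \<inter> (\<lambda>u. g (\<phi> u)) -` (- {0}))" using U by auto
      have "AE u in lborel. u \<notin> U \<inter> (\<lambda>u. g (\<phi> u)) -` (- {0})"
        using ae by eventually_elim auto
      then have "U \<inter> (\<lambda>u. g (\<phi> u)) -` (- {0}) \<in> null_sets lborel"
        using op by (subst AE_iff_null_sets) auto
      then have "negligible (U \<inter> (\<lambda>u. g (\<phi> u)) -` (- {0}))"
        by (simp add: negligible_iff_null_sets null_sets_completionI)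
      then show False using open_not_negligible[OF op] u n0 by blast
    qed
    then show "f x = 0" using u g(2) by auto
  qed
qed

section \<open>Finite-dimensional function spaces with an \<open>L\<^sup>2\<close> inner product\<close>

text \<open>\<open>zero_S\<close> makes the pairing definite: a member of \<open>S\<close> is
  determined by its values on \<open>X\<close>, either because a polynomial is determined on an open
  set or because members are extended by zero.\<close>

locale l2_space = flat_measure \<mu> X for \<mu> X +
  fixes S :: "(pt \<Rightarrow> 'b::euclidean_space) set"
  assumes subspace_S: "subspace S" and spanned_S: "finitely_spanned S"
    and cont_S: "\<And>f. f \<in> S \<Longrightarrow> cont_ext_on X f"
    and zero_S: "\<And>f. f \<in> S \<Longrightarrow> (\<And>x. x \<in> X \<Longrightarrow> f x = 0) \<Longrightarrow> f = (\<lambda>x. 0)"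
begin

definition ip :: "(pt \<Rightarrow> 'b) \<Rightarrow> (pt \<Rightarrow> 'b) \<Rightarrow> real" where
  "ip f g = (\<integral>x. f x \<bullet> g x \<partial>\<mu>)"

lemma ip_lin:
  assumes "cont_ext_on X f" "cont_ext_on X g" "cont_ext_on X h"
  shows "ip (a *\<^sub>R f + b *\<^sub>R g) h = a * ip f h + b * ip g h"
    "ip h (a *\<^sub>R f + b *\<^sub>R g) = a * ip h f + b * ip h g"
  using integral_inner_lin[OF assms] by (simp_all add: ip_def scaleR_fun_def)

lemma ip_diff:
  "cont_ext_on X f \<Longrightarrow> cont_ext_on X g \<Longrightarrow> cont_ext_on X h \<Longrightarrow> ip (f - g) h = ip f h - ip g h"
  using ip_lin(1)[of f g h 1 "-1"] by simp

lemma ip_add: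
  "cont_ext_on X f \<Longrightarrow> cont_ext_on X g \<Longrightarrow> cont_ext_on X h \<Longrightarrow> ip (f + g) h = ip f h + ip g h"
  using ip_lin(1)[of f g h 1 1] by simp

lemma ip_add_right:
  "cont_ext_on X f \<Longrightarrow> cont_ext_on X g \<Longrightarrow> cont_ext_on X h \<Longrightarrow> ip h (f + g) = ip h f + ip h g"
  using ip_lin(2)[of f g h 1 1] by simp

lemma lin_on_ip: "cont_ext_on X f \<Longrightarrow> lin_on S (ip f)"
  by (auto intro!: lin_onI simp: ip_lin cont_S)

lemma ip_eq_0_on: "cont_ext_on X f \<Longrightarrow> ip f f = 0 \<Longrightarrow> x \<in> X \<Longrightarrow> f x = 0"
  using integral_nonneg_eq_0[of "\<lambda>x. f x \<bullet> f x" x] by (simp add: ip_def cont_ext_on_inner)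

lemma ip_eq_0: "f \<in> S \<Longrightarrow> ip f f = 0 \<Longrightarrow> f = 0"
  using zero_S ip_eq_0_on cont_S by (force simp: zero_fun_def)

lemma zero_in_S [simp]: "0 \<in> S"
  using subspace_0[OF subspace_S] .

lemma ip_0_right: "ip f 0 = 0"
  by (simp add: ip_def)

text \<open>Gram-Schmidt carried out by induction on the spanning set. The hypothesis applied to
  \<open>ip b\<close> yields the projection \<open>q\<close> of \<open>b\<close> on the span of
  \<open>B\<close>; adding a multiple of \<open>e = b - q\<close> to the representer for
  \<open>B\<close> adjusts the value at \<open>b\<close> and leaves those on \<open>B\<close> alone.
  If \<open>e\<close> vanishes, \<open>b\<close> is in the span and its value is already
  forced.\<close>

lemma riesz_span:
  assumes "finite B" "B \<subseteq> S" "lin_on S \<Phi>"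
  shows "\<exists>p\<in>span B. \<forall>v\<in>B. ip p v = \<Phi> v"
  using assms
proof (induction B arbitrary: \<Phi> rule: finite_induct)
  case empty
  then show ?case by (auto simp: span_zero)
next
  case (insert b B)
  then have bS: "b \<in> S" and BS: "span B \<subseteq> S" using span_minimal[OF _ subspace_S, of B] by auto
  obtain q where q: "q \<in> span B" "\<And>v. v \<in> B \<Longrightarrow> ip q v = ip b v"
    using insert(3)[OF _ lin_on_ip[OF cont_S[OF bS]]] insert(4) by blast
  obtain p where p: "p \<in> span B" "\<And>v. v \<in> B \<Longrightarrow> ip p v = \<Phi> v"
    using insert(3)[OF _ insert(5)] insert(4) by blast
  define e where "e = b - q"
  have S: "q \<in> S" "p \<in> S" "e \<in> S" using q p BS bS subspace_diff[OF subspace_S] by (auto simp: e_def)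
  have e0: "ip e v = 0" if "v \<in> B" for v
    unfolding e_def using that insert(4) q by (subst ip_diff) (auto intro!: cont_S S bS)
  have lin0: "ip u v = 0" if "\<And>w. w \<in> B \<Longrightarrow> ip u w = 0" "v \<in> span B" "u \<in> S" for u v
  proof -
    have "ip u v = 0 \<and> v \<in> S"
      using that(2)
    proof (induction rule: span_induct_alt)
      case base
      show ?case by (intro conjI zero_in_S ip_0_right)
    next
      case (step c x y)
      then have x: "x \<in> S" using insert(4) by auto
      have "ip u (c *\<^sub>R x + 1 *\<^sub>R y) = c * ip u x + 1 * ip u y"
        by (rule ip_lin) (use x step that cont_S in auto)
      moreover have "c *\<^sub>R x + 1 *\<^sub>R y \<in> S" by (rule subspace_lin_comb[OF subspace_S x]) (use step in auto)
      ultimately have "ip u (c *\<^sub>R x + y) = 0" "c *\<^sub>R x + y \<in> S" using step that(1) by simp_all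
      then show ?case by (rule conjI)
    qed
    then show ?thesis by simp
  qed
  have eq: "ip e q = 0" using lin0[OF e0 q(1) S(3)] by blast
  show ?case
  proof (cases "ip e e = 0")
    case True
    then have "b = q" using ip_eq_0[OF S(3)] by (simp add: e_def)
    then have b: "b \<in> span B" using q by simp
    have "\<Phi> v = ip p v" if "v \<in> span B" for v
    proof -
      have "\<Phi> v = ip p v \<and> v \<in> S"
        using that
      proof (induction rule: span_induct_alt)
        case base
        show ?case unfolding lin_on_0[OF insert(5) subspace_S] ip_0_right by (intro conjI zero_in_S refl)
      next
        case (step c x y)
        then have x: "x \<in> S" using insert(4) by auto
        have "ip p (c *\<^sub>R x + 1 *\<^sub>R y) = c * ip p x + 1 * ip p y"
          by (rule ip_lin) (use x step S cont_S in auto)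
        moreover have "\<Phi> (c *\<^sub>R x + 1 *\<^sub>R y) = c * \<Phi> x + 1 * \<Phi> y"
          using lin_onD[OF insert(5) x conjunct2[OF step(2)], of c 1] by (simp only: real_scaleR_def)
        moreover have "c *\<^sub>R x + 1 *\<^sub>R y \<in> S" by (rule subspace_lin_comb[OF subspace_S x]) (use step in auto)
        moreover have "ip p x = \<Phi> x" "ip p y = \<Phi> y" using step p(2) by simp_all
        ultimately have "\<Phi> (c *\<^sub>R x + y) = ip p (c *\<^sub>R x + y)" "c *\<^sub>R x + y \<in> S"
          by (simp_all only: scaleR_one)
        then show ?case by (rule conjI)
      qed
      then show ?thesis by simp
    qed
    then show ?thesis using p b span_mono[of B "insert b B"] by (intro bexI[of _ p]) auto
  next
    case False
    \<comment> \<open>The quotient is right because \<open>ip e b = ip e e\<close>, the projection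
      \<open>q\<close> being orthogonal to \<open>e\<close>.\<close>
    define c where "c = (\<Phi> b - ip p b) / ip e e"
    have ebb: "ip e b = ip e e"
    proof -
      have "ip e (e + q) = ip e e + ip e q" by (rule ip_add_right) (auto intro!: cont_S S)
      then show ?thesis using eq by (simp add: e_def)
    qed
    have lc: "ip (1 *\<^sub>R p + c *\<^sub>R e) v = 1 * ip p v + c * ip e v" if "v \<in> S" for v
      by (rule ip_lin) (auto intro!: cont_S S that)
    have "ip (1 *\<^sub>R p + c *\<^sub>R e) v = \<Phi> v" if "v \<in> insert b B" for v
      using that
    proof
      assume "v = b"
      then show ?thesis using lc[OF bS] ebb False by (simp add: c_def)
    next
      assume v: "v \<in> B"
      then show ?thesis using lc[of v] e0[OF v] p(2)[OF v] insert(4) by auto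
    qed
    moreover have "1 *\<^sub>R p + c *\<^sub>R e \<in> span (insert b B)"
    proof -
      have "p \<in> span (insert b B)" "q \<in> span (insert b B)" "b \<in> span (insert b B)"
        using p q span_mono[of B "insert b B"] by (auto intro: span_base)
      then show ?thesis unfolding e_def by (intro span_add span_scale span_diff)
    qed
    ultimately show ?thesis by blast
  qed
qed

lemma riesz:
  assumes "lin_on S \<Phi>"
  shows "\<exists>p\<in>S. \<forall>v\<in>S. ip p v = \<Phi> v"
proof -
  obtain B where B: "finite B" "B \<subseteq> S" "S \<subseteq> span B" using spanned_S by (auto simp: finitely_spanned_def)
  then have sB: "span B = S" using span_minimal[OF _ subspace_S] by blast
  obtain p where p: "p \<in> S" "\<And>v. v \<in> B \<Longrightarrow> ip p v = \<Phi> v" using riesz_span[OF B(1,2) assms] sB by blast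
  have "ip p v = \<Phi> v" if "v \<in> S" for v
  proof -
    have "v \<in> span B" using that sB by simp
    then have "ip p v = \<Phi> v \<and> v \<in> S"
    proof (induction rule: span_induct_alt)
      case base
      show ?case unfolding lin_on_0[OF assms subspace_S] ip_0_right by (intro conjI zero_in_S refl)
    next
      case (step c x y)
      then have x: "x \<in> S" using B by auto
      have "ip p (c *\<^sub>R x + 1 *\<^sub>R y) = c * ip p x + 1 * ip p y"
        by (rule ip_lin) (use x step p cont_S in auto)
      moreover have "\<Phi> (c *\<^sub>R x + 1 *\<^sub>R y) = c * \<Phi> x + 1 * \<Phi> y"
        using lin_onD[OF assms x conjunct2[OF step(2)], of c 1] by (simp only: real_scaleR_def)
      moreover have "c *\<^sub>R x + 1 *\<^sub>R y \<in> S" by (rule subspace_lin_comb[OF subspace_S x]) (use step in auto)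
      moreover have "ip p x = \<Phi> x" "ip p y = \<Phi> y" using step p(2) by simp_all
      ultimately have "ip p (c *\<^sub>R x + y) = \<Phi> (c *\<^sub>R x + y)" "c *\<^sub>R x + y \<in> S"
        by (simp_all only: scaleR_one)
      then show ?case by (rule conjI)
    qed
    then show ?thesis by simp
  qed
  then show ?thesis using p by blast
qed

lemma ip_unique:
  assumes "p \<in> S" "q \<in> S" "\<And>v. v \<in> S \<Longrightarrow> ip p v = ip q v"
  shows "p = q"
proof -
  have d: "p - q \<in> S" using assms subspace_S by (simp add: subspace_diff)
  have "ip (p - q) (p - q) = 0"
    by (subst ip_diff) (use assms d in \<open>auto intro: cont_S\<close>)
  then show ?thesis using ip_eq_0[OF d] by simp
qed

text \<open>The abstract form of all reconstructions, with \<open>\<tau>\<close> a rotor, gradient, curl or divergence.\<close>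

lemma ex1_riesz_surj:
  assumes A: "subspace A" and \<tau>: "lin_on A \<tau>" "\<tau> ` A = S"
    and \<Phi>: "lin_on A \<Phi>" "\<And>a. a \<in> A \<Longrightarrow> \<tau> a = 0 \<Longrightarrow> \<Phi> a = (0::real)"
  shows "\<exists>!p. p \<in> S \<and> (\<forall>a\<in>A. ip p (\<tau> a) = \<Phi> a)"
proof -
  have cong: "\<Phi> a = \<Phi> b" if "a \<in> A" "b \<in> A" "\<tau> a = \<tau> b" for a b
  proof -
    have "\<tau> (a - b) = 0" using lin_on_diff[OF \<tau>(1) that(1,2)] that(3) by simp
    then have "\<Phi> (a - b) = 0" using \<Phi>(2) subspace_diff[OF A that(1,2)] by blast
    then show ?thesis using lin_on_diff[OF \<Phi>(1) that(1,2)] by simp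
  qed
  \<comment> \<open>The functional \<Phi> is pushed forward along \<tau>; by \<open>cong\<close> the
    choice of a preimage does not matter.\<close>
  define \<Psi> where "\<Psi> s = \<Phi> (SOME a. a \<in> A \<and> \<tau> a = s)" for s
  have \<Psi>: "\<Psi> (\<tau> a) = \<Phi> a" if a: "a \<in> A" for a
  proof -
    have "(SOME b. b \<in> A \<and> \<tau> b = \<tau> a) \<in> A \<and> \<tau> (SOME b. b \<in> A \<and> \<tau> b = \<tau> a) = \<tau> a"
      by (rule someI[of _ a]) (use a in simp)
    then show ?thesis unfolding \<Psi>_def using cong a by blast
  qed
  have "lin_on S \<Psi>"
  proof (rule lin_onI)
    fix x y and a b :: real
    assume "x \<in> S" "y \<in> S"
    then obtain u v where uv: "u \<in> A" "v \<in> A" "x = \<tau> u" "y = \<tau> v" using \<tau>(2) by blast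
    have "a *\<^sub>R x + b *\<^sub>R y = \<tau> (a *\<^sub>R u + b *\<^sub>R v)" using lin_onD[OF \<tau>(1) uv(1,2)] uv by simp
    then have "\<Psi> (a *\<^sub>R x + b *\<^sub>R y) = \<Phi> (a *\<^sub>R u + b *\<^sub>R v)"
      using \<Psi>[OF subspace_lin_comb[OF A uv(1,2)]] by simp
    also have "\<dots> = a *\<^sub>R \<Psi> x + b *\<^sub>R \<Psi> y" using lin_onD[OF \<Phi>(1) uv(1,2)] \<Psi> uv by simp
    finally show "\<Psi> (a *\<^sub>R x + b *\<^sub>R y) = a *\<^sub>R \<Psi> x + b *\<^sub>R \<Psi> y" .
  qed
  then obtain p where p: "p \<in> S" "\<And>v. v \<in> S \<Longrightarrow> ip p v = \<Psi> v" using riesz by blast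
  show ?thesis
  proof (rule ex1I[of _ p])
    show "p \<in> S \<and> (\<forall>a\<in>A. ip p (\<tau> a) = \<Phi> a)" using p \<Psi> \<tau>(2) by auto
    fix q
    assume q: "q \<in> S \<and> (\<forall>a\<in>A. ip q (\<tau> a) = \<Phi> a)"
    show "q = p"
    proof (rule ip_unique)
      fix v assume "v \<in> S"
      then obtain a where "a \<in> A" "v = \<tau> a" using \<tau>(2) by blast
      then show "ip q v = ip p v" using q p \<Psi> \<tau>(2) by auto
    qed (use q p in auto)
  qed
qed

lemma l2_proj_iff: "l2_proj \<mu> S f = (THE g. g \<in> S \<and> (\<forall>h\<in>S. ip (f - g) h = 0))"
  by (simp add: l2_proj_def ip_def)

lemma l2_proj_ex1:
  assumes "cont_ext_on X f"
  shows "\<exists>!g. g \<in> S \<and> (\<forall>h\<in>S. ip (f - g) h = 0)"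
proof -
  have "ip (f - g) h = 0 \<longleftrightarrow> ip g h = ip f h" if "g \<in> S" "h \<in> S" for g h
    by (subst ip_diff) (use assms that cont_S in auto)
  then have "(\<lambda>g. g \<in> S \<and> (\<forall>h\<in>S. ip (f - g) h = 0)) = (\<lambda>g. g \<in> S \<and> (\<forall>h\<in>S. ip g h = ip f h))" by blast
  then show ?thesis
    using ex1_riesz_surj[OF subspace_S, of "\<lambda>h. h" "ip f"] lin_on_ip[OF assms]
      lin_on_0[OF lin_on_ip[OF assms] subspace_S]
    by (simp add: lin_on_def)
qed

lemma l2_proj_in: "cont_ext_on X f \<Longrightarrow> l2_proj \<mu> S f \<in> S"
  and l2_proj_orth: "cont_ext_on X f \<Longrightarrow> h \<in> S \<Longrightarrow> ip (f - l2_proj \<mu> S f) h = 0"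
  unfolding l2_proj_iff using theI'[OF l2_proj_ex1] by blast+

lemma ip_l2_proj:
  assumes "cont_ext_on X f" "h \<in> S"
  shows "ip (l2_proj \<mu> S f) h = ip f h"
  using l2_proj_orth[OF assms] ip_diff[OF assms(1) cont_S[OF l2_proj_in[OF assms(1)]] cont_S[OF assms(2)]]
  by simp

lemma l2_proj_eqI:
  assumes "cont_ext_on X f" "g \<in> S" "\<And>h. h \<in> S \<Longrightarrow> ip g h = ip f h"
  shows "l2_proj \<mu> S f = g"
  unfolding l2_proj_iff
  by (rule the1_equality[OF l2_proj_ex1[OF assms(1)]])
    (use assms cont_S in \<open>auto simp: ip_diff\<close>)

lemma l2_proj_id: "f \<in> S \<Longrightarrow> l2_proj \<mu> S f = f"
  by (rule l2_proj_eqI) (auto intro: cont_S)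

lemma l2_proj_lin:
  assumes "cont_ext_on X f" "cont_ext_on X g"
  shows "l2_proj \<mu> S (a *\<^sub>R f + b *\<^sub>R g) = a *\<^sub>R l2_proj \<mu> S f + b *\<^sub>R l2_proj \<mu> S g"
proof (rule l2_proj_eqI)
  show "cont_ext_on X (a *\<^sub>R f + b *\<^sub>R g)"
    unfolding scaleR_fun_def plus_fun_def by (intro cont_ext_on_add cont_ext_on_scaleR cont_ext_on_const assms)
  show "a *\<^sub>R l2_proj \<mu> S f + b *\<^sub>R l2_proj \<mu> S g \<in> S"
    by (intro subspace_lin_comb subspace_S l2_proj_in assms)
  fix h assume h: "h \<in> S"
  then show "ip (a *\<^sub>R l2_proj \<mu> S f + b *\<^sub>R l2_proj \<mu> S g) h = ip (a *\<^sub>R f + b *\<^sub>R g) h"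
    using assms by (simp add: ip_lin cont_S l2_proj_in ip_l2_proj)
qed

lemma l2_space_subspace:
  assumes "subspace A" "A \<subseteq> S"
  shows "l2_space \<mu> X A"
  by unfold_locales (use assms finitely_spanned_subspace[OF spanned_S] cont_S zero_S in auto)

lemma l2_compl_eq: "l2_compl \<mu> S W = {v \<in> S. \<forall>w\<in>W. ip v w = 0}"
  by (simp add: l2_compl_def ip_def)

lemma l2_compl_subset: "l2_compl \<mu> S W \<subseteq> S"
  by (auto simp: l2_compl_def)

lemma subspace_l2_compl:
  assumes "W \<subseteq> S"
  shows "subspace (l2_compl \<mu> S W)"
proof (rule subspaceI)
  show "0 \<in> l2_compl \<mu> S W" by (simp add: l2_compl_def)
next
  fix u v assume uv: "u \<in> l2_compl \<mu> S W" "v \<in> l2_compl \<mu> S W"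
  then have "ip (u + v) w = 0" if "w \<in> W" for w
    using assms that by (subst ip_add) (auto simp: l2_compl_eq intro!: cont_S)
  then show "u + v \<in> l2_compl \<mu> S W" using uv subspace_S by (auto simp: l2_compl_eq subspace_add)
next
  fix c u assume u: "u \<in> l2_compl \<mu> S W"
  have "ip (c *\<^sub>R u + 0 *\<^sub>R u) w = 0" if "w \<in> W" for w
    using assms that u by (subst ip_lin) (auto simp: l2_compl_eq intro!: cont_S)
  then have "ip (c *\<^sub>R u) w = 0" if "w \<in> W" for w
    using that by simp
  then show "c *\<^sub>R u \<in> l2_compl \<mu> S W" using u subspace_S by (auto simp: l2_compl_eq subspace_scale)
qed

lemma l2_compl_disj:
  assumes "W \<subseteq> S"
  shows "W \<inter> l2_compl \<mu> S W \<subseteq> {0}"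
  using ip_eq_0 by (auto simp: l2_compl_eq)

lemma direct_sum_l2_compl:
  assumes "W \<subseteq> S" "subspace V" "V \<subseteq> W"
  shows "direct_sum V (l2_compl \<mu> S W)"
  by unfold_locales (use assms subspace_l2_compl[OF assms(1)] l2_compl_disj[OF assms(1)] in auto)

text \<open>The orthogonal projection on \<open>W\<close> exists because \<open>W\<close> inherits
  finite dimension from \<open>S\<close>.\<close>

lemma l2_compl_dsum:
  assumes "subspace W" "W \<subseteq> S" "v \<in> S"
  shows "\<exists>w\<in>W. \<exists>u\<in>l2_compl \<mu> S W. v = w + u"
proof -
  interpret W: l2_space \<mu> X W by (rule l2_space_subspace[OF assms(1,2)])
  have v: "cont_ext_on X v" using cont_S assms by auto
  have w: "l2_proj \<mu> W v \<in> W" by (rule W.l2_proj_in[OF v])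
  have "ip (v - l2_proj \<mu> W v) w = 0" if "w \<in> W" for w
    using W.l2_proj_orth[OF v that] by (simp add: ip_def W.ip_def)
  then have "v - l2_proj \<mu> W v \<in> l2_compl \<mu> S W"
    using w assms subspace_S by (auto simp: l2_compl_eq subspace_diff)
  then show ?thesis using w by (intro bexI[of _ "l2_proj \<mu> W v"] bexI[of _ "v - l2_proj \<mu> W v"]) auto
qed

text \<open>The two families of relations are merged into one with test map
  \<open>\<tau> a + w\<close> on pairs. If such a sum vanishes, then \<open>\<tau> a = - w\<close>
  lies both in \<open>W\<close> and in its complement, so both terms are zero and the kernel
  condition reduces to that for \<tau>.\<close>

lemma ex1_riesz_pair:
  assumes A: "subspace A" and \<tau>: "lin_on A \<tau>" "\<tau> ` A = W" and W: "W \<subseteq> S"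
    and \<Phi>: "lin_on A \<Phi>" "\<And>a. a \<in> A \<Longrightarrow> \<tau> a = 0 \<Longrightarrow> \<Phi> a = (0::real)"
    and \<Psi>: "lin_on (l2_compl \<mu> S W) \<Psi>"
  shows "\<exists>!p. p \<in> S \<and> (\<forall>a\<in>A. ip p (\<tau> a) = \<Phi> a) \<and> (\<forall>w\<in>l2_compl \<mu> S W. ip p w = (\<Psi> w :: real))"
proof -
  let ?C = "l2_compl \<mu> S W"
  have sW: "subspace W" using subspace_lin_on_image[OF A \<tau>(1)] \<tau>(2) by simp
  have sC: "subspace ?C" by (rule subspace_l2_compl[OF W])
  have CS: "?C \<subseteq> S" by (rule l2_compl_subset)
  let ?\<tau> = "\<lambda>(a, w). \<tau> a + w" and ?\<Phi> = "\<lambda>(a, w). \<Phi> a + \<Psi> w"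
  have ran: "?\<tau> ` (A \<times> ?C) = S"
  proof
    show "?\<tau> ` (A \<times> ?C) \<subseteq> S" using \<tau>(2) W CS subspace_add[OF subspace_S] by auto
    show "S \<subseteq> ?\<tau> ` (A \<times> ?C)"
    proof
      fix v assume "v \<in> S"
      then obtain w u where wu: "w \<in> W" "u \<in> ?C" "v = w + u" using l2_compl_dsum[OF sW W] by blast
      then obtain a where "a \<in> A" "w = \<tau> a" using \<tau>(2) by blast
      with wu show "v \<in> ?\<tau> ` (A \<times> ?C)" by (intro image_eqI[of _ _ "(a, u)"]) auto
    qed
  qed
  have lin: "lin_on (A \<times> ?C) ?\<tau>" "lin_on (A \<times> ?C) ?\<Phi>"
    using \<tau>(1) \<Phi>(1) \<Psi> by (auto simp: lin_on_def algebra_simps)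
  have ker: "?\<Phi> z = 0" if "z \<in> A \<times> ?C" "?\<tau> z = 0" for z
  proof -
    obtain a w where zaw: "z = (a, w)" by (cases z)
    have z: "z = (a, w)" "a \<in> A" "w \<in> ?C" "\<tau> a + w = 0"
      using that unfolding zaw mem_Times_iff fst_conv snd_conv case_prod_conv by blast+
    have "\<tau> a = - w" using z(4) by (simp add: eq_neg_iff_add_eq_0)
    moreover have "\<tau> a \<in> W" using z \<tau>(2) by auto
    moreover have "- w \<in> ?C" using z(3) sC by (simp add: subspace_neg)
    ultimately have "\<tau> a = 0" using l2_compl_disj[OF W] by auto
    then have "w = 0" using z(4) by simp
    then show ?thesis using \<Phi>(2)[OF z(2) \<open>\<tau> a = 0\<close>] lin_on_0[OF \<Psi> sC] by (simp add: z(1))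
  qed
  have eq: "(\<forall>z\<in>A \<times> ?C. ip p (?\<tau> z) = ?\<Phi> z) \<longleftrightarrow> (\<forall>a\<in>A. ip p (\<tau> a) = \<Phi> a) \<and> (\<forall>w\<in>?C. ip p w = \<Psi> w)"
    if p: "p \<in> S" for p
  proof -
    have ad: "ip p (\<tau> a + w) = ip p (\<tau> a) + ip p w" if "a \<in> A" "w \<in> ?C" for a w
      by (rule ip_add_right) (use that p \<tau>(2) W CS in \<open>auto intro!: cont_S\<close>)
    have z: "0 \<in> A" "0 \<in> ?C" "\<tau> 0 = 0" "\<Phi> 0 = 0" "\<Psi> 0 = 0"
      using A sC lin_on_0[OF \<tau>(1) A] lin_on_0[OF \<Phi>(1) A] lin_on_0[OF \<Psi> sC] by (auto simp: subspace_0)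
    have ip0: "ip p 0 = 0" by (simp add: ip_def)
    show ?thesis
    proof
      assume L: "\<forall>z\<in>A \<times> ?C. ip p (?\<tau> z) = ?\<Phi> z"
      have "ip p (\<tau> a) = \<Phi> a" if "a \<in> A" for a
        using bspec[OF L, of "(a, 0)"] z that by simp
      moreover have "ip p w = \<Psi> w" if "w \<in> ?C" for w
        using bspec[OF L, of "(0, w)"] z that by simp
      ultimately show "(\<forall>a\<in>A. ip p (\<tau> a) = \<Phi> a) \<and> (\<forall>w\<in>?C. ip p w = \<Psi> w)" by blast
    next
      assume "(\<forall>a\<in>A. ip p (\<tau> a) = \<Phi> a) \<and> (\<forall>w\<in>?C. ip p w = \<Psi> w)"
      then show "\<forall>z\<in>A \<times> ?C. ip p (?\<tau> z) = ?\<Phi> z" using ad by auto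
    qed
  qed
  have "\<exists>!p. p \<in> S \<and> (\<forall>z\<in>A \<times> ?C. ip p (?\<tau> z) = ?\<Phi> z)"
    by (rule ex1_riesz_surj[OF subspace_Times[OF A sC] lin(1) ran lin(2) ker])
  moreover have "(p \<in> S \<and> (\<forall>z\<in>A \<times> ?C. ip p (?\<tau> z) = ?\<Phi> z)) \<longleftrightarrow>
      (p \<in> S \<and> (\<forall>a\<in>A. ip p (\<tau> a) = \<Phi> a) \<and> (\<forall>w\<in>?C. ip p w = \<Psi> w))" for p
    using eq by blast
  ultimately show ?thesis by simp
qed

end

text \<open>If linear combinations of solutions solve the combined problem, uniqueness forces the
  solution to depend linearly on the datum.\<close>

lemma lin_on_the:
  assumes "subspace Q" and ex1: "\<And>q. q \<in> Q \<Longrightarrow> \<exists>!p. P q p"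
    and "\<And>q r p s a b. q \<in> Q \<Longrightarrow> r \<in> Q \<Longrightarrow> P q p \<Longrightarrow> P r s \<Longrightarrow> P (a *\<^sub>R q + b *\<^sub>R r) (a *\<^sub>R p + b *\<^sub>R s)"
  shows "lin_on Q (\<lambda>q. THE p. P q p)"
proof (rule lin_onI)
  fix q r a b assume qr: "q \<in> Q" "r \<in> Q"
  show "(THE p. P (a *\<^sub>R q + b *\<^sub>R r) p) = a *\<^sub>R (THE p. P q p) + b *\<^sub>R (THE p. P r p)"
    by (rule the1_equality[OF ex1[OF subspace_lin_comb[OF assms(1) qr]]])
      (intro assms(3) qr theI'[OF ex1])
qed

section \<open>The divergence theorem in one direction\<close>

lemma integrable_indicator_continuous:
  fixes f :: "'a::euclidean_space \<Rightarrow> real"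
  assumes "S \<in> sets borel" "bounded S" "continuous_on UNIV f"
  shows "integrable lborel (\<lambda>x. indicator S x * f x)"
proof -
  have "compact (closure S)" using assms(2) by simp
  then have "integrable lborel (\<lambda>x. indicator (closure S) x *\<^sub>R f x)"
    by (rule borel_integrable_compact) (rule continuous_on_subset[OF assms(3)], simp)
  then have "integrable lborel (\<lambda>x. indicator S x *\<^sub>R (indicator (closure S) x *\<^sub>R f x))"
    by (rule integrable_mult_indicator[rotated]) (use assms in auto)
  moreover have "(\<lambda>x. indicator S x *\<^sub>R (indicator (closure S) x *\<^sub>R f x)) = (\<lambda>x. indicator S x * f x)"
    using closure_subset[of S] by (auto simp: indicator_def fun_eq_iff)
  ultimately show ?thesis by (simp only:)
qed

text \<open>Adding a jump at each endpoint turns \<open>indicator V \<cdot> f\<close> into a continuous function, to which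
  the fundamental theorem applies.\<close>

lemma flux_1d:
  fixes V :: "real set" and c \<sigma> :: "'i \<Rightarrow> real"
  assumes V: "open V" "bounded V" and I: "finite I" "inj_on c I"
    and fr: "frontier V \<subseteq> c ` I" and \<sigma>: "\<And>i. i \<in> I \<Longrightarrow> \<sigma> i = 1 \<or> \<sigma> i = -1"
    and side: "\<And>i. i \<in> I \<Longrightarrow> \<exists>r>0. \<forall>s\<in>ball (c i) r. s \<in> V \<longleftrightarrow> \<sigma> i * (s - c i) < 0"
    and f: "\<And>s. (f has_real_derivative f' s) (at s)" and f': "continuous_on UNIV f'"
  shows "(\<integral>s. indicator V s * f' s \<partial>lborel) = (\<Sum>i\<in>I. \<sigma> i * f (c i))"
proof -
  \<comment> \<open>An endpoint never belongs to \<open>V\<close>. At a right end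
    (\<open>\<sigma> i = 1\<close>) the jump must already be present at \<open>c i\<close>, where
    \<open>indicator V\<close> has dropped to 0; at a left end it may start only beyond
    \<open>c i\<close>. With this choice \<open>F\<close> has no discontinuity there.\<close>
  define J where "J i s = (if (if \<sigma> i = 1 then c i \<le> s else c i < s) then \<sigma> i * f (c i) else 0)" for i s
  define F where "F s = indicator V s * f s + (\<Sum>i\<in>I. J i s)" for s
  have contf: "isCont f s" for s using f DERIV_isCont by blast
  have avoid: "\<exists>r>0. \<forall>i\<in>I. c i \<noteq> s \<longrightarrow> r \<le> dist s (c i)" for s
    using finite_set_avoid[of "c ` I" s] I(1) by auto
  have Jconst: "J i t = J i s" if "dist s t < r" "c i \<noteq> s \<Longrightarrow> r \<le> dist s (c i)" "c i \<noteq> s" for i s t r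
    using that unfolding J_def dist_real_def by auto
  have off: "\<exists>r>0. \<exists>K. \<forall>t\<in>ball s r. F t = indicator V s * f t + K"
    if s: "s \<notin> c ` I" for s
  proof -
    obtain r1 where r1: "r1 > 0" "\<forall>i\<in>I. c i \<noteq> s \<longrightarrow> r1 \<le> dist s (c i)" using avoid[of s] by blast
    have "\<exists>r2>0. \<forall>t\<in>ball s r2. t \<in> V \<longleftrightarrow> s \<in> V"
    proof (cases "s \<in> V")
      case True
      then obtain r2 where "r2 > 0" "ball s r2 \<subseteq> V" using openE[OF V(1)] by metis
      then show ?thesis using True by (intro exI[of _ r2]) auto
    next
      case False
      then have "s \<notin> closure V" using fr s V(1) by (auto simp: frontier_def interior_open)
      then obtain r2 where "r2 > 0" "ball s r2 \<subseteq> - closure V"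
        using openE[of "- closure V" s] by auto
      then show ?thesis using False closure_subset[of V] by (intro exI[of _ r2]) auto
    qed
    then obtain r2 where r2: "r2 > 0" "\<forall>t\<in>ball s r2. t \<in> V \<longleftrightarrow> s \<in> V" by blast
    have "F t = indicator V s * f t + (\<Sum>i\<in>I. J i s)" if t: "t \<in> ball s (min r1 r2)" for t
    proof -
      have "J i t = J i s" if "i \<in> I" for i
        by (rule Jconst[of s t r1]) (use t r1 that s in auto)
      then show ?thesis using bspec[OF r2(2), of t] t by (simp add: F_def indicator_def)
    qed
    then have "\<exists>K. \<forall>t\<in>ball s (min r1 r2). F t = indicator V s * f t + K" by blast
    moreover have "min r1 r2 > 0" using r1 r2 by simp
    ultimately show ?thesis by blast
  qed
  have on: "isCont F s" if s: "s \<in> c ` I" for s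
  proof -
    obtain i where i: "i \<in> I" "s = c i" using s by blast
    obtain r1 where r1: "r1 > 0" "\<forall>i\<in>I. c i \<noteq> s \<longrightarrow> r1 \<le> dist s (c i)" using avoid[of s] by blast
    obtain r2 where r2: "r2 > 0" "\<forall>t\<in>ball s r2. t \<in> V \<longleftrightarrow> \<sigma> i * (t - s) < 0"
      using side[OF i(1)] unfolding i(2)[symmetric] by blast
    define K where "K = (\<Sum>j\<in>I - {i}. J j s)"
    \<comment> \<open>Near \<open>s = c i\<close> the function is \<open>f\<close> frozen at
      \<open>s\<close> on one side, up to constants, and continuity is then visible.\<close>
    define G where "G t = (if \<sigma> i = 1 then f (min t s) else f (max t s) - f s) + K" for t
    have eq: "F t = G t" if t: "t \<in> ball s (min r1 r2)" for t
    proof -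
      have "J j t = J j s" if "j \<in> I - {i}" for j
        by (rule Jconst[of s t r1]) (use t r1 that i I(2) in \<open>auto dest: inj_onD\<close>)
      then have "F t = indicator V t * f t + (J i t + K)"
        unfolding F_def K_def using sum.remove[OF I(1) i(1), of "\<lambda>j. J j t"] by simp
      moreover have "indicator V t * f t + J i t = (if \<sigma> i = 1 then f (min t s) else f (max t s) - f s)"
      proof -
        have "t \<in> ball s r2" using t by simp
        then have "t \<in> V \<longleftrightarrow> \<sigma> i * (t - s) < 0" using r2(2) by blast
        then show ?thesis using \<sigma>[OF i(1)] unfolding J_def i(2)[symmetric]
          by (auto simp: indicator_def min_def max_def)
      qed
      ultimately show ?thesis by (simp add: G_def)
    qed
    have "isCont G s"
    proof (cases "\<sigma> i = 1")
      case True
      then have "G = (\<lambda>t. f (min t s) + K)" by (auto simp: G_def)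
      then show ?thesis by (auto intro!: continuous_intros isCont_o2[OF _ contf])
    next
      case False
      then have "G = (\<lambda>t. f (max t s) - f s + K)" by (auto simp: G_def)
      then show ?thesis by (auto intro!: continuous_intros isCont_o2[OF _ contf])
    qed
    moreover have "\<forall>\<^sub>F t in nhds s. F t = G t"
      unfolding eventually_nhds_metric using r1 r2 eq
      by (intro exI[of _ "min r1 r2"]) (auto simp: dist_commute)
    ultimately show ?thesis using isCont_cong by blast
  qed
  have der: "(F has_real_derivative indicator V s * f' s) (at s)" if s: "s \<notin> c ` I" for s
  proof -
    obtain r K where r: "r > 0" "\<forall>t\<in>ball s r. F t = indicator V s * f t + K"
      using off[OF s] by blast
    have "((\<lambda>t. indicator V s * f t + K) has_real_derivative indicator V s * f' s) (at s)"
      using f by (auto intro!: derivative_eq_intros)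
    moreover have "\<forall>\<^sub>F t in nhds s. indicator V s * f t + K = F t"
      unfolding eventually_nhds_metric using r by (intro exI[of _ r]) (auto simp: dist_commute)
    ultimately show ?thesis by (rule iffD1[OF DERIV_cong_ev[OF refl _ refl], rotated])
  qed
  have cont: "isCont F s" for s using on der DERIV_isCont by blast
  \<comment> \<open>Beyond \<open>V\<close> and all crossing points: at \<open>- B\<close> no jump
    has occurred yet and at \<open>B\<close> all of them have.\<close>
  obtain B where B: "V \<union> c ` I \<subseteq> ball 0 B" "B > 0"
    using bounded_subset_ballD[of "V \<union> c ` I" 0] V(2) I(1) by (auto simp: finite_imp_bounded)
  then have BV: "\<bar>s\<bar> < B" if "s \<in> V \<or> s \<in> c ` I" for s using that by (auto simp: dist_real_def)
  have "((\<lambda>s. indicator V s * f' s) has_integral F B - F (- B)) {- B..B}"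
  proof (rule fundamental_theorem_of_calculus_interior_strong[where S = "c ` I"])
    show "finite (c ` I)" "- B \<le> B" using I B by auto
    show "continuous_on {- B..B} F" using cont by (simp add: continuous_at_imp_continuous_on)
    show "(F has_vector_derivative indicator V x * f' x) (at x)" if "x \<in> {- B<..<B} - c ` I" for x
      using der[of x] that by (auto simp: has_real_derivative_iff_has_vector_derivative)
  qed
  moreover have "F (- B) = 0"
  proof -
    have "J i (- B) = 0" if "i \<in> I" for i using BV[of "c i"] that by (auto simp: J_def)
    moreover have "- B \<notin> V" using BV[of "- B"] by auto
    ultimately show ?thesis by (simp add: F_def)
  qed
  moreover have "F B = (\<Sum>i\<in>I. \<sigma> i * f (c i))"
  proof -
    have "J i B = \<sigma> i * f (c i)" if "i \<in> I" for i using BV[of "c i"] that by (auto simp: J_def)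
    moreover have "B \<notin> V" using BV[of B] by auto
    ultimately show ?thesis by (simp add: F_def)
  qed
  ultimately have "((\<lambda>s. indicator V s * f' s) has_integral (\<Sum>i\<in>I. \<sigma> i * f (c i))) {- B..B}" by simp
  then have "((\<lambda>s. if s \<in> {- B..B} then indicator V s * f' s else 0) has_integral (\<Sum>i\<in>I. \<sigma> i * f (c i))) UNIV"
    by (simp only: has_integral_restrict[OF subset_UNIV])
  moreover have "(\<lambda>s. if s \<in> {- B..B} then indicator V s * f' s else 0) = (\<lambda>s. indicator V s * f' s)"
    using BV by (force simp: indicator_def)
  ultimately have "((\<lambda>s. indicator V s * f' s) has_integral (\<Sum>i\<in>I. \<sigma> i * f (c i))) UNIV" by simp
  moreover have "integrable lborel (\<lambda>s. indicator V s * f' s)"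
    using V by (intro integrable_indicator_continuous f') auto
  ultimately show ?thesis using has_integral_integral_lborel has_integral_unique by blast
qed

text \<open>Fubini over the lines in the first coordinate direction. Since
  \<open>fst (\<nu> i)\<close> is nonzero, a line over \<open>y\<close> meets the piece
  \<open>X i\<close> at most once, at
  \<open>(c i - snd (\<nu> i) \<bullet> y) / fst (\<nu> i)\<close>, and the sign of
  \<open>fst (\<nu> i)\<close> tells whether it leaves or enters \<open>U\<close> there. The rest of
  the boundary is confined to the lines over the null set \<open>N\<close>.\<close>

lemma flux_fst_direction:
  fixes U :: "(real \<times> 'b::euclidean_space) set" and X :: "'i \<Rightarrow> (real \<times> 'b) set"
  assumes U: "open U" "bounded U" and I: "finite I"
    and \<nu>: "\<And>i. i \<in> I \<Longrightarrow> fst (\<nu> i) \<noteq> 0"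
    and X: "\<And>i x. i \<in> I \<Longrightarrow> x \<in> X i \<Longrightarrow> \<nu> i \<bullet> x = c i"
    and disj: "\<And>i j. i \<in> I \<Longrightarrow> j \<in> I \<Longrightarrow> i \<noteq> j \<Longrightarrow> X i \<inter> X j = {}"
    and meas: "\<And>i. i \<in> I \<Longrightarrow> snd ` X i \<in> sets borel" and bdd: "\<And>i. i \<in> I \<Longrightarrow> bounded (X i)"
    and side: "\<And>i x. i \<in> I \<Longrightarrow> x \<in> X i \<Longrightarrow> \<exists>r>0. \<forall>y\<in>ball x r. y \<in> U \<longleftrightarrow> \<nu> i \<bullet> (y - x) < 0"
    and fr: "frontier U \<subseteq> (\<Union>i\<in>I. X i) \<union> {x. snd x \<in> N}" and N: "N \<in> null_sets lborel"
    and f: "\<And>s y. ((\<lambda>s. f (s, y)) has_real_derivative f' (s, y)) (at s)"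
    and cont: "continuous_on UNIV f" "continuous_on UNIV f'"
  shows "(\<integral>z. indicator U z * f' z \<partial>lborel)
    = (\<Sum>i\<in>I. sgn (fst (\<nu> i)) * (\<integral>y. indicator (snd ` X i) y * f ((c i - snd (\<nu> i) \<bullet> y) / fst (\<nu> i), y) \<partial>lborel))"
proof -
  define g where "g i y = (c i - snd (\<nu> i) \<bullet> y) / fst (\<nu> i)" for i y
  have gX: "(g i y, y) \<in> X i" if "i \<in> I" "y \<in> snd ` X i" for i y
  proof -
    obtain s where s: "(s, y) \<in> X i" using \<open>y \<in> snd ` X i\<close> by auto
    then have "fst (\<nu> i) * s + snd (\<nu> i) \<bullet> y = c i" using X[OF that(1) s] by (simp add: inner_prod_def)
    then have "s = g i y" using \<nu>[OF that(1)] by (simp add: g_def field_simps)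
    then show ?thesis using s by simp
  qed
  have int: "integrable lborel (\<lambda>z. indicator U z * f' z)"
    using U by (intro integrable_indicator_continuous cont) auto
  have slice: "(\<integral>s. indicator U (s, y) * f' (s, y) \<partial>lborel)
      = (\<Sum>i\<in>I. sgn (fst (\<nu> i)) * (indicator (snd ` X i) y * f (g i y, y)))" if y: "y \<notin> N" for y
  proof -
    define V where "V = {s. (s, y) \<in> U}"
    \<comment> \<open>Only the pieces whose shadow contains \<open>y\<close> are crossed by this
      line.\<close>
    define K where "K = {i \<in> I. y \<in> snd ` X i}"
    have V_eq: "V = (\<lambda>s. (s, y)) -` U" by (auto simp: V_def)
    have contp: "continuous_on UNIV (\<lambda>s. (s, y))" by (intro continuous_intros)
    have "(\<integral>s. indicator V s * f' (s, y) \<partial>lborel) = (\<Sum>i\<in>K. sgn (fst (\<nu> i)) * f (g i y, y))"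
    proof (rule flux_1d[where c = "\<lambda>i. g i y" and \<sigma> = "\<lambda>i. sgn (fst (\<nu> i))" and f = "\<lambda>s. f (s, y)"])
      show "open V" unfolding V_eq using U(1) contp open_vimage by blast
      have "V \<subseteq> fst ` U" by (force simp: V_def)
      then show "bounded V" using bounded_fst[OF U(2)] bounded_subset by blast
      show "finite K" using I by (simp add: K_def)
      show "inj_on (\<lambda>i. g i y) K"
      proof (rule inj_onI)
        fix i j assume ij: "i \<in> K" "j \<in> K" "g i y = g j y"
        then have "(g i y, y) \<in> X i" "(g i y, y) \<in> X j" using gX[of i y] gX[of j y] by (auto simp: K_def)
        then show "i = j" using disj[of i j] ij by (auto simp: K_def)
      qed
      show "frontier V \<subseteq> (\<lambda>i. g i y) ` K"
      proof
        fix s assume s: "s \<in> frontier V"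
        have "(s, y) \<in> closure U"
        proof (rule ccontr)
          assume "(s, y) \<notin> closure U"
          moreover have "open ((\<lambda>s. (s, y)) -` (- closure U))" using contp by (intro open_vimage) auto
          ultimately have "s \<in> interior (- V)"
            using closure_subset[of U] by (intro interiorI[of "(\<lambda>s. (s, y)) -` (- closure U)"]) (auto simp: V_def)
          then show False using s by (auto simp: frontier_def interior_complement)
        qed
        moreover have "s \<notin> V" using s \<open>open V\<close> by (auto simp: frontier_def interior_open)
        ultimately have "(s, y) \<in> frontier U" using U(1) by (auto simp: V_def frontier_def interior_open)
        then obtain i where i: "i \<in> I" "(s, y) \<in> X i" using fr y by auto
        then have iK: "i \<in> K" by (force simp: K_def)
        have "fst (\<nu> i) * s + snd (\<nu> i) \<bullet> y = c i" using X[OF i] by (simp add: inner_prod_def)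
        then have "s = g i y" using \<nu>[OF i(1)] by (simp add: g_def field_simps)
        then show "s \<in> (\<lambda>i. g i y) ` K" using iK by blast
      qed
      show "sgn (fst (\<nu> i)) = 1 \<or> sgn (fst (\<nu> i)) = - 1" if "i \<in> K" for i
        using \<nu>[of i] that by (auto simp: K_def sgn_if)
      show "\<exists>r>0. \<forall>s\<in>ball (g i y) r. s \<in> V \<longleftrightarrow> sgn (fst (\<nu> i)) * (s - g i y) < 0" if "i \<in> K" for i
      proof -
        have iI: "i \<in> I" "y \<in> snd ` X i" using that by (auto simp: K_def)
        obtain r where r: "r > 0" "\<forall>z\<in>ball (g i y, y) r. z \<in> U \<longleftrightarrow> \<nu> i \<bullet> (z - (g i y, y)) < 0"
          using side[OF iI(1) gX[OF iI]] by blast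
        have "s \<in> V \<longleftrightarrow> sgn (fst (\<nu> i)) * (s - g i y) < 0" if "s \<in> ball (g i y) r" for s
          using bspec[OF r(2), of "(s, y)"] that \<nu>[OF iI(1)]
          by (simp add: V_def dist_Pair_Pair inner_prod_def sgn_if mult_less_0_iff)
        then show ?thesis using r(1) by blast
      qed
      show "((\<lambda>s. f (s, y)) has_real_derivative f' (s, y)) (at s)" for s by (rule f)
      show "continuous_on UNIV (\<lambda>s. f' (s, y))"
        by (rule continuous_on_compose2[OF cont(2) contp]) auto
    qed
    also have "(\<Sum>i\<in>K. sgn (fst (\<nu> i)) * f (g i y, y))
        = (\<Sum>i\<in>I. sgn (fst (\<nu> i)) * (indicator (snd ` X i) y * f (g i y, y)))"
      by (rule sum.mono_neutral_cong_left) (use I in \<open>auto simp: K_def\<close>)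
    finally show ?thesis by (simp add: V_def indicator_def)
  qed
  have gc: "continuous_on UNIV (\<lambda>y. f (g i y, y))" for i
    unfolding g_def divide_inverse
    by (rule continuous_on_compose2[OF cont(1)]) (auto intro!: continuous_intros)
  have inti: "integrable lborel (\<lambda>y. indicator (snd ` X i) y * f (g i y, y))" if "i \<in> I" for i
    by (intro integrable_indicator_continuous gc meas bounded_snd bdd that)
  have "(\<integral>z. indicator U z * f' z \<partial>lborel) = (\<integral>y. \<integral>s. indicator U (s, y) * f' (s, y) \<partial>lborel \<partial>lborel)"
  proof -
    have "integrable (lborel \<Otimes>\<^sub>M lborel) (\<lambda>(s, y). indicator U (s, y) * f' (s, y))"
      using int unfolding lborel_prod by (simp add: case_prod_unfold)
    from lborel_pair.integral_snd[OF this] show ?thesis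
      unfolding lborel_prod by (simp add: case_prod_unfold)
  qed
  also have "\<dots> = (\<integral>y. (\<Sum>i\<in>I. sgn (fst (\<nu> i)) * (indicator (snd ` X i) y * f (g i y, y))) \<partial>lborel)"
  proof (rule integral_cong_AE)
    have "integrable (lborel \<Otimes>\<^sub>M lborel) (\<lambda>(s, y). indicator U (s, y) * f' (s, y))"
      using int unfolding lborel_prod by (simp add: case_prod_unfold)
    then show "(\<lambda>y. \<integral>s. indicator U (s, y) * f' (s, y) \<partial>lborel) \<in> borel_measurable lborel"
      using lborel_pair.integrable_snd borel_measurable_integrable by blast
    show "(\<lambda>y. \<Sum>i\<in>I. sgn (fst (\<nu> i)) * (indicator (snd ` X i) y * f (g i y, y))) \<in> borel_measurable lborel"
      using inti by (intro borel_measurable_sum borel_measurable_times borel_measurable_integrable) auto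
    show "AE y in lborel. (\<integral>s. indicator U (s, y) * f' (s, y) \<partial>lborel)
        = (\<Sum>i\<in>I. sgn (fst (\<nu> i)) * (indicator (snd ` X i) y * f (g i y, y)))"
      using AE_not_in[OF N] by eventually_elim (rule slice)
  qed
  also have "\<dots> = (\<Sum>i\<in>I. sgn (fst (\<nu> i)) * (\<integral>y. indicator (snd ` X i) y * f (g i y, y) \<partial>lborel))"
    using inti by (subst Bochner_Integration.integral_sum) auto
  finally show ?thesis unfolding g_def .
qed

section \<open>Linear changes of variables\<close>

lemma nn_integral_lborel_swap:
  fixes h :: "'a::euclidean_space \<times> 'b::euclidean_space \<Rightarrow> ennreal"
  assumes [measurable]: "h \<in> borel_measurable borel"
  shows "(\<integral>\<^sup>+z. h z \<partial>lborel) = (\<integral>\<^sup>+s. \<integral>\<^sup>+t. h (s, t) \<partial>lborel \<partial>lborel)"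
    "(\<integral>\<^sup>+z. h z \<partial>lborel) = (\<integral>\<^sup>+t. \<integral>\<^sup>+s. h (s, t) \<partial>lborel \<partial>lborel)"
proof -
  have h: "h \<in> borel_measurable (lborel \<Otimes>\<^sub>M lborel)" by (simp add: lborel_prod)
  show "(\<integral>\<^sup>+z. h z \<partial>lborel) = (\<integral>\<^sup>+s. \<integral>\<^sup>+t. h (s, t) \<partial>lborel \<partial>lborel)"
    unfolding lborel_prod[symmetric] by (rule lborel.nn_integral_fst[OF h, symmetric])
  show "(\<integral>\<^sup>+z. h z \<partial>lborel) = (\<integral>\<^sup>+t. \<integral>\<^sup>+s. h (s, t) \<partial>lborel \<partial>lborel)"
    unfolding lborel_prod[symmetric] by (rule lborel_pair.nn_integral_snd[symmetric]) (use h in simp)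
qed

text \<open>Two one-dimensional substitutions with an exchange of the order of integration in
  between, as in Gaussian elimination with pivot \<alpha>.\<close>

lemma nn_integral_affine_plane:
  fixes h :: "real \<times> real \<Rightarrow> ennreal"
  assumes [measurable]: "h \<in> borel_measurable borel" and \<Delta>: "\<alpha> * \<delta> - \<beta> * \<gamma> \<noteq> 0"
  shows "(\<integral>\<^sup>+z. h z \<partial>lborel)
    = \<bar>\<alpha> * \<delta> - \<beta> * \<gamma>\<bar> * (\<integral>\<^sup>+z. h (\<alpha> * fst z + \<beta> * snd z + p, \<gamma> * fst z + \<delta> * snd z + q) \<partial>lborel)"
proof -
  have *: "(\<integral>\<^sup>+z. h z \<partial>lborel)
      = \<bar>\<alpha> * \<delta> - \<beta> * \<gamma>\<bar> * (\<integral>\<^sup>+t. \<integral>\<^sup>+s. h (\<alpha> * s + \<beta> * t + p, \<gamma> * s + \<delta> * t + q) \<partial>lborel \<partial>lborel)"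
    if \<Delta>: "\<alpha> * \<delta> - \<beta> * \<gamma> \<noteq> 0" and \<alpha>: "\<alpha> \<noteq> 0" for \<alpha> \<beta> \<gamma> \<delta> :: real
  proof -
    \<comment> \<open>The Schur complement of the pivot, so that \<open>\<alpha> * \<kappa>\<close>
      is the determinant.\<close>
    define \<kappa> where "\<kappa> = \<delta> - \<gamma> * \<beta> / \<alpha>"
    have \<kappa>: "\<kappa> \<noteq> 0" "\<bar>\<alpha>\<bar> * \<bar>\<kappa>\<bar> = \<bar>\<alpha> * \<delta> - \<beta> * \<gamma>\<bar>"
      using \<Delta> \<alpha> by (auto simp: \<kappa>_def field_simps abs_mult[symmetric])
    have "(\<integral>\<^sup>+z. h z \<partial>lborel) = (\<integral>\<^sup>+x. \<integral>\<^sup>+y. h (x, y) \<partial>lborel \<partial>lborel)"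
      by (rule nn_integral_lborel_swap) simp
    also have "\<dots> = (\<integral>\<^sup>+x. \<bar>\<kappa>\<bar> * (\<integral>\<^sup>+t. h (x, (\<gamma> * (x - p) / \<alpha> + q) + \<kappa> * t) \<partial>lborel) \<partial>lborel)"
      by (intro nn_integral_cong nn_integral_real_affine \<kappa>) simp
    also have "\<dots> = \<bar>\<kappa>\<bar> * (\<integral>\<^sup>+x. (\<integral>\<^sup>+t. h (x, (\<gamma> * (x - p) / \<alpha> + q) + \<kappa> * t) \<partial>lborel) \<partial>lborel)"
      by (intro nn_integral_cmult) simp
    also have "(\<integral>\<^sup>+x. (\<integral>\<^sup>+t. h (x, (\<gamma> * (x - p) / \<alpha> + q) + \<kappa> * t) \<partial>lborel) \<partial>lborel)
        = (\<integral>\<^sup>+t. (\<integral>\<^sup>+x. h (x, (\<gamma> * (x - p) / \<alpha> + q) + \<kappa> * t) \<partial>lborel) \<partial>lborel)"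
    proof -
      have [measurable]: "(\<lambda>z. h (fst z, (\<gamma> * (fst z - p) / \<alpha> + q) + \<kappa> * snd z)) \<in> borel_measurable borel"
        unfolding divide_inverse
        by (rule measurable_compose[OF borel_measurable_continuous_onI assms(1)]) (intro continuous_intros)
      show ?thesis
        using nn_integral_lborel_swap[of "\<lambda>z. h (fst z, (\<gamma> * (fst z - p) / \<alpha> + q) + \<kappa> * snd z)"] by simp
    qed
    also have "\<dots> = (\<integral>\<^sup>+t. \<bar>\<alpha>\<bar> * (\<integral>\<^sup>+s. h ((\<beta> * t + p) + \<alpha> * s,
        (\<gamma> * ((\<beta> * t + p) + \<alpha> * s - p) / \<alpha> + q) + \<kappa> * t) \<partial>lborel) \<partial>lborel)"
      by (intro nn_integral_cong nn_integral_real_affine[of "\<lambda>x. h (x, (\<gamma> * (x - p) / \<alpha> + q) + \<kappa> * _)"] \<alpha>) simp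
    also have "\<dots> = (\<integral>\<^sup>+t. \<bar>\<alpha>\<bar> * (\<integral>\<^sup>+s. h (\<alpha> * s + \<beta> * t + p, \<gamma> * s + \<delta> * t + q) \<partial>lborel) \<partial>lborel)"
    proof -
      have "(\<gamma> * ((\<beta> * t + p) + \<alpha> * s - p) / \<alpha> + q) + \<kappa> * t = \<gamma> * s + \<delta> * t + q" for s t
        using \<alpha> by (simp add: \<kappa>_def field_simps)
      moreover have "(\<beta> * t + p) + \<alpha> * s = \<alpha> * s + \<beta> * t + p" for s t by simp
      ultimately show ?thesis by (simp only:)
    qed
    also have "\<dots> = \<bar>\<alpha>\<bar> * (\<integral>\<^sup>+t. (\<integral>\<^sup>+s. h (\<alpha> * s + \<beta> * t + p, \<gamma> * s + \<delta> * t + q) \<partial>lborel) \<partial>lborel)"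
      by (intro nn_integral_cmult) simp
    finally show ?thesis
      unfolding \<kappa>(2)[symmetric] by (simp add: ennreal_mult mult_ac)
  qed
  have sw: "(\<integral>\<^sup>+z. h (\<alpha> * fst z + \<beta> * snd z + p, \<gamma> * fst z + \<delta> * snd z + q) \<partial>lborel)
      = (\<integral>\<^sup>+t. \<integral>\<^sup>+s. h (\<alpha> * s + \<beta> * t + p, \<gamma> * s + \<delta> * t + q) \<partial>lborel \<partial>lborel)"
    "(\<integral>\<^sup>+z. h (\<alpha> * fst z + \<beta> * snd z + p, \<gamma> * fst z + \<delta> * snd z + q) \<partial>lborel)
      = (\<integral>\<^sup>+s. \<integral>\<^sup>+t. h (\<beta> * t + \<alpha> * s + p, \<delta> * t + \<gamma> * s + q) \<partial>lborel \<partial>lborel)"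
  proof -
    have [measurable]: "(\<lambda>z. h (\<alpha> * fst z + \<beta> * snd z + p, \<gamma> * fst z + \<delta> * snd z + q)) \<in> borel_measurable borel"
      by (rule measurable_compose[OF borel_measurable_continuous_onI assms(1)]) (intro continuous_intros)
    show "(\<integral>\<^sup>+z. h (\<alpha> * fst z + \<beta> * snd z + p, \<gamma> * fst z + \<delta> * snd z + q) \<partial>lborel)
        = (\<integral>\<^sup>+t. \<integral>\<^sup>+s. h (\<alpha> * s + \<beta> * t + p, \<gamma> * s + \<delta> * t + q) \<partial>lborel \<partial>lborel)"
      by (subst nn_integral_lborel_swap(2)) simp_all
    show "(\<integral>\<^sup>+z. h (\<alpha> * fst z + \<beta> * snd z + p, \<gamma> * fst z + \<delta> * snd z + q) \<partial>lborel)
        = (\<integral>\<^sup>+s. \<integral>\<^sup>+t. h (\<beta> * t + \<alpha> * s + p, \<delta> * t + \<gamma> * s + q) \<partial>lborel \<partial>lborel)"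
      by (subst nn_integral_lborel_swap(1)) (simp, simp add: add.commute[of "_ * _" "_ * _"])
  qed
  show ?thesis
  proof (cases "\<alpha> = 0")
    case False
    then show ?thesis using *[OF \<Delta> False] sw(1) by simp
  next
    case True
    \<comment> \<open>Exchanging the two variables brings \<beta>, which cannot vanish as well, into
      the pivot position.\<close>
    then have "\<beta> \<noteq> 0" "\<beta> * \<gamma> - \<alpha> * \<delta> \<noteq> 0" using \<Delta> by auto
    from *[OF this(2,1)] show ?thesis using sw(2) by (simp add: abs_minus_commute)
  qed
qed

text \<open>The nonnegative case, applied to indicators, is an equality of measures; this carries
  over to the Bochner integral whether or not \<open>h\<close> is integrable.\<close>

lemma integral_affine_plane:
  fixes h :: "real \<times> real \<Rightarrow> real"
  assumes [measurable]: "h \<in> borel_measurable borel" and \<Delta>: "\<alpha> * \<delta> - \<beta> * \<gamma> \<noteq> 0"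
  shows "(\<integral>z. h z \<partial>lborel)
    = \<bar>\<alpha> * \<delta> - \<beta> * \<gamma>\<bar> * (\<integral>z. h (\<alpha> * fst z + \<beta> * snd z + p, \<gamma> * fst z + \<delta> * snd z + q) \<partial>lborel)"
proof -
  define A where "A z = (\<alpha> * fst z + \<beta> * snd z + p, \<gamma> * fst z + \<delta> * snd z + q)" for z
  have [measurable]: "A \<in> borel_measurable borel" unfolding A_def
    by (intro borel_measurable_continuous_onI continuous_intros)
  have "lborel = density (distr lborel borel A) (\<lambda>_. ennreal \<bar>\<alpha> * \<delta> - \<beta> * \<gamma>\<bar>)"
  proof (rule measure_eqI)
    fix B :: "(real \<times> real) set" assume "B \<in> sets lborel"
    then have [measurable]: "B \<in> sets borel" by simp
    show "emeasure lborel B = emeasure (density (distr lborel borel A) (\<lambda>_. ennreal \<bar>\<alpha> * \<delta> - \<beta> * \<gamma>\<bar>)) B"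
    proof -
      have "emeasure (distr lborel borel A) B = (\<integral>\<^sup>+z. indicator B z \<partial>distr lborel borel A)" by simp
      also have "\<dots> = (\<integral>\<^sup>+z. indicator B (A z) \<partial>lborel)" by (subst nn_integral_distr) auto
      finally show ?thesis
        using nn_integral_affine_plane[of "indicator B", OF _ \<Delta>, of p q]
        by (simp add: emeasure_density nn_integral_cmult A_def[symmetric])
    qed
  qed simp
  then have "(\<integral>z. h z \<partial>lborel) = (\<integral>z. h z \<partial>density (distr lborel borel A) (\<lambda>_. ennreal \<bar>\<alpha> * \<delta> - \<beta> * \<gamma>\<bar>))"
    by simp
  also have "\<dots> = \<bar>\<alpha> * \<delta> - \<beta> * \<gamma>\<bar> * (\<integral>z. h (A z) \<partial>lborel)"
    by (subst integral_density) (auto simp: integral_distr)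
  finally show ?thesis unfolding A_def .
qed

section \<open>Permutations of the coordinate axes\<close>

definition coord_map :: "3 \<Rightarrow> 3 \<Rightarrow> 3 \<Rightarrow> real \<times> real \<times> real \<Rightarrow> pt" where
  "coord_map i j k = (\<lambda>(s, t, u). s *\<^sub>R axis i 1 + t *\<^sub>R axis j 1 + u *\<^sub>R axis k 1)"

lemma UNIV_3_perm: "i \<noteq> j \<Longrightarrow> j \<noteq> k \<Longrightarrow> i \<noteq> k \<Longrightarrow> (UNIV :: 3 set) = {i, j, k}"
  using exhaust_3[of i] exhaust_3[of j] exhaust_3[of k] by (auto simp: UNIV_3)

lemma box_Pair: "box (a, c) (b, d) = box a b \<times> box c (d :: 'b::euclidean_space)"
  for a b :: "'a::euclidean_space"
  by (auto simp: box_def Basis_prod_def ball_Un)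

lemma emeasure_lborel_Times:
  fixes A :: "'a::euclidean_space set" and B :: "'b::euclidean_space set"
  assumes "A \<in> sets borel" "B \<in> sets borel"
  shows "emeasure lborel (A \<times> B) = emeasure lborel A * emeasure lborel B"
  unfolding lborel_prod[symmetric] by (rule lborel.emeasure_pair_measure_Times) (use assms in auto)

text \<open>The preimage of a box is a box with the same side lengths in another order, and volumes
  of boxes determine the measure. It allows any axis to play the role of the first coordinate in
  \<open>flux_fst_direction\<close>.\<close>

lemma lborel_coord_map:
  assumes "i \<noteq> j" "j \<noteq> k" "i \<noteq> k"
  shows "distr lborel borel (coord_map i j k) = lborel"
proof -
  have [measurable]: "coord_map i j k \<in> borel_measurable borel"
    unfolding coord_map_def case_prod_beta by (intro borel_measurable_continuous_onI continuous_intros)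
  have "lborel = distr lborel borel (coord_map i j k)"
  proof (rule lborel_eqI)
    fix l u :: pt
    assume "\<And>b. b \<in> Basis \<Longrightarrow> l \<bullet> b \<le> u \<bullet> b"
    then have lu: "l $ m \<le> u $ m" for m by (metis axis_in_Basis_iff Basis_real_def inner_axis inner_real_def mult.right_neutral singletonI)
    have "coord_map i j k -` box l u = box (l $ i, l $ j, l $ k) (u $ i, u $ j, u $ k)"
    proof -
      have all: "(\<forall>m. P m) \<longleftrightarrow> P i \<and> P j \<and> P k" for P
        using UNIV_3_perm[OF assms] by (metis UNIV_I insertE singletonD)
      show ?thesis
        using assms by (auto simp: mem_box_cart box_Pair coord_map_def axis_def all)
    qed
    then have "emeasure (distr lborel borel (coord_map i j k)) (box l u)
        = emeasure lborel (box (l $ i, l $ j, l $ k) (u $ i, u $ j, u $ k))"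
      by (simp add: emeasure_distr)
    also have "\<dots> = ennreal ((u $ i - l $ i) * ((u $ j - l $ j) * (u $ k - l $ k)))"
      using lu by (simp add: box_Pair emeasure_lborel_Times borel_open open_Times ennreal_mult)
    also have "(u $ i - l $ i) * ((u $ j - l $ j) * (u $ k - l $ k)) = (\<Prod>m\<in>UNIV. (u - l) $ m)"
      using assms by (simp add: UNIV_3_perm[OF assms])
    also have "\<dots> = (\<Prod>b\<in>Basis. (u - l) \<bullet> b)"
    proof -
      have "(Basis :: pt set) = (\<lambda>m. axis m 1) ` UNIV" by (auto simp: Basis_vec_def)
      moreover have "inj (\<lambda>m. axis m 1 :: pt)" by (simp add: inj_on_def axis_eq_axis)
      ultimately have "(\<Prod>b\<in>Basis. (u - l) \<bullet> b) = (\<Prod>m\<in>UNIV. (u - l) \<bullet> axis m 1)"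
        using prod.reindex[of "\<lambda>m. axis m 1 :: pt" UNIV "\<lambda>b. (u - l) \<bullet> b"] by simp
      then show ?thesis by (simp add: inner_axis)
    qed
    finally show "emeasure (distr lborel borel (coord_map i j k)) (box l u) = ennreal (\<Prod>b\<in>Basis. (u - l) \<bullet> b)" .
  qed simp
  then show ?thesis by simp
qed

section \<open>Local structure of the boundary\<close>

text \<open>A flat piece of the boundary cannot contain the direction \<open>e\<close> of the local graph, so
  the graph is a hyperplane there.\<close>

lemma local_half_space:
  fixes S :: "pt set"
  assumes lip: "lipschitz_boundary S" and x: "x \<in> rel_frontier S" and S: "rel_interior S = S"
    and flat: "0 < \<rho>" "\<And>y. y \<in> ball x \<rho> \<inter> affine hull S \<Longrightarrow> (y - x) \<bullet> n = 0 \<Longrightarrow> y \<in> rel_frontier S"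
  shows "\<exists>\<sigma>. (\<sigma> = 1 \<or> \<sigma> = -1) \<and>
    (\<exists>r>0. \<forall>y \<in> ball x r \<inter> affine hull S. y \<in> S \<longleftrightarrow> \<sigma> * ((y - x) \<bullet> n) < (0::real))"
proof -
  let ?A = "affine hull S"
  obtain e \<phi> L r where e: "norm e = 1" "x + e \<in> ?A" "L-lipschitz_on UNIV (\<phi> :: pt \<Rightarrow> real)" "0 < r"
    and gr: "\<forall>y \<in> ball x r \<inter> ?A. y \<in> S \<longleftrightarrow> (y - x) \<bullet> e < \<phi> (y - x - ((y - x) \<bullet> e) *\<^sub>R e)"
    using bspec[OF lip[unfolded lipschitz_boundary_def] x] by metis
  have cont: "continuous_on UNIV \<phi>" using e(3) lipschitz_on_continuous_on by blast
  have ee: "e \<bullet> e = 1" using e(1) by (simp add: dot_square_norm)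
  have clA: "closure S \<subseteq> ?A" by (metis closure_affine_hull closure_mono hull_subset)
  have xA: "x \<in> ?A" using x clA by (auto simp: rel_frontier_def)
  have add: "y + t *\<^sub>R e \<in> ?A" if "y \<in> ?A" for y t
    using mem_affine_3_minus[OF affine_affine_hull that e(2) xA, of t] by simp
  define pr where "pr y = y - x - ((y - x) \<bullet> e) *\<^sub>R e" for y
  \<comment> \<open>A frontier point in the ball lies on the graph: below it the point would belong
    to \<open>S\<close>, and strictly above it would have a neighbourhood free of
    \<open>S\<close>.\<close>
  have graph: "(z - x) \<bullet> e = \<phi> (pr z)" if z: "z \<in> ball x r" "z \<in> rel_frontier S" for z
  proof -
    have zA: "z \<in> ?A" and zS: "z \<notin> S" and zc: "z \<in> closure S"
      using z clA S by (auto simp: rel_frontier_def)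
    have "\<not> (z - x) \<bullet> e < \<phi> (pr z)" using bspec[OF gr, of z] z zA zS by (simp add: pr_def)
    moreover have "\<not> \<phi> (pr z) < (z - x) \<bullet> e"
    proof
      assume gt: "\<phi> (pr z) < (z - x) \<bullet> e"
      define W where "W = {y. \<phi> (pr y) < (y - x) \<bullet> e} \<inter> ball x r"
      have "continuous_on UNIV (\<lambda>y. \<phi> (pr y))"
        by (rule continuous_on_compose2[OF cont]) (auto simp: pr_def intro!: continuous_intros)
      then have "open W" unfolding W_def
        by (intro open_Int open_Collect_less continuous_intros) auto
      moreover have "z \<in> W" using gt z by (simp add: W_def)
      ultimately obtain y where y: "y \<in> S" "y \<in> W" using zc by (meson closure_iff_nhds_not_empty subset_refl disjoint_iff)
      then have "y \<in> ball x r \<inter> ?A" using hull_subset[of S affine] by (auto simp: W_def)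
      then show False using bspec[OF gr, of y] y by (auto simp: W_def pr_def)
    qed
    ultimately show ?thesis by linarith
  qed
  \<comment> \<open>Otherwise the segment from \<open>x\<close> in direction \<open>e\<close> would
    lie in the flat piece, hence on the graph, although \<open>pr\<close> does not change along
    it.\<close>
  have en: "e \<bullet> n \<noteq> 0"
  proof
    assume 0: "e \<bullet> n = 0"
    define t where "t = min \<rho> r / 2"
    have t: "0 < t" "t < \<rho>" "t < r" using flat(1) e(4) by (auto simp: t_def)
    have "x + t *\<^sub>R e \<in> rel_frontier S"
      by (rule flat(2)) (use add[OF xA] t 0 e(1) in \<open>auto simp: dist_norm\<close>)
    then have "t = \<phi> (pr (x + t *\<^sub>R e))" using graph[of "x + t *\<^sub>R e"] t e(1) ee by (simp add: dist_norm)
    moreover have "0 = \<phi> (pr x)" using graph[of x] x e(4) by simp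
    ultimately show False using t ee by (simp add: pr_def)
  qed
  \<comment> \<open>\<open>q\<close> bounds the factor by which projecting along \<open>e\<close>
    onto the hyperplane can increase the distance from \<open>x\<close>; a ball of radius
    \<open>r'\<close> is then projected into both given balls.\<close>
  define q where "q = 1 + norm n / \<bar>e \<bullet> n\<bar>"
  have q: "1 \<le> q" by (simp add: q_def)
  define r' where "r' = min \<rho> r / q"
  have "min \<rho> r * 1 \<le> min \<rho> r * q" using flat(1) e(4) q by (intro mult_left_mono) auto
  then have "min \<rho> r \<le> r * q" using mult_right_mono[of "min \<rho> r" r q] q
    by (auto intro: order_trans)
  then have r': "0 < r'" "r' * q = min \<rho> r" "r' \<le> r"
    using flat(1) e(4) q by (auto simp: r'_def divide_simps)
  have key: "y \<in> S \<longleftrightarrow> sgn (e \<bullet> n) * ((y - x) \<bullet> n) < 0" if y: "y \<in> ball x r' \<inter> ?A" for y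
  proof -
    \<comment> \<open>\<open>z\<close> is the projection of \<open>y\<close> along \<open>e\<close>
      onto the hyperplane. It lies on the graph and has the same \<open>pr\<close> as
      \<open>y\<close>, so \<open>y\<close> is below the graph exactly when \<open>l\<close> is
      negative.\<close>
    define l where "l = ((y - x) \<bullet> n) / (e \<bullet> n)"
    define z where "z = y + (- l) *\<^sub>R e"
    have zA: "z \<in> ?A" unfolding z_def using add y by blast
    have "(z - x) \<bullet> n = (y - x) \<bullet> n - l * (e \<bullet> n)" by (simp add: z_def algebra_simps inner_add_left inner_diff_left)
    then have zn: "(z - x) \<bullet> n = 0" using en by (simp add: l_def)
    have "\<bar>l\<bar> \<le> norm (y - x) * (norm n / \<bar>e \<bullet> n\<bar>)"
      unfolding l_def abs_divide using Cauchy_Schwarz_ineq2[of "y - x" n] by (simp add: divide_right_mono)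
    then have "norm (z - x) \<le> norm (y - x) * q"
      using norm_triangle_ineq4[of "y - x" "l *\<^sub>R e"] e(1) by (simp add: z_def q_def algebra_simps)
    also have "\<dots> < r' * q" using y q by (auto simp: dist_norm norm_minus_commute)
    finally have "norm (z - x) < min \<rho> r" using r' by simp
    then have zb: "z \<in> ball x \<rho>" "z \<in> ball x r" by (auto simp: dist_norm norm_minus_commute)
    then have "(z - x) \<bullet> e = \<phi> (pr z)" using graph flat(2) zA zn by auto
    moreover have "pr z = pr y" using ee by (simp add: pr_def z_def algebra_simps inner_add_left inner_diff_left)
    moreover have "(z - x) \<bullet> e = (y - x) \<bullet> e - l" using ee by (simp add: z_def inner_add_left inner_diff_left)
    moreover have "y \<in> S \<longleftrightarrow> (y - x) \<bullet> e < \<phi> (pr y)" using bspec[OF gr, of y] y r' by (auto simp: pr_def)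
    ultimately have "y \<in> S \<longleftrightarrow> l < 0" by auto
    also have "\<dots> \<longleftrightarrow> sgn (e \<bullet> n) * ((y - x) \<bullet> n) < 0"
      using en by (auto simp: l_def sgn_if divide_less_0_iff mult_less_0_iff)
    finally show ?thesis .
  qed
  have "sgn (e \<bullet> n) = 1 \<or> sgn (e \<bullet> n) = -1" using en by (auto simp: sgn_if)
  then show ?thesis using key r'(1) by (intro exI[of _ "sgn (e \<bullet> n)"]) blast
qed

text \<open>Each of the two signs is locally constant along \<open>X\<close> and they exclude one
  another, so connectedness makes the sign global. This gives the default -1 its meaning: if
  \<open>points_out\<close> fails anywhere, every point of \<open>X\<close> has the sign -1.\<close>

lemma points_out_half_space:
  fixes S X A :: "pt set"
  assumes X: "connected X" "X \<noteq> {}" and n: "norm n = 1"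
    and A: "\<And>x t. x \<in> X \<Longrightarrow> x + t *\<^sub>R n \<in> A" and flat: "\<And>x y. x \<in> X \<Longrightarrow> y \<in> X \<Longrightarrow> (y - x) \<bullet> n = 0"
    and side: "\<And>x. x \<in> X \<Longrightarrow> \<exists>\<sigma>. (\<sigma> = 1 \<or> \<sigma> = -1) \<and>
      (\<exists>r>0. \<forall>y \<in> ball x r \<inter> A. y \<in> S \<longleftrightarrow> \<sigma> * ((y - x) \<bullet> n) < (0::real))"
    and x: "x \<in> X"
  shows "\<exists>r>0. \<forall>y \<in> ball x r \<inter> A. y \<in> S \<longleftrightarrow> (if points_out n S X then 1 else -1) * ((y - x) \<bullet> n) < (0::real)"
proof -
  define P where "P \<sigma> x \<longleftrightarrow> (\<exists>r>0. \<forall>y \<in> ball x r \<inter> A. y \<in> S \<longleftrightarrow> \<sigma> * ((y - x) \<bullet> n) < (0::real))" for \<sigma> x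
  have nn: "n \<bullet> n = 1" using n by (simp add: dot_square_norm)
  have cases: "P 1 x \<or> P (-1) x" if "x \<in> X" for x using side[OF that] unfolding P_def by blast
  have excl: "\<not> (P 1 x \<and> P (-1) x)" if xX: "x \<in> X" for x
  proof
    assume "P 1 x \<and> P (-1) x"
    then obtain r s where r: "r > 0" "\<forall>y \<in> ball x r \<inter> A. y \<in> S \<longleftrightarrow> 1 * ((y - x) \<bullet> n) < 0"
      and s: "s > 0" "\<forall>y \<in> ball x s \<inter> A. y \<in> S \<longleftrightarrow> (-1) * ((y - x) \<bullet> n) < 0"
      unfolding P_def by metis
    define t where "t = min r s / 2"
    have t: "t > 0" "t < r" "t < s" using r s by (auto simp: t_def)
    have "x + t *\<^sub>R n \<in> ball x r \<inter> A" "x + t *\<^sub>R n \<in> ball x s \<inter> A" using t n A[OF xX] by (auto simp: dist_norm)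
    then show False using bspec[OF r(2), of "x + t *\<^sub>R n"] bspec[OF s(2), of "x + t *\<^sub>R n"] t nn by auto
  qed
  have loc: "\<exists>T. openin (top_of_set X) T \<and> a \<in> T \<and> (\<forall>x \<in> T. P 1 x = P 1 a)" if a: "a \<in> X" for a
  proof -
    obtain \<sigma> where \<sigma>: "\<sigma> = 1 \<or> \<sigma> = -1" "P \<sigma> a" using cases[OF a] by blast
    then obtain r where r: "r > 0" "\<forall>y \<in> ball a r \<inter> A. y \<in> S \<longleftrightarrow> \<sigma> * ((y - a) \<bullet> n) < 0" unfolding P_def by blast
    have "P \<sigma> b" if b: "b \<in> X \<inter> ball a (r / 2)" for b
    proof -
      have "y \<in> S \<longleftrightarrow> \<sigma> * ((y - b) \<bullet> n) < 0" if y: "y \<in> ball b (r / 2) \<inter> A" for y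
      proof -
        have "dist a y < r" using dist_triangle[of a y b] b y by (auto simp: dist_commute)
        moreover have "(y - a) \<bullet> n = (y - b) \<bullet> n" using flat[OF a, of b] b by (auto simp: inner_diff_left)
        ultimately show ?thesis using bspec[OF r(2), of y] y by auto
      qed
      then show ?thesis unfolding P_def using r(1) by (intro exI[of _ "r / 2"]) auto
    qed
    then have "P 1 b = P 1 a" if b: "b \<in> X \<inter> ball a (r / 2)" for b
      using \<sigma> excl[OF a] excl[of b] b by blast
    then have "\<forall>b \<in> X \<inter> ball a (r / 2). P 1 b = P 1 a" by blast
    moreover have "openin (top_of_set X) (X \<inter> ball a (r / 2))" by (intro openin_open_Int) auto
    moreover have "a \<in> X \<inter> ball a (r / 2)" using a r(1) by simp
    ultimately show ?thesis by (intro exI[of _ "X \<inter> ball a (r / 2)"] conjI)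
  qed
  have const: "P 1 a = P 1 b" if "a \<in> X" "b \<in> X" for a b
    using locally_constant_imp_constant[OF X(1), of "P 1"] loc that unfolding constant_on_def by metis
  have out: "points_out n S X \<longleftrightarrow> (\<forall>x\<in>X. P 1 x)"
  proof
    assume po: "points_out n S X"
    show "\<forall>x\<in>X. P 1 x"
    proof (rule ballI, rule ccontr)
      fix x assume x: "x \<in> X" "\<not> P 1 x"
      then obtain r where r: "r > 0" "\<forall>y \<in> ball x r \<inter> A. y \<in> S \<longleftrightarrow> (-1) * ((y - x) \<bullet> n) < 0"
        using cases[OF x(1)] unfolding P_def by blast
      obtain \<epsilon> where \<epsilon>: "\<epsilon> > 0" "\<forall>s. 0 < s \<and> s < \<epsilon> \<longrightarrow> x - s *\<^sub>R n \<in> S \<and> x + s *\<^sub>R n \<notin> S"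
        using po x(1) unfolding points_out_def by blast
      define t where "t = min r \<epsilon> / 2"
      have t: "t > 0" "t < r" "t < \<epsilon>" using r \<epsilon> by (auto simp: t_def)
      have "x + t *\<^sub>R n \<in> ball x r \<inter> A" using t n A[OF x(1)] by (auto simp: dist_norm)
      then show False using bspec[OF r(2), of "x + t *\<^sub>R n"] \<epsilon>(2) t nn by auto
    qed
  next
    assume all: "\<forall>x\<in>X. P 1 x"
    show "points_out n S X" unfolding points_out_def
    proof
      fix x assume x: "x \<in> X"
      then obtain r where r: "r > 0" "\<forall>y \<in> ball x r \<inter> A. y \<in> S \<longleftrightarrow> 1 * ((y - x) \<bullet> n) < 0"
        using all unfolding P_def by blast
      have "x - s *\<^sub>R n \<in> S \<and> x + s *\<^sub>R n \<notin> S" if s: "0 < s" "s < r" for s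
      proof -
        have "x + s *\<^sub>R n \<in> ball x r \<inter> A" "x - s *\<^sub>R n \<in> ball x r \<inter> A"
          using s n A[OF x, of s] A[OF x, of "- s"] by (auto simp: dist_norm)
        then show ?thesis
          using bspec[OF r(2), of "x + s *\<^sub>R n"] bspec[OF r(2), of "x - s *\<^sub>R n"] s nn by auto
      qed
      then show "\<exists>\<epsilon>>0. \<forall>s. 0 < s \<and> s < \<epsilon> \<longrightarrow> x - s *\<^sub>R n \<in> S \<and> x + s *\<^sub>R n \<notin> S" using r(1) by blast
    qed
  qed
  show ?thesis
  proof (cases "points_out n S X")
    case True
    then show ?thesis using out x unfolding P_def by auto
  next
    case False
    then have "\<not> P 1 x" using out const x by blast
    then have "P (-1) x" using cases[OF x] by blast
    then show ?thesis using False unfolding P_def by auto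
  qed
qed

section \<open>Orthonormal frames\<close>

lemma exists_orthogonal_to_two:
  fixes u v :: pt
  assumes "u \<noteq> 0"
  shows "\<exists>m. norm m = 1 \<and> m \<bullet> u = 0 \<and> m \<bullet> v = 0"
proof -
  have "\<exists>m. m \<noteq> 0 \<and> m \<bullet> u = 0 \<and> m \<bullet> v = 0"
  proof (cases "cross3 u v = 0")
    case False
    then show ?thesis by (intro exI[of _ "cross3 u v"]) (simp add: dot_cross_self)
  next
    case True
    \<comment> \<open>When the cross product vanishes, \<open>v\<close> is a multiple of
      \<open>u\<close>, and any vector orthogonal to \<open>u\<close> will do.\<close>
    obtain w where w: "cross3 u w \<noteq> 0" using cross_basis_nonzero[OF assms] by blast
    have "0 = cross3 u (cross3 u v)" using True by simp
    then have "(u \<bullet> u) *\<^sub>R v = (u \<bullet> v) *\<^sub>R u" by (simp add: Lagrange)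
    then have "(u \<bullet> u) * (cross3 u w \<bullet> v) = (u \<bullet> v) * (cross3 u w \<bullet> u)" by (metis inner_scaleR_right)
    then have "cross3 u w \<bullet> v = 0" using assms by (simp add: dot_cross_self)
    then show ?thesis using w by (intro exI[of _ "cross3 u w"]) (simp add: dot_cross_self)
  qed
  then obtain m where "m \<noteq> 0" "m \<bullet> u = 0" "m \<bullet> v = 0" by blast
  then show ?thesis by (intro exI[of _ "sgn m"]) (simp add: sgn_div_norm)
qed

text \<open>The remainder \<open>u\<close> is orthogonal to \<open>n\<close> and \<open>a\<close>,
  so its cross product with \<open>cross3 n a\<close> vanishes by Lagrange's formula; as it is also
  orthogonal to that unit vector, it is zero.\<close>

lemma orthonormal_expansion:
  fixes n a v :: pt
  assumes n: "norm n = 1" and a: "norm a = 1" "a \<bullet> n = 0" and v: "v \<bullet> n = 0"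
  shows "v = (v \<bullet> a) *\<^sub>R a + (v \<bullet> cross3 n a) *\<^sub>R cross3 n a"
    and "norm (cross3 n a) = 1"
proof -
  let ?b = "cross3 n a"
  have "(norm ?b)\<^sup>2 = 1" using norm_cross_dot[of n a] n a by (simp add: inner_commute)
  then show nb: "norm ?b = 1" by (simp add: power2_eq_1_iff) (smt (verit) norm_ge_zero)
  define u where "u = v - (v \<bullet> a) *\<^sub>R a - (v \<bullet> ?b) *\<^sub>R ?b"
  have aa: "a \<bullet> a = 1" "?b \<bullet> ?b = 1" using a nb by (simp_all add: dot_square_norm)
  have u: "u \<bullet> n = 0" "u \<bullet> a = 0" "u \<bullet> ?b = 0"
    by (simp_all only: u_def inner_diff_left inner_scaleR_left aa a v dot_cross_self inner_commute[of "cross3 n a" a])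
      simp_all?
  have "cross3 u ?b = 0" using u by (simp add: Lagrange)
  then have "(norm u * norm ?b)\<^sup>2 = 0" using norm_cross_dot[of u ?b] u by simp
  then have "u = 0" using nb by simp
  then show "v = (v \<bullet> a) *\<^sub>R a + (v \<bullet> ?b) *\<^sub>R ?b"
    unfolding u_def by (simp add: diff_eq_eq add.commute)
qed

section \<open>Polyhedra\<close>

text \<open>With \<open>face_a\<close> and \<open>face_b\<close> it names the choices buried in
  \<open>area_measure\<close>, and for edges the one in \<open>length_measure\<close>, so that these
  measures become images under explicit charts.\<close>

definition face_origin :: "pt set \<Rightarrow> pt" where
  "face_origin F = (SOME x. x \<in> F)"

definition face_a :: "polyhedral_cell \<Rightarrow> pt set \<Rightarrow> pt" where
  "face_a M F = (SOME a. norm a = 1 \<and> a \<bullet> fnormal M F = 0)"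

definition face_b :: "polyhedral_cell \<Rightarrow> pt set \<Rightarrow> pt" where
  "face_b M F = cross3 (fnormal M F) (face_a M F)"

definition face_map :: "polyhedral_cell \<Rightarrow> pt set \<Rightarrow> real \<times> real \<Rightarrow> pt" where
  "face_map M F z = face_origin F + fst z *\<^sub>R face_a M F + snd z *\<^sub>R face_b M F"

definition face_plane :: "polyhedral_cell \<Rightarrow> pt set \<Rightarrow> pt set" where
  "face_plane M F = {y. fnormal M F \<bullet> y = fnormal M F \<bullet> face_origin F}"

definition edge_map :: "polyhedral_cell \<Rightarrow> pt set \<Rightarrow> real \<Rightarrow> pt" where
  "edge_map M E s = face_origin E + s *\<^sub>R etangent M E"

lemma area_measure_eq:
  "area_measure M F = restrict_space (distr lborel borel (face_map M F)) F"
  unfolding area_measure_def Let_def face_map_def[abs_def] face_origin_def face_b_def face_a_def case_prod_unfold ..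

lemma length_measure_eq:
  "length_measure M E = restrict_space (distr lborel borel (edge_map M E)) E"
  unfolding length_measure_def Let_def edge_map_def[abs_def] face_origin_def ..

lemma norm_orthonormal_comb:
  fixes a b :: pt
  assumes "norm a = 1" "norm b = 1" "a \<bullet> b = 0"
  shows "norm (s *\<^sub>R a + t *\<^sub>R b) = norm (s, t)"
proof -
  have "(norm (s *\<^sub>R a + t *\<^sub>R b))\<^sup>2 = s\<^sup>2 + t\<^sup>2"
    unfolding power2_norm_eq_inner using assms
    by (simp add: inner_add_left inner_add_right inner_commute[of b a] norm_eq_1 power2_eq_square)
  then show ?thesis by (metis norm_Pair norm_ge_zero power2_abs real_norm_def real_sqrt_unique)
qed

locale polyhedron =
  fixes M :: polyhedral_cell
  assumes poly: "is_polyhedron M"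
begin

abbreviation "T \<equiv> cell M"

lemma
  shows dom_T: "polyhedral_domain T" and fin_F: "finite (faces M)"
    and doms_F: "\<forall>F\<in>faces M. polygonal_domain F"
    and disj_F: "pairwise disjnt (faces M)" and front_T: "frontier T = (\<Union>F\<in>faces M. closure F)"
    and fin_E: "finite (edges M)" and disj_E: "pairwise disjnt (edges M)"
    and edges_ends: "\<forall>E\<in>edges M. \<exists>a\<in>vertices M. \<exists>b\<in>vertices M. a \<noteq> b \<and> E = open_segment a b"
    and rel_fronts_F: "\<forall>F\<in>faces M. rel_frontier F = (\<Union>E\<in>edges_of M F. closure E)"
    and normals_F: "\<forall>F\<in>faces M. norm (fnormal M F) = 1 \<and> (\<forall>x\<in>F. \<forall>y\<in>F. (y - x) \<bullet> fnormal M F = 0)"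
    and etangents: "\<forall>E\<in>edges M. \<exists>a b. a \<noteq> b \<and> E = open_segment a b \<and> etangent M E = sgn (b - a)"
proof -
  note P = poly[unfolded is_polyhedron_def]
  show "polyhedral_domain T"
    using P by (elim conjE)
  show "finite (faces M)"
    using P by (elim conjE)
  show "\<forall>F\<in>faces M. polygonal_domain F"
    using P by (elim conjE)
  show "pairwise disjnt (faces M)"
    using P by (elim conjE)
  show "frontier T = (\<Union>F\<in>faces M. closure F)"
    using P by (elim conjE)
  show "finite (edges M)"
    using P by (elim conjE)
  show "pairwise disjnt (edges M)"
    using P by (elim conjE)
  show "\<forall>E\<in>edges M. \<exists>a\<in>vertices M. \<exists>b\<in>vertices M. a \<noteq> b \<and> E = open_segment a b"
    using P by (elim conjE)
  show "\<forall>F\<in>faces M. rel_frontier F = (\<Union>E\<in>edges_of M F. closure E)"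
    using P by (elim conjE)
  show "\<forall>F\<in>faces M. norm (fnormal M F) = 1 \<and> (\<forall>x\<in>F. \<forall>y\<in>F. (y - x) \<bullet> fnormal M F = 0)"
    using P by (elim conjE)
  show "\<forall>E\<in>edges M. \<exists>a b. a \<noteq> b \<and> E = open_segment a b \<and> etangent M E = sgn (b - a)"
    using P by (elim conjE)
qed

lemma dom_F: "F \<in> faces M \<Longrightarrow> polygonal_domain F"
  and edge_ends: "E \<in> edges M \<Longrightarrow> \<exists>a\<in>vertices M. \<exists>b\<in>vertices M. a \<noteq> b \<and> E = open_segment a b"
  and rel_front_F: "F \<in> faces M \<Longrightarrow> rel_frontier F = (\<Union>E\<in>edges_of M F. closure E)"
  and norm_n: "F \<in> faces M \<Longrightarrow> norm (fnormal M F) = 1"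
  and etangent_eq: "E \<in> edges M \<Longrightarrow> \<exists>a b. a \<noteq> b \<and> E = open_segment a b \<and> etangent M E = sgn (b - a)"
  by (rule bspec[OF doms_F] bspec[OF edges_ends] bspec[OF rel_fronts_F] bspec[OF etangents]
      conjunct1[OF bspec[OF normals_F]]; assumption)+

lemma flat_F: "F \<in> faces M \<Longrightarrow> x \<in> F \<Longrightarrow> y \<in> F \<Longrightarrow> (y - x) \<bullet> fnormal M F = 0"
  using normals_F by blast

lemma face_plane_iff: "y \<in> face_plane M F \<longleftrightarrow> (y - face_origin F) \<bullet> fnormal M F = 0"
  unfolding face_plane_def mem_Collect_eq inner_diff_left by (simp add: inner_commute)

lemma face_plane_iff_at: "x \<in> face_plane M F \<Longrightarrow> y \<in> face_plane M F \<longleftrightarrow> (y - x) \<bullet> fnormal M F = 0"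
  unfolding face_plane_def mem_Collect_eq inner_diff_left by (simp add: inner_commute)

lemma T_props: "T \<noteq> {}" "connected T" "open T" "bounded T" "lipschitz_boundary T"
proof -
  obtain K where K: "finite K" "\<forall>S\<in>K. 3 simplex S" "T = interior (\<Union>K)"
    using dom_T unfolding polyhedral_domain_def by blast
  then show "open T" by simp
  have "bounded (\<Union>K)" using K by (intro bounded_Union) (auto intro: compact_imp_bounded compact_simplex)
  then show "bounded T" using K(3) bounded_subset interior_subset by metis
qed (use dom_T[unfolded polyhedral_domain_def] in blast)+

text \<open>\<open>F\<close> is open in the affine hull of its triangles and hence has the same
  hull. That hull is two-dimensional and contained in the plane orthogonal to the given normal, so
  it is this plane.\<close>

lemma F_props:
  assumes "F \<in> faces M"
  shows "F \<noteq> {}" "connected F" "bounded F" "lipschitz_boundary F" "rel_interior F = F"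
    "affine hull F = face_plane M F" "\<exists>W. open W \<and> F = W \<inter> face_plane M F"
proof -
  note D = dom_F[OF assms, unfolded polygonal_domain_def]
  show ne: "F \<noteq> {}" "connected F" "lipschitz_boundary F" using D by blast+
  obtain K where K: "finite K" "\<forall>S\<in>K. 2 simplex S" "aff_dim (\<Union>K) = 2" "F = rel_interior (\<Union>K)"
    using D by blast
  have "bounded (\<Union>K)" using K by (intro bounded_Union) (auto intro: compact_imp_bounded compact_simplex)
  then show "bounded F" using K(4) bounded_subset rel_interior_subset by metis
  have op: "openin (top_of_set (affine hull (\<Union>K))) F" unfolding K(4) by (rule openin_rel_interior)
  have h: "affine hull F = affine hull (\<Union>K)" by (rule affine_hull_openin[OF op ne(1)])
  then show "rel_interior F = F" using op rel_interior_openin by metis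
  have x: "face_origin F \<in> F" unfolding face_origin_def using ne(1) some_in_eq by blast
  have sub: "F \<subseteq> face_plane M F"
    using flat_F[OF assms x] by (auto simp: face_plane_iff)
  have aff: "affine (face_plane M F)" unfolding face_plane_def by (rule affine_hyperplane)
  show H: "affine hull F = face_plane M F"
  proof (rule affine_dim_equal)
    show "affine hull F \<subseteq> face_plane M F" using sub aff by (rule hull_minimal)
    have "aff_dim (face_plane M F) = 2"
      using norm_n[OF assms] unfolding face_plane_def by (subst aff_dim_hyperplane) auto
    then show "aff_dim (affine hull F) = aff_dim (face_plane M F)" using h K(3) aff_dim_affine_hull by metis
  qed (use ne aff in auto)
  show "\<exists>W. open W \<and> F = W \<inter> face_plane M F"
    using op unfolding h[symmetric] H openin_open by blast
qed

lemma face_frame: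
  assumes "F \<in> faces M"
  shows "norm (face_a M F) = 1" "face_a M F \<bullet> fnormal M F = 0" "norm (face_b M F) = 1"
    "face_b M F \<bullet> fnormal M F = 0" "face_a M F \<bullet> face_b M F = 0" "face_origin F \<in> F"
    "face_origin F \<in> face_plane M F"
proof -
  have "\<exists>a. norm a = 1 \<and> a \<bullet> fnormal M F = 0"
    using exists_orthogonal_to_two[of "fnormal M F"] norm_n[OF assms] by (metis norm_zero zero_neq_one)
  then have a: "norm (face_a M F) = 1 \<and> face_a M F \<bullet> fnormal M F = 0" unfolding face_a_def by (rule someI_ex)
  then show "norm (face_a M F) = 1" "face_a M F \<bullet> fnormal M F = 0" by auto
  show "norm (face_b M F) = 1"
    unfolding face_b_def using orthonormal_expansion(2)[OF norm_n[OF assms], of "face_a M F" 0] a by simp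
  show "face_b M F \<bullet> fnormal M F = 0" "face_a M F \<bullet> face_b M F = 0"
    by (simp_all add: face_b_def dot_cross_self)
  show "face_origin F \<in> F" unfolding face_origin_def using F_props(1)[OF assms] some_in_eq by blast
  show "face_origin F \<in> face_plane M F" by (simp add: face_plane_def)
qed

lemma face_expansion:
  assumes "F \<in> faces M" "v \<bullet> fnormal M F = 0"
  shows "v = (v \<bullet> face_a M F) *\<^sub>R face_a M F + (v \<bullet> face_b M F) *\<^sub>R face_b M F"
  unfolding face_b_def using orthonormal_expansion(1) norm_n face_frame assms by blast

lemma dist_face_map: "F \<in> faces M \<Longrightarrow> dist (face_map M F u) (face_map M F v) = dist u v"
proof -
  assume F: "F \<in> faces M"
  have "face_map M F u - face_map M F v
      = (fst u - fst v) *\<^sub>R face_a M F + (snd u - snd v) *\<^sub>R face_b M F"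
    by (simp add: face_map_def algebra_simps)
  then show ?thesis
    using norm_orthonormal_comb[of "face_a M F" "face_b M F" "fst u - fst v" "snd u - snd v"] face_frame[OF F]
    by (simp add: dist_norm norm_prod_def)
qed

lemma continuous_face_map: "continuous_on S (face_map M F)"
  unfolding face_map_def by (intro continuous_intros)

lemma range_face_map:
  assumes "F \<in> faces M"
  shows "range (face_map M F) = face_plane M F"
proof
  show "range (face_map M F) \<subseteq> face_plane M F"
    using face_frame[OF assms] by (auto simp: face_map_def face_plane_def inner_add_right inner_commute)
  show "face_plane M F \<subseteq> range (face_map M F)"
  proof
    fix y assume "y \<in> face_plane M F"
    then have "(y - face_origin F) \<bullet> fnormal M F = 0" by (simp only: face_plane_iff)
    from face_expansion[OF assms this]
    have "y = face_map M F ((y - face_origin F) \<bullet> face_a M F, (y - face_origin F) \<bullet> face_b M F)"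
      unfolding face_map_def fst_conv snd_conv by (metis add.assoc add_diff_cancel_left' diff_add_cancel add.commute)
    then show "y \<in> range (face_map M F)" by blast
  qed
qed

lemma face_preimage:
  assumes F: "F \<in> faces M"
  shows "open (face_map M F -` F)" "bounded (face_map M F -` F)" "face_map M F ` (face_map M F -` F) = F"
proof -
  obtain W where W: "open W" "F = W \<inter> face_plane M F" using F_props(7)[OF F] by blast
  have "face_map M F u \<in> face_plane M F" for u using range_face_map[OF F] by blast
  then have "face_map M F -` F = face_map M F -` W" using W(2) by blast
  then show "open (face_map M F -` F)" using W(1) continuous_face_map open_vimage by metis
  have "F \<subseteq> range (face_map M F)" unfolding range_face_map[OF F] using W(2) by blast
  then show im: "face_map M F ` (face_map M F -` F) = F" by (simp add: image_vimage_eq Int_absorb2)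
  obtain x B where B: "\<forall>y\<in>F. dist x y \<le> B" using F_props(3)[OF F] unfolding bounded_def by blast
  have x: "face_origin F = face_map M F 0" by (simp add: face_map_def)
  have "dist 0 u \<le> dist x (face_origin F) + B" if "u \<in> face_map M F -` F" for u
  proof -
    have "dist 0 u = dist (face_origin F) (face_map M F u)" unfolding x dist_face_map[OF F] ..
    also have "\<dots> \<le> dist x (face_origin F) + dist x (face_map M F u)" by (rule dist_triangle3)
    finally show ?thesis using B that by fastforce
  qed
  then show "bounded (face_map M F -` F)" unfolding bounded_def by blast
qed

lemma flat_measure_face:
  assumes F: "F \<in> faces M"
  shows "flat_measure (area_measure M F) F"
    and "cont_ext_on F f \<Longrightarrow> int_F M F f = (\<integral>u. indicator (face_map M F -` F) u * f (face_map M F u) \<partial>lborel)"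
proof -
  note im = face_preimage[OF F]
  have eq: "area_measure M F
      = restrict_space (distr lborel borel (face_map M F)) (face_map M F ` (face_map M F -` F))"
    unfolding im(3) by (rule area_measure_eq)
  note * = flat_measure_image[OF dist_face_map[OF F] im(1,2) eq, unfolded im(3)]
  show "flat_measure (area_measure M F) F" by (rule *(1))
  show "int_F M F f = (\<integral>u. indicator (face_map M F -` F) u * f (face_map M F u) \<partial>lborel)"
    if "cont_ext_on F f" unfolding int_F_def using *(2) that by simp
qed

lemma flat_measure_cell:
  shows "flat_measure (vol_measure M) T"
    and "cont_ext_on T f \<Longrightarrow> int_T M f = (\<integral>u. indicator T u * f u \<partial>lborel)"
proof -
  have eq: "vol_measure M = restrict_space (distr lborel borel (\<lambda>x. x)) ((\<lambda>x. x) ` T)"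
    by (simp add: vol_measure_def distr_id[of lborel, unfolded id_def])
      (metis distr_id2 sets_lborel)
  note * = flat_measure_image[OF _ T_props(3,4) eq, unfolded image_ident]
  show "flat_measure (vol_measure M) T" by (rule *(1)) simp
  show "int_T M f = (\<integral>u. indicator T u * f u \<partial>lborel)" if "cont_ext_on T f"
    unfolding int_T_def using *(2) that by simp
qed

lemma edge_line:
  assumes E: "E \<in> edges M"
  shows "norm (etangent M E) = 1" "dist (edge_map M E u) (edge_map M E v) = dist u v"
    "\<exists>l r. l < 0 \<and> 0 < r \<and> (\<forall>s. edge_map M E s \<in> E \<longleftrightarrow> l < s \<and> s < r) \<and> E \<subseteq> range (edge_map M E)"
proof -
  obtain a b where ab: "a \<noteq> b" "E = open_segment a b" "etangent M E = sgn (b - a)"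
    using etangent_eq[OF E] by blast
  then show n: "norm (etangent M E) = 1" by (simp add: norm_sgn)
  show "dist (edge_map M E u) (edge_map M E v) = dist u v"
    using n by (simp add: edge_map_def dist_norm scaleR_left_diff_distrib[symmetric])
  have "midpoint a b \<in> E" using ab by (simp add: midpoint_in_open_segment)
  then have "face_origin E \<in> E" unfolding face_origin_def using someI by metis
  \<comment> \<open>The origin is whatever \<open>SOME\<close> picks; \<open>u0\<close> is its
    affine coordinate on the open segment, and \<open>0 < u0 < 1\<close> yields a parameter interval
    that extends to both sides of 0.\<close>
  then obtain u0 where u0: "0 < u0" "u0 < 1" "face_origin E = (1 - u0) *\<^sub>R a + u0 *\<^sub>R b"
    using ab by (auto simp: in_segment)
  define d where "d = norm (b - a)"
  have d: "d > 0" "b - a = d *\<^sub>R etangent M E" using ab by (auto simp: d_def sgn_div_norm)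
  have seg: "(1 - u) *\<^sub>R a + u *\<^sub>R b = edge_map M E ((u - u0) * d)" for u
  proof -
    have "(1 - u) *\<^sub>R a + u *\<^sub>R b = face_origin E + (u - u0) *\<^sub>R (b - a)"
      unfolding u0(3) by (simp add: algebra_simps)
    then show ?thesis unfolding d(2) by (simp add: edge_map_def)
  qed
  have "E = (\<lambda>u. (1 - u) *\<^sub>R a + u *\<^sub>R b) ` {0<..<1}"
    using ab by (auto simp: in_segment)
  also have "\<dots> = edge_map M E ` (\<lambda>u. (u - u0) * d) ` {0<..<1}"
    unfolding seg by (simp add: image_image)
  also have "(\<lambda>u. (u - u0) * d) ` {0<..<1} = {- u0 * d<..<(1 - u0) * d}"
  proof
    show "(\<lambda>u. (u - u0) * d) ` {0<..<1} \<subseteq> {- u0 * d<..<(1 - u0) * d}"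
    proof
      fix s assume "s \<in> (\<lambda>u. (u - u0) * d) ` {0<..<1}"
      then obtain u where u': "s = (u - u0) * d" "u \<in> {0<..<1}" by (rule imageE)
      then have u: "s = (u - u0) * d" "0 < u" "u < 1" by (simp_all only: greaterThanLessThan_iff)
      have "- u0 * d < (u - u0) * d" "(u - u0) * d < (1 - u0) * d"
        using u d(1) by (intro mult_strict_right_mono; simp)+
      then show "s \<in> {- u0 * d<..<(1 - u0) * d}" using u(1) by simp
    qed
    show "{- u0 * d<..<(1 - u0) * d} \<subseteq> (\<lambda>u. (u - u0) * d) ` {0<..<1}"
    proof
      fix s assume "s \<in> {- u0 * d<..<(1 - u0) * d}"
      then show "s \<in> (\<lambda>u. (u - u0) * d) ` {0<..<1}"
        using d(1) by (intro image_eqI[of _ _ "s / d + u0"]) (auto simp: field_simps)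
    qed
  qed
  finally have eq: "E = edge_map M E ` {- u0 * d<..<(1 - u0) * d}" .
  have inj: "inj (edge_map M E)" using n by (auto simp: inj_def edge_map_def)
  have "edge_map M E s \<in> E \<longleftrightarrow> edge_map M E s \<in> edge_map M E ` {- u0 * d<..<(1 - u0) * d}" for s
    by (rule arg_cong[OF eq])
  then have "\<forall>s. edge_map M E s \<in> E \<longleftrightarrow> - u0 * d < s \<and> s < (1 - u0) * d"
    by (simp add: inj_image_mem_iff[OF inj])
  moreover have "E \<subseteq> range (edge_map M E)"
    by (rule ord_eq_le_trans[OF eq image_mono[OF subset_UNIV]])
  moreover have "- u0 * d < 0" "0 < (1 - u0) * d" using u0 d(1) by auto
  ultimately show "\<exists>l r. l < 0 \<and> 0 < r \<and> (\<forall>s. edge_map M E s \<in> E \<longleftrightarrow> l < s \<and> s < r) \<and> E \<subseteq> range (edge_map M E)"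
    by blast
qed

lemma edge_preimage:
  assumes E: "E \<in> edges M"
  shows "open (edge_map M E -` E)" "bounded (edge_map M E -` E)" "edge_map M E ` (edge_map M E -` E) = E"
proof -
  obtain l r where lr: "\<forall>s. edge_map M E s \<in> E \<longleftrightarrow> l < s \<and> s < r" "E \<subseteq> range (edge_map M E)"
    using edge_line(3)[OF E] by (elim exE conjE) (rule that)
  have eq: "edge_map M E -` E = {l<..<r}"
    by (intro set_eqI) (simp only: vimage_eq lr(1)[rule_format] greaterThanLessThan_iff)
  show "open (edge_map M E -` E)" by (simp only: eq open_greaterThanLessThan)
  show "bounded (edge_map M E -` E)" unfolding eq using bounded_box[of l r] by (simp only: box_real)
  show "edge_map M E ` (edge_map M E -` E) = E" using lr(2) by (simp only: image_vimage_eq Int_absorb2)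
qed

lemma flat_measure_edge:
  assumes E: "E \<in> edges M"
  shows "flat_measure (length_measure M E) E"
    and "cont_ext_on E f \<Longrightarrow> int_E M E f = (\<integral>u. indicator (edge_map M E -` E) u * f (edge_map M E u) \<partial>lborel)"
proof -
  note im = edge_preimage[OF E]
  have eq: "length_measure M E
      = restrict_space (distr lborel borel (edge_map M E)) (edge_map M E ` (edge_map M E -` E))"
    unfolding im(3) by (rule length_measure_eq)
  note * = flat_measure_image[OF edge_line(2)[OF E] im(1,2) eq, unfolded im(3)]
  show "flat_measure (length_measure M E) E" by (rule *(1))
  show "int_E M E f = (\<integral>u. indicator (edge_map M E -` E) u * f (edge_map M E u) \<partial>lborel)"
    if "cont_ext_on E f" unfolding int_E_def using *(2) that by simp
qed

lemma edges_ofD: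
  assumes "E \<in> edges_of M F"
  shows "E \<in> edges M" "E \<subseteq> rel_frontier F"
  using assms by (auto simp: edges_of_def)

lemma closure_F_subset: "F \<in> faces M \<Longrightarrow> closure F \<subseteq> face_plane M F"
  using F_props(6) by (metis closure_affine_hull closure_mono hull_subset)

lemma edge_in_plane:
  assumes F: "F \<in> faces M" and E: "E \<in> edges_of M F"
  shows "E \<subseteq> face_plane M F" "etangent M E \<bullet> fnormal M F = 0"
proof -
  show sub: "E \<subseteq> face_plane M F"
    using edges_ofD(2)[OF E] closure_F_subset[OF F] by (auto simp: rel_frontier_def)
  obtain l r where lr: "l < 0" "0 < r" "\<forall>s. edge_map M E s \<in> E \<longleftrightarrow> l < s \<and> s < r"
    using edge_line(3)[OF edges_ofD(1)[OF E]] by (elim exE conjE) (rule that)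
  have "edge_map M E 0 \<in> face_plane M F" "edge_map M E (r / 2) \<in> face_plane M F"
    by (intro subsetD[OF sub]; use lr in simp)+
  then show "etangent M E \<bullet> fnormal M F = 0"
    using lr(2) by (simp add: face_plane_def edge_map_def inner_add_right inner_commute)
qed

text \<open>\<open>F\<close> is relatively open in its plane and contained in the frontier of
  \<open>T\<close>, so near a point of \<open>F\<close> the plane belongs to the frontier. This is
  the flatness that \<open>local_half_space\<close> asks for.\<close>

lemma half_space_T:
  assumes F: "F \<in> faces M" and x: "x \<in> F"
  shows "\<exists>r>0. \<forall>y\<in>ball x r. y \<in> T \<longleftrightarrow> omega_TF M F * ((y - x) \<bullet> fnormal M F) < 0"
proof -
  have hull: "affine hull T = UNIV" using T_props affine_hull_open by blast
  have int: "rel_interior T = T" using T_props(3) rel_interior_open by blast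
  have rf: "rel_frontier T = frontier T" by (rule rel_frontier_frontier[OF hull])
  have sub: "F \<subseteq> frontier T" using front_T F closure_subset by blast
  obtain W where W: "open W" "F = W \<inter> face_plane M F" using F_props(7)[OF F] by blast
  have "\<exists>\<sigma>. (\<sigma> = 1 \<or> \<sigma> = -1) \<and>
      (\<exists>r>0. \<forall>y \<in> ball x r \<inter> affine hull T. y \<in> T \<longleftrightarrow> \<sigma> * ((y - x) \<bullet> fnormal M F) < (0::real))"
    if x: "x \<in> F" for x
  proof -
    obtain \<rho> where \<rho>: "\<rho> > 0" "ball x \<rho> \<subseteq> W" using openE[OF W(1)] x W(2) by blast
    show ?thesis
    proof (rule local_half_space[OF T_props(5) _ int \<rho>(1)])
      show "x \<in> rel_frontier T" using rf sub x by auto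
      fix y assume y: "y \<in> ball x \<rho> \<inter> affine hull T" "(y - x) \<bullet> fnormal M F = 0"
      have "x \<in> face_plane M F" using x W(2) by blast
      then have "y \<in> face_plane M F" using y(2) face_plane_iff_at by blast
      then have "y \<in> F" using y(1) \<rho>(2) W(2) by blast
      then show "y \<in> rel_frontier T" using rf sub by blast
    qed
  qed
  from points_out_half_space[OF F_props(2,1)[OF F] norm_n[OF F] _ flat_F[OF F] this x]
  show ?thesis by (simp add: omega_TF_def hull)
qed

lemma norm_normal_FE:
  assumes F: "F \<in> faces M" and E: "E \<in> edges_of M F"
  shows "norm (normal_FE M F E) = 1" "normal_FE M F E \<bullet> fnormal M F = 0" "normal_FE M F E \<bullet> etangent M E = 0"
  unfolding normal_FE_def
  using orthonormal_expansion(2)[OF norm_n[OF F] edge_line(1)[OF edges_ofD(1)[OF E]] edge_in_plane(2)[OF F E], of 0]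
  by (simp_all add: dot_cross_self)

text \<open>The same argument inside the plane of \<open>F\<close>: near a point of
  \<open>E\<close>, the points of the plane that differ from it orthogonally to
  \<open>normal_FE M F E\<close> lie on the line of \<open>E\<close>, and so in the open segment
  itself.\<close>

lemma half_space_F:
  assumes F: "F \<in> faces M" and E: "E \<in> edges_of M F" and x: "x \<in> E"
  shows "\<exists>r>0. \<forall>y\<in>ball x r \<inter> face_plane M F. y \<in> F \<longleftrightarrow> omega_FE M F E * ((y - x) \<bullet> normal_FE M F E) < 0"
proof -
  note E' = edges_ofD[OF E]
  note hull = F_props(6)[OF F] and n = norm_normal_FE[OF F E]
  obtain l r where lr: "\<forall>s. edge_map M E s \<in> E \<longleftrightarrow> l < s \<and> s < r" "E \<subseteq> range (edge_map M E)"
    using edge_line(3)[OF E'(1)] by (elim exE conjE) (rule that)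
  obtain a b where "E = open_segment a b" using edge_ends[OF E'(1)] by blast
  then have conn: "connected E" using convex_open_segment convex_connected by blast
  have flat: "(y - x) \<bullet> normal_FE M F E = 0" if xy: "x \<in> E" "y \<in> E" for x y
  proof -
    obtain s t where "x = edge_map M E s" "y = edge_map M E t" using xy lr(2) by blast
    then have "y - x = (t - s) *\<^sub>R etangent M E" by (simp add: edge_map_def algebra_simps)
    then show ?thesis using n(3) by (simp add: inner_commute)
  qed
  have add: "x + t *\<^sub>R normal_FE M F E \<in> face_plane M F" if "x \<in> E" for x t
    using edge_in_plane(1)[OF F E] that n(2) by (auto simp: face_plane_def inner_add_right inner_commute)
  have side: "\<exists>\<sigma>. (\<sigma> = 1 \<or> \<sigma> = -1) \<and>
      (\<exists>r>0. \<forall>y \<in> ball x r \<inter> affine hull F. y \<in> F \<longleftrightarrow> \<sigma> * ((y - x) \<bullet> normal_FE M F E) < (0::real))"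
    if x: "x \<in> E" for x
  proof -
    obtain s where s: "x = edge_map M E s" using x lr(2) by blast
    then have s': "l < s" "s < r" using x lr(1) by auto
    \<comment> \<open>The distance to the nearer end of the edge, measured in arc length.\<close>
    define \<rho> where "\<rho> = min (s - l) (r - s)"
    have \<rho>: "\<rho> > 0" using s' by (simp add: \<rho>_def)
    show ?thesis
    proof (rule local_half_space[OF F_props(4)[OF F] _ F_props(5)[OF F] \<rho>])
      show "x \<in> rel_frontier F" using E'(2) x by blast
      fix y assume y: "y \<in> ball x \<rho> \<inter> affine hull F" "(y - x) \<bullet> normal_FE M F E = 0"
      have "x \<in> face_plane M F" using x edge_in_plane(1)[OF F E] by blast
      then have "(y - x) \<bullet> fnormal M F = 0"
        using y(1) face_plane_iff_at unfolding hull by blast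
      from orthonormal_expansion(1)[OF norm_n[OF F] edge_line(1)[OF E'(1)] edge_in_plane(2)[OF F E] this]
      have yx: "y - x = ((y - x) \<bullet> etangent M E) *\<^sub>R etangent M E"
        using y(2) by (simp add: normal_FE_def)
      define p where "p = (y - x) \<bullet> etangent M E"
      have "\<bar>p\<bar> < \<rho>"
        using Cauchy_Schwarz_ineq2[of "y - x" "etangent M E"] edge_line(1)[OF E'(1)] y(1)
        by (simp add: p_def dist_norm norm_minus_commute)
      then have "l < s + p" "s + p < r" by (auto simp: \<rho>_def)
      then have "edge_map M E (s + p) \<in> E" using lr(1) by blast
      moreover have "y - x = p *\<^sub>R etangent M E" using yx unfolding p_def .
      then have "y = edge_map M E (s + p)"
        using s by (simp add: edge_map_def scaleR_left_distrib diff_eq_eq add.commute add.left_commute)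
      ultimately have "y \<in> E" by simp
      then show "y \<in> rel_frontier F" using E'(2) by blast
    qed
  qed
  have "E \<noteq> {}" using x by blast
  from points_out_half_space[OF conn this n(1) add flat side[unfolded hull] x]
  show ?thesis by (simp add: omega_FE_def)
qed

end

section \<open>The divergence theorem on the cell and Stokes' theorem on its faces\<close>

lemma polys_line_derivative:
  assumes "p \<in> polys l"
  shows "((\<lambda>s. p (w + s *\<^sub>R h)) has_real_derivative grad p (w + s *\<^sub>R h) \<bullet> h) (at s)"
proof -
  have "((\<lambda>s. p (w + s *\<^sub>R h)) has_derivative (\<lambda>r. frechet_derivative p (at (w + s *\<^sub>R h)) (r *\<^sub>R h))) (at s)"
    by (rule has_derivative_compose[where g = p, OF _ polys_has_derivative[OF assms]])
      (auto intro!: derivative_eq_intros)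
  also have "(\<lambda>r. frechet_derivative p (at (w + s *\<^sub>R h)) (r *\<^sub>R h)) = (*) (grad p (w + s *\<^sub>R h) \<bullet> h)"
    by (auto simp: frechet_derivative_polys[OF assms] inner_vec_def grad_comp sum_distrib_left
        sum_distrib_right algebra_simps)
  finally show ?thesis by (simp add: has_field_derivative_def)
qed

lemma hyperplane_null_sets:
  fixes m :: "'a::euclidean_space"
  assumes "m \<noteq> 0"
  shows "{y. m \<bullet> y = c} \<in> null_sets lborel"
proof -
  have "{y. m \<bullet> y = c} \<in> null_sets lebesgue"
    using negligible_hyperplane[of m c] assms negligible_iff_null_sets by blast
  moreover have "{y. m \<bullet> y = c} \<in> sets borel" using closed_hyperplane borel_closed by blast
  ultimately show ?thesis using null_sets_completion_iff[of "{y. m \<bullet> y = c}" lborel] by simp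
qed

lemma closure_vimage_subset:
  assumes "continuous_on UNIV f"
  shows "closure (f -` S) \<subseteq> f -` closure S"
proof -
  have "f ` closure (f -` S) \<subseteq> closure S"
    by (rule image_closure_subset) (use assms continuous_on_subset closure_subset in blast)+
  then show ?thesis by blast
qed

context polyhedron
begin

lemma omega_TF_cases: "omega_TF M F = 1 \<or> omega_TF M F = -1"
  by (simp add: omega_TF_def)

lemma omega_FE_cases: "omega_FE M F E = 1 \<or> omega_FE M F E = -1"
  by (simp add: omega_FE_def)

lemma closure_F_cases:
  assumes "F \<in> faces M" "x \<in> closure F"
  shows "x \<in> F \<or> (\<exists>E\<in>edges_of M F. x \<in> closure E)"
proof (cases "x \<in> F")
  case False
  then have "x \<in> rel_frontier F" using assms F_props(5) by (simp add: rel_frontier_def)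
  then show ?thesis using rel_front_F[OF assms(1)] by blast
qed simp

text \<open>\<open>flux_fst_direction\<close> with the lines parallel to axis \<open>i\<close>.
  Faces parallel to that axis contribute 0 on the right and, like the edges, cast a shadow of
  measure zero. On every other face the integral over the shadow is transported to the face chart,
  with Jacobian the absolute value of \<open>fnormal M F $ i\<close>; the sign of the crossing
  restores the sign of that component.\<close>

lemma int_T_pd_axis:
  fixes i j k :: 3
  assumes ijk: "(i, j, k) = (1, 2, 3) \<or> (i, j, k) = (2, 3, 1) \<or> (i, j, k) = (3, 1, 2 :: 3)"
    and p: "p \<in> polys l"
  shows "int_T M (pd i p) = (\<Sum>F\<in>faces M. omega_TF M F * (fnormal M F $ i * int_F M F p))"
proof -
  have ne: "i \<noteq> j" "j \<noteq> k" "i \<noteq> k" using ijk by auto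
  let ?\<phi> = "coord_map i j k"
  define pr where "pr x = (x $ i, x $ j, x $ k)" for x :: pt
  have \<phi>c: "?\<phi> z $ i = fst z" "?\<phi> z $ j = fst (snd z)" "?\<phi> z $ k = snd (snd z)" for z
    using ne by (auto simp: coord_map_def axis_def case_prod_unfold)
  have \<phi>pr: "?\<phi> (pr x) = x" for x
  proof -
    have "?\<phi> (pr x) $ m = x $ m" for m
      using UNIV_3_perm[OF ne] \<phi>c[of "pr x"] by (metis (no_types, lifting) UNIV_I fst_conv insertE pr_def singletonD snd_conv)
    then show ?thesis by (simp add: vec_eq_iff)
  qed
  have pr\<phi>: "pr (?\<phi> z) = z" for z by (simp add: pr_def \<phi>c)
  have vim: "?\<phi> -` S = pr ` S" for S
    using \<phi>pr pr\<phi> by (auto simp: image_iff) metis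
  have lin: "bounded_linear pr" unfolding pr_def
    by (intro bounded_linear_Pair bounded_linear_vec_nth)
  have bvim: "bounded (?\<phi> -` S)" if "bounded S" for S
    unfolding vim by (rule bounded_linear_image[OF that lin])
  have inn: "v \<bullet> ?\<phi> z = pr v \<bullet> z" for v z
  proof -
    have "v \<bullet> ?\<phi> z = (\<Sum>m\<in>{i, j, k}. v $ m * ?\<phi> z $ m)" by (simp add: inner_vec_def UNIV_3_perm[OF ne])
    then show ?thesis using ne by (simp add: \<phi>c pr_def inner_prod_def)
  qed
  have nrm: "norm (?\<phi> z) = norm z" for z
    unfolding norm_eq_sqrt_inner inn pr\<phi> ..
  have sub: "?\<phi> z - ?\<phi> w = ?\<phi> (z - w)" for z w
    by (simp add: coord_map_def case_prod_unfold algebra_simps)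
  have dist\<phi>: "dist (?\<phi> z) (?\<phi> w) = dist z w" for z w
    by (simp add: dist_norm sub nrm)
  have cont\<phi>: "continuous_on S ?\<phi>" for S
    unfolding coord_map_def case_prod_unfold by (intro continuous_intros)
  have cp: "continuous_on S p" "continuous_on S (pd i p)" for S
    using polys_continuous_on[OF p] polys_continuous_on[OF polys_pd[OF p]] by auto
  define I where "I = {F \<in> faces M. fnormal M F $ i \<noteq> 0}"
  define \<nu> where "\<nu> F = omega_TF M F *\<^sub>R pr (fnormal M F)" for F
  define c where "c F = omega_TF M F * (fnormal M F \<bullet> face_origin F)" for F
  define X where "X F = ?\<phi> -` F" for F
  define U where "U = ?\<phi> -` T"
  \<comment> \<open>Normal of a plane that contains both the edge and the direction of the lines.
    Projected along axis \<open>i\<close>, the edge therefore falls into a straight line.\<close>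
  define m where "m E = (SOME m. norm m = 1 \<and> m \<bullet> axis i 1 = 0 \<and> m \<bullet> etangent M E = 0)" for E
  have m: "norm (m E) = 1 \<and> m E \<bullet> axis i 1 = 0 \<and> m E \<bullet> etangent M E = 0" for E
    unfolding m_def by (rule someI_ex, rule exists_orthogonal_to_two) (simp add: axis_eq_0_iff)
  define H where "H v d = {y. snd (pr v) \<bullet> y = d}" for v :: pt and d :: real
  have Hnull: "H v d \<in> null_sets lborel" if "v $ i = 0" "v \<noteq> 0" for v d
  proof -
    have "snd (pr v) \<noteq> 0"
    proof
      assume "snd (pr v) = 0"
      then have "pr v = 0" using that(1) by (simp add: pr_def prod_eq_iff)
      then have "?\<phi> (pr v) = 0" by (simp add: coord_map_def case_prod_unfold)
      then show False using that(2) \<phi>pr by simp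
    qed
    then show ?thesis unfolding H_def by (rule hyperplane_null_sets)
  qed
  have Hmem: "snd z \<in> H v (v \<bullet> ?\<phi> z)" if "v $ i = 0" for v z
    unfolding H_def inn using that by (simp add: pr_def inner_prod_def)
  \<comment> \<open>The lines that contain the shadows of the faces parallel to axis
    \<open>i\<close> and of all edges.\<close>
  define N where "N = (\<Union>F\<in>faces M - I. H (fnormal M F) (fnormal M F \<bullet> face_origin F)) \<union>
    (\<Union>E\<in>edges M. H (m E) (m E \<bullet> face_origin E))"
  have F_plane: "F \<subseteq> face_plane M F" if "F \<in> faces M" for F using F_props(7)[OF that] by blast
  have \<nu>_inner: "\<nu> F \<bullet> z = omega_TF M F * (fnormal M F \<bullet> ?\<phi> z)" for F z
    by (simp add: \<nu>_def inn)
  have fst\<nu>: "fst (\<nu> F) = omega_TF M F * fnormal M F $ i" for F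
    by (simp add: \<nu>_def pr_def)
  have \<nu>0: "fst (\<nu> F) \<noteq> 0" if "F \<in> I" for F
    using that omega_TF_cases[of F] by (auto simp: fst\<nu> I_def)
  define g where "g F y = (c F - snd (\<nu> F) \<bullet> y) / fst (\<nu> F)" for F y
  have gX: "?\<phi> (g F y, y) \<in> face_plane M F" if "F \<in> I" for F y
  proof -
    have "\<nu> F \<bullet> (g F y, y) = c F" using \<nu>0[OF that] by (simp add: inner_prod_def g_def)
    then show ?thesis unfolding \<nu>_inner c_def face_plane_def using omega_TF_cases[of F] by auto
  qed
  have geq: "g F (snd z) = fst z" if "F \<in> I" "?\<phi> z \<in> face_plane M F" for F z
  proof -
    have "fst (\<nu> F) * fst z + snd (\<nu> F) \<bullet> snd z = c F"
      using that(2) \<nu>_inner[of F z] by (simp add: c_def face_plane_def inner_prod_def)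
    then have "c F - snd (\<nu> F) \<bullet> snd z = fst (\<nu> F) * fst z" by simp
    then show ?thesis unfolding g_def using \<nu>0[OF that(1)] by simp
  qed
  have sndX: "snd ` X F = (\<lambda>y. ?\<phi> (g F y, y)) -` F" if "F \<in> I" for F
  proof
    show "snd ` X F \<subseteq> (\<lambda>y. ?\<phi> (g F y, y)) -` F"
    proof (rule image_subsetI)
      fix z assume "z \<in> X F"
      then have z: "?\<phi> z \<in> F" by (simp add: X_def)
      then have "g F (snd z) = fst z" using geq[OF that, of z] F_plane that by (auto simp: I_def)
      then show "snd z \<in> (\<lambda>y. ?\<phi> (g F y, y)) -` F" using z by simp
    qed
    show "(\<lambda>y. ?\<phi> (g F y, y)) -` F \<subseteq> snd ` X F" by (force simp: X_def)
  qed
  have contg: "continuous_on UNIV (\<lambda>y. ?\<phi> (g F y, y))" for F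
    by (rule continuous_on_compose2[OF cont\<phi>[of UNIV]])
      (auto intro!: continuous_intros simp: g_def divide_inverse)
  have opX: "open (snd ` X F)" if "F \<in> I" for F
  proof -
    have F: "F \<in> faces M" using that by (simp add: I_def)
    obtain W where W: "open W" "F = W \<inter> face_plane M F" using F_props(7)[OF F] by blast
    have "(\<lambda>y. ?\<phi> (g F y, y)) -` F = (\<lambda>y. ?\<phi> (g F y, y)) -` W"
      using W(2) gX[OF that] by blast
    then show ?thesis unfolding sndX[OF that] using open_vimage[OF W(1) contg] by simp
  qed
  have "(\<integral>z. indicator U z * pd i p (?\<phi> z) \<partial>lborel)
      = (\<Sum>F\<in>I. sgn (fst (\<nu> F)) * (\<integral>y. indicator (snd ` X F) y * p (?\<phi> ((c F - snd (\<nu> F) \<bullet> y) / fst (\<nu> F), y)) \<partial>lborel))"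
  proof (rule flux_fst_direction[where N = N and f = "\<lambda>z. p (?\<phi> z)"])
    show "open U" unfolding U_def by (rule open_vimage[OF T_props(3) cont\<phi>])
    show "bounded U" unfolding U_def by (rule bvim[OF T_props(4)])
    show "finite I" using fin_F by (simp add: I_def)
    show "fst (\<nu> F) \<noteq> 0" if "F \<in> I" for F using that by (rule \<nu>0)
    show "\<nu> F \<bullet> z = c F" if "F \<in> I" "z \<in> X F" for F z
      using F_plane[of F] that unfolding \<nu>_inner c_def face_plane_def X_def I_def by auto
    show "X F \<inter> X G = {}" if "F \<in> I" "G \<in> I" "F \<noteq> G" for F G
      using disj_F that unfolding X_def I_def pairwise_def disjnt_def by blast
    show "snd ` X F \<in> sets borel" if "F \<in> I" for F using opX[OF that] by simp
    show "bounded (X F)" if "F \<in> I" for F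
      unfolding X_def using that F_props(3) by (intro bvim) (auto simp: I_def)
    show "\<exists>r>0. \<forall>y\<in>ball z r. y \<in> U \<longleftrightarrow> \<nu> F \<bullet> (y - z) < 0" if "F \<in> I" "z \<in> X F" for F z
    proof -
      have F: "F \<in> faces M" "?\<phi> z \<in> F" using that by (auto simp: I_def X_def)
      obtain r where r: "r > 0" "\<forall>y\<in>ball (?\<phi> z) r. y \<in> T \<longleftrightarrow> omega_TF M F * ((y - ?\<phi> z) \<bullet> fnormal M F) < 0"
        using half_space_T[OF F] by blast
      have "y \<in> U \<longleftrightarrow> \<nu> F \<bullet> (y - z) < 0" if "y \<in> ball z r" for y
      proof -
        have "?\<phi> y \<in> ball (?\<phi> z) r" using that by (simp add: dist\<phi>)
        then show ?thesis using r(2) unfolding U_def \<nu>_inner sub[symmetric]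
          by (simp add: inner_commute)
      qed
      then show ?thesis using r(1) by blast
    qed
    show "frontier U \<subseteq> (\<Union>F\<in>I. X F) \<union> {x. snd x \<in> N}"
    proof
      fix z assume z: "z \<in> frontier U"
      then have "z \<notin> U" using \<open>open U\<close> by (simp add: frontier_def interior_open)
      moreover have "?\<phi> z \<in> closure T"
        using z closure_vimage_subset[OF cont\<phi>, of T] by (auto simp: U_def frontier_def)
      ultimately have "?\<phi> z \<in> frontier T" using T_props(3) by (simp add: U_def frontier_def interior_open)
      then obtain F where F: "F \<in> faces M" "?\<phi> z \<in> closure F" using front_T by blast
      consider "?\<phi> z \<in> F" | E where "E \<in> edges_of M F" "?\<phi> z \<in> closure E"
        using closure_F_cases[OF F] by blast
      then show "z \<in> (\<Union>F\<in>I. X F) \<union> {x. snd x \<in> N}"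
      proof cases
        case 1
        show ?thesis
        proof (cases "F \<in> I")
          case True
          then show ?thesis using 1 by (auto simp: X_def)
        next
          case False
          then have 0: "fnormal M F $ i = 0" using F(1) by (simp add: I_def)
          have "fnormal M F \<bullet> ?\<phi> z = fnormal M F \<bullet> face_origin F"
            using F_plane[OF F(1)] 1 by (auto simp: face_plane_def)
          then have "snd z \<in> H (fnormal M F) (fnormal M F \<bullet> face_origin F)" using Hmem[OF 0, of z] by simp
          then show ?thesis using False F(1) by (auto simp: N_def)
        qed
      next
        case (2 E)
        have E: "E \<in> edges M" using 2 edges_ofD by blast
        have "E \<subseteq> {x. m E \<bullet> x = m E \<bullet> face_origin E}"
        proof
          fix x assume "x \<in> E"
          then obtain s where "x = edge_map M E s" using edge_preimage(3)[OF E] by blast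
          then show "x \<in> {x. m E \<bullet> x = m E \<bullet> face_origin E}" using m[of E] by (simp add: edge_map_def inner_add_right)
        qed
        then have "closure E \<subseteq> {x. m E \<bullet> x = m E \<bullet> face_origin E}"
          by (rule closure_minimal) (rule closed_hyperplane)
        then have "m E \<bullet> ?\<phi> z = m E \<bullet> face_origin E" using 2 by blast
        then have "snd z \<in> H (m E) (m E \<bullet> face_origin E)" using Hmem[of "m E" z] m[of E] by (simp add: inner_axis)
        then show ?thesis using E by (auto simp: N_def)
      qed
    qed
    show "N \<in> null_sets lborel" unfolding N_def
    proof (intro null_sets.Un null_sets.finite_UN)
      show "finite (faces M - I)" "finite (edges M)" using fin_F fin_E by auto
      show "H (fnormal M F) (fnormal M F \<bullet> face_origin F) \<in> null_sets lborel" if "F \<in> faces M - I" for F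
        using that norm_n[of F] by (intro Hnull) (auto simp: I_def)
      show "H (m E) (m E \<bullet> face_origin E) \<in> null_sets lborel" if "E \<in> edges M" for E
        using m[of E] by (intro Hnull) (auto simp: inner_axis)
    qed
    show "((\<lambda>s. p (?\<phi> (s, y))) has_real_derivative pd i p (?\<phi> (s, y))) (at s)" for s y
    proof -
      define w where "w = ?\<phi> (0, y)"
      have "?\<phi> (s, y) = w + s *\<^sub>R axis i 1" for s by (simp add: w_def coord_map_def case_prod_unfold)
      then show ?thesis using polys_line_derivative[OF p, of w "axis i 1" s]
        by (simp add: inner_axis grad_comp)
    qed
    show "continuous_on UNIV (\<lambda>z. p (?\<phi> z))" "continuous_on UNIV (\<lambda>z. pd i p (?\<phi> z))"
      by (rule continuous_on_compose2[OF cp(1) cont\<phi> subset_UNIV] continuous_on_compose2[OF cp(2) cont\<phi> subset_UNIV])+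
  qed
  also have "\<dots> = (\<Sum>F\<in>I. omega_TF M F * (fnormal M F $ i * int_F M F p))"
  proof (rule sum.cong[OF refl])
    fix F assume FI: "F \<in> I"
    then have F: "F \<in> faces M" by (simp add: I_def)
    let ?a = "face_a M F" and ?b = "face_b M F" and ?o = "face_origin F"
    have "cross3 ?a ?b = fnormal M F"
      using face_frame[OF F] unfolding face_b_def by (simp add: Lagrange norm_eq_1)
    \<comment> \<open>The determinant of the substitution is a component of
      \<open>cross3 ?a ?b\<close>, with the right sign because \<open>(i, j, k)\<close> is in cyclic
      order.\<close>
    then have \<Delta>: "?a $ j * ?b $ k - ?b $ j * ?a $ k = fnormal M F $ i"
      using ijk cross3_comp[of ?a ?b] by (auto simp: mult.commute)
    have meas: "(\<lambda>y. indicator (snd ` X F) y * p (?\<phi> (g F y, y)) :: real) \<in> borel_measurable borel"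
      using opX[OF FI] by (intro borel_measurable_times borel_measurable_indicator borel_open
          borel_measurable_continuous_onI continuous_on_compose2[OF cp(1) contg]) auto
    have "(\<integral>y. indicator (snd ` X F) y * p (?\<phi> (g F y, y)) \<partial>lborel)
      = \<bar>fnormal M F $ i\<bar> * (\<integral>u. indicator (snd ` X F) (snd (pr (face_map M F u))) *
          p (?\<phi> (g F (snd (pr (face_map M F u))), snd (pr (face_map M F u)))) \<partial>lborel)"
      using integral_affine_plane[OF meas, of "?a $ j" "?b $ k" "?b $ j" "?a $ k" "?o $ j" "?o $ k"] \<Delta> FI
      by (simp add: I_def face_map_def pr_def algebra_simps)
    also have "(\<integral>u. indicator (snd ` X F) (snd (pr (face_map M F u))) *
          p (?\<phi> (g F (snd (pr (face_map M F u))), snd (pr (face_map M F u)))) \<partial>lborel)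
       = (\<integral>u. indicator (face_map M F -` F) u * p (face_map M F u) \<partial>lborel)"
    proof -
      have e: "?\<phi> (g F (snd (pr (face_map M F u))), snd (pr (face_map M F u))) = face_map M F u" for u
      proof -
        have "?\<phi> (pr (face_map M F u)) \<in> face_plane M F" unfolding \<phi>pr using range_face_map[OF F] by blast
        then show ?thesis using geq[OF FI, of "pr (face_map M F u)"] \<phi>pr by simp
      qed
      show ?thesis unfolding sndX[OF FI] e by (simp add: indicator_def e)
    qed
    also have "\<dots> = int_F M F p" by (rule flat_measure_face(2)[OF F cont_ext_on_polys[OF p], symmetric])
    finally show "sgn (fst (\<nu> F)) * (\<integral>y. indicator (snd ` X F) y * p (?\<phi> ((c F - snd (\<nu> F) \<bullet> y) / fst (\<nu> F), y)) \<partial>lborel)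
        = omega_TF M F * (fnormal M F $ i * int_F M F p)"
      using omega_TF_cases[of F] unfolding g_def[symmetric] unfolding fst\<nu> by (auto simp: sgn_mult abs_if sgn_if)
  qed
  also have "\<dots> = (\<Sum>F\<in>faces M. omega_TF M F * (fnormal M F $ i * int_F M F p))"
    by (rule sum.mono_neutral_left) (use fin_F in \<open>auto simp: I_def\<close>)
  also have "(\<integral>z. indicator U z * pd i p (?\<phi> z) \<partial>lborel) = int_T M (pd i p)"
  proof -
    have "int_T M (pd i p) = (\<integral>x. indicator T x * pd i p x \<partial>lborel)"
      by (rule flat_measure_cell(2)[OF cont_ext_on_polys[OF polys_pd[OF p]]])
    also have "\<dots> = (\<integral>x. indicator T x * pd i p x \<partial>distr lborel borel ?\<phi>)"
      by (simp only: lborel_coord_map[OF ne])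
    also have "\<dots> = (\<integral>z. indicator T (?\<phi> z) * pd i p (?\<phi> z) \<partial>lborel)"
      using T_props(3) by (intro integral_distr borel_measurable_times borel_measurable_indicator borel_open
          borel_measurable_continuous_onI cp cont\<phi>) (auto intro: borel_measurable_continuous_onI cont\<phi>)
    finally show ?thesis by (simp add: U_def indicator_def)
  qed
  finally show ?thesis .
qed

lemma int_T_pd:
  "p \<in> polys l \<Longrightarrow> int_T M (pd i p) = (\<Sum>F\<in>faces M. omega_TF M F * (fnormal M F $ i * int_F M F p))"
  using int_T_pd_axis[of 1 2 3] int_T_pd_axis[of 2 3 1] int_T_pd_axis[of 3 1 2] exhaust_3[of i] by auto

lemma divergence_theorem:
  assumes v: "v \<in> vpolys l"
  shows "int_T M (dvg v) = (\<Sum>F\<in>faces M. omega_TF M F * int_F M F (\<lambda>x. v x \<bullet> fnormal M F))"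
proof -
  note vc = vpolys_comp[OF v]
  interpret T: flat_measure "vol_measure M" T by (rule flat_measure_cell)
  have ce: "cont_ext_on T (pd i (\<lambda>x. v x $ i))" for i by (rule cont_ext_on_polys[OF polys_pd[OF vc]])
  have "int_T M (dvg v) = (\<integral>x. (\<Sum>i\<in>UNIV. pd i (\<lambda>x. v x $ i) x) \<partial>vol_measure M)"
    unfolding int_T_def by (intro Bochner_Integration.integral_cong) (simp_all add: dvg_eq[OF v])
  also have "\<dots> = (\<Sum>i\<in>UNIV. int_T M (pd i (\<lambda>x. v x $ i)))"
    unfolding int_T_def using T.integrable_cont[OF ce] by (intro Bochner_Integration.integral_sum) auto
  also have "\<dots> = (\<Sum>i\<in>UNIV. \<Sum>F\<in>faces M. omega_TF M F * (fnormal M F $ i * int_F M F (\<lambda>x. v x $ i)))"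
    by (simp add: int_T_pd[OF vc])
  also have "\<dots> = (\<Sum>F\<in>faces M. \<Sum>i\<in>UNIV. omega_TF M F * (fnormal M F $ i * int_F M F (\<lambda>x. v x $ i)))"
    by (rule sum.swap)
  also have "\<dots> = (\<Sum>F\<in>faces M. omega_TF M F * int_F M F (\<lambda>x. v x \<bullet> fnormal M F))"
  proof (rule sum.cong[OF refl])
    fix F assume F: "F \<in> faces M"
    interpret F: flat_measure "area_measure M F" F by (rule flat_measure_face[OF F])
    have "integrable (area_measure M F) (\<lambda>x. v x $ i * fnormal M F $ i)" for i
      by (intro F.integrable_cont cont_ext_on_polys[OF polys_multc[OF vc]])
    then have "int_F M F (\<lambda>x. v x \<bullet> fnormal M F) = (\<Sum>i\<in>UNIV. \<integral>x. v x $ i * fnormal M F $ i \<partial>area_measure M F)"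
      unfolding int_F_def inner_vec_def inner_real_def by (intro Bochner_Integration.integral_sum) auto
    then show "(\<Sum>i\<in>UNIV. omega_TF M F * (fnormal M F $ i * int_F M F (\<lambda>x. v x $ i)))
        = omega_TF M F * int_F M F (\<lambda>x. v x \<bullet> fnormal M F)"
      by (simp add: int_F_def sum_distrib_left mult.commute)
  qed
  finally show ?thesis .
qed

text \<open>Planar counterpart of the argument for the cell, with lines in direction
  \<open>p\<close> and second coordinate along \<open>q\<close>. \<open>tq\<close> identifies the
  Jacobian of projecting an edge to the \<open>q\<close>-axis with the size of its normal component
  along \<open>p\<close>; taken as a hypothesis, it lets the lemma serve for both orders of the face
  frame.\<close>

lemma face_flux_direction:
  assumes F: "F \<in> faces M" and f: "f \<in> polys l"
    and pq: "norm p = 1" "norm q = 1" "p \<bullet> q = 0" "p \<bullet> fnormal M F = 0" "q \<bullet> fnormal M F = 0"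
    and ex: "\<And>v. v \<bullet> fnormal M F = 0 \<Longrightarrow> v = (v \<bullet> p) *\<^sub>R p + (v \<bullet> q) *\<^sub>R q"
    and tq: "\<And>E. E \<in> edges_of M F \<Longrightarrow> \<bar>normal_FE M F E \<bullet> p\<bar> = \<bar>etangent M E \<bullet> q\<bar>"
  defines "\<psi> \<equiv> \<lambda>z. face_origin F + fst z *\<^sub>R p + snd z *\<^sub>R q"
  shows "(\<integral>z. indicator (\<psi> -` F) z * (grad f (\<psi> z) \<bullet> p) \<partial>lborel)
    = (\<Sum>E\<in>edges_of M F. omega_FE M F E * ((normal_FE M F E \<bullet> p) * int_E M E f))"
proof -
  let ?o = "face_origin F"
  have pp: "p \<bullet> p = 1" "q \<bullet> q = 1" "q \<bullet> p = 0" using pq by (auto simp: dot_square_norm inner_commute)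
  define pr where "pr x = ((x - ?o) \<bullet> p, (x - ?o) \<bullet> q)" for x
  have \<psi>plane: "\<psi> z \<in> face_plane M F" for z
    using pq by (simp add: \<psi>_def face_plane_iff inner_add_left)
  have \<psi>pr: "\<psi> (pr x) = x" if "x \<in> face_plane M F" for x
  proof -
    have "(x - ?o) \<bullet> fnormal M F = 0" using that by (simp only: face_plane_iff)
    from ex[OF this] have "((x - ?o) \<bullet> p) *\<^sub>R p + ((x - ?o) \<bullet> q) *\<^sub>R q = x - ?o" by (rule sym)
    then show ?thesis unfolding \<psi>_def pr_def fst_conv snd_conv add.assoc by simp
  qed
  have pr\<psi>: "pr (\<psi> z) = z" for z
    using pp pq(3) by (simp add: pr_def \<psi>_def inner_add_left)
  have \<psi>sub: "\<psi> z - \<psi> w = (fst z - fst w) *\<^sub>R p + (snd z - snd w) *\<^sub>R q" for z w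
    by (simp add: \<psi>_def algebra_simps)
  have dist\<psi>: "dist (\<psi> z) (\<psi> w) = dist z w" for z w
    unfolding dist_norm \<psi>sub norm_orthonormal_comb[OF pq(1-3)] by (simp add: norm_prod_def)
  have cont\<psi>: "continuous_on S \<psi>" for S unfolding \<psi>_def by (intro continuous_intros)
  have bvim: "bounded (\<psi> -` S)" if S: "bounded S" for S
  proof -
    obtain B where B: "\<forall>y\<in>S. dist ?o y \<le> B" using S bounded_any_center by blast
    have "dist 0 z \<le> B" if "z \<in> \<psi> -` S" for z
    proof -
      have "dist 0 z = dist (\<psi> 0) (\<psi> z)" by (rule dist\<psi>[symmetric])
      also have "\<psi> 0 = ?o" by (simp add: \<psi>_def)
      finally show ?thesis using B that by simp
    qed
    then show ?thesis unfolding bounded_def by blast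
  qed
  have contf: "continuous_on S f" "continuous_on S (\<lambda>x. grad f x \<bullet> p)" for S
    using polys_continuous_on[OF f] polys_continuous_on[OF vpolys_inner_const[OF grad_vpolys[OF f]]] by auto
  define n where "n E = normal_FE M F E" for E
  define I where "I = {E \<in> edges_of M F. n E \<bullet> p \<noteq> 0}"
  define \<nu> where "\<nu> E = omega_FE M F E *\<^sub>R (n E \<bullet> p, n E \<bullet> q)" for E
  define c where "c E = omega_FE M F E * (n E \<bullet> (face_origin E - ?o))" for E
  define X where "X E = \<psi> -` E" for E
  define U where "U = \<psi> -` F"
  \<comment> \<open>All points of an edge parallel to \<open>p\<close> share the second coordinate
    of its origin. Adding the coordinates of all end points still leaves only finitely many lines to
    avoid.\<close>
  define N where "N = (\<lambda>x. (x - ?o) \<bullet> q) ` (face_origin ` edges_of M F \<union> (\<Union>E\<in>edges_of M F. closure E - E))"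
  have finE: "finite (edges_of M F)" using fin_E by (simp add: edges_of_def)
  have fin_ends: "finite (closure E - E)" if E: "E \<in> edges_of M F" for E
  proof -
    obtain a b where ab: "a \<noteq> b" "E = open_segment a b" using edge_ends[OF edges_ofD(1)[OF E]] by blast
    then have "closure E = closed_segment a b" by simp
    then have "closure E - E \<subseteq> {a, b}" unfolding ab(2) open_segment_def by blast
    then show ?thesis using finite_subset by blast
  qed
  have ed: "E \<in> edges M" "n E \<bullet> fnormal M F = 0" "n E \<bullet> etangent M E = 0" "E \<subseteq> face_plane M F"
    "edge_map M E s \<in> face_plane M F" if E: "E \<in> edges_of M F" for E s
  proof -
    show "E \<in> edges M" "n E \<bullet> fnormal M F = 0" "n E \<bullet> etangent M E = 0" "E \<subseteq> face_plane M F"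
      using edges_ofD(1)[OF E] norm_normal_FE[OF F E] edge_in_plane[OF F E] by (auto simp: n_def)
    obtain l r where lr: "l < 0" "0 < r" "\<forall>s. edge_map M E s \<in> E \<longleftrightarrow> l < s \<and> s < r"
      using edge_line(3)[OF edges_ofD(1)[OF E]] by (elim exE conjE) (rule that)
    then have "edge_map M E 0 \<in> E" by blast
    then have "face_origin E \<in> face_plane M F" using edge_in_plane(1)[OF F E] by (auto simp: edge_map_def)
    then show "edge_map M E s \<in> face_plane M F"
      using edge_in_plane(2)[OF F E] by (simp add: face_plane_def edge_map_def inner_add_right inner_commute)
  qed
  have \<nu>_inner: "\<nu> E \<bullet> z = omega_FE M F E * (n E \<bullet> (\<psi> z - ?o))" for E z
    by (simp add: \<nu>_def \<psi>_def inner_prod_def inner_add_right algebra_simps)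
  have fst\<nu>: "fst (\<nu> E) = omega_FE M F E * (n E \<bullet> p)" for E by (simp add: \<nu>_def)
  have \<nu>0: "fst (\<nu> E) \<noteq> 0" if "E \<in> I" for E
    using that omega_FE_cases[of F E] by (auto simp: fst\<nu> I_def)
  define g where "g E y = (c E - snd (\<nu> E) \<bullet> y) / fst (\<nu> E)" for E y
  have edge_line_eq: "\<nu> E \<bullet> pr (edge_map M E s) = c E" if "E \<in> edges_of M F" for E s
    unfolding \<nu>_inner c_def \<psi>pr[OF ed(5)[OF that]] using ed(3)[OF that]
    by (simp add: edge_map_def inner_add_right inner_diff_right)
  have gE: "\<psi> (g E (snd (pr (edge_map M E s))), snd (pr (edge_map M E s))) = edge_map M E s"
    if E: "E \<in> I" for E s
  proof -
    let ?z = "pr (edge_map M E s)"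
    have E': "E \<in> edges_of M F" using E by (simp add: I_def)
    have "fst (\<nu> E) * fst ?z + snd (\<nu> E) * snd ?z = c E"
      using edge_line_eq[OF E', of s] by (simp add: inner_prod_def)
    then have "c E - snd (\<nu> E) \<bullet> snd ?z = fst (\<nu> E) * fst ?z" by simp
    then have "g E (snd ?z) = fst ?z" unfolding g_def using \<nu>0[OF E] by simp
    then show ?thesis using \<psi>pr[OF ed(5)[OF E', of s]] by simp
  qed
  define \<kappa> where "\<kappa> E = etangent M E \<bullet> q" for E
  define y0 where "y0 E = (face_origin E - ?o) \<bullet> q" for E
  have snd_pr: "snd (pr (edge_map M E s)) = y0 E + \<kappa> E * s" for E s
    by (simp add: pr_def edge_map_def y0_def \<kappa>_def inner_diff_left inner_add_left)
  have \<kappa>0: "\<kappa> E \<noteq> 0" if "E \<in> I" for E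
    using that tq[of E] by (auto simp: I_def \<kappa>_def n_def)
  have sndX: "y0 E + \<kappa> E * s \<in> snd ` X E \<longleftrightarrow> edge_map M E s \<in> E" if E: "E \<in> I" for E s
  proof
    have E': "E \<in> edges_of M F" using E by (simp add: I_def)
    show "edge_map M E s \<in> E" if y: "y0 E + \<kappa> E * s \<in> snd ` X E"
    proof -
      obtain z where z: "snd z = y0 E + \<kappa> E * s" "\<psi> z \<in> E" using y by (auto simp: X_def)
      then obtain s' where s': "\<psi> z = edge_map M E s'" using edge_preimage(3)[OF ed(1)[OF E']] by blast
      then have "snd z = y0 E + \<kappa> E * s'" using pr\<psi>[of z] snd_pr[of E s'] by simp
      then have "s = s'" using z(1) \<kappa>0[OF E] by simp
      then show ?thesis using s' z(2) by simp
    qed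
    show "y0 E + \<kappa> E * s \<in> snd ` X E" if "edge_map M E s \<in> E"
      unfolding snd_pr[symmetric] using that \<psi>pr[OF ed(5)[OF E', of s]] by (auto simp: X_def)
  qed
  have sndX': "snd ` X E = (\<lambda>y. (y - y0 E) / \<kappa> E) -` (edge_map M E -` E)" if E: "E \<in> I" for E
  proof (rule set_eqI)
    fix y
    have "y = y0 E + \<kappa> E * ((y - y0 E) / \<kappa> E)" using \<kappa>0[OF E] by simp
    then show "y \<in> snd ` X E \<longleftrightarrow> y \<in> (\<lambda>y. (y - y0 E) / \<kappa> E) -` (edge_map M E -` E)"
      using sndX[OF E, of "(y - y0 E) / \<kappa> E"] by simp
  qed
  have opX: "open (snd ` X E)" if "E \<in> I" for E
  proof -
    have "open (edge_map M E -` E)" using that by (intro edge_preimage(1) ed(1)) (simp add: I_def)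
    moreover have "continuous_on UNIV (\<lambda>y. (y - y0 E) / \<kappa> E)"
      unfolding divide_inverse by (intro continuous_intros)
    ultimately show ?thesis unfolding sndX'[OF that] by (rule open_vimage)
  qed
  have contg: "continuous_on UNIV (\<lambda>y. \<psi> (g E y, y))" for E
    by (rule continuous_on_compose2[OF cont\<psi>[of UNIV]])
      (auto intro!: continuous_intros simp: g_def divide_inverse)
  have "(\<integral>z. indicator U z * (grad f (\<psi> z) \<bullet> p) \<partial>lborel)
      = (\<Sum>E\<in>I. sgn (fst (\<nu> E)) * (\<integral>y. indicator (snd ` X E) y * f (\<psi> ((c E - snd (\<nu> E) \<bullet> y) / fst (\<nu> E), y)) \<partial>lborel))"
  proof (rule flux_fst_direction[where N = N and f = "\<lambda>z. f (\<psi> z)"])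
    obtain W where W: "open W" "F = W \<inter> face_plane M F" using F_props(7)[OF F] by blast
    then have "U = \<psi> -` W" using \<psi>plane unfolding U_def by blast
    then show opU: "open U" using open_vimage[OF W(1) cont\<psi>] by simp
    show "bounded U" unfolding U_def by (rule bvim[OF F_props(3)[OF F]])
    show "finite I" using finE by (simp add: I_def)
    show "fst (\<nu> E) \<noteq> 0" if "E \<in> I" for E using that by (rule \<nu>0)
    show "\<nu> E \<bullet> z = c E" if EI: "E \<in> I" and z: "z \<in> X E" for E z
    proof -
      have E': "E \<in> edges_of M F" using EI by (simp add: I_def)
      have "\<psi> z \<in> E" using z by (simp add: X_def)
      then obtain s where "\<psi> z = edge_map M E s" using edge_preimage(3)[OF ed(1)[OF E']] by blast
      then show ?thesis using edge_line_eq[OF E', of s] pr\<psi>[of z] by simp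
    qed
    show "X E \<inter> X E' = {}" if "E \<in> I" "E' \<in> I" "E \<noteq> E'" for E E'
      using disj_E that edges_ofD(1) unfolding X_def I_def pairwise_def disjnt_def by blast
    show "snd ` X E \<in> sets borel" if "E \<in> I" for E using opX[OF that] by simp
    show "bounded (X E)" if E: "E \<in> I" for E
    proof -
      have "E \<in> edges_of M F" using E by (simp add: I_def)
      then obtain a b where "E = open_segment a b" using edge_ends[OF ed(1)] by blast
      then have "bounded E" by (simp add: bounded_open_segment)
      then show ?thesis unfolding X_def by (rule bvim)
    qed
    show "\<exists>r>0. \<forall>y\<in>ball z r. y \<in> U \<longleftrightarrow> \<nu> E \<bullet> (y - z) < 0" if "E \<in> I" "z \<in> X E" for E z
    proof -
      have E: "E \<in> edges_of M F" "\<psi> z \<in> E" using that by (auto simp: I_def X_def)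
      obtain r where r: "r > 0" "\<forall>y\<in>ball (\<psi> z) r \<inter> face_plane M F.
          y \<in> F \<longleftrightarrow> omega_FE M F E * ((y - \<psi> z) \<bullet> normal_FE M F E) < 0"
        using half_space_F[OF F E] by blast
      have "y \<in> U \<longleftrightarrow> \<nu> E \<bullet> (y - z) < 0" if y: "y \<in> ball z r" for y
      proof -
        have "\<psi> y \<in> ball (\<psi> z) r \<inter> face_plane M F" using y \<psi>plane by (simp add: dist\<psi>)
        moreover have "\<nu> E \<bullet> (y - z) = omega_FE M F E * ((\<psi> y - \<psi> z) \<bullet> normal_FE M F E)"
          unfolding inner_diff_right \<nu>_inner inner_diff_left n_def[symmetric]
          by (simp add: inner_commute algebra_simps)
        ultimately show ?thesis using r(2) unfolding U_def by auto
      qed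
      then show ?thesis using r(1) by blast
    qed
    show "frontier U \<subseteq> (\<Union>E\<in>I. X E) \<union> {x. snd x \<in> N}"
    proof
      fix z assume z: "z \<in> frontier U"
      then have "z \<notin> U" using opU by (simp add: frontier_def interior_open)
      moreover have "\<psi> z \<in> closure F"
        using z closure_vimage_subset[OF cont\<psi>, of F] by (auto simp: U_def frontier_def)
      ultimately obtain E where E: "E \<in> edges_of M F" "\<psi> z \<in> closure E"
        using closure_F_cases[OF F, of "\<psi> z"] by (auto simp: U_def)
      have sz: "snd z = (\<psi> z - ?o) \<bullet> q" using arg_cong[OF pr\<psi>[of z], of snd] by (simp add: pr_def)
      show "z \<in> (\<Union>E\<in>I. X E) \<union> {x. snd x \<in> N}"
      proof (cases "\<psi> z \<in> E")
        case False
        then show ?thesis using E sz by (auto simp: N_def)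
      next
        case True
        show ?thesis
        proof (cases "E \<in> I")
          case True
          then show ?thesis using \<open>\<psi> z \<in> E\<close> by (auto simp: X_def)
        next
          case False
          then have "\<kappa> E = 0" using E tq[of E] by (auto simp: I_def \<kappa>_def n_def)
          obtain s where "\<psi> z = edge_map M E s" using edge_preimage(3)[OF ed(1)[OF E(1)]] True by blast
          then have "snd z = y0 E" using snd_pr[of E s] pr\<psi>[of z] \<open>\<kappa> E = 0\<close> by simp
          then show ?thesis using E by (auto simp: N_def y0_def)
        qed
      qed
    qed
    have "finite N" unfolding N_def using finE fin_ends by auto
    then show "N \<in> null_sets lborel" by (rule finite_imp_null_set_lborel)
    show "((\<lambda>s. f (\<psi> (s, y))) has_real_derivative grad f (\<psi> (s, y)) \<bullet> p) (at s)" for s y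
    proof -
      define w where "w = \<psi> (0, y)"
      have "\<psi> (s, y) = w + s *\<^sub>R p" for s by (simp add: w_def \<psi>_def)
      then show ?thesis using polys_line_derivative[OF f, of w p s] by simp
    qed
    show "continuous_on UNIV (\<lambda>z. f (\<psi> z))" by (rule continuous_on_compose2[OF contf(1) cont\<psi> subset_UNIV])
    show "continuous_on UNIV (\<lambda>z. grad f (\<psi> z) \<bullet> p)" by (rule continuous_on_compose2[OF contf(2) cont\<psi> subset_UNIV])
  qed
  also have "\<dots> = (\<Sum>E\<in>I. omega_FE M F E * ((n E \<bullet> p) * int_E M E f))"
  proof (rule sum.cong[OF refl])
    fix E assume E: "E \<in> I"
    then have E': "E \<in> edges_of M F" by (simp add: I_def)
    have "(\<integral>y. indicator (snd ` X E) y * f (\<psi> (g E y, y)) \<partial>lborel)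
        = \<bar>\<kappa> E\<bar> *\<^sub>R (\<integral>s. indicator (snd ` X E) (y0 E + \<kappa> E * s) * f (\<psi> (g E (y0 E + \<kappa> E * s), y0 E + \<kappa> E * s)) \<partial>lborel)"
      by (rule lborel_integral_real_affine[OF \<kappa>0[OF E]])
    also have "(\<integral>s. indicator (snd ` X E) (y0 E + \<kappa> E * s) * f (\<psi> (g E (y0 E + \<kappa> E * s), y0 E + \<kappa> E * s)) \<partial>lborel)
        = (\<integral>s. indicator (edge_map M E -` E) s * f (edge_map M E s) \<partial>lborel)"
      using gE[OF E] sndX[OF E] unfolding snd_pr by (simp add: indicator_def)
    also have "\<dots> = int_E M E f"
      by (rule flat_measure_edge(2)[OF ed(1)[OF E'] cont_ext_on_polys[OF f], symmetric])
    finally show "sgn (fst (\<nu> E)) * (\<integral>y. indicator (snd ` X E) y * f (\<psi> ((c E - snd (\<nu> E) \<bullet> y) / fst (\<nu> E), y)) \<partial>lborel)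
        = omega_FE M F E * ((n E \<bullet> p) * int_E M E f)"
      using omega_FE_cases[of F E] tq[OF E'] unfolding g_def[symmetric] unfolding fst\<nu> \<kappa>_def n_def
      by (auto simp: sgn_mult abs_if sgn_if split: if_splits)
  qed
  also have "\<dots> = (\<Sum>E\<in>edges_of M F. omega_FE M F E * ((n E \<bullet> p) * int_E M E f))"
    by (rule sum.mono_neutral_left) (use finE in \<open>auto simp: I_def\<close>)
  finally show ?thesis unfolding U_def n_def .
qed

text \<open>As \<open>fnormal M F\<close> is \<open>cross3 ?a ?b\<close>, this is the planar rotor
  of the tangential components in the frame of the face. Each of its two terms is a directional
  derivative of the kind \<open>face_flux_direction\<close> integrates.\<close>

lemma curl_normal_component:
  assumes F: "F \<in> faces M" and v: "v \<in> vpolys l"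
  shows "curl v x \<bullet> fnormal M F
    = grad (\<lambda>x. v x \<bullet> face_b M F) x \<bullet> face_a M F - grad (\<lambda>x. v x \<bullet> face_a M F) x \<bullet> face_b M F"
proof -
  let ?a = "face_a M F" and ?b = "face_b M F"
  have n: "fnormal M F = cross3 ?a ?b"
    using face_frame[OF F] unfolding face_b_def by (simp add: Lagrange norm_eq_1)
  have pd: "pd i (\<lambda>x. v x \<bullet> w) x = (\<Sum>j\<in>UNIV. w $ j * pd i (\<lambda>x. v x $ j) x)" for i and w :: pt
  proof -
    have "(\<lambda>x. v x \<bullet> w) = (\<lambda>x. \<Sum>j\<in>UNIV. w $ j * v x $ j)" by (simp add: inner_vec_def mult.commute)
    then show ?thesis
      by (simp add: pd_sum pd_cmult differentiable_mult polys_differentiable[OF vpolys_comp[OF v]])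
  qed
  have ip: "y \<bullet> u = (\<Sum>i\<in>UNIV. y $ i * u $ i)" for y u :: pt by (simp add: inner_vec_def)
  have g: "grad (\<lambda>x. v x \<bullet> w) x \<bullet> u = (\<Sum>i\<in>UNIV. (\<Sum>j\<in>UNIV. w $ j * pd i (\<lambda>x. v x $ j) x) * u $ i)"
    for w u :: pt
    unfolding ip[of "grad (\<lambda>x. v x \<bullet> w) x" u] grad_comp pd ..
  show ?thesis
    unfolding n g ip[of "curl v x"] sum_3 curl_comp[OF v] cross3_comp
    by (simp add: algebra_simps)
qed

text \<open>The minus sign stems from the convention for \<open>omega_FE\<close>, which is 1 where
  the tangent runs against the counter-clockwise orientation. The two terms of the planar rotor are
  integrated with the frame in its two orders, and their edge contributions combine to the
  tangential component.\<close>

lemma stokes_face: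
  assumes F: "F \<in> faces M" and v: "v \<in> vpolys l"
  shows "int_F M F (\<lambda>x. curl v x \<bullet> fnormal M F)
    = - (\<Sum>E\<in>edges_of M F. omega_FE M F E * int_E M E (\<lambda>x. v x \<bullet> etangent M E))"
proof -
  let ?a = "face_a M F" and ?b = "face_b M F" and ?n = "fnormal M F"
  note fr = face_frame[OF F]
  have va: "(\<lambda>x. v x \<bullet> w) \<in> polys l" for w by (rule vpolys_inner_const[OF v])
  have ex: "u = (u \<bullet> ?a) *\<^sub>R ?a + (u \<bullet> ?b) *\<^sub>R ?b" if "u \<bullet> ?n = 0" for u
    by (rule face_expansion[OF F that])
  have t: "etangent M E \<bullet> ?n = 0" if "E \<in> edges_of M F" for E by (rule edge_in_plane(2)[OF F that])
  have nt: "normal_FE M F E \<bullet> ?a = - (etangent M E \<bullet> ?b)" "normal_FE M F E \<bullet> ?b = etangent M E \<bullet> ?a"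
    if "E \<in> edges_of M F" for E
  proof -
    have nn: "?n \<bullet> ?n = 1" using norm_n[OF F] by (simp add: norm_eq_1)
    show "normal_FE M F E \<bullet> ?b = etangent M E \<bullet> ?a"
      unfolding normal_FE_def face_b_def dot_cross using nn fr(2) by (simp add: inner_commute)
    show "normal_FE M F E \<bullet> ?a = - (etangent M E \<bullet> ?b)"
      unfolding normal_FE_def face_b_def by (simp add: cross3_def inner_vec_def sum_3 algebra_simps)
  qed
  let ?f = "\<lambda>x. grad (\<lambda>x. v x \<bullet> ?b) x \<bullet> ?a" and ?g = "\<lambda>x. grad (\<lambda>x. v x \<bullet> ?a) x \<bullet> ?b"
  have fg: "?f \<in> polys (l - 1)" "?g \<in> polys (l - 1)"
    by (intro vpolys_inner_const grad_vpolys va)+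
  interpret F: flat_measure "area_measure M F" F by (rule flat_measure_face[OF F])
  have "int_F M F (\<lambda>x. curl v x \<bullet> ?n) = int_F M F ?f - int_F M F ?g"
    unfolding int_F_def curl_normal_component[OF F v]
    by (rule F.integral_diff) (intro cont_ext_on_polys[OF fg(1)] cont_ext_on_polys[OF fg(2)])+
  also have "int_F M F ?f = (\<Sum>E\<in>edges_of M F. omega_FE M F E * ((normal_FE M F E \<bullet> ?a) * int_E M E (\<lambda>x. v x \<bullet> ?b)))"
  proof -
    have "int_F M F ?f = (\<integral>z. indicator (face_map M F -` F) z * ?f (face_map M F z) \<partial>lborel)"
      by (rule flat_measure_face(2)[OF F cont_ext_on_polys[OF fg(1)]])
    also have "\<dots> = (\<Sum>E\<in>edges_of M F. omega_FE M F E * ((normal_FE M F E \<bullet> ?a) * int_E M E (\<lambda>x. v x \<bullet> ?b)))"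
      unfolding face_map_def[abs_def]
      by (rule face_flux_direction[OF F va fr(1,3,5,2,4) ex]) (simp_all add: nt)
    finally show ?thesis .
  qed
  also have "int_F M F ?g = (\<Sum>E\<in>edges_of M F. omega_FE M F E * ((normal_FE M F E \<bullet> ?b) * int_E M E (\<lambda>x. v x \<bullet> ?a)))"
  proof -
    let ?\<psi> = "\<lambda>z. face_origin F + fst z *\<^sub>R ?b + snd z *\<^sub>R ?a"
    have sw: "face_map M F (snd z, fst z) = ?\<psi> z" for z by (simp add: face_map_def algebra_simps)
    have c: "continuous_on UNIV (\<lambda>z. ?g (face_map M F z))"
      by (rule continuous_on_compose2[OF polys_continuous_on[OF fg(2)] continuous_face_map subset_UNIV])
    have "int_F M F ?g = (\<integral>z. indicator (face_map M F -` F) z * ?g (face_map M F z) \<partial>lborel)"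
      by (rule flat_measure_face(2)[OF F cont_ext_on_polys[OF fg(2)]])
    \<comment> \<open>Exchanging the two coordinates preserves area and turns the face chart into
      the one for the frame \<open>(?b, ?a)\<close>.\<close>
    also have "\<dots> = (\<integral>z. indicator (?\<psi> -` F) z * ?g (?\<psi> z) \<partial>lborel)"
    proof -
      have "(\<lambda>z. indicator (face_map M F -` F) z * ?g (face_map M F z)) \<in> borel_measurable borel"
        using face_preimage(1)[OF F] c
        by (intro borel_measurable_times borel_measurable_indicator borel_open borel_measurable_continuous_onI)
      from integral_affine_plane[OF this, of 0 0 1 1 0 0]
      show ?thesis by (simp add: sw indicator_def)
    qed
    also have "\<dots> = (\<Sum>E\<in>edges_of M F. omega_FE M F E * ((normal_FE M F E \<bullet> ?b) * int_E M E (\<lambda>x. v x \<bullet> ?a)))"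
    proof (rule face_flux_direction[OF F va fr(3,1) _ fr(4,2)])
      show "?b \<bullet> ?a = 0" using fr(5) by (simp add: inner_commute)
      show "u = (u \<bullet> ?b) *\<^sub>R ?b + (u \<bullet> ?a) *\<^sub>R ?a" if "u \<bullet> ?n = 0" for u
        using ex[OF that] by (simp add: add.commute)
    qed (simp add: nt)
    finally show ?thesis .
  qed
  finally have "int_F M F (\<lambda>x. curl v x \<bullet> ?n) = (\<Sum>E\<in>edges_of M F.
      omega_FE M F E * ((normal_FE M F E \<bullet> ?a) * int_E M E (\<lambda>x. v x \<bullet> ?b))
      - omega_FE M F E * ((normal_FE M F E \<bullet> ?b) * int_E M E (\<lambda>x. v x \<bullet> ?a)))"
    by (simp add: sum_subtractf)
  also have "\<dots> = (\<Sum>E\<in>edges_of M F. - (omega_FE M F E * int_E M E (\<lambda>x. v x \<bullet> etangent M E)))"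
  proof (rule sum.cong[OF refl])
    fix E assume E: "E \<in> edges_of M F"
    let ?t = "etangent M E"
    interpret E: flat_measure "length_measure M E" E by (rule flat_measure_edge[OF edges_ofD(1)[OF E]])
    have ce: "cont_ext_on E (\<lambda>x. v x \<bullet> w)" for w by (rule cont_ext_on_polys[OF va])
    have "v x \<bullet> ?t = (?t \<bullet> ?a) * (v x \<bullet> ?a) + (?t \<bullet> ?b) * (v x \<bullet> ?b)" for x
      by (subst ex[OF t[OF E]]) (simp add: inner_add_right)
    then have "int_E M E (\<lambda>x. v x \<bullet> ?t)
        = (?t \<bullet> ?a) * int_E M E (\<lambda>x. v x \<bullet> ?a) + (?t \<bullet> ?b) * int_E M E (\<lambda>x. v x \<bullet> ?b)"
      unfolding int_E_def
      by (simp add: E.integral_add cont_ext_on_mult cont_ext_on_const ce)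
    then show "omega_FE M F E * ((normal_FE M F E \<bullet> ?a) * int_E M E (\<lambda>x. v x \<bullet> ?b))
      - omega_FE M F E * ((normal_FE M F E \<bullet> ?b) * int_E M E (\<lambda>x. v x \<bullet> ?a))
      = - (omega_FE M F E * int_E M E (\<lambda>x. v x \<bullet> ?t))"
      unfolding nt[OF E] by (simp add: algebra_simps)
  qed
  finally show ?thesis by (simp add: sum_negf)
qed

end

section \<open>Reconstruction operators on the faces\<close>

context flat_measure
begin

lemma lin_on_integral_left:
  fixes L :: "'q::real_vector \<Rightarrow> pt \<Rightarrow> 'b::real_inner"
  assumes "lin_on Q L" "\<And>q. q \<in> Q \<Longrightarrow> cont_ext_on X (L q)" "cont_ext_on X h"
  shows "lin_on Q (\<lambda>q. \<integral>x. L q x \<bullet> h x \<partial>\<mu>)"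
  by (rule lin_onI) (simp add: lin_onD[OF assms(1)] plus_fun_def scaleR_fun_def integral_inner_lin assms)

lemma lin_on_integral_right:
  fixes L :: "'q::real_vector \<Rightarrow> pt \<Rightarrow> 'b::real_inner"
  assumes "lin_on Q L" "\<And>q. q \<in> Q \<Longrightarrow> cont_ext_on X (L q)" "cont_ext_on X h"
  shows "lin_on Q (\<lambda>q. \<integral>x. h x \<bullet> L q x \<partial>\<mu>)"
  using lin_on_integral_left[OF assms] by (simp add: inner_commute)

lemma lin_on_integral_mult_left:
  assumes "lin_on Q L" "\<And>q. q \<in> Q \<Longrightarrow> cont_ext_on X (L q)" "cont_ext_on X h"
  shows "lin_on Q (\<lambda>q. \<integral>x. L q x * h x \<partial>\<mu> :: real)"
  using lin_on_integral_left[OF assms] by simp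

lemma lin_on_integral_mult_right:
  assumes "lin_on Q L" "\<And>q. q \<in> Q \<Longrightarrow> cont_ext_on X (L q)" "cont_ext_on X h"
  shows "lin_on Q (\<lambda>q. \<integral>x. h x * L q x \<partial>\<mu> :: real)"
  using lin_on_integral_right[OF assms] by simp

lemma lin_on_integral:
  assumes "lin_on Q L" "\<And>q. q \<in> Q \<Longrightarrow> cont_ext_on X (L q)"
  shows "lin_on Q (\<lambda>q. \<integral>x. L q x \<partial>\<mu> :: real)"
  using lin_on_integral_mult_left[OF assms, of "\<lambda>x. 1"] by (simp add: cont_ext_on_const)

lemma integral_one_pos: "X \<noteq> {} \<Longrightarrow> 0 < (\<integral>x. 1 \<partial>\<mu> :: real)"
  using integral_nonneg_eq_0[of "\<lambda>x. 1"] integral_nonneg[of "\<lambda>x. 1"] cont_ext_on_const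
  by (metis all_not_in_conv less_eq_real_def zero_le_one zero_neq_one)

end

context l2_space
begin

text \<open>It suffices that for each fixed test the right-hand side is linear in the datum.\<close>

lemma lin_on_reconstruction:
  assumes Q: "subspace Q" and ex1: "\<And>q. q \<in> Q \<Longrightarrow> \<exists>!p. p \<in> S \<and> (\<forall>a\<in>A. ip p (\<tau> a) = \<Phi> q a)"
    and \<tau>: "\<tau> ` A \<subseteq> S" and lin: "\<And>a. a \<in> A \<Longrightarrow> lin_on Q (\<lambda>q. \<Phi> q a)"
  shows "lin_on Q (\<lambda>q. THE p. p \<in> S \<and> (\<forall>a\<in>A. ip p (\<tau> a) = (\<Phi> q a :: real)))"
proof (rule lin_on_the[OF Q ex1])
  fix q r p s a b
  assume *: "q \<in> Q" "r \<in> Q" "p \<in> S \<and> (\<forall>a\<in>A. ip p (\<tau> a) = \<Phi> q a)" "s \<in> S \<and> (\<forall>a\<in>A. ip s (\<tau> a) = \<Phi> r a)"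
  have "ip (a *\<^sub>R p + b *\<^sub>R s) (\<tau> v) = \<Phi> (a *\<^sub>R q + b *\<^sub>R r) v" if v: "v \<in> A" for v
  proof -
    have "\<tau> v \<in> S" using v \<tau> by blast
    then have "ip (a *\<^sub>R p + b *\<^sub>R s) (\<tau> v) = a * ip p (\<tau> v) + b * ip s (\<tau> v)"
      using * by (intro ip_lin cont_S) auto
    then show ?thesis using lin_onD[OF lin[OF v] *(1,2)] * v by simp
  qed
  moreover have "a *\<^sub>R p + b *\<^sub>R s \<in> S" using * by (intro subspace_lin_comb subspace_S) auto
  ultimately show "a *\<^sub>R p + b *\<^sub>R s \<in> S \<and> (\<forall>v\<in>A. ip (a *\<^sub>R p + b *\<^sub>R s) (\<tau> v) = \<Phi> (a *\<^sub>R q + b *\<^sub>R r) v)"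
    by blast
qed

lemma lin_on_reconstruction_pair:
  assumes Q: "subspace Q"
    and ex1: "\<And>q. q \<in> Q \<Longrightarrow> \<exists>!p. p \<in> S \<and> (\<forall>a\<in>A. ip p (\<tau> a) = \<Phi> q a) \<and> (\<forall>w\<in>C. ip p w = \<Psi> q w)"
    and \<tau>: "\<tau> ` A \<subseteq> S" and C: "C \<subseteq> S" and lin: "\<And>a. a \<in> A \<Longrightarrow> lin_on Q (\<lambda>q. \<Phi> q a)"
    and lin': "\<And>w. w \<in> C \<Longrightarrow> lin_on Q (\<lambda>q. \<Psi> q w)"
  shows "lin_on Q (\<lambda>q. THE p. p \<in> S \<and> (\<forall>a\<in>A. ip p (\<tau> a) = (\<Phi> q a :: real)) \<and> (\<forall>w\<in>C. ip p w = (\<Psi> q w :: real)))"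
proof (rule lin_on_the[OF Q ex1])
  fix q r p s a b
  assume *: "q \<in> Q" "r \<in> Q" "p \<in> S \<and> (\<forall>a\<in>A. ip p (\<tau> a) = \<Phi> q a) \<and> (\<forall>w\<in>C. ip p w = \<Psi> q w)"
    "s \<in> S \<and> (\<forall>a\<in>A. ip s (\<tau> a) = \<Phi> r a) \<and> (\<forall>w\<in>C. ip s w = \<Psi> r w)"
  have ipl: "ip (a *\<^sub>R p + b *\<^sub>R s) v = a * ip p v + b * ip s v" if "v \<in> S" for v
    using * that by (intro ip_lin cont_S) auto
  have "ip (a *\<^sub>R p + b *\<^sub>R s) (\<tau> v) = \<Phi> (a *\<^sub>R q + b *\<^sub>R r) v" if v: "v \<in> A" for v
    using ipl[of "\<tau> v"] \<tau> v lin_onD[OF lin[OF v] *(1,2)] * by auto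
  moreover have "ip (a *\<^sub>R p + b *\<^sub>R s) w = \<Psi> (a *\<^sub>R q + b *\<^sub>R r) w" if w: "w \<in> C" for w
    using ipl[of w] C w lin_onD[OF lin'[OF w] *(1,2)] * by auto
  moreover have "a *\<^sub>R p + b *\<^sub>R s \<in> S" using * by (intro subspace_lin_comb subspace_S) auto
  ultimately show "a *\<^sub>R p + b *\<^sub>R s \<in> S \<and> (\<forall>v\<in>A. ip (a *\<^sub>R p + b *\<^sub>R s) (\<tau> v) = \<Phi> (a *\<^sub>R q + b *\<^sub>R r) v) \<and>
      (\<forall>w\<in>C. ip (a *\<^sub>R p + b *\<^sub>R s) w = \<Psi> (a *\<^sub>R q + b *\<^sub>R r) w)"
    by blast
qed

end

lemma lin_on_restr: "lin_on S (restr X :: (pt \<Rightarrow> 'b::real_vector) \<Rightarrow> _)"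
  by (rule lin_onI) (auto simp: restr_def fun_eq_iff plus_fun_def scaleR_fun_def)

lemma finitely_spanned_polys: "finitely_spanned (polys l)"
  unfolding finitely_spanned_def by (rule polys_span_finite)

lemma finitely_spanned_vpolys: "finitely_spanned (vpolys l)"
proof -
  obtain B where B: "finite B" "B \<subseteq> polys l" "polys l \<subseteq> span B" using polys_span_finite by blast
  define e where "e i p = (\<lambda>x. axis i (p x) :: pt)" for i :: 3 and p :: "pt \<Rightarrow> real"
  have lin: "lin_on (polys l) (e i)" for i
    by (rule lin_onI) (auto simp: e_def fun_eq_iff plus_fun_def scaleR_fun_def vec_eq_iff axis_def)
  have in_v: "e i p \<in> vpolys l" if "p \<in> polys l" for i p
  proof (rule vpolysI)
    fix j
    have "(\<lambda>x. e i p x $ j) = (if j = i then p else (\<lambda>x. 0))" by (auto simp: e_def axis_def)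
    then show "(\<lambda>x. e i p x $ j) \<in> polys l" using that by simp
  qed
  have "vpolys l \<subseteq> span (\<Union>i. e i ` B)"
  proof
    fix v assume v: "v \<in> vpolys l"
    have "e i (\<lambda>x. v x $ i) \<in> span (\<Union>i. e i ` B)" for i
      using lin_on_image_span[OF subspace_polys lin B(2,3), of i] vpolys_comp[OF v, of i]
        span_mono[of "e i ` B" "\<Union>i. e i ` B"] by blast
    then have "(\<Sum>i\<in>UNIV. e i (\<lambda>x. v x $ i)) \<in> span (\<Union>i. e i ` B)" by (intro span_sum)
    moreover have "v = (\<Sum>i\<in>UNIV. e i (\<lambda>x. v x $ i))"
    proof
      fix x
      have "(\<Sum>i\<in>UNIV. e i (\<lambda>x. v x $ i)) x = (\<Sum>i\<in>UNIV. axis i (v x $ i))"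
        by (simp add: sum_3 plus_fun_def e_def)
      also have "\<dots> = v x" by (simp add: vec_eq_iff sum_3 forall_3 axis_def)
      finally show "v x = (\<Sum>i\<in>UNIV. e i (\<lambda>x. v x $ i)) x" by simp
    qed
    ultimately show "v \<in> span (\<Union>i. e i ` B)" by simp
  qed
  moreover have "finite (\<Union>i. e i ` B)" using B(1) by simp
  moreover have "(\<Union>i. e i ` B) \<subseteq> vpolys l" using in_v B(2) by auto
  ultimately show ?thesis unfolding finitely_spanned_def by blast
qed

lemma polys_on_cont: "f \<in> polys_on l X \<Longrightarrow> cont_ext_on X f"
  unfolding polys_on_def using cont_ext_on_restr cont_ext_on_polys by blast

lemma polys_on_zero: "f \<in> polys_on l X \<Longrightarrow> x \<notin> X \<Longrightarrow> f x = 0"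
  by (auto simp: polys_on_def restr_def)

lemma subspace_polys_on: "subspace (polys_on l X)"
  unfolding polys_on_def by (rule subspace_lin_on_image[OF subspace_polys lin_on_restr])

lemma polys_onI: "p \<in> polys l \<Longrightarrow> restr X p \<in> polys_on l X"
  by (simp add: polys_on_def)

lemma lin_on_grad: "lin_on (polys l) grad"
  by (rule lin_onI) (simp add: plus_fun_def scaleR_fun_def grad_add_scaleR)

lemma lin_on_dvg: "lin_on (vpolys l) dvg"
  by (rule lin_onI) (simp add: plus_fun_def scaleR_fun_def dvg_add_scaleR)

lemma lin_on_curl: "lin_on (vpolys l) curl"
  by (rule lin_onI) (simp add: plus_fun_def scaleR_fun_def curl_add_scaleR)

lemma lin_on_id: "lin_on S (\<lambda>x. x)"
  by (simp add: lin_on_def)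

lemma lin_on_pointwise:
  assumes "lin_on Q L" "\<And>x. linear (h x)"
  shows "lin_on Q (\<lambda>q x. h x (L q x))"
proof (rule lin_onI, rule ext)
  fix q r a b x assume qr: "q \<in> Q" "r \<in> Q"
  have "h x (a *\<^sub>R L q x + b *\<^sub>R L r x) = a *\<^sub>R h x (L q x) + b *\<^sub>R h x (L r x)"
    by (simp add: linear_add[OF assms(2)] linear_scale[OF assms(2)])
  then show "h x (L (a *\<^sub>R q + b *\<^sub>R r) x) = (a *\<^sub>R (\<lambda>x. h x (L q x)) + b *\<^sub>R (\<lambda>x. h x (L r x))) x"
    by (simp add: lin_onD[OF assms(1) qr] plus_fun_def scaleR_fun_def)
qed

lemma linear_cross3_left: "linear (\<lambda>v. cross3 v n)"
  by (rule linearI) (simp_all add: cross_add_left cross_mult_left)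

lemma grad_F_tangential: "norm (fnormal M F) = 1 \<Longrightarrow> grad_F M F r x \<bullet> fnormal M F = 0"
  by (simp add: grad_F_def inner_diff_left norm_eq_1)

lemma grad_F_vpolys: "r \<in> polys l \<Longrightarrow> grad_F M F r \<in> vpolys (l - 1)"
proof -
  assume r: "r \<in> polys l"
  have "(\<lambda>x. grad r x - (grad r x \<bullet> fnormal M F) *\<^sub>R fnormal M F) \<in> vpolys (l - 1)"
    using vpolys_smult[OF vpolys_inner_const[OF grad_vpolys[OF r], of "fnormal M F"], of "\<lambda>x. fnormal M F" 0]
    by (intro vpolys_diff grad_vpolys[OF r]) simp
  then show ?thesis by (simp add: grad_F_def[abs_def])
qed

lemma rot_F_vpolys: "r \<in> polys l \<Longrightarrow> rot_F M F r \<in> vpolys (l - 1)"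
  unfolding rot_F_def[abs_def] by (intro vpolys_cross3_const grad_F_vpolys)

lemma lin_on_rot_F: "lin_on (polys l) (rot_F M F)"
proof -
  have "linear (\<lambda>v. cross3 (v - (v \<bullet> fnormal M F) *\<^sub>R fnormal M F) (fnormal M F))"
    by (rule linearI) (simp_all add: inner_add_left scaleR_left_distrib cross_add_left cross_mult_left
        Cross3.left_diff_distrib algebra_simps)
  from lin_on_pointwise[OF lin_on_grad this, of l]
  show ?thesis by (simp add: rot_F_def[abs_def] grad_F_def[abs_def])
qed

section \<open>Polynomial spaces on the cell, the faces and the edges\<close>

context polyhedron
begin

lemma l2_polys: "l2_space (vol_measure M) T (polys l)"
proof -
  interpret flat_measure "vol_measure M" T by (rule flat_measure_cell)
  show ?thesis
    by unfold_locales (use finitely_spanned_polys cont_ext_on_polys polys_eq_zero T_props in auto)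
qed

lemma l2_vpolys: "l2_space (vol_measure M) T (vpolys l)"
proof -
  interpret flat_measure "vol_measure M" T by (rule flat_measure_cell)
  show ?thesis
  proof unfold_locales
    fix f assume f: "f \<in> vpolys l" "\<And>x. x \<in> T \<Longrightarrow> f x = 0"
    have "(\<lambda>x. f x $ i) = (\<lambda>x. 0)" for i
      by (rule polys_eq_zero[OF vpolys_comp[OF f(1)] T_props(3,1)]) (simp add: f(2))
    then show "f = (\<lambda>x. 0)" by (auto simp: fun_eq_iff vec_eq_iff)
  qed (use finitely_spanned_vpolys cont_ext_on_vpolys in auto)
qed

lemma l2_restr:
  assumes "flat_measure \<mu> X" "subspace S" "finitely_spanned S" "\<And>f. f \<in> S \<Longrightarrow> cont_ext_on X f"
  shows "l2_space \<mu> X (restr X ` S)"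
proof -
  interpret flat_measure \<mu> X by (rule assms(1))
  show ?thesis
  proof unfold_locales
    show "subspace (restr X ` S)" by (rule subspace_lin_on_image[OF assms(2) lin_on_restr])
    show "finitely_spanned (restr X ` S)" by (rule finitely_spanned_image[OF assms(3,2) lin_on_restr])
    show "cont_ext_on X f" if "f \<in> restr X ` S" for f using that assms(4) cont_ext_on_restr by auto
    show "f = (\<lambda>x. 0)" if "f \<in> restr X ` S" "\<And>x. x \<in> X \<Longrightarrow> f x = 0" for f
      using that by (auto simp: restr_def fun_eq_iff)
  qed
qed

lemma l2_polys_on_F: "F \<in> faces M \<Longrightarrow> l2_space (area_measure M F) F (polys_on l F)"
  unfolding polys_on_def
  by (rule l2_restr[OF flat_measure_face(1) subspace_polys finitely_spanned_polys cont_ext_on_polys])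

lemma l2_polys_on_E: "E \<in> edges M \<Longrightarrow> l2_space (length_measure M E) E (polys_on l E)"
  unfolding polys_on_def
  by (rule l2_restr[OF flat_measure_edge(1) subspace_polys finitely_spanned_polys cont_ext_on_polys])

lemma subspace_tpolys_on: "subspace (tpolys_on M l F)"
proof -
  have "subspace (restr F ` vpolys l)" by (rule subspace_lin_on_image[OF subspace_vpolys lin_on_restr])
  then show ?thesis
    unfolding tpolys_on_def subspace_def
    by (auto simp: inner_add_left plus_fun_def scaleR_fun_def zero_fun_def)
qed

lemma l2_tpolys_on: "F \<in> faces M \<Longrightarrow> l2_space (area_measure M F) F (tpolys_on M l F)"
proof -
  assume F: "F \<in> faces M"
  interpret l2_space "area_measure M F" F "restr F ` vpolys l"
    by (rule l2_restr[OF flat_measure_face(1)[OF F] subspace_vpolys finitely_spanned_vpolys cont_ext_on_vpolys])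
  show ?thesis by (rule l2_space_subspace[OF subspace_tpolys_on]) (auto simp: tpolys_on_def)
qed

lemma face_ball:
  assumes F: "F \<in> faces M" and x: "x \<in> F"
  shows "\<exists>\<rho>>0. \<forall>y\<in>ball x \<rho>. (y - x) \<bullet> fnormal M F = 0 \<longrightarrow> y \<in> F"
proof -
  obtain W where W: "open W" "F = W \<inter> face_plane M F" using F_props(7)[OF F] by blast
  obtain \<rho> where "\<rho> > 0" "ball x \<rho> \<subseteq> W" using openE[OF W(1)] x W(2) by blast
  moreover have "x \<in> face_plane M F" using x W(2) by blast
  ultimately show ?thesis using W(2) face_plane_iff_at by blast
qed

text \<open>A spatial polynomial vanishing on \<open>F\<close> may have a nonzero normal derivative,
  but along each tangential line it is zero near a point of \<open>F\<close>. On \<open>F\<close>,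
  \<open>rot_F\<close> therefore depends only on the restriction of the polynomial.\<close>

lemma grad_F_eq_0_of_zero:
  assumes F: "F \<in> faces M" and r: "r \<in> polys l" and 0: "\<And>x. x \<in> F \<Longrightarrow> r x = 0" and x: "x \<in> F"
  shows "grad_F M F r x = 0"
proof -
  obtain \<rho> where \<rho>: "\<rho> > 0" "\<forall>y\<in>ball x \<rho>. (y - x) \<bullet> fnormal M F = 0 \<longrightarrow> y \<in> F"
    using face_ball[OF F x] by blast
  have dir: "grad r x \<bullet> h = 0" if h: "h \<bullet> fnormal M F = 0" "norm h = 1" for h
  proof -
    have "((\<lambda>s. r (x + s *\<^sub>R h)) has_real_derivative grad r (x + 0 *\<^sub>R h) \<bullet> h) (at 0)"
      by (rule polys_line_derivative[OF r])
    moreover have "\<forall>\<^sub>F s in nhds 0. r (x + s *\<^sub>R h) = 0"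
      unfolding eventually_nhds_metric
    proof (intro exI[of _ \<rho>] conjI allI impI)
      fix s :: real assume "dist s 0 < \<rho>"
      then have "x + s *\<^sub>R h \<in> ball x \<rho>" using h by (simp add: dist_norm)
      then show "r (x + s *\<^sub>R h) = 0" using \<rho>(2) h 0 by auto
    qed (rule \<rho>(1))
    ultimately have "((\<lambda>s. 0) has_real_derivative grad r x \<bullet> h) (at 0)"
      using DERIV_cong_ev[OF refl _ refl, of "\<lambda>s. r (x + s *\<^sub>R h)" "\<lambda>s. 0" 0] by simp
    then show ?thesis using DERIV_unique[OF _ DERIV_const] by blast
  qed
  have 0: "grad_F M F r x \<bullet> face_a M F = 0" "grad_F M F r x \<bullet> face_b M F = 0"
    unfolding grad_F_def inner_diff_left inner_scaleR_left inner_commute[of "fnormal M F" "face_a M F"]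
      inner_commute[of "fnormal M F" "face_b M F"]
    using dir[OF face_frame(2)[OF F] face_frame(1)[OF F]] dir[OF face_frame(4)[OF F] face_frame(3)[OF F]]
    by (simp_all only: face_frame(2)[OF F] face_frame(4)[OF F] mult_zero_right diff_zero)
  show ?thesis
    by (rule trans[OF face_expansion[OF F grad_F_tangential[OF norm_n[OF F]]]]) (simp only: 0 scaleR_zero_left add_0)
qed

text \<open>The vanishing rotor removes all tangential derivatives, so \<open>r\<close> is constant
  along short segments in \<open>F\<close>; connectedness of \<open>F\<close> makes the constant
  global.\<close>

lemma restr_rot_F_eq_0:
  assumes F: "F \<in> faces M" and r: "r \<in> polys l" and 0: "restr F (rot_F M F r) = 0"
    and xy: "x \<in> F" "y \<in> F"
  shows "r x = r y"
proof -
  have g0: "grad r x \<bullet> h = 0" if x: "x \<in> F" and h: "h \<bullet> fnormal M F = 0" for x h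
  proof -
    have "cross3 (grad_F M F r x) (fnormal M F) = 0"
      using fun_cong[OF 0, of x] x by (simp add: restr_def rot_F_def)
    then have "(norm (grad_F M F r x) * norm (fnormal M F))\<^sup>2 = 0"
      using norm_cross_dot[of "grad_F M F r x" "fnormal M F"] grad_F_tangential[OF norm_n[OF F]] by simp
    then have "grad_F M F r x = 0" using norm_n[OF F] by simp
    then have "grad r x = (grad r x \<bullet> fnormal M F) *\<^sub>R fnormal M F" by (simp add: grad_F_def)
    then have "grad r x \<bullet> h = (grad r x \<bullet> fnormal M F) * (fnormal M F \<bullet> h)" by (metis inner_scaleR_left)
    then show ?thesis using h by (simp add: inner_commute)
  qed
  have "r constant_on F"
  proof (rule locally_constant_imp_constant[OF F_props(2)[OF F]])
    fix x assume x: "x \<in> F"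
    obtain \<rho> where \<rho>: "\<rho> > 0" "\<forall>y\<in>ball x \<rho>. (y - x) \<bullet> fnormal M F = 0 \<longrightarrow> y \<in> F"
      using face_ball[OF F x] by blast
    have "r y = r x" if y: "y \<in> F \<inter> ball x \<rho>" for y
    proof -
      have yn: "(y - x) \<bullet> fnormal M F = 0" using flat_F[OF F x] y by blast
      let ?f = "\<lambda>s. r (x + s *\<^sub>R (y - x))"
      have der: "(?f has_real_derivative 0) (at s)" if s: "0 < s" "s < 1" for s
      proof -
        have "s * norm (y - x) \<le> 1 * norm (y - x)" using s by (intro mult_right_mono) auto
        then have "x + s *\<^sub>R (y - x) \<in> ball x \<rho>"
          using y s by (simp add: dist_norm norm_minus_commute)
        then have "x + s *\<^sub>R (y - x) \<in> F" using \<rho>(2) yn by simp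
        then show ?thesis using polys_line_derivative[OF r, of x "y - x" s] g0 yn by simp
      qed
      have "continuous_on {0..1} ?f"
        by (rule continuous_on_compose2[OF polys_continuous_on[OF r, of UNIV] _ subset_UNIV]) (intro continuous_intros)
      then have "?f 1 = ?f 0" by (rule DERIV_isconst2[OF zero_less_one _ der]) simp_all
      then show ?thesis by simp
    qed
    moreover have "openin (top_of_set F) (F \<inter> ball x \<rho>)" by (intro openin_open_Int) auto
    moreover have "x \<in> F \<inter> ball x \<rho>" using x \<rho>(1) by simp
    ultimately show "\<exists>U. openin (top_of_set F) U \<and> x \<in> U \<and> (\<forall>y\<in>U. r y = r x)"
      by (intro exI[of _ "F \<inter> ball x \<rho>"] conjI ballI)
  qed
  then show ?thesis using xy by (auto simp: constant_on_def)
qed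

text \<open>The edges lie in the closure of \<open>F\<close>, so by continuity the boundary terms of
  the face operators also depend only on the restriction of the test polynomial to
  \<open>F\<close>.\<close>

lemma zero_on_edge:
  assumes F: "F \<in> faces M" and r: "r \<in> polys l" and 0: "\<And>x. x \<in> F \<Longrightarrow> r x = 0"
    and E: "E \<in> edges_of M F" "x \<in> E"
  shows "r x = 0"
proof -
  have "x \<in> closure F" using edges_ofD(2)[OF E(1)] E(2) by (auto simp: rel_frontier_def)
  moreover have "closed {x. r x = 0}"
    using continuous_closed_preimage_constant[OF polys_continuous_on[OF r, of UNIV], of 0] by simp
  ultimately show ?thesis using closure_minimal[of F "{x. r x = 0}"] 0 by blast
qed

lemma R_F_subset_tpolys_on: "F \<in> faces M \<Longrightarrow> R_F M l F \<subseteq> tpolys_on M l F"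
  unfolding R_F_def tpolys_on_def
  using rot_F_vpolys[of _ "l + 1"] by (auto simp: restr_def rot_F_def dot_cross_self)

lemma lin_on_restr_rot_F: "lin_on (polys l) (\<lambda>r. restr F (rot_F M F r))"
  by (rule lin_on_comp[OF lin_on_rot_F lin_on_restr subset_UNIV])

lemma subspace_R_F: "subspace (R_F M l F)"
  unfolding R_F_def by (rule subspace_lin_on_image[OF subspace_polys lin_on_restr_rot_F])

lemma R_F_mono: "l \<le> l' \<Longrightarrow> R_F M l F \<subseteq> R_F M l' F"
  unfolding R_F_def using polys_mono[of _ "l + 1" "l' + 1"] by auto

lemma direct_sum_F:
  assumes "F \<in> faces M"
  shows "direct_sum (R_F M (int k - 1) F) (R_F_perp M k F)"
proof -
  interpret l2_space "area_measure M F" F "tpolys_on M k F" by (rule l2_tpolys_on[OF assms])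
  show ?thesis unfolding R_F_perp_def
    by (rule direct_sum_l2_compl[OF R_F_subset_tpolys_on[OF assms] subspace_R_F]) (simp add: R_F_mono)
qed

lemma R_F_cont: "F \<in> faces M \<Longrightarrow> v \<in> R_F M l F \<Longrightarrow> cont_ext_on F v"
  using l2_space.cont_S[OF l2_tpolys_on] R_F_subset_tpolys_on by blast

lemma R_F_perp_cont: "F \<in> faces M \<Longrightarrow> v \<in> R_F_perp M l F \<Longrightarrow> cont_ext_on F v"
  using l2_space.cont_S[OF l2_tpolys_on] unfolding R_F_perp_def l2_compl_def by blast

text \<open>The face components of the discrete curl space, with the edge component indexed by the
  edges of the face.\<close>

definition X_rot_F :: "nat \<Rightarrow> pt set \<Rightarrow> rot_F_dofs set" where
  "X_rot_F k F = dsum (R_F M (int k - 1) F) (R_F_perp M k F) \<times> {vE. \<forall>E\<in>edges_of M F. vE E \<in> polys_on k E}"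

lemma subspace_X_rot_F:
  assumes F: "F \<in> faces M"
  shows "subspace (X_rot_F k F)"
proof -
  interpret direct_sum "R_F M (int k - 1) F" "R_F_perp M k F" by (rule direct_sum_F[OF F])
  have "subspace {vE :: pt set \<Rightarrow> pt \<Rightarrow> real. \<forall>E\<in>edges_of M F. vE E \<in> polys_on k E}"
    unfolding subspace_def using subspace_polys_on[of k]
    by (auto simp: subspace_def plus_fun_def scaleR_fun_def zero_fun_def)
  then show ?thesis
    unfolding X_rot_F_def by (intro subspace_Times subspace_dsum subspace_A subspace_B)
qed

lemma R_part_F_props:
  assumes F: "F \<in> faces M"
  shows "lin_on (X_rot_F k F) (\<lambda>q. R_part_F M k F (fst q))"
    "lin_on (X_rot_F k F) (\<lambda>q. R_perp_part_F M k F (fst q))"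
    "q \<in> X_rot_F k F \<Longrightarrow> R_part_F M k F (fst q) \<in> R_F M (int k - 1) F"
    "q \<in> X_rot_F k F \<Longrightarrow> R_perp_part_F M k F (fst q) \<in> R_F_perp M k F"
    "q \<in> X_rot_F k F \<Longrightarrow> cont_ext_on F (R_part_F M k F (fst q))"
    "q \<in> X_rot_F k F \<Longrightarrow> cont_ext_on F (R_perp_part_F M k F (fst q))"
proof -
  interpret direct_sum "R_F M (int k - 1) F" "R_F_perp M k F" by (rule direct_sum_F[OF F])
  have fst: "lin_on (X_rot_F k F) fst" "fst ` X_rot_F k F \<subseteq> dsum (R_F M (int k - 1) F) (R_F_perp M k F)"
    by (auto simp: lin_on_def X_rot_F_def)
  show "lin_on (X_rot_F k F) (\<lambda>q. R_part_F M k F (fst q))" "lin_on (X_rot_F k F) (\<lambda>q. R_perp_part_F M k F (fst q))"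
    unfolding R_part_F_def R_perp_part_F_def
    using lin_on_comp[OF fst(1) lin_on_dsum_fst fst(2)] lin_on_comp[OF fst(1) lin_on_dsum_snd fst(2)] by auto
  show *: "R_part_F M k F (fst q) \<in> R_F M (int k - 1) F" "R_perp_part_F M k F (fst q) \<in> R_F_perp M k F"
    if "q \<in> X_rot_F k F" for q
    using that fst(2) dsum_fst_in dsum_snd_in unfolding R_part_F_def R_perp_part_F_def by blast+
  show "cont_ext_on F (R_part_F M k F (fst q))" "cont_ext_on F (R_perp_part_F M k F (fst q))"
    if "q \<in> X_rot_F k F" using * that R_F_cont[OF F] R_F_perp_cont[OF F] by blast+
qed

lemma edge_comp_props:
  assumes "E \<in> edges_of M F"
  shows "lin_on (X_rot_F k F) (\<lambda>q. snd q E)" "q \<in> X_rot_F k F \<Longrightarrow> cont_ext_on E (snd q E)"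
  using assms polys_on_cont by (auto simp: lin_on_def plus_fun_def scaleR_fun_def X_rot_F_def)

lemma edge_sum_lin:
  assumes F: "F \<in> faces M"
  shows "r \<in> polys l \<Longrightarrow> lin_on (X_rot_F k F) (\<lambda>q. \<Sum>E\<in>edges_of M F. omega_FE M F E * int_E M E (\<lambda>x. snd q E x * r x))"
    "q \<in> X_rot_F k F \<Longrightarrow> lin_on (polys l) (\<lambda>r. \<Sum>E\<in>edges_of M F. omega_FE M F E * int_E M E (\<lambda>x. snd q E x * r x))"
    "r \<in> polys l \<Longrightarrow> restr F r = 0 \<Longrightarrow> (\<Sum>E\<in>edges_of M F. omega_FE M F E * int_E M E (\<lambda>x. snd q E x * r x)) = 0"
proof -
  have fm: "flat_measure (length_measure M E) E" if "E \<in> edges_of M F" for E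
    by (rule flat_measure_edge(1)[OF edges_ofD(1)[OF that]])
  show "lin_on (X_rot_F k F) (\<lambda>q. \<Sum>E\<in>edges_of M F. omega_FE M F E * int_E M E (\<lambda>x. snd q E x * r x))"
    if r: "r \<in> polys l"
    unfolding int_E_def real_scaleR_def[symmetric]
    by (intro lin_on_sum_fun lin_on_scale_fun, unfold real_scaleR_def,
        intro flat_measure.lin_on_integral_mult_left[OF fm] edge_comp_props(1)
          edge_comp_props(2)[where k = k] cont_ext_on_polys[OF r])
  show "lin_on (polys l) (\<lambda>r. \<Sum>E\<in>edges_of M F. omega_FE M F E * int_E M E (\<lambda>x. snd q E x * r x))"
    if q: "q \<in> X_rot_F k F"
    unfolding int_E_def real_scaleR_def[symmetric]
    by (intro lin_on_sum_fun lin_on_scale_fun, unfold real_scaleR_def,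
        intro flat_measure.lin_on_integral_mult_right[OF fm] edge_comp_props(2)[OF _ q] cont_ext_on_polys lin_on_id)
  show "(\<Sum>E\<in>edges_of M F. omega_FE M F E * int_E M E (\<lambda>x. snd q E x * r x)) = 0"
    if r: "r \<in> polys l" "restr F r = 0"
  proof (rule sum.neutral, rule ballI)
    fix E assume E: "E \<in> edges_of M F"
    have "r x = 0" if "x \<in> F" for x using fun_cong[OF r(2), of x] that by (simp add: restr_def)
    then have "r x = 0" if "x \<in> E" for x using zero_on_edge[OF F r(1) _ E that] by blast
    then have "int_E M E (\<lambda>x. snd q E x * r x) = int_E M E (\<lambda>x. 0)"
      unfolding int_E_def by (intro flat_measure.integral_cong[OF fm[OF E]]) simp
    then show "omega_FE M F E * int_E M E (\<lambda>x. snd q E x * r x) = 0" by (simp add: int_E_def)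
  qed
qed

text \<open>The tests are spatial polynomials, while the relation is posed on \<open>F\<close>: the
  test map is restriction, and its kernel consists of polynomials that vanish on \<open>F\<close>.
  For these the rotor vanishes on \<open>F\<close> and the values on the edges vanish too, so the
  right-hand side does.\<close>

lemma face_curl_ex1:
  assumes F: "F \<in> faces M" and q: "q \<in> X_rot_F k F"
  defines "\<Phi> \<equiv> \<lambda>q r. int_F M F (\<lambda>x. R_part_F M k F (fst q) x \<bullet> rot_F M F r x)
            - (\<Sum>E\<in>edges_of M F. omega_FE M F E * int_E M E (\<lambda>x. snd q E x * r x))"
  shows "\<exists>!c. c \<in> polys_on k F \<and> (\<forall>r\<in>polys k. l2_space.ip (area_measure M F) c (restr F r) = \<Phi> q r)"
proof -
  interpret l2_space "area_measure M F" F "polys_on k F" by (rule l2_polys_on_F[OF F])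
  show ?thesis
  proof (rule ex1_riesz_surj[OF subspace_polys lin_on_restr])
    show "restr F ` polys k = polys_on k F" by (simp add: polys_on_def)
    show "lin_on (polys k) (\<Phi> q)"
      unfolding \<Phi>_def int_F_def
      by (intro lin_on_diff_fun lin_on_integral_right lin_on_rot_F edge_sum_lin(2)[OF F q]
          R_part_F_props(5)[OF F q] cont_ext_on_vpolys[OF rot_F_vpolys])
    fix r assume r: "r \<in> polys k" "restr F r = 0"
    have "r x = 0" if "x \<in> F" for x using fun_cong[OF r(2), of x] that by (simp add: restr_def)
    then have "rot_F M F r x = 0" if "x \<in> F" for x
      using grad_F_eq_0_of_zero[OF F r(1) _ that] by (simp add: rot_F_def)
    then have "int_F M F (\<lambda>x. R_part_F M k F (fst q) x \<bullet> rot_F M F r x) = int_F M F (\<lambda>x. 0)"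
      unfolding int_F_def by (intro integral_cong) simp
    then show "\<Phi> q r = 0" unfolding \<Phi>_def using edge_sum_lin(3)[OF F r] by (simp add: int_F_def)
  qed
qed

lemma face_curl_eq:
  assumes F: "F \<in> faces M"
  shows "face_curl M k F q = (THE c. c \<in> polys_on k F \<and> (\<forall>r\<in>polys k. l2_space.ip (area_measure M F) c (restr F r) =
     int_F M F (\<lambda>x. R_part_F M k F (fst q) x \<bullet> rot_F M F r x)
            - (\<Sum>E\<in>edges_of M F. omega_FE M F E * int_E M E (\<lambda>x. snd q E x * r x))))"
proof -
  interpret l2_space "area_measure M F" F "polys_on k F" by (rule l2_polys_on_F[OF F])
  have "int_F M F (\<lambda>x. c x * r x) = ip c (restr F r)" for c r
    unfolding int_F_def ip_def by (rule integral_cong) (simp add: restr_def)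
  then show ?thesis unfolding face_curl_def by (simp add: case_prod_unfold)
qed

lemma face_curl_props:
  assumes F: "F \<in> faces M"
  shows "lin_on (X_rot_F k F) (face_curl M k F)"
    "q \<in> X_rot_F k F \<Longrightarrow> face_curl M k F q \<in> polys_on k F"
    "q \<in> X_rot_F k F \<Longrightarrow> c \<in> polys_on k F \<Longrightarrow>
      (\<And>r. r \<in> polys k \<Longrightarrow> int_F M F (\<lambda>x. c x * r x) = int_F M F (\<lambda>x. R_part_F M k F (fst q) x \<bullet> rot_F M F r x)
            - (\<Sum>E\<in>edges_of M F. omega_FE M F E * int_E M E (\<lambda>x. snd q E x * r x))) \<Longrightarrow>
      face_curl M k F q = c"
proof -
  interpret l2_space "area_measure M F" F "polys_on k F" by (rule l2_polys_on_F[OF F])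
  have ip: "int_F M F (\<lambda>x. c x * r x) = ip c (restr F r)" for c r
    unfolding int_F_def ip_def by (rule integral_cong) (simp add: restr_def)
  have "lin_on (X_rot_F k F) (\<lambda>q. face_curl M k F q)"
    unfolding face_curl_eq[OF F]
  proof (rule lin_on_reconstruction[OF subspace_X_rot_F[OF F] face_curl_ex1[OF F]])
    show "restr F ` polys k \<subseteq> polys_on k F" by (simp add: polys_on_def)
    show "lin_on (X_rot_F k F) (\<lambda>q. int_F M F (\<lambda>x. R_part_F M k F (fst q) x \<bullet> rot_F M F r x)
        - (\<Sum>E\<in>edges_of M F. omega_FE M F E * int_E M E (\<lambda>x. snd q E x * r x)))" if r: "r \<in> polys k" for r
      unfolding int_F_def
      by (intro lin_on_diff_fun lin_on_integral_left edge_sum_lin(1)[OF F r] R_part_F_props[OF F]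
          cont_ext_on_vpolys[OF rot_F_vpolys[OF r]])
  qed
  then show "lin_on (X_rot_F k F) (face_curl M k F)" .
  show "face_curl M k F q \<in> polys_on k F" if "q \<in> X_rot_F k F"
    unfolding face_curl_eq[OF F] using theI'[OF face_curl_ex1[OF F that]] by (rule conjunct1)
  show "face_curl M k F q = c" if "q \<in> X_rot_F k F" "c \<in> polys_on k F"
    "\<And>r. r \<in> polys k \<Longrightarrow> int_F M F (\<lambda>x. c x * r x) = int_F M F (\<lambda>x. R_part_F M k F (fst q) x \<bullet> rot_F M F r x)
            - (\<Sum>E\<in>edges_of M F. omega_FE M F E * int_E M E (\<lambda>x. snd q E x * r x))"
    unfolding face_curl_eq[OF F]
    by (rule the1_equality[OF face_curl_ex1[OF F that(1)]]) (use that in \<open>simp add: ip\<close>)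
qed

definition zero_mean_F :: "int \<Rightarrow> pt set \<Rightarrow> (pt \<Rightarrow> real) set" where
  "zero_mean_F l F = {r \<in> polys l. int_F M F r = 0}"

text \<open>Subtracting the mean value does not change the rotor, so zero-mean tests reach every
  rotor; \<open>0 \<le> l\<close> ensures that constants are in \<open>polys l\<close>.\<close>

lemma zero_mean_F_props:
  assumes F: "F \<in> faces M" and l: "0 \<le> l"
  shows "subspace (zero_mean_F l F)" "(\<lambda>r. restr F (rot_F M F r)) ` zero_mean_F l F = R_F M (l - 1) F"
proof -
  interpret flat_measure "area_measure M F" F by (rule flat_measure_face(1)[OF F])
  have lin: "lin_on (polys l) (int_F M F)"
    unfolding int_F_def by (rule lin_on_integral[OF lin_on_id cont_ext_on_polys])
  show "subspace (zero_mean_F l F)"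
    unfolding zero_mean_F_def
    by (rule subspaceI)
      (auto simp: lin_on_0[OF lin subspace_polys] lin_on_add[OF lin] lin_on_scale[OF lin]
        subspace_0 subspace_add subspace_scale)
  show "(\<lambda>r. restr F (rot_F M F r)) ` zero_mean_F l F = R_F M (l - 1) F"
  proof
    show "(\<lambda>r. restr F (rot_F M F r)) ` zero_mean_F l F \<subseteq> R_F M (l - 1) F"
      by (auto simp: R_F_def zero_mean_F_def)
    show "R_F M (l - 1) F \<subseteq> (\<lambda>r. restr F (rot_F M F r)) ` zero_mean_F l F"
    proof
      fix w assume "w \<in> R_F M (l - 1) F"
      then obtain r where r: "r \<in> polys l" "w = restr F (rot_F M F r)" by (auto simp: R_F_def)
      define m where "m = int_F M F r / int_F M F (\<lambda>x. 1)"
      define s where "s = 1 *\<^sub>R r + (- m) *\<^sub>R (\<lambda>x. 1 :: real)"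
      have one: "(\<lambda>x. 1 :: real) \<in> polys l" using l by simp
      have pos: "0 < int_F M F (\<lambda>x. 1)" unfolding int_F_def by (rule integral_one_pos[OF F_props(1)[OF F]])
      have "int_F M F s = int_F M F r - m * int_F M F (\<lambda>x. 1)"
        unfolding s_def lin_onD[OF lin r(1) one] by simp
      then have "int_F M F s = 0" using pos by (simp add: m_def)
      moreover have "s \<in> polys l" unfolding s_def by (intro subspace_lin_comb subspace_polys r one)
      moreover have "rot_F M F s = rot_F M F r"
      proof -
        have "grad (\<lambda>x. 1) = (\<lambda>x. 0)" by (auto simp: fun_eq_iff vec_eq_iff grad_comp)
        then have "rot_F M F (\<lambda>x. 1) = 0" by (simp add: fun_eq_iff rot_F_def grad_F_def)
        then show ?thesis unfolding s_def lin_onD[OF lin_on_rot_F r(1) one] by simp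
      qed
      ultimately show "w \<in> (\<lambda>r. restr F (rot_F M F r)) ` zero_mean_F l F"
        unfolding zero_mean_F_def r(2) by (intro image_eqI[of _ _ s]) auto
    qed
  qed
qed

end

section \<open>Properties shared by all reconstructions\<close>

context l2_space
begin

text \<open>The last part, identifying the value by checking the relations, is the means by which
  reconstructions of interpolated polynomials are computed.\<close>

lemma reconstruction_props:
  assumes Q: "subspace Q" and ex1: "\<And>q. q \<in> Q \<Longrightarrow> \<exists>!p. p \<in> S \<and> (\<forall>a\<in>A. ip p (\<tau> a) = \<Phi> q a)"
    and \<tau>: "\<tau> ` A \<subseteq> S" and lin: "\<And>a. a \<in> A \<Longrightarrow> lin_on Q (\<lambda>q. \<Phi> q a)"
    and op: "\<And>q. f q = (THE p. p \<in> S \<and> (\<forall>a\<in>A. ip p (\<tau> a) = (\<Phi> q a :: real)))"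
  shows "lin_on Q f" "q \<in> Q \<Longrightarrow> f q \<in> S" "q \<in> Q \<Longrightarrow> a \<in> A \<Longrightarrow> ip (f q) (\<tau> a) = \<Phi> q a"
    "q \<in> Q \<Longrightarrow> p \<in> S \<Longrightarrow> (\<And>a. a \<in> A \<Longrightarrow> ip p (\<tau> a) = \<Phi> q a) \<Longrightarrow> f q = p"
proof -
  have f: "f = (\<lambda>q. THE p. p \<in> S \<and> (\<forall>a\<in>A. ip p (\<tau> a) = \<Phi> q a))" using op by blast
  show "lin_on Q f" unfolding f by (rule lin_on_reconstruction[OF Q ex1 \<tau> lin])
  show "f q \<in> S" "a \<in> A \<Longrightarrow> ip (f q) (\<tau> a) = \<Phi> q a" if "q \<in> Q"
    using theI'[OF ex1[OF that]] unfolding op by blast+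
  show "f q = p" if "q \<in> Q" "p \<in> S" "\<And>a. a \<in> A \<Longrightarrow> ip p (\<tau> a) = \<Phi> q a"
    unfolding op by (rule the1_equality[OF ex1[OF that(1)]]) (use that in blast)
qed

lemma reconstruction_pair_props:
  assumes Q: "subspace Q"
    and ex1: "\<And>q. q \<in> Q \<Longrightarrow> \<exists>!p. p \<in> S \<and> (\<forall>a\<in>A. ip p (\<tau> a) = \<Phi> q a) \<and> (\<forall>w\<in>C. ip p w = \<Psi> q w)"
    and \<tau>: "\<tau> ` A \<subseteq> S" and C: "C \<subseteq> S" and lin: "\<And>a. a \<in> A \<Longrightarrow> lin_on Q (\<lambda>q. \<Phi> q a)"
    and lin': "\<And>w. w \<in> C \<Longrightarrow> lin_on Q (\<lambda>q. \<Psi> q w)"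
    and op: "\<And>q. f q = (THE p. p \<in> S \<and> (\<forall>a\<in>A. ip p (\<tau> a) = (\<Phi> q a :: real)) \<and> (\<forall>w\<in>C. ip p w = (\<Psi> q w :: real)))"
  shows "lin_on Q f" "q \<in> Q \<Longrightarrow> f q \<in> S" "q \<in> Q \<Longrightarrow> a \<in> A \<Longrightarrow> ip (f q) (\<tau> a) = \<Phi> q a"
    "q \<in> Q \<Longrightarrow> w \<in> C \<Longrightarrow> ip (f q) w = \<Psi> q w"
    "q \<in> Q \<Longrightarrow> p \<in> S \<Longrightarrow> (\<And>a. a \<in> A \<Longrightarrow> ip p (\<tau> a) = \<Phi> q a) \<Longrightarrow> (\<And>w. w \<in> C \<Longrightarrow> ip p w = \<Psi> q w) \<Longrightarrow> f q = p"
proof -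
  have f: "f = (\<lambda>q. THE p. p \<in> S \<and> (\<forall>a\<in>A. ip p (\<tau> a) = \<Phi> q a) \<and> (\<forall>w\<in>C. ip p w = \<Psi> q w))" using op by blast
  show "lin_on Q f" unfolding f by (rule lin_on_reconstruction_pair[OF Q ex1 \<tau> C lin lin'])
  show "f q \<in> S" "a \<in> A \<Longrightarrow> ip (f q) (\<tau> a) = \<Phi> q a" "w \<in> C \<Longrightarrow> ip (f q) w = \<Psi> q w" if "q \<in> Q"
    using theI'[OF ex1[OF that]] unfolding op by blast+
  show "f q = p" if "q \<in> Q" "p \<in> S" "\<And>a. a \<in> A \<Longrightarrow> ip p (\<tau> a) = \<Phi> q a" "\<And>w. w \<in> C \<Longrightarrow> ip p w = \<Psi> q w"
    unfolding op by (rule the1_equality[OF ex1[OF that(1)]]) (use that in blast)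
qed

end

section \<open>Tangential reconstruction and its polynomial consistency\<close>

context polyhedron
begin

text \<open>A zero-mean test with vanishing rotor on \<open>F\<close> is constant on
  \<open>F\<close>, hence zero there, and both the face term and the edge terms drop out. The
  criterion in the last part demands the relation for all of \<open>polys (int k + 1)\<close>, since
  Stokes' theorem provides it without a condition on the mean.\<close>

lemma tangential_reconstruction_props:
  assumes F: "F \<in> faces M"
  shows "lin_on (X_rot_F k F) (tangential_reconstruction M k F)"
    "q \<in> X_rot_F k F \<Longrightarrow> tangential_reconstruction M k F q \<in> tpolys_on M k F"
    "q \<in> X_rot_F k F \<Longrightarrow> g \<in> tpolys_on M k F \<Longrightarrow>
      (\<And>r. r \<in> polys (int k + 1) \<Longrightarrow> int_F M F (\<lambda>x. g x \<bullet> rot_F M F r x) =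
            int_F M F (\<lambda>x. face_curl M k F q x * r x)
            + (\<Sum>E\<in>edges_of M F. omega_FE M F E * int_E M E (\<lambda>x. snd q E x * r x))) \<Longrightarrow>
      (\<And>w. w \<in> R_F_perp M k F \<Longrightarrow> int_F M F (\<lambda>x. g x \<bullet> w x) = int_F M F (\<lambda>x. R_perp_part_F M k F (fst q) x \<bullet> w x)) \<Longrightarrow>
      tangential_reconstruction M k F q = g"
proof -
  interpret l2_space "area_measure M F" F "tpolys_on M k F" by (rule l2_tpolys_on[OF F])
  let ?A = "zero_mean_F (int k + 1) F" and ?\<tau> = "\<lambda>r. restr F (rot_F M F r)"
  define \<Phi> where "\<Phi> q r = int_F M F (\<lambda>x. face_curl M k F q x * r x)
            + (\<Sum>E\<in>edges_of M F. omega_FE M F E * int_E M E (\<lambda>x. snd q E x * r x))" for q r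
  define \<Psi> where "\<Psi> q w = int_F M F (\<lambda>x. R_perp_part_F M k F (fst q) x \<bullet> w x)" for q :: rot_F_dofs and w
  have A: "subspace ?A" "?\<tau> ` ?A = R_F M k F" "?A \<subseteq> polys (int k + 1)"
    using zero_mean_F_props[OF F, of "int k + 1"] by (auto simp: zero_mean_F_def)
  have W: "R_F M k F \<subseteq> tpolys_on M k F" by (rule R_F_subset_tpolys_on[OF F])
  have C: "R_F_perp M k F = l2_compl (area_measure M F) (tpolys_on M k F) (R_F M k F)" by (simp add: R_F_perp_def)
  have Csub: "R_F_perp M k F \<subseteq> tpolys_on M k F" unfolding C by (rule l2_compl_subset)
  have fc: "cont_ext_on F (face_curl M k F q)" if "q \<in> X_rot_F k F" for q
    by (rule polys_on_cont[OF face_curl_props(2)[OF F that]])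
  have lin: "lin_on (X_rot_F k F) (\<lambda>q. \<Phi> q r)" if r: "r \<in> ?A" for r
    unfolding \<Phi>_def int_F_def using r A(3)
    by (intro lin_on_add_fun lin_on_integral_mult_left edge_sum_lin(1)[OF F, of r "int k + 1"] face_curl_props(1)[OF F] fc
        cont_ext_on_polys[of r "int k + 1"]) auto
  have lin': "lin_on (X_rot_F k F) (\<lambda>q. \<Psi> q w)" if w: "w \<in> R_F_perp M k F" for w
    unfolding \<Psi>_def int_F_def
    by (intro lin_on_integral_left R_part_F_props[OF F] R_F_perp_cont[OF F w])
  have ex1: "\<exists>!g. g \<in> tpolys_on M k F \<and> (\<forall>r\<in>?A. ip g (?\<tau> r) = \<Phi> q r) \<and> (\<forall>w\<in>R_F_perp M k F. ip g w = \<Psi> q w)"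
    if q: "q \<in> X_rot_F k F" for q
    unfolding C
  proof (rule ex1_riesz_pair[OF A(1) _ A(2) W])
    show "lin_on ?A ?\<tau>" by (rule lin_on_subset[OF lin_on_restr_rot_F A(3)])
    have "lin_on (polys (int k + 1)) (\<Phi> q)"
      unfolding \<Phi>_def int_F_def
      by (intro lin_on_add_fun lin_on_integral_mult_right edge_sum_lin(2)[OF F q] fc[OF q] lin_on_id cont_ext_on_polys)
    then show "lin_on ?A (\<Phi> q)" by (rule lin_on_subset[OF _ A(3)])
    show "lin_on (l2_compl (area_measure M F) (tpolys_on M k F) (R_F M k F)) (\<Psi> q)"
      unfolding C[symmetric] \<Psi>_def int_F_def
      by (intro lin_on_integral_right lin_on_id R_F_perp_cont[OF F] R_part_F_props(6)[OF F q])
    fix r assume r: "r \<in> ?A" "?\<tau> r = 0"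
    then have rp: "r \<in> polys (int k + 1)" "int_F M F r = 0" by (auto simp: zero_mean_F_def)
    let ?x = "face_origin F"
    have c: "r x = r ?x" if "x \<in> F" for x
      by (rule restr_rot_F_eq_0[OF F rp(1) r(2) that face_frame(6)[OF F]])
    have "int_F M F r = int_F M F (\<lambda>x. r ?x * 1)" unfolding int_F_def by (rule integral_cong) (simp add: c)
    also have "\<dots> = r ?x * int_F M F (\<lambda>x. 1)" by (simp add: int_F_def)
    finally have "r ?x = 0"
      using rp(2) integral_one_pos[OF F_props(1)[OF F]] by (simp add: int_F_def)
    then have r0: "r x = 0" if "x \<in> F" for x using c[OF that] by simp
    then have "restr F r = 0" by (auto simp: restr_def fun_eq_iff)
    moreover have "int_F M F (\<lambda>x. face_curl M k F q x * r x) = int_F M F (\<lambda>x. 0)"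
      unfolding int_F_def by (rule integral_cong) (simp add: r0)
    ultimately show "\<Phi> q r = 0" unfolding \<Phi>_def using edge_sum_lin(3)[OF F rp(1)] by (simp add: int_F_def)
  qed
  have ip\<tau>: "int_F M F (\<lambda>x. g x \<bullet> rot_F M F r x) = ip g (?\<tau> r)" for g r
    unfolding int_F_def ip_def by (rule integral_cong) (simp add: restr_def)
  have ipw: "int_F M F (\<lambda>x. g x \<bullet> w x) = ip g w" for g w by (simp add: int_F_def ip_def)
  have ball: "(\<forall>r\<in>polys (int k + 1). int_F M F r = 0 \<longrightarrow> P r) \<longleftrightarrow> (\<forall>r\<in>?A. P r)" for P
    by (auto simp: zero_mean_F_def)
  have op: "tangential_reconstruction M k F q = (THE g. g \<in> tpolys_on M k F \<and> (\<forall>r\<in>?A. ip g (?\<tau> r) = \<Phi> q r)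
      \<and> (\<forall>w\<in>R_F_perp M k F. ip g w = \<Psi> q w))" for q
    unfolding tangential_reconstruction_def case_prod_unfold ball ip\<tau> unfolding \<Phi>_def \<Psi>_def ipw by simp
  have \<tau>S: "?\<tau> ` ?A \<subseteq> tpolys_on M k F" using A(2) W by simp
  show "lin_on (X_rot_F k F) (tangential_reconstruction M k F)" 
    by (rule reconstruction_pair_props(1)[OF subspace_X_rot_F[OF F] ex1 \<tau>S Csub lin lin' op])
  show "tangential_reconstruction M k F q \<in> tpolys_on M k F" if "q \<in> X_rot_F k F"
    by (rule reconstruction_pair_props(2)[OF subspace_X_rot_F[OF F] ex1 \<tau>S Csub lin lin' op that])
  show "tangential_reconstruction M k F q = g" if qg: "q \<in> X_rot_F k F" "g \<in> tpolys_on M k F"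
      and gr: "\<And>r. r \<in> polys (int k + 1) \<Longrightarrow> int_F M F (\<lambda>x. g x \<bullet> rot_F M F r x) =
            int_F M F (\<lambda>x. face_curl M k F q x * r x)
            + (\<Sum>E\<in>edges_of M F. omega_FE M F E * int_E M E (\<lambda>x. snd q E x * r x))"
      and gw: "\<And>w. w \<in> R_F_perp M k F \<Longrightarrow> int_F M F (\<lambda>x. g x \<bullet> w x) = int_F M F (\<lambda>x. R_perp_part_F M k F (fst q) x \<bullet> w x)"
  proof (rule reconstruction_pair_props(5)[OF subspace_X_rot_F[OF F] ex1 \<tau>S Csub lin lin' op qg])
    show "ip g (?\<tau> r) = \<Phi> q r" if "r \<in> ?A" for r
      using gr[of r] that A(3) unfolding ip\<tau> \<Phi>_def by blast
    show "ip g w = \<Psi> q w" if "w \<in> R_F_perp M k F" for w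
      using gw[OF that] unfolding \<Psi>_def ipw .
  qed
qed

lemma tangential_trace_eq:
  assumes F: "F \<in> faces M"
  shows "tangential_trace M F v = restr F (\<lambda>x. v x - (v x \<bullet> fnormal M F) *\<^sub>R fnormal M F)"
proof -
  have nn: "fnormal M F \<bullet> fnormal M F = 1" using norm_n[OF F] by (simp add: norm_eq_1)
  have "cross3 (fnormal M F) (cross3 (v x) (fnormal M F)) = v x - (v x \<bullet> fnormal M F) *\<^sub>R fnormal M F" for x
    unfolding Lagrange using nn by (simp add: inner_commute)
  then show ?thesis unfolding tangential_trace_def by simp
qed

lemma tangential_trace_props:
  assumes F: "F \<in> faces M"
  shows "v \<in> vpolys l \<Longrightarrow> tangential_trace M F v \<in> tpolys_on M l F"
    "lin_on (vpolys l) (tangential_trace M F)"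
    "v \<in> vpolys l \<Longrightarrow> cont_ext_on F (tangential_trace M F v)"
proof -
  have nn: "fnormal M F \<bullet> fnormal M F = 1" using norm_n[OF F] by (simp add: norm_eq_1)
  show *: "tangential_trace M F v \<in> tpolys_on M l F" if "v \<in> vpolys l" for v
    unfolding tpolys_on_def mem_Collect_eq tangential_trace_def
    using vpolys_cross3_const(2)[OF vpolys_cross3_const(1)[OF that]]
    by (auto simp: restr_def dot_cross_self)
  have "linear (\<lambda>v. cross3 (fnormal M F) (cross3 v (fnormal M F)))"
    by (rule linearI) (simp_all add: cross_add_left cross_mult_left cross_add_right cross_mult_right)
  from lin_on_comp[OF lin_on_pointwise[OF lin_on_id this] lin_on_restr subset_UNIV]
  show "lin_on (vpolys l) (tangential_trace M F)" unfolding tangential_trace_def[abs_def] .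
  show "cont_ext_on F (tangential_trace M F v)" if "v \<in> vpolys l"
    using *[OF that] l2_space.cont_S[OF l2_tpolys_on[OF F]] by blast
qed

text \<open>Stokes' theorem for the field \<open>r x *\<^sub>R v x\<close>, expanded by the product
  rule. Crossing with the normal removes the normal part of the gradient, and the rotor, being
  tangential, meets only the tangential part of \<open>v\<close>.\<close>

lemma stokes_face_by_parts:
  assumes F: "F \<in> faces M" and v: "v \<in> vpolys l" and r: "r \<in> polys l'"
  shows "int_F M F (\<lambda>x. tangential_trace M F v x \<bullet> rot_F M F r x)
    = int_F M F (\<lambda>x. (curl v x \<bullet> fnormal M F) * r x)
      + (\<Sum>E\<in>edges_of M F. omega_FE M F E * int_E M E (\<lambda>x. (v x \<bullet> etangent M E) * r x))"
proof -
  let ?n = "fnormal M F"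
  interpret flat_measure "area_measure M F" F by (rule flat_measure_face(1)[OF F])
  have eq: "curl (\<lambda>x. r x *\<^sub>R v x) x \<bullet> ?n
      = (curl v x \<bullet> ?n) * r x - tangential_trace M F v x \<bullet> rot_F M F r x" if x: "x \<in> F" for x
  proof -
    have "rot_F M F r x = cross3 (grad r x) ?n"
      by (simp add: rot_F_def grad_F_def Cross3.left_diff_distrib cross_mult_left)
    then have "tangential_trace M F v x \<bullet> rot_F M F r x = v x \<bullet> cross3 (grad r x) ?n"
      using x by (simp add: tangential_trace_eq[OF F] restr_def inner_diff_left dot_cross_self)
    also have "\<dots> = - (cross3 (grad r x) (v x) \<bullet> ?n)"
      by (simp add: inner_vec_def sum_3 cross3_comp algebra_simps)
    finally show ?thesis by (simp add: curl_smult[OF r v] inner_add_left mult.commute)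
  qed
  have "int_F M F (\<lambda>x. curl (\<lambda>x. r x *\<^sub>R v x) x \<bullet> ?n)
      = int_F M F (\<lambda>x. (curl v x \<bullet> ?n) * r x - tangential_trace M F v x \<bullet> rot_F M F r x)"
    unfolding int_F_def by (rule integral_cong) (rule eq)
  also have "\<dots> = int_F M F (\<lambda>x. (curl v x \<bullet> ?n) * r x) - int_F M F (\<lambda>x. tangential_trace M F v x \<bullet> rot_F M F r x)"
    unfolding int_F_def
    by (intro integral_diff cont_ext_on_mult cont_ext_on_inner tangential_trace_props(3)[OF F v]
        cont_ext_on_vpolys[OF rot_F_vpolys[OF r]] cont_ext_on_polys[OF r] cont_ext_on_const
        cont_ext_on_vpolys[OF curl_vpolys[OF v]])
  finally show ?thesis
    using stokes_face[OF F vpolys_smult[OF r v]] by (simp add: mult.commute)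
qed

text \<open>The face curl is tested with rotors of polynomials of degree \<open>k\<close>. These lie
  in \<open>R_F M (int k - 1) F\<close>, where the projected component acts like the full tangential
  trace, so integration by parts gives the normal component of the true curl. With it the relations
  of the tangential reconstruction become the same formula for tests of degree
  \<open>k + 1\<close>.\<close>

lemma curl_dofs_face_consistency:
  assumes F: "F \<in> faces M" and v: "v \<in> vpolys k"
  defines "q \<equiv> curl_to_face M F (I_curl_T M k v)"
  shows "q \<in> X_rot_F k F" "tangential_reconstruction M k F q = tangential_trace M F v"
proof -
  let ?t = "tangential_trace M F v"
  have t: "?t \<in> tpolys_on M k F" "cont_ext_on F ?t" using tangential_trace_props[OF F] v by auto
  interpret l2_space "area_measure M F" F "tpolys_on M k F" by (rule l2_tpolys_on[OF F])
  interpret R: l2_space "area_measure M F" F "R_F M (int k - 1) F"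
    by (rule l2_space_subspace[OF subspace_R_F]) (use R_F_subset_tpolys_on[OF F] R_F_mono[of "int k - 1" k] in auto)
  interpret P: l2_space "area_measure M F" F "R_F_perp M k F"
    unfolding R_F_perp_def
    by (rule l2_space_subspace[OF subspace_l2_compl[OF R_F_subset_tpolys_on[OF F]] l2_compl_subset])
  interpret ds: direct_sum "R_F M (int k - 1) F" "R_F_perp M k F" by (rule direct_sum_F[OF F])
  let ?r = "l2_proj (area_measure M F) (R_F M (int k - 1) F) ?t"
  let ?p = "l2_proj (area_measure M F) (R_F_perp M k F) ?t"
  have rp: "?r \<in> R_F M (int k - 1) F" "?p \<in> R_F_perp M k F"
    by (rule R.l2_proj_in[OF t(2)], rule P.l2_proj_in[OF t(2)])
  have fq: "fst q = ?r + ?p" using F by (simp add: q_def curl_to_face_def I_curl_T_def)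
  have vt: "restr E (\<lambda>x. v x \<bullet> etangent M E) \<in> polys_on k E" for E
    by (rule polys_onI[OF vpolys_inner_const[OF v]])
  have sq: "snd q E = restr E (\<lambda>x. v x \<bullet> etangent M E)" if E: "E \<in> edges_of M F" for E
    using E edges_ofD(1)[OF E] l2_space.l2_proj_id[OF l2_polys_on_E vt]
    by (simp add: q_def curl_to_face_def I_curl_T_def)
  show q: "q \<in> X_rot_F k F"
    unfolding X_rot_F_def using rp fq sq vt by (auto simp: mem_Times_iff dsum_def)
  have parts: "R_part_F M k F (fst q) = ?r" "R_perp_part_F M k F (fst q) = ?p"
    unfolding R_part_F_def R_perp_part_F_def fq by (rule ds.dsum_fst_eq[OF rp], rule ds.dsum_snd_eq[OF rp])
  have edge: "int_E M E (\<lambda>x. snd q E x * r x) = int_E M E (\<lambda>x. (v x \<bullet> etangent M E) * r x)"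
    if E: "E \<in> edges_of M F" for E r
    unfolding int_E_def sq[OF E]
    by (rule flat_measure.integral_cong[OF flat_measure_edge(1)[OF edges_ofD(1)[OF E]]]) (simp add: restr_def)
  have fc: "face_curl M k F q = restr F (\<lambda>x. curl v x \<bullet> fnormal M F)"
  proof (rule face_curl_props(3)[OF F q])
    show "restr F (\<lambda>x. curl v x \<bullet> fnormal M F) \<in> polys_on k F"
      by (rule polys_onI, rule polys_mono[OF vpolys_inner_const[OF curl_vpolys[OF v]]]) simp
    fix r assume r: "r \<in> polys k"
    have "int_F M F (\<lambda>x. ?r x \<bullet> rot_F M F r x) = R.ip ?r (restr F (rot_F M F r))"
      unfolding int_F_def R.ip_def by (rule integral_cong) (simp add: restr_def)
    also have "\<dots> = R.ip ?t (restr F (rot_F M F r))"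
      by (rule R.ip_l2_proj[OF t(2)]) (use r in \<open>auto simp: R_F_def\<close>)
    also have "\<dots> = int_F M F (\<lambda>x. ?t x \<bullet> rot_F M F r x)"
      unfolding int_F_def R.ip_def by (rule integral_cong) (simp add: restr_def)
    finally have 1: "int_F M F (\<lambda>x. ?r x \<bullet> rot_F M F r x) = int_F M F (\<lambda>x. ?t x \<bullet> rot_F M F r x)" .
    have 2: "int_F M F (\<lambda>x. restr F (\<lambda>x. curl v x \<bullet> fnormal M F) x * r x) = int_F M F (\<lambda>x. (curl v x \<bullet> fnormal M F) * r x)"
      unfolding int_F_def by (rule integral_cong) (simp add: restr_def)
    show "int_F M F (\<lambda>x. restr F (\<lambda>x. curl v x \<bullet> fnormal M F) x * r x)
      = int_F M F (\<lambda>x. R_part_F M k F (fst q) x \<bullet> rot_F M F r x)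
        - (\<Sum>E\<in>edges_of M F. omega_FE M F E * int_E M E (\<lambda>x. snd q E x * r x))"
      unfolding parts 1 2 stokes_face_by_parts[OF F v r] using edge by simp
  qed
  show "tangential_reconstruction M k F q = ?t"
  proof (rule tangential_reconstruction_props(3)[OF F q t(1)])
    fix r assume r: "r \<in> polys (int k + 1)"
    have "int_F M F (\<lambda>x. face_curl M k F q x * r x) = int_F M F (\<lambda>x. (curl v x \<bullet> fnormal M F) * r x)"
      unfolding int_F_def fc by (rule integral_cong) (simp add: restr_def)
    then show "int_F M F (\<lambda>x. ?t x \<bullet> rot_F M F r x) = int_F M F (\<lambda>x. face_curl M k F q x * r x)
        + (\<Sum>E\<in>edges_of M F. omega_FE M F E * int_E M E (\<lambda>x. snd q E x * r x))"
      unfolding stokes_face_by_parts[OF F v r] using edge by simp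
  next
    fix w assume w: "w \<in> R_F_perp M k F"
    show "int_F M F (\<lambda>x. ?t x \<bullet> w x) = int_F M F (\<lambda>x. R_perp_part_F M k F (fst q) x \<bullet> w x)"
      using P.ip_l2_proj[OF t(2) w] unfolding parts by (simp add: P.ip_def int_F_def)
  qed
qed

section \<open>Reconstruction operators on the cell\<close>

lemma subspace_R_T: "subspace (R_T l)"
  unfolding R_T_def by (rule subspace_lin_on_image[OF subspace_vpolys lin_on_curl])

lemma subspace_G_T: "subspace (G_T l)"
  unfolding G_T_def by (rule subspace_lin_on_image[OF subspace_polys lin_on_grad])

lemma R_T_subset: "R_T l \<subseteq> vpolys l"
  unfolding R_T_def using curl_vpolys[of _ "l + 1"] by auto

lemma G_T_subset: "G_T l \<subseteq> vpolys l"
  unfolding G_T_def using grad_vpolys[of _ "l + 1"] by auto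

lemma R_T_mono: "l \<le> l' \<Longrightarrow> R_T l \<subseteq> R_T l'"
  unfolding R_T_def using vpolys_mono[of _ "l + 1" "l' + 1"] by auto

lemma G_T_mono: "l \<le> l' \<Longrightarrow> G_T l \<subseteq> G_T l'"
  unfolding G_T_def using polys_mono[of _ "l + 1" "l' + 1"] by auto

lemma perp_subset: "R_T_perp M l \<subseteq> vpolys l" "G_T_perp M l \<subseteq> vpolys l"
  by (auto simp: R_T_perp_def G_T_perp_def l2_compl_def)

lemma perp_subspace: "subspace (R_T_perp M l)" "subspace (G_T_perp M l)"
  unfolding R_T_perp_def G_T_perp_def
  using l2_space.subspace_l2_compl[OF l2_vpolys] R_T_subset G_T_subset by blast+

lemma direct_sum_R_T: "direct_sum (R_T (int k - 1)) (R_T_perp M k)"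
  unfolding R_T_perp_def
  by (rule l2_space.direct_sum_l2_compl[OF l2_vpolys R_T_subset subspace_R_T]) (simp add: R_T_mono)

lemma direct_sum_G_T: "direct_sum (G_T (int k - 1)) (G_T_perp M k)"
  unfolding G_T_perp_def
  by (rule l2_space.direct_sum_l2_compl[OF l2_vpolys G_T_subset subspace_G_T]) (simp add: G_T_mono)

text \<open>The curl part of a preimage may be dropped because it is divergence-free. Conversely, a
  divergence-free member of the complement is a curl and so orthogonal to itself.\<close>

lemma dvg_image_R_T_perp: "dvg ` R_T_perp M (l + 1) = polys l"
  and dvg_R_T_perp_eq_0: "v \<in> R_T_perp M l' \<Longrightarrow> dvg v = 0 \<Longrightarrow> v = 0"
proof -
  show "dvg ` R_T_perp M (l + 1) = polys l"
  proof
    show "dvg ` R_T_perp M (l + 1) \<subseteq> polys l" using dvg_polys[of _ "l + 1"] perp_subset(1)[of "l + 1"] by auto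
    show "polys l \<subseteq> dvg ` R_T_perp M (l + 1)"
    proof
      fix p assume p: "p \<in> polys l"
      obtain v where v: "v \<in> vpolys (l + 1)" "\<And>x. dvg v x = p x" using dvg_surj[OF p] by blast
      interpret l2_space "vol_measure M" T "vpolys (l + 1)" by (rule l2_vpolys)
      obtain w u where wu: "w \<in> R_T (l + 1)" "u \<in> R_T_perp M (l + 1)" "v = w + u"
        using l2_compl_dsum[OF subspace_R_T R_T_subset v(1)] unfolding R_T_perp_def by blast
      obtain z where z: "z \<in> vpolys (l + 1 + 1)" "w = curl z" using wu(1) by (auto simp: R_T_def)
      have "dvg v = dvg w + dvg u"
        unfolding wu(3) by (rule lin_on_add[OF lin_on_dvg]) (use wu R_T_subset perp_subset in blast)+
      moreover have "dvg w = 0" unfolding z(2) using dvg_curl[OF z(1)] by (auto simp: fun_eq_iff)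
      ultimately have "dvg u = p" using v(2) by (auto simp: fun_eq_iff)
      then show "p \<in> dvg ` R_T_perp M (l + 1)" using wu(2) by blast
    qed
  qed
  show "v = 0" if v: "v \<in> R_T_perp M l'" "dvg v = 0"
  proof -
    interpret l2_space "vol_measure M" T "vpolys l'" by (rule l2_vpolys)
    have vp: "v \<in> vpolys l'" using v(1) perp_subset by blast
    obtain w where "w \<in> vpolys (l' + 1)" "\<And>x. curl w x = v x"
      using exists_curl_potential[OF vp] v(2) by (auto simp: fun_eq_iff)
    then have "v \<in> R_T l'" unfolding R_T_def by (intro image_eqI[of _ _ w]) auto
    then show ?thesis using l2_compl_disj[OF R_T_subset] v(1) unfolding R_T_perp_def by blast
  qed
qed

text \<open>One place earlier in the sequence: the gradient part of a preimage has no curl, and a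
  curl-free member of the complement is a gradient, hence orthogonal to itself.\<close>

lemma curl_image_G_T_perp: "curl ` G_T_perp M (l + 1) = R_T l"
  and curl_G_T_perp_eq_0: "v \<in> G_T_perp M l' \<Longrightarrow> curl v = 0 \<Longrightarrow> v = 0"
proof -
  show "curl ` G_T_perp M (l + 1) = R_T l"
  proof
    show "curl ` G_T_perp M (l + 1) \<subseteq> R_T l" using perp_subset(2)[of "l + 1"] by (auto simp: R_T_def)
    show "R_T l \<subseteq> curl ` G_T_perp M (l + 1)"
    proof
      fix p assume "p \<in> R_T l"
      then obtain v where v: "v \<in> vpolys (l + 1)" "p = curl v" by (auto simp: R_T_def)
      interpret l2_space "vol_measure M" T "vpolys (l + 1)" by (rule l2_vpolys)
      obtain w u where wu: "w \<in> G_T (l + 1)" "u \<in> G_T_perp M (l + 1)" "v = w + u"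
        using l2_compl_dsum[OF subspace_G_T G_T_subset v(1)] unfolding G_T_perp_def by blast
      obtain z where z: "z \<in> polys (l + 1 + 1)" "w = grad z" using wu(1) by (auto simp: G_T_def)
      have "curl v = curl w + curl u"
        unfolding wu(3) by (rule lin_on_add[OF lin_on_curl]) (use wu G_T_subset perp_subset in blast)+
      moreover have "curl w = 0" unfolding z(2) curl_grad[OF z(1)] by (simp add: zero_fun_def)
      ultimately have "curl u = p" using v(2) by simp
      then show "p \<in> curl ` G_T_perp M (l + 1)" using wu(2) by blast
    qed
  qed
  show "v = 0" if v: "v \<in> G_T_perp M l'" "curl v = 0"
  proof -
    interpret l2_space "vol_measure M" T "vpolys l'" by (rule l2_vpolys)
    have vp: "v \<in> vpolys l'" using v(1) perp_subset by blast
    obtain q where "q \<in> polys (l' + 1)" "\<And>x. grad q x = v x"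
      using exists_grad_potential[OF vp] v(2) by (auto simp: fun_eq_iff)
    then have "v \<in> G_T l'" unfolding G_T_def by (intro image_eqI[of _ _ q]) auto
    then show ?thesis using l2_compl_disj[OF G_T_subset] v(1) unfolding G_T_perp_def by blast
  qed
qed

definition zero_mean_T :: "int \<Rightarrow> (pt \<Rightarrow> real) set" where
  "zero_mean_T l = {q \<in> polys l. int_T M q = 0}"

lemma zero_mean_T_props:
  assumes l: "0 \<le> l"
  shows "subspace (zero_mean_T l)" "grad ` zero_mean_T l = G_T (l - 1)"
    "q \<in> zero_mean_T l \<Longrightarrow> grad q = 0 \<Longrightarrow> q = 0"
proof -
  interpret flat_measure "vol_measure M" T by (rule flat_measure_cell(1))
  have lin: "lin_on (polys l) (int_T M)"
    unfolding int_T_def by (rule lin_on_integral[OF lin_on_id cont_ext_on_polys])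
  have pos: "0 < int_T M (\<lambda>x. 1)" unfolding int_T_def by (rule integral_one_pos[OF T_props(1)])
  have one: "(\<lambda>x. 1 :: real) \<in> polys l" using l by simp
  show "subspace (zero_mean_T l)"
    unfolding zero_mean_T_def
    by (rule subspaceI)
      (auto simp: lin_on_0[OF lin subspace_polys] lin_on_add[OF lin] lin_on_scale[OF lin]
        subspace_0 subspace_add subspace_scale)
  show "grad ` zero_mean_T l = G_T (l - 1)"
  proof
    show "grad ` zero_mean_T l \<subseteq> G_T (l - 1)" by (auto simp: G_T_def zero_mean_T_def)
    show "G_T (l - 1) \<subseteq> grad ` zero_mean_T l"
    proof
      fix w assume "w \<in> G_T (l - 1)"
      then obtain r where r: "r \<in> polys l" "w = grad r" by (auto simp: G_T_def)
      define m where "m = int_T M r / int_T M (\<lambda>x. 1)"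
      define s where "s = 1 *\<^sub>R r + (- m) *\<^sub>R (\<lambda>x. 1 :: real)"
      \<comment> \<open>\<open>m\<close> is the mean value of \<open>r\<close>, so \<open>s\<close>
        has mean zero; its gradient is that of \<open>r\<close>.\<close>
      have "int_T M s = int_T M r - m * int_T M (\<lambda>x. 1)"
        unfolding s_def lin_onD[OF lin r(1) one] by simp
      then have "int_T M s = 0" using pos by (simp add: m_def)
      moreover have "s \<in> polys l" unfolding s_def by (intro subspace_lin_comb subspace_polys r one)
      moreover have "grad s = grad r"
      proof -
        have "grad (\<lambda>x. 1) = 0" by (auto simp: fun_eq_iff vec_eq_iff grad_comp)
        then show ?thesis unfolding s_def lin_onD[OF lin_on_grad r(1) one] by simp
      qed
      ultimately show "w \<in> grad ` zero_mean_T l"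
        unfolding zero_mean_T_def r(2) by (intro image_eqI[of _ _ s]) auto
    qed
  qed
  show "q = 0" if q: "q \<in> zero_mean_T l" "grad q = 0"
  proof -
    have qp: "q \<in> polys l" "int_T M q = 0" using q(1) by (auto simp: zero_mean_T_def)
    have c: "q x = q 0" for x by (rule grad_eq_0[OF qp(1)]) (simp add: q(2))
    then have "int_T M q = int_T M (\<lambda>x. q 0 * 1)" by (metis mult.right_neutral)
    also have "\<dots> = q 0 * int_T M (\<lambda>x. 1)" by (simp add: int_T_def)
    finally have "q 0 = 0" using qp(2) pos by simp
    then show ?thesis using c by (auto simp: fun_eq_iff)
  qed
qed

end

section \<open>Linear dependence on the degrees of freedom\<close>

context polyhedron
begin

lemma face_sum_lin:
  fixes L :: "pt set \<Rightarrow> 'q::real_vector \<Rightarrow> pt \<Rightarrow> 'b::real_inner"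
  assumes "\<And>F. F \<in> faces M \<Longrightarrow> lin_on Q (L F)" "\<And>F q. F \<in> faces M \<Longrightarrow> q \<in> Q \<Longrightarrow> cont_ext_on F (L F q)"
    and "\<And>F. F \<in> faces M \<Longrightarrow> cont_ext_on F (h F)"
  shows "lin_on Q (\<lambda>q. \<Sum>F\<in>faces M. omega_TF M F * int_F M F (\<lambda>x. L F q x \<bullet> h F x))"
    "lin_on Q (\<lambda>q. \<Sum>F\<in>faces M. omega_TF M F * int_F M F (\<lambda>x. h F x \<bullet> L F q x))"
proof -
  show "lin_on Q (\<lambda>q. \<Sum>F\<in>faces M. omega_TF M F * int_F M F (\<lambda>x. L F q x \<bullet> h F x))"
    unfolding int_F_def real_scaleR_def[symmetric]
    by (intro lin_on_sum_fun lin_on_scale_fun flat_measure.lin_on_integral_left[OF flat_measure_face(1)] assms)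
  then show "lin_on Q (\<lambda>q. \<Sum>F\<in>faces M. omega_TF M F * int_F M F (\<lambda>x. h F x \<bullet> L F q x))"
    by (simp add: inner_commute)
qed

lemma face_sum_lin_mult:
  assumes "\<And>F. F \<in> faces M \<Longrightarrow> lin_on Q (L F)" "\<And>F q. F \<in> faces M \<Longrightarrow> q \<in> Q \<Longrightarrow> cont_ext_on F (L F q)"
    and "\<And>F. F \<in> faces M \<Longrightarrow> cont_ext_on F (h F)"
  shows "lin_on Q (\<lambda>q. \<Sum>F\<in>faces M. omega_TF M F * int_F M F (\<lambda>x. L F q x * h F x))"
    "lin_on Q (\<lambda>q. \<Sum>F\<in>faces M. omega_TF M F * int_F M F (\<lambda>x. h F x * L F q x))"
  using face_sum_lin[of Q L h, OF assms] by simp_all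

lemma subspace_polys_family: "subspace (polys_family l \<X>)"
  unfolding polys_family_def subspace_def using subspace_polys_on[of l]
  by (auto simp: subspace_def plus_fun_def scaleR_fun_def zero_fun_def)

lemma restr_lin: "restr X (a *\<^sub>R f + b *\<^sub>R g) = a *\<^sub>R restr X f + b *\<^sub>R restr X (g :: pt \<Rightarrow> 'b::real_vector)"
  by (rule lin_onD[OF lin_on_restr[of UNIV]]) auto

lemma subspace_polys_c: "subspace (polys_c l \<E>)"
proof (rule subspaceI)
  have "restr E 0 \<in> polys_on l E" for E :: "pt set"
    using polys_onI[OF polys_0[of l], of E] by (simp add: zero_fun_def)
  then show "0 \<in> polys_c l \<E>" by (simp add: polys_c_def zero_fun_def)
next
  fix p q assume "p \<in> polys_c l \<E>" "q \<in> polys_c l \<E>"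
  then show "p + q \<in> polys_c l \<E>"
    using restr_lin[of _ 1 p 1 q] subspace_add[OF subspace_polys_on[of l]]
    by (auto simp: polys_c_def plus_fun_def[of p q] intro!: continuous_intros)
next
  fix c p assume "p \<in> polys_c l \<E>"
  then show "c *\<^sub>R p \<in> polys_c l \<E>"
    using restr_lin[of _ c p 0 p] subspace_scale[OF subspace_polys_on[of l], of _ _ c]
    by (auto simp: polys_c_def scaleR_fun_def[of c p] intro!: continuous_intros)
qed

lemma subspace_X_grad_T: "subspace (X_grad_T M k)"
  unfolding X_grad_T_def by (intro subspace_Times subspace_polys subspace_polys_family subspace_polys_c)

lemma subspace_X_curl_T: "subspace (X_curl_T M k)"
proof -
  have d: "subspace (dsum (R_F M (int k - 1) F) (R_F_perp M k F))" if "F \<in> faces M" for F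
    by (rule subspace_dsum[OF direct_sum.subspace_A[OF direct_sum_F[OF that]] direct_sum.subspace_B[OF direct_sum_F[OF that]]])
  have "subspace {v. (\<forall>F\<in>faces M. v F \<in> dsum (R_F M (int k - 1) F) (R_F_perp M k F)) \<and> (\<forall>F. F \<notin> faces M \<longrightarrow> v F = 0)}"
    unfolding subspace_def using d
    by (auto simp: subspace_def plus_fun_def scaleR_fun_def zero_fun_def)
  then show ?thesis unfolding X_curl_T_def
    by (intro subspace_Times subspace_dsum subspace_R_T perp_subspace subspace_polys_family)
qed

lemma subspace_X_div_T: "subspace (X_div_T M k)"
  unfolding X_div_T_def
  by (intro subspace_Times subspace_dsum subspace_G_T perp_subspace subspace_polys_family)

lemma lin_on_fst: "lin_on Q fst" and lin_on_snd: "lin_on Q snd"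
  by (auto simp: lin_on_def)

lemma lin_on_apply: "lin_on Q L \<Longrightarrow> lin_on Q (\<lambda>q. L q F)"
  by (auto simp: lin_on_def plus_fun_def scaleR_fun_def)

lemma lin_on_fst': "lin_on Q L \<Longrightarrow> lin_on Q (\<lambda>q. fst (L q))"
  and lin_on_snd': "lin_on Q L \<Longrightarrow> lin_on Q (\<lambda>q. snd (L q))"
  by (auto simp: lin_on_def)

lemma rel_frontier_skeleton: "F \<in> faces M \<Longrightarrow> skeleton (edges_of M F) = rel_frontier F"
  using rel_front_F by (simp add: skeleton_def)

text \<open>The relative frontier is the skeleton of the edges of the face, so cutting off with
  \<open>restr\<close> keeps continuity on exactly the set where it is required.\<close>

lemma polys_c_restrict:
  assumes F: "F \<in> faces M" and q: "q \<in> polys_c l (edges M)"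
  shows "restr (rel_frontier F) q \<in> polys_c l (edges_of M F)"
proof -
  have sub: "rel_frontier F \<subseteq> skeleton (edges M)"
  proof -
    have "skeleton (edges_of M F) \<subseteq> skeleton (edges M)" unfolding skeleton_def edges_of_def by blast
    then show ?thesis unfolding rel_frontier_skeleton[OF F] .
  qed
  have "continuous_on (rel_frontier F) q" using q sub continuous_on_subset by (auto simp: polys_c_def)
  then have "continuous_on (rel_frontier F) (restr (rel_frontier F) q)"
    by (rule continuous_on_eq) (simp add: restr_def)
  moreover have "restr E (restr (rel_frontier F) q) = restr E q" if "E \<in> edges_of M F" for E
    using edges_ofD(2)[OF that] by (auto simp: restr_def fun_eq_iff)
  ultimately show ?thesis
    using q edges_ofD(1) unfolding polys_c_def rel_frontier_skeleton[OF F] by (auto simp: restr_def[of "rel_frontier F"])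
qed

lemma scaleR_fun_apply: "(c *\<^sub>R f) x = c *\<^sub>R f x"
  by (simp add: scaleR_fun_def)

lemma grad_to_face_props:
  assumes F: "F \<in> faces M"
  shows "lin_on (X_grad_T M k) (grad_to_face F)" "grad_to_face F ` X_grad_T M k \<subseteq> X_grad_F M k F"
proof -
  have eq: "grad_to_face F q = (fst (snd q) F, restr (rel_frontier F) (snd (snd q)))" for q
    by (simp add: grad_to_face_def case_prod_unfold)
  show "lin_on (X_grad_T M k) (grad_to_face F)"
    by (rule lin_onI)
      (simp only: eq fst_add snd_add fst_scaleR snd_scaleR restr_lin plus_fun_apply scaleR_fun_apply add_Pair scaleR_Pair)
  show "grad_to_face F ` X_grad_T M k \<subseteq> X_grad_F M k F"
  proof (rule image_subsetI)
    fix q assume q: "q \<in> X_grad_T M k"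
    have "fst (snd q) F \<in> polys_on (int k - 1) F"
      using q F by (simp add: X_grad_T_def mem_Times_iff polys_family_def)
    moreover have "snd (snd q) \<in> polys_c (int k + 1) (edges M)" using q by (simp add: X_grad_T_def mem_Times_iff)
    ultimately show "grad_to_face F q \<in> X_grad_F M k F"
      unfolding eq X_grad_F_def mem_Times_iff fst_conv snd_conv by (intro conjI polys_c_restrict[OF F])
  qed
qed

lemma curl_to_face_props:
  assumes F: "F \<in> faces M"
  shows "lin_on (X_curl_T M k) (curl_to_face M F)" "curl_to_face M F ` X_curl_T M k \<subseteq> X_rot_F k F"
proof -
  have eq: "curl_to_face M F v = (fst (snd v) F, \<lambda>E. if E \<in> edges_of M F then snd (snd v) E else 0)" for v
    by (simp add: curl_to_face_def case_prod_unfold)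
  show "lin_on (X_curl_T M k) (curl_to_face M F)"
  proof (rule lin_onI)
    fix v w :: curl_T_dofs and a b :: real
    have "(\<lambda>E. if E \<in> edges_of M F then snd (snd (a *\<^sub>R v + b *\<^sub>R w)) E else 0)
      = a *\<^sub>R (\<lambda>E. if E \<in> edges_of M F then snd (snd v) E else 0)
        + b *\<^sub>R (\<lambda>E. if E \<in> edges_of M F then snd (snd w) E else 0)"
      by (rule ext) (simp only: snd_add snd_scaleR plus_fun_apply scaleR_fun_apply scaleR_zero_right add_0 split: if_splits, simp)
    then show "curl_to_face M F (a *\<^sub>R v + b *\<^sub>R w) = a *\<^sub>R curl_to_face M F v + b *\<^sub>R curl_to_face M F w"
      by (simp only: eq fst_add fst_scaleR snd_add snd_scaleR plus_fun_apply scaleR_fun_apply add_Pair scaleR_Pair)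
  qed
  show "curl_to_face M F ` X_curl_T M k \<subseteq> X_rot_F k F"
  proof (rule image_subsetI)
    fix v assume v: "v \<in> X_curl_T M k"
    have "fst (snd v) F \<in> dsum (R_F M (int k - 1) F) (R_F_perp M k F)"
      using v F by (simp add: X_curl_T_def mem_Times_iff)
    moreover have "snd (snd v) E \<in> polys_on k E" if "E \<in> edges_of M F" for E
      using v edges_ofD(1)[OF that] by (simp add: X_curl_T_def mem_Times_iff polys_family_def)
    ultimately show "curl_to_face M F v \<in> X_rot_F k F"
      unfolding eq X_rot_F_def mem_Times_iff fst_conv snd_conv by simp
  qed
qed

lemma tangential_trace_dofs_props:
  assumes F: "F \<in> faces M"
  shows "lin_on (X_curl_T M k) (\<lambda>v. tangential_reconstruction M k F (curl_to_face M F v))"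
    "v \<in> X_curl_T M k \<Longrightarrow> cont_ext_on F (tangential_reconstruction M k F (curl_to_face M F v))"
proof -
  show "lin_on (X_curl_T M k) (\<lambda>v. tangential_reconstruction M k F (curl_to_face M F v))"
    by (rule lin_on_comp[OF curl_to_face_props(1)[OF F] tangential_reconstruction_props(1)[OF F] curl_to_face_props(2)[OF F]])
  show "cont_ext_on F (tangential_reconstruction M k F (curl_to_face M F v))" if v: "v \<in> X_curl_T M k"
  proof -
    have "curl_to_face M F v \<in> X_rot_F k F" by (rule subsetD[OF curl_to_face_props(2)[OF F] imageI[OF v]])
    from l2_space.cont_S[OF l2_tpolys_on[OF F] tangential_reconstruction_props(2)[OF F this]] show ?thesis .
  qed
qed

lemma R_part_T_props:
  shows "lin_on (X_curl_T M k) (\<lambda>v. R_part_T M k (fst v))" "lin_on (X_curl_T M k) (\<lambda>v. R_perp_part_T M k (fst v))"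
    "v \<in> X_curl_T M k \<Longrightarrow> R_part_T M k (fst v) \<in> R_T (int k - 1)"
    "v \<in> X_curl_T M k \<Longrightarrow> R_perp_part_T M k (fst v) \<in> R_T_perp M k"
    "v \<in> X_curl_T M k \<Longrightarrow> R_part_T M k (fst v) + R_perp_part_T M k (fst v) = fst v"
    "v \<in> X_curl_T M k \<Longrightarrow> fst v \<in> vpolys k"
proof -
  interpret direct_sum "R_T (int k - 1)" "R_T_perp M k" by (rule direct_sum_R_T)
  have f: "fst ` X_curl_T M k \<subseteq> dsum (R_T (int k - 1)) (R_T_perp M k)" by (auto simp: X_curl_T_def)
  show "lin_on (X_curl_T M k) (\<lambda>v. R_part_T M k (fst v))" "lin_on (X_curl_T M k) (\<lambda>v. R_perp_part_T M k (fst v))"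
    unfolding R_part_T_def R_perp_part_T_def
    using lin_on_comp[OF lin_on_fst lin_on_dsum_fst f] lin_on_comp[OF lin_on_fst lin_on_dsum_snd f] by auto
  show 1: "R_part_T M k (fst v) \<in> R_T (int k - 1)" and 2: "R_perp_part_T M k (fst v) \<in> R_T_perp M k"
    and 3: "R_part_T M k (fst v) + R_perp_part_T M k (fst v) = fst v" if v: "v \<in> X_curl_T M k" for v
  proof -
    have "fst v \<in> dsum (R_T (int k - 1)) (R_T_perp M k)" by (rule subsetD[OF f imageI[OF v]])
    note d = dsum_fst_in[OF this] dsum_snd_in[OF this] dsum_fst_snd[OF this]
    show "R_part_T M k (fst v) \<in> R_T (int k - 1)" "R_perp_part_T M k (fst v) \<in> R_T_perp M k"
      "R_part_T M k (fst v) + R_perp_part_T M k (fst v) = fst v"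
      unfolding R_part_T_def R_perp_part_T_def by (rule d(1), rule d(2), rule d(3))
  qed
  show "fst v \<in> vpolys k" if v: "v \<in> X_curl_T M k"
  proof -
    have "R_part_T M k (fst v) \<in> vpolys k" using 1[OF v] R_T_subset[of k] R_T_mono[of "int k - 1" k] by auto
    moreover have "R_perp_part_T M k (fst v) \<in> vpolys k" by (rule subsetD[OF perp_subset(1) 2[OF v]])
    ultimately have "R_part_T M k (fst v) + R_perp_part_T M k (fst v) \<in> vpolys k"
      by (rule subspace_add[OF subspace_vpolys])
    then show ?thesis unfolding 3[OF v] .
  qed
qed

lemma G_part_T_props:
  shows "lin_on (X_div_T M k) (\<lambda>v. G_perp_part_T M k (fst v))"
    "v \<in> X_div_T M k \<Longrightarrow> G_perp_part_T M k (fst v) \<in> G_T_perp M k"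
    "v \<in> X_div_T M k \<Longrightarrow> \<exists>g\<in>G_T (int k - 1). g + G_perp_part_T M k (fst v) = fst v"
    "v \<in> X_div_T M k \<Longrightarrow> fst v \<in> vpolys k"
proof -
  interpret direct_sum "G_T (int k - 1)" "G_T_perp M k" by (rule direct_sum_G_T)
  have f: "fst ` X_div_T M k \<subseteq> dsum (G_T (int k - 1)) (G_T_perp M k)" by (auto simp: X_div_T_def)
  show "lin_on (X_div_T M k) (\<lambda>v. G_perp_part_T M k (fst v))"
    unfolding G_perp_part_T_def using lin_on_comp[OF lin_on_fst lin_on_dsum_snd f] by auto
  show 1: "G_perp_part_T M k (fst v) \<in> G_T_perp M k"
    and 2: "\<exists>g\<in>G_T (int k - 1). g + G_perp_part_T M k (fst v) = fst v" if v: "v \<in> X_div_T M k" for v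
  proof -
    have "fst v \<in> dsum (G_T (int k - 1)) (G_T_perp M k)" by (rule subsetD[OF f imageI[OF v]])
    note d = dsum_fst_in[OF this] dsum_snd_in[OF this] dsum_fst_snd[OF this]
    show "G_perp_part_T M k (fst v) \<in> G_T_perp M k" unfolding G_perp_part_T_def by (rule d(2))
    show "\<exists>g\<in>G_T (int k - 1). g + G_perp_part_T M k (fst v) = fst v"
      unfolding G_perp_part_T_def
      by (rule bexI[of _ "dsum_fst (G_T (int k - 1)) (G_T_perp M k) (fst v)"]) (rule d(3), rule d(1))
  qed
  show "fst v \<in> vpolys k" if v: "v \<in> X_div_T M k"
  proof -
    obtain g where g: "g \<in> G_T (int k - 1)" "g + G_perp_part_T M k (fst v) = fst v" using 2[OF v] by blast
    have "g \<in> vpolys k" using g(1) G_T_subset[of k] G_T_mono[of "int k - 1" k] by auto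
    moreover have "G_perp_part_T M k (fst v) \<in> vpolys k" by (rule subsetD[OF perp_subset(2) 1[OF v]])
    ultimately have "g + G_perp_part_T M k (fst v) \<in> vpolys k" by (rule subspace_add[OF subspace_vpolys])
    then show ?thesis unfolding g(2) .
  qed
qed

section \<open>Curl and vector potential on the cell\<close>

lemma full_curl_props:
  shows "lin_on (X_curl_T M k) (full_curl M k)" "v \<in> X_curl_T M k \<Longrightarrow> full_curl M k v \<in> vpolys k"
    "v \<in> X_curl_T M k \<Longrightarrow> p \<in> vpolys k \<Longrightarrow>
      (\<And>w. w \<in> vpolys k \<Longrightarrow> int_T M (\<lambda>x. p x \<bullet> w x) = int_T M (\<lambda>x. fst v x \<bullet> curl w x)
            + (\<Sum>F\<in>faces M. omega_TF M F *
                int_F M F (\<lambda>x. tangential_reconstruction M k F (curl_to_face M F v) x \<bullet> cross3 (w x) (fnormal M F)))) \<Longrightarrow>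
      full_curl M k v = p"
proof -
  interpret l2_space "vol_measure M" T "vpolys k" by (rule l2_vpolys)
  define \<Phi> where "\<Phi> v w = int_T M (\<lambda>x. fst v x \<bullet> curl w x)
            + (\<Sum>F\<in>faces M. omega_TF M F *
                int_F M F (\<lambda>x. tangential_reconstruction M k F (curl_to_face M F v) x \<bullet> cross3 (w x) (fnormal M F)))" for v w
  have lin: "lin_on (X_curl_T M k) (\<lambda>v. \<Phi> v w)" if w: "w \<in> vpolys k" for w
    unfolding \<Phi>_def int_T_def
    by (intro lin_on_add_fun lin_on_integral_left face_sum_lin(1) lin_on_fst tangential_trace_dofs_props
        cont_ext_on_vpolys[OF R_part_T_props(6)] cont_ext_on_vpolys[OF curl_vpolys[OF w]]
        cont_ext_on_vpolys[OF vpolys_cross3_const(1)[OF w]])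
  have lin2: "lin_on (vpolys k) (\<Phi> v)" if v: "v \<in> X_curl_T M k" for v
    unfolding \<Phi>_def int_T_def
    by (intro lin_on_add_fun lin_on_integral_right face_sum_lin(2) lin_on_curl tangential_trace_dofs_props(2)[OF _ v]
        cont_ext_on_vpolys[OF R_part_T_props(6)[OF v]] cont_ext_on_vpolys[OF curl_vpolys]
        cont_ext_on_vpolys[OF vpolys_cross3_const(1)] lin_on_pointwise[OF lin_on_id linear_cross3_left])
  have ex1: "\<exists>!p. p \<in> vpolys k \<and> (\<forall>w\<in>vpolys k. ip p w = \<Phi> v w)" if "v \<in> X_curl_T M k" for v
    by (rule ex1_riesz_surj[OF subspace_vpolys lin_on_id _ lin2[OF that]])
      (use lin_on_0[OF lin2[OF that] subspace_vpolys] in auto)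
  have op: "full_curl M k v = (THE p. p \<in> vpolys k \<and> (\<forall>w\<in>vpolys k. ip p w = \<Phi> v w))" for v
    by (simp add: full_curl_def ip_def int_T_def \<Phi>_def)
  have ran: "(\<lambda>w. w) ` vpolys k \<subseteq> vpolys k" by simp
  show "lin_on (X_curl_T M k) (full_curl M k)"
    by (rule reconstruction_props(1)[OF subspace_X_curl_T ex1 ran lin op])
  show "full_curl M k v \<in> vpolys k" if "v \<in> X_curl_T M k"
    by (rule reconstruction_props(2)[OF subspace_X_curl_T ex1 ran lin op that])
  show "full_curl M k v = p" if vp: "v \<in> X_curl_T M k" "p \<in> vpolys k"
    and eq: "\<And>w. w \<in> vpolys k \<Longrightarrow> int_T M (\<lambda>x. p x \<bullet> w x) = int_T M (\<lambda>x. fst v x \<bullet> curl w x)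
            + (\<Sum>F\<in>faces M. omega_TF M F *
                int_F M F (\<lambda>x. tangential_reconstruction M k F (curl_to_face M F v) x \<bullet> cross3 (w x) (fnormal M F)))"
  proof (rule reconstruction_props(4)[OF subspace_X_curl_T ex1 ran lin op vp])
    show "ip p a = \<Phi> v a" if "a \<in> vpolys k" for a
      using eq[OF that] by (simp add: ip_def int_T_def \<Phi>_def)
  qed
qed

text \<open>Since \<open>curl\<close> is injective on \<open>G_T_perp M (int k + 1)\<close>, the
  compatibility condition is void. The criterion in the last part is stated for all of
  \<open>vpolys (int k + 1)\<close>, the form in which Green's formula supplies it.\<close>

lemma P_curl_T_props:
  shows "lin_on (X_curl_T M k) (P_curl_T M k)" "v \<in> X_curl_T M k \<Longrightarrow> P_curl_T M k v \<in> vpolys k"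
    "v \<in> X_curl_T M k \<Longrightarrow> w \<in> R_T_perp M k \<Longrightarrow>
      int_T M (\<lambda>x. P_curl_T M k v x \<bullet> w x) = int_T M (\<lambda>x. R_perp_part_T M k (fst v) x \<bullet> w x)"
    "v \<in> X_curl_T M k \<Longrightarrow> p \<in> vpolys k \<Longrightarrow>
      (\<And>w. w \<in> vpolys (int k + 1) \<Longrightarrow> int_T M (\<lambda>x. p x \<bullet> curl w x) = int_T M (\<lambda>x. full_curl M k v x \<bullet> w x)
            - (\<Sum>F\<in>faces M. omega_TF M F *
                int_F M F (\<lambda>x. tangential_reconstruction M k F (curl_to_face M F v) x \<bullet> cross3 (w x) (fnormal M F)))) \<Longrightarrow>
      (\<And>w. w \<in> R_T_perp M k \<Longrightarrow> int_T M (\<lambda>x. p x \<bullet> w x) = int_T M (\<lambda>x. R_perp_part_T M k (fst v) x \<bullet> w x)) \<Longrightarrow>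
      P_curl_T M k v = p"
proof -
  interpret l2_space "vol_measure M" T "vpolys k" by (rule l2_vpolys)
  let ?A = "G_T_perp M (int k + 1)" and ?C = "R_T_perp M k"
  define \<Phi> where "\<Phi> v w = int_T M (\<lambda>x. full_curl M k v x \<bullet> w x)
            - (\<Sum>F\<in>faces M. omega_TF M F *
                int_F M F (\<lambda>x. tangential_reconstruction M k F (curl_to_face M F v) x \<bullet> cross3 (w x) (fnormal M F)))" for v w
  define \<Psi> where "\<Psi> v w = int_T M (\<lambda>x. R_perp_part_T M k (fst v) x \<bullet> w x)" for v :: curl_T_dofs and w
  have A: "?A \<subseteq> vpolys (int k + 1)" "subspace ?A" by (rule perp_subset(2), rule perp_subspace(2))
  have Rc: "cont_ext_on T (R_perp_part_T M k (fst v))" if "v \<in> X_curl_T M k" for v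
    using R_part_T_props(4)[OF that] perp_subset(1) cont_ext_on_vpolys by blast
  have lin: "lin_on (X_curl_T M k) (\<lambda>v. \<Phi> v w)" if w: "w \<in> ?A" for w
  proof -
    have w: "w \<in> vpolys (int k + 1)" using w A by blast
    show ?thesis unfolding \<Phi>_def int_T_def
    by (intro lin_on_diff_fun lin_on_integral_left face_sum_lin(1) full_curl_props(1) tangential_trace_dofs_props
        cont_ext_on_vpolys[OF full_curl_props(2)] cont_ext_on_vpolys[OF w]
        cont_ext_on_vpolys[OF vpolys_cross3_const(1)[OF w]])
  qed
  have lin': "lin_on (X_curl_T M k) (\<lambda>v. \<Psi> v w)" if w: "w \<in> ?C" for w
    unfolding \<Psi>_def int_T_def
    by (intro lin_on_integral_left R_part_T_props(2) Rc) (use w perp_subset(1) cont_ext_on_vpolys in blast)+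
  have lin2: "lin_on ?A (\<Phi> v)" if v: "v \<in> X_curl_T M k" for v
  proof -
    have "lin_on (vpolys (int k + 1)) (\<Phi> v)" unfolding \<Phi>_def int_T_def
    by (intro lin_on_diff_fun lin_on_integral_right face_sum_lin(2) lin_on_id tangential_trace_dofs_props(2)[OF _ v]
        cont_ext_on_vpolys[OF full_curl_props(2)[OF v]] cont_ext_on_vpolys
        cont_ext_on_vpolys[OF vpolys_cross3_const(1)] lin_on_pointwise[OF lin_on_id linear_cross3_left])
    then show ?thesis by (rule lin_on_subset[OF _ A(1)])
  qed
  have lin2': "lin_on ?C (\<Psi> v)" if v: "v \<in> X_curl_T M k" for v
    unfolding \<Psi>_def int_T_def
    by (intro lin_on_integral_right lin_on_id Rc[OF v]) (use perp_subset(1) cont_ext_on_vpolys in blast)+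
  have im: "curl ` ?A = R_T k" by (rule curl_image_G_T_perp)
  have ex1: "\<exists>!p. p \<in> vpolys k \<and> (\<forall>w\<in>?A. ip p (curl w) = \<Phi> v w) \<and> (\<forall>w\<in>?C. ip p w = \<Psi> v w)"
    if v: "v \<in> X_curl_T M k" for v
    unfolding R_T_perp_def
  proof (rule ex1_riesz_pair[OF A(2) lin_on_subset[OF lin_on_curl A(1)] im R_T_subset lin2[OF v]])
    show "\<Phi> v a = 0" if "a \<in> ?A" "curl a = 0" for a
      using curl_G_T_perp_eq_0[OF that] lin_on_0[OF lin2[OF v] A(2)] by simp
  qed (rule lin2'[OF v, unfolded R_T_perp_def])
  have op: "P_curl_T M k v = (THE p. p \<in> vpolys k \<and> (\<forall>w\<in>?A. ip p (curl w) = \<Phi> v w) \<and> (\<forall>w\<in>?C. ip p w = \<Psi> v w))" for v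
    by (simp add: P_curl_T_def ip_def int_T_def \<Phi>_def \<Psi>_def)
  have ran: "curl ` ?A \<subseteq> vpolys k" unfolding im by (rule R_T_subset)
  note C = perp_subset(1)[of k]
  show "lin_on (X_curl_T M k) (P_curl_T M k)"
    by (rule reconstruction_pair_props(1)[OF subspace_X_curl_T ex1 ran C lin lin' op])
  show "P_curl_T M k v \<in> vpolys k" if "v \<in> X_curl_T M k"
    by (rule reconstruction_pair_props(2)[OF subspace_X_curl_T ex1 ran C lin lin' op that])
  show "int_T M (\<lambda>x. P_curl_T M k v x \<bullet> w x) = int_T M (\<lambda>x. R_perp_part_T M k (fst v) x \<bullet> w x)"
    if "v \<in> X_curl_T M k" "w \<in> R_T_perp M k"
  proof -
    have "ip (P_curl_T M k v) w = \<Psi> v w"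
      by (rule reconstruction_pair_props(4)[OF subspace_X_curl_T ex1 ran C lin lin' op that])
    then show ?thesis by (simp add: ip_def int_T_def \<Psi>_def)
  qed
  show "P_curl_T M k v = p" if vp: "v \<in> X_curl_T M k" "p \<in> vpolys k"
    and eq: "\<And>w. w \<in> vpolys (int k + 1) \<Longrightarrow> int_T M (\<lambda>x. p x \<bullet> curl w x) = int_T M (\<lambda>x. full_curl M k v x \<bullet> w x)
            - (\<Sum>F\<in>faces M. omega_TF M F *
                int_F M F (\<lambda>x. tangential_reconstruction M k F (curl_to_face M F v) x \<bullet> cross3 (w x) (fnormal M F)))"
    and eq': "\<And>w. w \<in> R_T_perp M k \<Longrightarrow> int_T M (\<lambda>x. p x \<bullet> w x) = int_T M (\<lambda>x. R_perp_part_T M k (fst v) x \<bullet> w x)"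
  proof (rule reconstruction_pair_props(5)[OF subspace_X_curl_T ex1 ran C lin lin' op vp])
    show "ip p (curl w) = \<Phi> v w" if "w \<in> ?A" for w
      using eq[of w] that A(1) by (auto simp: ip_def int_T_def \<Phi>_def)
    show "ip p w = \<Psi> v w" if "w \<in> ?C" for w using eq'[OF that] by (simp add: ip_def int_T_def \<Psi>_def)
  qed
qed

section \<open>Divergence and its potential on the cell\<close>

lemma face_comp_props:
  assumes "F \<in> faces M"
  shows "lin_on (X_div_T M k) (\<lambda>v. snd v F)" "v \<in> X_div_T M k \<Longrightarrow> cont_ext_on F (snd v F)"
proof -
  show "lin_on (X_div_T M k) (\<lambda>v. snd v F)" by (rule lin_on_apply[OF lin_on_snd])
  show "cont_ext_on F (snd v F)" if "v \<in> X_div_T M k"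
    using that assms by (intro polys_on_cont[of _ k]) (auto simp: X_div_T_def polys_family_def)
qed

lemma divergence_props:
  shows "lin_on (X_div_T M k) (divergence M k)" "v \<in> X_div_T M k \<Longrightarrow> divergence M k v \<in> polys k"
    "v \<in> X_div_T M k \<Longrightarrow> q \<in> polys k \<Longrightarrow>
      int_T M (\<lambda>x. divergence M k v x * q x) = - int_T M (\<lambda>x. fst v x \<bullet> grad q x)
            + (\<Sum>F\<in>faces M. omega_TF M F * int_F M F (\<lambda>x. snd v F x * q x))"
    "v \<in> X_div_T M k \<Longrightarrow> p \<in> polys k \<Longrightarrow>
      (\<And>q. q \<in> polys k \<Longrightarrow> int_T M (\<lambda>x. p x * q x) = - int_T M (\<lambda>x. fst v x \<bullet> grad q x)
            + (\<Sum>F\<in>faces M. omega_TF M F * int_F M F (\<lambda>x. snd v F x * q x))) \<Longrightarrow>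
      divergence M k v = p"
proof -
  interpret l2_space "vol_measure M" T "polys k" by (rule l2_polys)
  \<comment> \<open>The minus sign is written as a scalar multiple so that the closure rules for
    \<open>lin_on\<close> apply.\<close>
  define \<Phi> where "\<Phi> v q = (-1) *\<^sub>R int_T M (\<lambda>x. fst v x \<bullet> grad q x)
            + (\<Sum>F\<in>faces M. omega_TF M F * int_F M F (\<lambda>x. snd v F x * q x))"
    for v :: div_T_dofs and q
  have lin: "lin_on (X_div_T M k) (\<lambda>v. \<Phi> v q)" if q: "q \<in> polys k" for q
    unfolding \<Phi>_def int_T_def
    by (intro lin_on_add_fun lin_on_scale_fun lin_on_integral_left face_sum_lin_mult(1) lin_on_fst face_comp_props
        cont_ext_on_vpolys[OF G_part_T_props(4)] cont_ext_on_vpolys[OF grad_vpolys[OF q]] cont_ext_on_polys[OF q])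
  have lin2: "lin_on (polys k) (\<Phi> v)" if v: "v \<in> X_div_T M k" for v
    unfolding \<Phi>_def int_T_def
    by (intro lin_on_add_fun lin_on_scale_fun lin_on_integral_right face_sum_lin_mult(2) lin_on_grad lin_on_id
        face_comp_props(2)[OF _ v] cont_ext_on_vpolys[OF G_part_T_props(4)[OF v]]
        cont_ext_on_vpolys[OF grad_vpolys] cont_ext_on_polys)
  have ex1: "\<exists>!p. p \<in> polys k \<and> (\<forall>q\<in>polys k. ip p q = \<Phi> v q)" if "v \<in> X_div_T M k" for v
    by (rule ex1_riesz_surj[OF subspace_polys lin_on_id _ lin2[OF that]])
      (use lin_on_0[OF lin2[OF that] subspace_polys] in auto)
  have op: "divergence M k v = (THE p. p \<in> polys k \<and> (\<forall>q\<in>polys k. ip p q = \<Phi> v q))" for v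
    by (simp add: divergence_def ip_def int_T_def \<Phi>_def)
  have ran: "(\<lambda>q. q) ` polys k \<subseteq> polys k" by simp
  show "lin_on (X_div_T M k) (divergence M k)"
    by (rule reconstruction_props(1)[OF subspace_X_div_T ex1 ran lin op])
  show "divergence M k v \<in> polys k" if "v \<in> X_div_T M k"
    by (rule reconstruction_props(2)[OF subspace_X_div_T ex1 ran lin op that])
  show "int_T M (\<lambda>x. divergence M k v x * q x) = - int_T M (\<lambda>x. fst v x \<bullet> grad q x)
            + (\<Sum>F\<in>faces M. omega_TF M F * int_F M F (\<lambda>x. snd v F x * q x))"
    if "v \<in> X_div_T M k" "q \<in> polys k"
  proof -
    have "ip (divergence M k v) q = \<Phi> v q"
      by (rule reconstruction_props(3)[OF subspace_X_div_T ex1 ran lin op that])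
    then show ?thesis by (simp add: ip_def int_T_def \<Phi>_def)
  qed
  show "divergence M k v = p" if vp: "v \<in> X_div_T M k" "p \<in> polys k"
    and eq: "\<And>q. q \<in> polys k \<Longrightarrow> int_T M (\<lambda>x. p x * q x) = - int_T M (\<lambda>x. fst v x \<bullet> grad q x)
            + (\<Sum>F\<in>faces M. omega_TF M F * int_F M F (\<lambda>x. snd v F x * q x))"
  proof (rule reconstruction_props(4)[OF subspace_X_div_T ex1 ran lin op vp])
    show "ip p a = \<Phi> v a" if "a \<in> polys k" for a
      using eq[OF that] by (simp add: ip_def int_T_def \<Phi>_def)
  qed
qed

text \<open>\<open>grad\<close> is injective on the zero-mean tests, so compatibility is void again.
  The relation in the third part is available for zero-mean tests only, which the definiteness proof
  has to respect; the criterion in the last part asks for more, because interpolated polynomials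
  satisfy it for every test.\<close>

lemma P_div_T_props:
  shows "lin_on (X_div_T M k) (P_div_T M k)" "v \<in> X_div_T M k \<Longrightarrow> P_div_T M k v \<in> vpolys k"
    "v \<in> X_div_T M k \<Longrightarrow> q \<in> polys (int k + 1) \<Longrightarrow> int_T M q = 0 \<Longrightarrow>
      int_T M (\<lambda>x. P_div_T M k v x \<bullet> grad q x) = - int_T M (\<lambda>x. divergence M k v x * q x)
            + (\<Sum>F\<in>faces M. omega_TF M F * int_F M F (\<lambda>x. snd v F x * q x))"
    "v \<in> X_div_T M k \<Longrightarrow> w \<in> G_T_perp M k \<Longrightarrow>
      int_T M (\<lambda>x. P_div_T M k v x \<bullet> w x) = int_T M (\<lambda>x. G_perp_part_T M k (fst v) x \<bullet> w x)"
    "v \<in> X_div_T M k \<Longrightarrow> p \<in> vpolys k \<Longrightarrow>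
      (\<And>q. q \<in> polys (int k + 1) \<Longrightarrow> int_T M (\<lambda>x. p x \<bullet> grad q x) = - int_T M (\<lambda>x. divergence M k v x * q x)
            + (\<Sum>F\<in>faces M. omega_TF M F * int_F M F (\<lambda>x. snd v F x * q x))) \<Longrightarrow>
      (\<And>w. w \<in> G_T_perp M k \<Longrightarrow> int_T M (\<lambda>x. p x \<bullet> w x) = int_T M (\<lambda>x. G_perp_part_T M k (fst v) x \<bullet> w x)) \<Longrightarrow>
      P_div_T M k v = p"
proof -
  interpret l2_space "vol_measure M" T "vpolys k" by (rule l2_vpolys)
  let ?A = "zero_mean_T (int k + 1)" and ?C = "G_T_perp M k"
  define \<Phi> where "\<Phi> v q = (-1) *\<^sub>R int_T M (\<lambda>x. divergence M k v x * q x)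
            + (\<Sum>F\<in>faces M. omega_TF M F * int_F M F (\<lambda>x. snd v F x * q x))" for v q
  define \<Psi> where "\<Psi> v w = int_T M (\<lambda>x. G_perp_part_T M k (fst v) x \<bullet> w x)" for v :: div_T_dofs and w
  have A: "?A \<subseteq> polys (int k + 1)" "subspace ?A" "grad ` ?A = G_T k"
    using zero_mean_T_props(1,2)[of "int k + 1"] by (auto simp: zero_mean_T_def)
  have Gc: "cont_ext_on T (G_perp_part_T M k (fst v))" if "v \<in> X_div_T M k" for v
    using G_part_T_props(2)[OF that] perp_subset(2) cont_ext_on_vpolys by blast
  have lin: "lin_on (X_div_T M k) (\<lambda>v. \<Phi> v q)" if q: "q \<in> ?A" for q
  proof -
    have q: "q \<in> polys (int k + 1)" using q A by blast
    show ?thesis unfolding \<Phi>_def int_T_def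
    by (intro lin_on_add_fun lin_on_scale_fun lin_on_integral_mult_left face_sum_lin_mult(1) divergence_props(1) face_comp_props
        cont_ext_on_polys[OF divergence_props(2)] cont_ext_on_polys[OF q])
  qed
  have lin': "lin_on (X_div_T M k) (\<lambda>v. \<Psi> v w)" if w: "w \<in> ?C" for w
    unfolding \<Psi>_def int_T_def
    by (intro lin_on_integral_left G_part_T_props(1) Gc) (use w perp_subset(2) cont_ext_on_vpolys in blast)+
  have lin2: "lin_on ?A (\<Phi> v)" if v: "v \<in> X_div_T M k" for v
  proof -
    have "lin_on (polys (int k + 1)) (\<Phi> v)" unfolding \<Phi>_def int_T_def
    by (intro lin_on_add_fun lin_on_scale_fun lin_on_integral_mult_right face_sum_lin_mult(2) lin_on_id
        face_comp_props(2)[OF _ v] cont_ext_on_polys[OF divergence_props(2)[OF v]] cont_ext_on_polys)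
    then show ?thesis by (rule lin_on_subset[OF _ A(1)])
  qed
  have lin2': "lin_on ?C (\<Psi> v)" if v: "v \<in> X_div_T M k" for v
    unfolding \<Psi>_def int_T_def
    by (intro lin_on_integral_right lin_on_id Gc[OF v]) (use perp_subset(2) cont_ext_on_vpolys in blast)+
  have ex1: "\<exists>!p. p \<in> vpolys k \<and> (\<forall>q\<in>?A. ip p (grad q) = \<Phi> v q) \<and> (\<forall>w\<in>?C. ip p w = \<Psi> v w)"
    if v: "v \<in> X_div_T M k" for v
    unfolding G_T_perp_def
  proof (rule ex1_riesz_pair[OF A(2) lin_on_subset[OF lin_on_grad A(1)] A(3) G_T_subset lin2[OF v]])
    show "\<Phi> v a = 0" if "a \<in> ?A" "grad a = 0" for a
      using zero_mean_T_props(3)[OF _ that] lin_on_0[OF lin2[OF v] A(2)] by simp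
  qed (rule lin2'[OF v, unfolded G_T_perp_def])
  have ball: "(\<forall>r\<in>polys (int k + 1). int_T M r = 0 \<longrightarrow> P r) \<longleftrightarrow> (\<forall>r\<in>?A. P r)" for P
    by (auto simp: zero_mean_T_def)
  have op: "P_div_T M k v = (THE p. p \<in> vpolys k \<and> (\<forall>q\<in>?A. ip p (grad q) = \<Phi> v q) \<and> (\<forall>w\<in>?C. ip p w = \<Psi> v w))" for v
    unfolding P_div_T_def ball by (simp add: ip_def int_T_def \<Phi>_def \<Psi>_def)
  have ran: "grad ` ?A \<subseteq> vpolys k" unfolding A(3) by (rule G_T_subset)
  note C = perp_subset(2)[of k]
  show "lin_on (X_div_T M k) (P_div_T M k)"
    by (rule reconstruction_pair_props(1)[OF subspace_X_div_T ex1 ran C lin lin' op])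
  show "P_div_T M k v \<in> vpolys k" if "v \<in> X_div_T M k"
    by (rule reconstruction_pair_props(2)[OF subspace_X_div_T ex1 ran C lin lin' op that])
  show "int_T M (\<lambda>x. P_div_T M k v x \<bullet> grad q x) = - int_T M (\<lambda>x. divergence M k v x * q x)
            + (\<Sum>F\<in>faces M. omega_TF M F * int_F M F (\<lambda>x. snd v F x * q x))"
    if "v \<in> X_div_T M k" "q \<in> polys (int k + 1)" "int_T M q = 0"
  proof -
    have q: "q \<in> ?A" using that by (simp add: zero_mean_T_def)
    have "ip (P_div_T M k v) (grad q) = \<Phi> v q"
      by (rule reconstruction_pair_props(3)[OF subspace_X_div_T ex1 ran C lin lin' op that(1) q])
    then show ?thesis by (simp add: ip_def int_T_def \<Phi>_def)
  qed
  show "int_T M (\<lambda>x. P_div_T M k v x \<bullet> w x) = int_T M (\<lambda>x. G_perp_part_T M k (fst v) x \<bullet> w x)"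
    if "v \<in> X_div_T M k" "w \<in> G_T_perp M k"
  proof -
    have "ip (P_div_T M k v) w = \<Psi> v w"
      by (rule reconstruction_pair_props(4)[OF subspace_X_div_T ex1 ran C lin lin' op that])
    then show ?thesis by (simp add: ip_def int_T_def \<Psi>_def)
  qed
  show "P_div_T M k v = p" if vp: "v \<in> X_div_T M k" "p \<in> vpolys k"
    and eq: "\<And>q. q \<in> polys (int k + 1) \<Longrightarrow> int_T M (\<lambda>x. p x \<bullet> grad q x) = - int_T M (\<lambda>x. divergence M k v x * q x)
            + (\<Sum>F\<in>faces M. omega_TF M F * int_F M F (\<lambda>x. snd v F x * q x))"
    and eq': "\<And>w. w \<in> G_T_perp M k \<Longrightarrow> int_T M (\<lambda>x. p x \<bullet> w x) = int_T M (\<lambda>x. G_perp_part_T M k (fst v) x \<bullet> w x)"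
  proof (rule reconstruction_pair_props(5)[OF subspace_X_div_T ex1 ran C lin lin' op vp])
    show "ip p (grad q) = \<Phi> v q" if "q \<in> ?A" for q
      using eq[of q] that A(1) by (auto simp: ip_def int_T_def \<Phi>_def)
    show "ip p w = \<Psi> v w" if "w \<in> ?C" for w using eq'[OF that] by (simp add: ip_def int_T_def \<Psi>_def)
  qed
qed

end

section \<open>Gradient and scalar potential for a given scalar trace\<close>

locale polyhedron_with_trace = polyhedron +
  fixes k :: nat and \<gamma> :: "pt set \<Rightarrow> grad_F_dofs \<Rightarrow> pt \<Rightarrow> real"
  assumes trace: "scalar_trace M k \<gamma>"
begin

lemma trace_props:
  assumes F: "F \<in> faces M"
  shows "lin_on (X_grad_T M k) (\<lambda>q. \<gamma> F (grad_to_face F q))"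
    "q \<in> X_grad_T M k \<Longrightarrow> cont_ext_on F (\<gamma> F (grad_to_face F q))"
    "r \<in> polys (int k + 1) \<Longrightarrow> \<gamma> F (I_grad_F M k F r) = restr F r"
proof -
  note t = bspec[OF trace[unfolded scalar_trace_def] F]
  have "lin_on (X_grad_F M k F) (\<gamma> F)" unfolding lin_on_def by (rule conjunct1[OF conjunct2[OF t]])
  from lin_on_comp[OF grad_to_face_props(1)[OF F] this grad_to_face_props(2)[OF F]]
  show "lin_on (X_grad_T M k) (\<lambda>q. \<gamma> F (grad_to_face F q))" .
  show "cont_ext_on F (\<gamma> F (grad_to_face F q))" if q: "q \<in> X_grad_T M k"
    by (rule polys_on_cont[OF bspec[OF conjunct1[OF t] subsetD[OF grad_to_face_props(2)[OF F] imageI[OF q]]]])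
  show "\<gamma> F (I_grad_F M k F r) = restr F r" if r: "r \<in> polys (int k + 1)"
    by (rule bspec[OF conjunct1[OF conjunct2[OF conjunct2[OF t]]] r])
qed

lemma full_gradient_props:
  shows "lin_on (X_grad_T M k) (full_gradient M k \<gamma>)" "q \<in> X_grad_T M k \<Longrightarrow> full_gradient M k \<gamma> q \<in> vpolys k"
    "q \<in> X_grad_T M k \<Longrightarrow> p \<in> vpolys k \<Longrightarrow>
      (\<And>v. v \<in> vpolys k \<Longrightarrow> int_T M (\<lambda>x. p x \<bullet> v x) = - int_T M (\<lambda>x. fst q x * dvg v x)
            + (\<Sum>F\<in>faces M. omega_TF M F *
                int_F M F (\<lambda>x. \<gamma> F (grad_to_face F q) x * (v x \<bullet> fnormal M F)))) \<Longrightarrow>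
      full_gradient M k \<gamma> q = p"
proof -
  interpret l2_space "vol_measure M" T "vpolys k" by (rule l2_vpolys)
  define \<Phi> where "\<Phi> q v = (-1) *\<^sub>R int_T M (\<lambda>x. fst q x * dvg v x)
            + (\<Sum>F\<in>faces M. omega_TF M F *
                int_F M F (\<lambda>x. \<gamma> F (grad_to_face F q) x * (v x \<bullet> fnormal M F)))" for q v
  have q1: "fst q \<in> polys (int k - 1)" if "q \<in> X_grad_T M k" for q using that by (auto simp: X_grad_T_def)
  have linn: "linear (\<lambda>v. v \<bullet> n)" for n :: pt by (rule linearI) (simp_all add: inner_add_left)
  have lin: "lin_on (X_grad_T M k) (\<lambda>q. \<Phi> q v)" if v: "v \<in> vpolys k" for v
    unfolding \<Phi>_def int_T_def
    by (intro lin_on_add_fun lin_on_scale_fun lin_on_integral_mult_left face_sum_lin_mult(1) lin_on_fst trace_props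
        cont_ext_on_polys[OF q1] cont_ext_on_polys[OF dvg_polys[OF v]] cont_ext_on_polys[OF vpolys_inner_const[OF v]])
  have lin2: "lin_on (vpolys k) (\<Phi> q)" if q: "q \<in> X_grad_T M k" for q
    unfolding \<Phi>_def int_T_def
    by (intro lin_on_add_fun lin_on_scale_fun lin_on_integral_mult_right face_sum_lin_mult(2) lin_on_dvg
        trace_props(2)[OF _ q] cont_ext_on_polys[OF q1[OF q]] cont_ext_on_polys[OF dvg_polys]
        cont_ext_on_polys[OF vpolys_inner_const] lin_on_pointwise[OF lin_on_id linn])
  have ex1: "\<exists>!p. p \<in> vpolys k \<and> (\<forall>v\<in>vpolys k. ip p v = \<Phi> q v)" if "q \<in> X_grad_T M k" for q
    by (rule ex1_riesz_surj[OF subspace_vpolys lin_on_id _ lin2[OF that]])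
      (use lin_on_0[OF lin2[OF that] subspace_vpolys] in auto)
  have op: "full_gradient M k \<gamma> q = (THE p. p \<in> vpolys k \<and> (\<forall>v\<in>vpolys k. ip p v = \<Phi> q v))" for q
    by (simp add: full_gradient_def ip_def int_T_def \<Phi>_def)
  have ran: "(\<lambda>w. w) ` vpolys k \<subseteq> vpolys k" by simp
  show "lin_on (X_grad_T M k) (full_gradient M k \<gamma>)"
    by (rule reconstruction_props(1)[OF subspace_X_grad_T ex1 ran lin op])
  show "full_gradient M k \<gamma> q \<in> vpolys k" if "q \<in> X_grad_T M k"
    by (rule reconstruction_props(2)[OF subspace_X_grad_T ex1 ran lin op that])
  show "full_gradient M k \<gamma> q = p" if vp: "q \<in> X_grad_T M k" "p \<in> vpolys k"
    and eq: "\<And>v. v \<in> vpolys k \<Longrightarrow> int_T M (\<lambda>x. p x \<bullet> v x) = - int_T M (\<lambda>x. fst q x * dvg v x)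
            + (\<Sum>F\<in>faces M. omega_TF M F *
                int_F M F (\<lambda>x. \<gamma> F (grad_to_face F q) x * (v x \<bullet> fnormal M F)))"
  proof (rule reconstruction_props(4)[OF subspace_X_grad_T ex1 ran lin op vp])
    show "ip p a = \<Phi> q a" if "a \<in> vpolys k" for a
      using eq[OF that] by (simp add: ip_def int_T_def \<Phi>_def)
  qed
qed

text \<open>The divergences of the tests already fill \<open>polys (int k + 1)\<close>, so a single
  family of relations determines the potential. Membership in the complement is needed for
  injectivity only; the identification criterion uses all of
  \<open>vpolys (int k + 2)\<close>.\<close>

lemma P_grad_T_props:
  shows "lin_on (X_grad_T M k) (P_grad_T M k \<gamma>)" "q \<in> X_grad_T M k \<Longrightarrow> P_grad_T M k \<gamma> q \<in> polys (int k + 1)"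
    "q \<in> X_grad_T M k \<Longrightarrow> p \<in> polys (int k + 1) \<Longrightarrow>
      (\<And>v. v \<in> vpolys (int k + 2) \<Longrightarrow> int_T M (\<lambda>x. p x * dvg v x) = - int_T M (\<lambda>x. full_gradient M k \<gamma> q x \<bullet> v x)
            + (\<Sum>F\<in>faces M. omega_TF M F *
                int_F M F (\<lambda>x. \<gamma> F (grad_to_face F q) x * (v x \<bullet> fnormal M F)))) \<Longrightarrow>
      P_grad_T M k \<gamma> q = p"
proof -
  interpret l2_space "vol_measure M" T "polys (int k + 1)" by (rule l2_polys)
  let ?A = "R_T_perp M (int k + 2)"
  define \<Phi> where "\<Phi> q v = (-1) *\<^sub>R int_T M (\<lambda>x. full_gradient M k \<gamma> q x \<bullet> v x)
            + (\<Sum>F\<in>faces M. omega_TF M F *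
                int_F M F (\<lambda>x. \<gamma> F (grad_to_face F q) x * (v x \<bullet> fnormal M F)))" for q v
  have A: "?A \<subseteq> vpolys (int k + 2)" "subspace ?A" by (rule perp_subset(1), rule perp_subspace(1))
  have linn: "linear (\<lambda>v. v \<bullet> n)" for n :: pt by (rule linearI) (simp_all add: inner_add_left)
  have lin: "lin_on (X_grad_T M k) (\<lambda>q. \<Phi> q v)" if v: "v \<in> ?A" for v
  proof -
    have v: "v \<in> vpolys (int k + 2)" using v A by blast
    show ?thesis unfolding \<Phi>_def int_T_def
    by (intro lin_on_add_fun lin_on_scale_fun lin_on_integral_left face_sum_lin_mult(1) full_gradient_props(1) trace_props
        cont_ext_on_vpolys[OF full_gradient_props(2)] cont_ext_on_vpolys[OF v] cont_ext_on_polys[OF vpolys_inner_const[OF v]])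
  qed
  have lin2: "lin_on ?A (\<Phi> q)" if q: "q \<in> X_grad_T M k" for q
  proof -
    have "lin_on (vpolys (int k + 2)) (\<Phi> q)" unfolding \<Phi>_def int_T_def
    by (intro lin_on_add_fun lin_on_scale_fun lin_on_integral_right face_sum_lin_mult(2) lin_on_id
        trace_props(2)[OF _ q] cont_ext_on_vpolys[OF full_gradient_props(2)[OF q]] cont_ext_on_vpolys
        cont_ext_on_polys[OF vpolys_inner_const] lin_on_pointwise[OF lin_on_id linn])
    then show ?thesis by (rule lin_on_subset[OF _ A(1)])
  qed
  \<comment> \<open>Splits the degree so that the image of the complement under \<open>dvg\<close>
    comes out one degree lower, at \<open>int k + 1\<close>.\<close>
  have "int k + 2 = int k + 1 + 1" by simp
  then have im: "dvg ` ?A = polys (int k + 1)" by (simp only: dvg_image_R_T_perp)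
  have ex1: "\<exists>!p. p \<in> polys (int k + 1) \<and> (\<forall>v\<in>?A. ip p (dvg v) = \<Phi> q v)" if q: "q \<in> X_grad_T M k" for q
  proof (rule ex1_riesz_surj[OF A(2) lin_on_subset[OF lin_on_dvg A(1)] im lin2[OF q]])
    show "\<Phi> q a = 0" if "a \<in> ?A" "dvg a = 0" for a
      using dvg_R_T_perp_eq_0[OF that] lin_on_0[OF lin2[OF q] A(2)] by simp
  qed
  have op: "P_grad_T M k \<gamma> q = (THE p. p \<in> polys (int k + 1) \<and> (\<forall>v\<in>?A. ip p (dvg v) = \<Phi> q v))" for q
    by (simp add: P_grad_T_def ip_def int_T_def \<Phi>_def)
  have ran: "dvg ` ?A \<subseteq> polys (int k + 1)" unfolding im by simp
  show "lin_on (X_grad_T M k) (P_grad_T M k \<gamma>)"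
    by (rule reconstruction_props(1)[OF subspace_X_grad_T ex1 ran lin op])
  show "P_grad_T M k \<gamma> q \<in> polys (int k + 1)" if "q \<in> X_grad_T M k"
    by (rule reconstruction_props(2)[OF subspace_X_grad_T ex1 ran lin op that])
  show "P_grad_T M k \<gamma> q = p" if vp: "q \<in> X_grad_T M k" "p \<in> polys (int k + 1)"
    and eq: "\<And>v. v \<in> vpolys (int k + 2) \<Longrightarrow> int_T M (\<lambda>x. p x * dvg v x) = - int_T M (\<lambda>x. full_gradient M k \<gamma> q x \<bullet> v x)
            + (\<Sum>F\<in>faces M. omega_TF M F *
                int_F M F (\<lambda>x. \<gamma> F (grad_to_face F q) x * (v x \<bullet> fnormal M F)))"
  proof (rule reconstruction_props(4)[OF subspace_X_grad_T ex1 ran lin op vp])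
    show "ip p (dvg v) = \<Phi> q v" if "v \<in> ?A" for v
      using eq[of v] that A(1) by (auto simp: ip_def int_T_def \<Phi>_def)
  qed
qed

end

section \<open>Polynomial consistency\<close>

context polyhedron
begin

text \<open>In arc length \<open>P\<close> is \<open>(s - l) * (s - r) * R s\<close>. If it were
  nonzero, \<open>R\<close> would have degree at most \<open>k - 1\<close>, which is absurd for
  \<open>k = 0\<close> and otherwise admits \<open>R\<close> itself as a test; the product of
  \<open>P\<close> with it has constant sign inside the edge.\<close>

lemma edge_polynomial_eq_0:
  assumes E: "E \<in> edges M" and P: "P \<in> polys (int k + 1)" and ends: "\<And>x. x \<in> closure E - E \<Longrightarrow> P x = 0"
    and orth: "\<And>h. h \<in> polys_on (int k - 1) E \<Longrightarrow> int_E M E (\<lambda>x. P x * h x) = 0" and x: "x \<in> E"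
  shows "P x = 0"
proof -
  let ?o = "face_origin E" and ?t = "etangent M E"
  interpret flat_measure "length_measure M E" E by (rule flat_measure_edge(1)[OF E])
  obtain l r where lr: "l < 0" "0 < r" "\<forall>s. edge_map M E s \<in> E \<longleftrightarrow> l < s \<and> s < r" "E \<subseteq> range (edge_map M E)"
    using edge_line(3)[OF E] by (elim exE conjE) (rule that)
  have "edge_map M E ` closure {l<..<r} \<subseteq> closure E"
    by (rule image_closure_subset)
      (use lr(3) closure_subset[of E] in \<open>auto simp: edge_map_def[abs_def] intro!: continuous_intros\<close>)
  then have "edge_map M E l \<in> closure E - E" "edge_map M E r \<in> closure E - E"
    using lr by (auto simp: closure_greaterThanLessThan)
  then have 0: "P (edge_map M E l) = 0" "P (edge_map M E r) = 0" using ends by auto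
  obtain Q where Q: "Q \<noteq> 0 \<longrightarrow> int (degree Q) \<le> int k + 1" "\<And>s::real. P (?o + s *\<^sub>R ?t) = poly Q s"
    using polys_along_line[OF P] by blast
  have "Q = 0"
  proof (rule ccontr)
    assume Q0: "Q \<noteq> 0"
    have "poly Q l = 0" "poly Q r = 0" using 0 Q(2) by (simp_all add: edge_map_def)
    then obtain Q1 where Q1: "Q = [:- l, 1:] * Q1" by (auto simp: poly_eq_0_iff_dvd elim: dvdE)
    have "(r - l) * poly Q1 r = 0" using \<open>poly Q r = 0\<close> unfolding Q1 by auto
    then have "poly Q1 r = 0" using lr by simp
    then obtain R where R: "Q1 = [:- r, 1:] * R" by (auto simp: poly_eq_0_iff_dvd elim: dvdE)
    have R0: "R \<noteq> 0" using Q0 Q1 R by auto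
    have nz: "[:- l, 1:] \<noteq> 0" "[:- r, 1:] \<noteq> 0" by simp_all
    have "[:- r, 1:] * R \<noteq> 0" using R0 nz(2) by (simp only: mult_eq_0_iff) simp
    then have "degree Q = degree [:- l, 1:] + degree ([:- r, 1:] * R)"
      unfolding Q1 R by (rule degree_mult_eq[OF nz(1)])
    also have "degree ([:- r, 1:] * R) = degree [:- r, 1:] + degree R" by (rule degree_mult_eq[OF nz(2) R0])
    finally have "degree Q = Suc (Suc (degree R))" by simp
    then have deg: "int (degree R) \<le> int k - 1" using Q Q0 by simp
    define h where "h = restr E (\<lambda>x. poly R ((x - ?o) \<bullet> ?t))"
    have h: "h \<in> polys_on (int k - 1) E"
      unfolding h_def by (intro polys_onI poly_linear_form_in_polys deg)
    \<comment> \<open>The factor -1 compensates \<open>(s - l) * (s - r) < 0\<close> inside the edge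
      and makes the integrand nonnegative.\<close>
    have ch: "cont_ext_on E (\<lambda>x. (-1) * (P x * h x))"
      by (intro cont_ext_on_mult cont_ext_on_const cont_ext_on_polys[OF P] polys_on_cont[OF h])
    have val: "(-1) * (P (edge_map M E s) * h (edge_map M E s)) = (s - l) * (r - s) * (poly R s)\<^sup>2"
      if s: "l < s" "s < r" for s
    proof -
      have "edge_map M E s \<in> E" using lr(3) s by blast
      moreover have "(edge_map M E s - ?o) \<bullet> ?t = s" using edge_line(1)[OF E] by (simp add: edge_map_def norm_eq_1)
      ultimately have "h (edge_map M E s) = poly R s" by (simp add: h_def restr_def)
      moreover have "P (edge_map M E s) = (s - l) * ((s - r) * poly R s)"
        using Q(2)[of s] by (simp add: edge_map_def Q1 R algebra_simps)
      ultimately have "(-1) * (P (edge_map M E s) * h (edge_map M E s)) = (-1) * ((s - l) * ((s - r) * poly R s) * poly R s)"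
        by (simp only:)
      also have "\<dots> = (s - l) * (r - s) * (poly R s)\<^sup>2" by (simp add: power2_eq_square algebra_simps)
      finally show ?thesis .
    qed
    have nonneg: "0 \<le> (-1) * (P x * h x)" if xE: "x \<in> E" for x
    proof -
      obtain s where s: "x = edge_map M E s" using lr(4) xE by blast
      then have "l < s" "s < r" using lr(3) xE by auto
      then show ?thesis unfolding s val[OF \<open>l < s\<close> \<open>s < r\<close>] by simp
    qed
    have "(\<integral>x. (-1) * (P x * h x) \<partial>length_measure M E) = 0"
      using orth[OF h] by (simp add: int_E_def)
    then have z: "(-1) * (P x * h x) = 0" if "x \<in> E" for x
      using integral_nonneg_eq_0[OF ch nonneg _ that] by blast
    have "{l<..<r} \<subseteq> {s. poly R s = 0}"
    proof
      fix s assume s: "s \<in> {l<..<r}"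
      then have s': "l < s" "s < r" by auto
      then have "edge_map M E s \<in> E" using lr(3) by blast
      then have "(s - l) * (r - s) * (poly R s)\<^sup>2 = 0" by (rule trans[OF sym[OF val[OF s']] z])
      then show "s \<in> {s. poly R s = 0}" using s by simp
    qed
    moreover have "infinite {l<..<r}" using lr by (simp add: infinite_Ioo)
    ultimately show False using poly_roots_finite[OF R0] finite_subset by blast
  qed
  obtain s where "x = edge_map M E s" using lr(4) x by blast
  then show ?thesis using Q(2)[of s] \<open>Q = 0\<close> by (simp add: edge_map_def)
qed

text \<open>Uniqueness is shown one edge at a time. A competitor \<open>p\<close> coincides on
  \<open>E\<close> with some polynomial \<open>P\<close> of degree \<open>k + 1\<close>; equality of
  the projections makes \<open>P - q\<close> orthogonal to the tests of degree \<open>k - 1\<close>,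
  and the vertex values make it vanish at the ends, so \<open>edge_polynomial_eq_0\<close>
  applies.\<close>

lemma interp_skeleton_poly:
  assumes \<E>: "\<E> \<subseteq> edges M" and ends: "\<And>E. E \<in> \<E> \<Longrightarrow> closure E - E \<subseteq> \<V>" and \<V>: "\<V> \<subseteq> skeleton \<E>"
    and q: "q \<in> polys (int k + 1)"
  shows "interp_skeleton M k \<E> \<V> q = restr (skeleton \<E>) q"
  unfolding interp_skeleton_def
proof (rule the_equality)
  have cl: "closure E \<subseteq> skeleton \<E>" if "E \<in> \<E>" for E using that by (auto simp: skeleton_def)
  have rr: "restr E (restr (skeleton \<E>) q) = restr E q" if "E \<in> \<E>" for E
    using cl[OF that] closure_subset[of E] by (auto simp: restr_def fun_eq_iff)
  have "continuous_on (skeleton \<E>) (restr (skeleton \<E>) q)"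
    by (rule continuous_on_eq[OF polys_continuous_on[OF q]]) (simp add: restr_def)
  then have "restr (skeleton \<E>) q \<in> polys_c (int k + 1) \<E>"
    using rr polys_onI[OF q] by (auto simp: polys_c_def restr_def[of "skeleton \<E>"])
  moreover have "\<forall>V\<in>\<V>. restr (skeleton \<E>) q V = q V" using \<V> by (auto simp: restr_def)
  ultimately show "restr (skeleton \<E>) q \<in> polys_c (int k + 1) \<E> \<and>
    (\<forall>E\<in>\<E>. l2_proj (length_measure M E) (polys_on (int k - 1) E) (restr E (restr (skeleton \<E>) q))
      = l2_proj (length_measure M E) (polys_on (int k - 1) E) (restr E q)) \<and>
    (\<forall>V\<in>\<V>. restr (skeleton \<E>) q V = q V)"
    using rr by simp
  fix p
  assume p: "p \<in> polys_c (int k + 1) \<E> \<and>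
    (\<forall>E\<in>\<E>. l2_proj (length_measure M E) (polys_on (int k - 1) E) (restr E p)
      = l2_proj (length_measure M E) (polys_on (int k - 1) E) (restr E q)) \<and> (\<forall>V\<in>\<V>. p V = q V)"
  have eq: "p x = q x" if E: "E \<in> \<E>" and x: "x \<in> closure E" for E x
  proof -
    have EM: "E \<in> edges M" using E \<E> by blast
    interpret l2_space "length_measure M E" E "polys_on (int k - 1) E" by (rule l2_polys_on_E[OF EM])
    have "restr E p \<in> polys_on (int k + 1) E" using p E by (simp add: polys_c_def)
    then obtain P where P: "P \<in> polys (int k + 1)" "restr E p = restr E P" by (auto simp: polys_on_def)
    have pP: "p x = P x" if "x \<in> E" for x using fun_cong[OF P(2), of x] that by (simp add: restr_def)
    have "continuous_on (closure E) p" using p cl[OF E] continuous_on_subset by (auto simp: polys_c_def)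
    then have cont: "continuous_on (closure E) (\<lambda>x. p x - g x)" if "g \<in> polys (int k + 1)" for g
      by (intro continuous_on_diff polys_continuous_on[OF that])
    \<comment> \<open>The vertex values are prescribed for \<open>p\<close>, whereas
      \<open>P\<close> is known only inside the edge; continuity up to the ends connects the
      two.\<close>
    have pPc: "p x - P x = 0" if "x \<in> closure E" for x
      by (rule continuous_constant_on_closure[OF cont[OF P(1)] _ that]) (simp add: pP)
    define D where "D = (\<lambda>x. P x - q x)"
    have D: "D \<in> polys (int k + 1)" unfolding D_def by (intro polys_diff P(1) q)
    have D0: "D x = 0" if xE: "x \<in> E" for x
    proof (rule edge_polynomial_eq_0[OF EM D _ _ xE])
      fix y assume y: "y \<in> closure E - E"
      then have "p y = q y" using ends[OF E] p by blast
      then show "D y = 0" using pPc[of y] y by (simp add: D_def)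
    next
      fix h assume h: "h \<in> polys_on (int k - 1) E"
      have c: "cont_ext_on E (restr E p)" "cont_ext_on E (restr E q)"
        unfolding P(2) by (intro cont_ext_on_restr cont_ext_on_polys[OF P(1)], intro cont_ext_on_restr cont_ext_on_polys[OF q])
      have "ip (restr E p) h = ip (restr E q) h"
        using ip_l2_proj[OF c(1) h] ip_l2_proj[OF c(2) h] p E by simp
      then have "ip (restr E p - restr E q) h = 0" by (simp add: ip_diff[OF c cont_S[OF h]])
      moreover have "ip (restr E p - restr E q) h = int_E M E (\<lambda>x. D x * h x)"
        unfolding ip_def int_E_def by (rule integral_cong) (simp add: restr_def D_def pP)
      ultimately show "int_E M E (\<lambda>x. D x * h x) = 0" by simp
    qed
    have "p x - q x = 0"
      by (rule continuous_constant_on_closure[OF cont[OF q] _ x]) (use D0 pP in \<open>simp add: D_def\<close>)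
    then show ?thesis by simp
  qed
  show "p = restr (skeleton \<E>) q"
  proof
    fix x
    show "p x = restr (skeleton \<E>) q x"
      using eq[of _ x] p by (cases "x \<in> skeleton \<E>") (auto simp: restr_def skeleton_def polys_c_def)
  qed
qed

lemma edge_ends_vertices: "E \<in> edges M \<Longrightarrow> closure E - E \<subseteq> vertices M"
proof -
  assume "E \<in> edges M"
  then obtain a b where ab: "a \<in> vertices M" "b \<in> vertices M" "a \<noteq> b" "E = open_segment a b" using edge_ends by blast
  then have "closure E = closed_segment a b" by simp
  then show ?thesis unfolding ab(4) open_segment_def using ab by auto
qed

lemma vertices_on_skeleton: "vertices M \<subseteq> skeleton (edges M)"
proof -
  have "\<forall>V\<in>vertices M. (\<exists>E\<in>edges M. V \<in> closure E) \<and> V \<notin> \<Union> (edges M)"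
    using poly[unfolded is_polyhedron_def] by (elim conjE)
  then show ?thesis unfolding skeleton_def by blast
qed

lemma interp_skeleton_cell:
  "q \<in> polys (int k + 1) \<Longrightarrow> interp_skeleton M k (edges M) (vertices M) q = restr (skeleton (edges M)) q"
  by (rule interp_skeleton_poly[OF subset_refl edge_ends_vertices vertices_on_skeleton])

lemma interp_skeleton_face:
  assumes F: "F \<in> faces M" and q: "q \<in> polys (int k + 1)"
  shows "interp_skeleton M k (edges_of M F) (vertices_of M F) q = restr (rel_frontier F) q"
proof -
  have "interp_skeleton M k (edges_of M F) (vertices_of M F) q = restr (skeleton (edges_of M F)) q"
  proof (rule interp_skeleton_poly[OF _ _ _ q])
    show "edges_of M F \<subseteq> edges M" by (auto simp: edges_of_def)
    show "closure E - E \<subseteq> vertices_of M F" if E: "E \<in> edges_of M F" for E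
    proof -
      have "closure E \<subseteq> rel_frontier F" using rel_front_F[OF F] E by blast
      then show ?thesis using edge_ends_vertices[OF edges_ofD(1)[OF E]] by (auto simp: vertices_of_def)
    qed
    show "vertices_of M F \<subseteq> skeleton (edges_of M F)"
      unfolding rel_frontier_skeleton[OF F] by (simp add: vertices_of_def)
  qed
  then show ?thesis unfolding rel_frontier_skeleton[OF F] .
qed

lemma I_grad_T_poly:
  assumes q: "q \<in> polys (int k + 1)"
  shows "I_grad_T M k q = (l2_proj (vol_measure M) (polys (int k - 1)) q,
      \<lambda>F. if F \<in> faces M then l2_proj (area_measure M F) (polys_on (int k - 1) F) (restr F q) else 0,
      restr (skeleton (edges M)) q)"
    "I_grad_T M k q \<in> X_grad_T M k"
    "F \<in> faces M \<Longrightarrow> grad_to_face F (I_grad_T M k q) = I_grad_F M k F q"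
proof -
  show eq: "I_grad_T M k q = (l2_proj (vol_measure M) (polys (int k - 1)) q,
      \<lambda>F. if F \<in> faces M then l2_proj (area_measure M F) (polys_on (int k - 1) F) (restr F q) else 0,
      restr (skeleton (edges M)) q)"
    unfolding I_grad_T_def interp_skeleton_cell[OF q] ..
  have "l2_proj (area_measure M F) (polys_on (int k - 1) F) (restr F q) \<in> polys_on (int k - 1) F" if "F \<in> faces M" for F
    by (rule l2_space.l2_proj_in[OF l2_polys_on_F[OF that] cont_ext_on_restr[OF cont_ext_on_polys[OF q]]])
  moreover have "l2_proj (vol_measure M) (polys (int k - 1)) q \<in> polys (int k - 1)"
    by (rule l2_space.l2_proj_in[OF l2_polys cont_ext_on_polys[OF q]])
  moreover have "restr (skeleton (edges M)) q \<in> polys_c (int k + 1) (edges M)"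
  proof -
    have "restr E (restr (skeleton (edges M)) q) = restr E q" if "E \<in> edges M" for E
      using that closure_subset[of E] by (auto simp: restr_def fun_eq_iff skeleton_def)
    moreover have "continuous_on (skeleton (edges M)) (restr (skeleton (edges M)) q)"
      by (rule continuous_on_eq[OF polys_continuous_on[OF q]]) (simp add: restr_def)
    ultimately show ?thesis
      using polys_onI[OF q] by (auto simp: polys_c_def restr_def[of "skeleton (edges M)"])
  qed
  ultimately show "I_grad_T M k q \<in> X_grad_T M k"
    unfolding eq by (auto simp: X_grad_T_def polys_family_def)
  show "grad_to_face F (I_grad_T M k q) = I_grad_F M k F q" if F: "F \<in> faces M"
  proof -
    have "skeleton (edges_of M F) \<subseteq> skeleton (edges M)" unfolding skeleton_def edges_of_def by blast
    then have "rel_frontier F \<subseteq> skeleton (edges M)" unfolding rel_frontier_skeleton[OF F] .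
    then have "restr (rel_frontier F) (restr (skeleton (edges M)) q) = restr (rel_frontier F) q"
      by (auto simp: restr_def fun_eq_iff)
    then show ?thesis unfolding eq grad_to_face_def I_grad_F_def interp_skeleton_face[OF F q] using F by simp
  qed
qed

lemma lin_on_l2_proj:
  fixes L :: "'q::real_vector \<Rightarrow> pt \<Rightarrow> 'b::euclidean_space"
  assumes "l2_space \<mu> X S" "lin_on Q L" "\<And>q. q \<in> Q \<Longrightarrow> cont_ext_on X (L q)"
  shows "lin_on Q (\<lambda>q. l2_proj \<mu> S (L q))"
  by (rule lin_onI) (simp only: lin_onD[OF assms(2)] l2_space.l2_proj_lin[OF assms(1)] assms(3))

lemma lin_on_Pair: "lin_on Q f \<Longrightarrow> lin_on Q g \<Longrightarrow> lin_on Q (\<lambda>q. (f q, g q))"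
  by (auto simp: lin_on_def)

lemma lin_on_family: "(\<And>F. F \<in> \<X> \<Longrightarrow> lin_on Q (\<lambda>q. L q F)) \<Longrightarrow> lin_on Q (\<lambda>q F. if F \<in> \<X> then L q F else 0)"
  unfolding lin_on_def by (auto simp: fun_eq_iff scaleR_fun_apply)

text \<open>On polynomials the skeleton component is a plain restriction. Linearity is claimed only
  there, not for the \<open>THE\<close> in \<open>interp_skeleton\<close> on general
  functions.\<close>

lemma lin_on_I_grad_T: "lin_on (polys (int k + 1)) (I_grad_T M k)"
proof -
  have "lin_on (polys (int k + 1)) (\<lambda>q. (l2_proj (vol_measure M) (polys (int k - 1)) q,
      \<lambda>F. if F \<in> faces M then l2_proj (area_measure M F) (polys_on (int k - 1) F) (restr F q) else 0,
      restr (skeleton (edges M)) q))"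
    by (intro lin_on_Pair lin_on_family lin_on_l2_proj[OF l2_polys] lin_on_l2_proj[OF l2_polys_on_F] lin_on_id lin_on_restr
        cont_ext_on_polys cont_ext_on_restr)
  then show ?thesis
    unfolding lin_on_def using I_grad_T_poly(1) subspace_lin_comb[OF subspace_polys] by simp
qed

section \<open>Green's formulas and interpolated fields\<close>

lemma green_grad:
  assumes q: "q \<in> polys l" and v: "v \<in> vpolys l'"
  shows "int_T M (\<lambda>x. q x * dvg v x) = - int_T M (\<lambda>x. grad q x \<bullet> v x)
    + (\<Sum>F\<in>faces M. omega_TF M F * int_F M F (\<lambda>x. q x * (v x \<bullet> fnormal M F)))"
proof -
  interpret flat_measure "vol_measure M" T by (rule flat_measure_cell(1))
  have "int_T M (dvg (\<lambda>x. q x *\<^sub>R v x)) = int_T M (\<lambda>x. q x * dvg v x + grad q x \<bullet> v x)"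
    unfolding int_T_def by (rule integral_cong) (simp add: dvg_smult[OF q v] inner_commute)
  also have "\<dots> = int_T M (\<lambda>x. q x * dvg v x) + int_T M (\<lambda>x. grad q x \<bullet> v x)"
    unfolding int_T_def
    by (intro integral_add cont_ext_on_mult cont_ext_on_inner cont_ext_on_polys[OF q] cont_ext_on_vpolys[OF v]
        cont_ext_on_polys[OF dvg_polys[OF v]] cont_ext_on_vpolys[OF grad_vpolys[OF q]])
  finally show ?thesis using divergence_theorem[OF vpolys_smult[OF q v]] by simp
qed

text \<open>The divergence theorem for \<open>cross3 (v x) (w x)\<close>. By cyclicity of the triple
  product the boundary integrand is \<open>v x\<close> against \<open>cross3 (w x) n\<close>, which
  is tangential, so only the tangential trace of \<open>v\<close> enters.\<close>

lemma green_curl: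
  assumes v: "v \<in> vpolys l" and w: "w \<in> vpolys l'"
  shows "int_T M (\<lambda>x. curl v x \<bullet> w x) = int_T M (\<lambda>x. v x \<bullet> curl w x)
    + (\<Sum>F\<in>faces M. omega_TF M F * int_F M F (\<lambda>x. tangential_trace M F v x \<bullet> cross3 (w x) (fnormal M F)))"
proof -
  interpret flat_measure "vol_measure M" T by (rule flat_measure_cell(1))
  have "int_T M (dvg (\<lambda>x. cross3 (v x) (w x))) = int_T M (\<lambda>x. curl v x \<bullet> w x - v x \<bullet> curl w x)"
    unfolding int_T_def by (rule integral_cong) (simp add: dvg_cross3[OF v w])
  also have "\<dots> = int_T M (\<lambda>x. curl v x \<bullet> w x) - int_T M (\<lambda>x. v x \<bullet> curl w x)"
    unfolding int_T_def
    by (intro integral_diff cont_ext_on_inner cont_ext_on_vpolys[OF v] cont_ext_on_vpolys[OF w]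
        cont_ext_on_vpolys[OF curl_vpolys[OF v]] cont_ext_on_vpolys[OF curl_vpolys[OF w]])
  finally have "int_T M (\<lambda>x. curl v x \<bullet> w x) = int_T M (\<lambda>x. v x \<bullet> curl w x)
    + (\<Sum>F\<in>faces M. omega_TF M F * int_F M F (\<lambda>x. cross3 (v x) (w x) \<bullet> fnormal M F))"
    using divergence_theorem[OF vpolys_cross3[OF v w]] by simp
  moreover have "int_F M F (\<lambda>x. cross3 (v x) (w x) \<bullet> fnormal M F)
      = int_F M F (\<lambda>x. tangential_trace M F v x \<bullet> cross3 (w x) (fnormal M F))" if F: "F \<in> faces M" for F
    unfolding int_F_def
  proof (rule flat_measure.integral_cong[OF flat_measure_face(1)[OF F]])
    fix x assume "x \<in> F"
    then have "tangential_trace M F v x \<bullet> cross3 (w x) (fnormal M F) = v x \<bullet> cross3 (w x) (fnormal M F)"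
      by (simp add: tangential_trace_eq[OF F] restr_def inner_diff_left dot_cross_self)
    also have "\<dots> = cross3 (v x) (w x) \<bullet> fnormal M F"
      by (simp add: inner_vec_def sum_3 cross3_comp algebra_simps)
    finally show "cross3 (v x) (w x) \<bullet> fnormal M F = tangential_trace M F v x \<bullet> cross3 (w x) (fnormal M F)" ..
  qed
  ultimately show ?thesis by simp
qed

lemma l2_sub_vpolys:
  assumes "subspace S" "S \<subseteq> vpolys l"
  shows "l2_space (vol_measure M) T S"
  by (rule l2_space.l2_space_subspace[OF l2_vpolys assms])

lemma l2_parts_T:
  shows "l2_space (vol_measure M) T (R_T l)" "l2_space (vol_measure M) T (R_T_perp M l)"
    "l2_space (vol_measure M) T (G_T l)" "l2_space (vol_measure M) T (G_T_perp M l)"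
  by (rule l2_sub_vpolys[OF subspace_R_T R_T_subset] l2_sub_vpolys[OF perp_subspace(1) perp_subset(1)]
      l2_sub_vpolys[OF subspace_G_T G_T_subset] l2_sub_vpolys[OF perp_subspace(2) perp_subset(2)])+

text \<open>The volume component of an interpolated field is a sum of two projections. Against a
  test in \<open>A\<close> that is orthogonal to \<open>B\<close> the second one is invisible and
  the first acts like the field itself.\<close>

lemma l2_proj_sum_test:
  fixes v :: "pt \<Rightarrow> pt"
  assumes A: "l2_space (vol_measure M) T A" and B: "l2_space (vol_measure M) T B" and v: "cont_ext_on T v"
    and h: "h \<in> A" and orth: "\<And>b. b \<in> B \<Longrightarrow> int_T M (\<lambda>x. b x \<bullet> h x) = 0"
  shows "int_T M (\<lambda>x. (l2_proj (vol_measure M) A v + l2_proj (vol_measure M) B v) x \<bullet> h x) = int_T M (\<lambda>x. v x \<bullet> h x)"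
proof -
  interpret A: l2_space "vol_measure M" T A by (rule A)
  interpret B: l2_space "vol_measure M" T B by (rule B)
  have "A.ip (l2_proj (vol_measure M) A v + l2_proj (vol_measure M) B v) h
      = A.ip (l2_proj (vol_measure M) A v) h + A.ip (l2_proj (vol_measure M) B v) h"
    by (intro A.ip_add A.cont_S[OF A.l2_proj_in[OF v]] B.cont_S[OF B.l2_proj_in[OF v]] A.cont_S[OF h])
  also have "A.ip (l2_proj (vol_measure M) B v) h = 0"
    using orth[OF B.l2_proj_in[OF v]] by (simp add: A.ip_def int_T_def)
  also have "A.ip (l2_proj (vol_measure M) A v) h = A.ip v h" by (rule A.ip_l2_proj[OF v h])
  finally show ?thesis by (simp add: A.ip_def int_T_def)
qed

text \<open>In the full curl the volume component meets only curls of fields of degree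
  \<open>k\<close>, which lie in \<open>R_T (int k - 1)\<close>; there the interpolated component is
  as good as \<open>v\<close>. The face traces are exact, so Green's formula identifies the full
  curl with \<open>curl v\<close>, and used once more with tests of degree \<open>k + 1\<close> it
  identifies the potential with \<open>v\<close>.\<close>

lemma I_curl_T_poly:
  assumes v: "v \<in> vpolys k"
  shows "I_curl_T M k v \<in> X_curl_T M k" "full_curl M k (I_curl_T M k v) = curl v"
    "P_curl_T M k (I_curl_T M k v) = v"
proof -
  let ?I = "I_curl_T M k v"
  have vc: "cont_ext_on T v" by (rule cont_ext_on_vpolys[OF v])
  interpret P: l2_space "vol_measure M" T "R_T_perp M k" by (rule l2_parts_T)
  interpret R: l2_space "vol_measure M" T "R_T (int k - 1)" by (rule l2_parts_T)
  interpret ds: direct_sum "R_T (int k - 1)" "R_T_perp M k" by (rule direct_sum_R_T)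
  let ?r = "l2_proj (vol_measure M) (R_T (int k - 1)) v" and ?p = "l2_proj (vol_measure M) (R_T_perp M k) v"
  have rp: "?r \<in> R_T (int k - 1)" "?p \<in> R_T_perp M k" by (rule R.l2_proj_in[OF vc], rule P.l2_proj_in[OF vc])
  have f: "fst ?I = ?r + ?p" by (simp add: I_curl_T_def)
  show I: "?I \<in> X_curl_T M k"
  proof -
    have "fst ?I \<in> dsum (R_T (int k - 1)) (R_T_perp M k)" unfolding f dsum_def using rp by blast
    moreover have "fst (snd ?I) F \<in> dsum (R_F M (int k - 1) F) (R_F_perp M k F)" if F: "F \<in> faces M" for F
      using curl_dofs_face_consistency(1)[OF F v] by (simp add: X_rot_F_def curl_to_face_def case_prod_unfold)
    moreover have "snd (snd ?I) E \<in> polys_on k E" if "E \<in> edges M" for E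
      using l2_space.l2_proj_in[OF l2_polys_on_E[OF that] cont_ext_on_restr[OF cont_ext_on_polys[OF vpolys_inner_const[OF v]]]] that
      by (simp add: I_curl_T_def)
    ultimately show ?thesis
      unfolding X_curl_T_def mem_Times_iff polys_family_def by (simp add: I_curl_T_def)
  qed
  have tr: "tangential_reconstruction M k F (curl_to_face M F ?I) = tangential_trace M F v" if "F \<in> faces M" for F
    by (rule curl_dofs_face_consistency(2)[OF that v])
  show fc: "full_curl M k ?I = curl v"
  proof (rule full_curl_props(3)[OF I])
    show "curl v \<in> vpolys k" by (rule vpolys_mono[OF curl_vpolys[OF v]]) simp
    fix w assume w: "w \<in> vpolys k"
    have cw: "curl w \<in> R_T (int k - 1)" using w by (simp add: R_T_def)
    have "int_T M (\<lambda>x. b x \<bullet> curl w x) = 0" if "b \<in> R_T_perp M k" for b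
      using that cw R_T_mono[of "int k - 1" k] by (auto simp: R_T_perp_def l2_compl_def int_T_def)
    then have "int_T M (\<lambda>x. fst ?I x \<bullet> curl w x) = int_T M (\<lambda>x. v x \<bullet> curl w x)"
      unfolding f by (rule l2_proj_sum_test[OF l2_parts_T(1,2) vc cw])
    then show "int_T M (\<lambda>x. curl v x \<bullet> w x) = int_T M (\<lambda>x. fst ?I x \<bullet> curl w x)
        + (\<Sum>F\<in>faces M. omega_TF M F *
            int_F M F (\<lambda>x. tangential_reconstruction M k F (curl_to_face M F ?I) x \<bullet> cross3 (w x) (fnormal M F)))"
      unfolding green_curl[OF v w] using tr by simp
  qed
  show "P_curl_T M k ?I = v"
  proof (rule P_curl_T_props(4)[OF I v])
    fix w assume w: "w \<in> vpolys (int k + 1)"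
    show "int_T M (\<lambda>x. v x \<bullet> curl w x) = int_T M (\<lambda>x. full_curl M k ?I x \<bullet> w x)
        - (\<Sum>F\<in>faces M. omega_TF M F *
            int_F M F (\<lambda>x. tangential_reconstruction M k F (curl_to_face M F ?I) x \<bullet> cross3 (w x) (fnormal M F)))"
      unfolding fc green_curl[OF v w] using tr by simp
  next
    fix w assume w: "w \<in> R_T_perp M k"
    have "R_perp_part_T M k (fst ?I) = ?p" unfolding R_perp_part_T_def f by (rule ds.dsum_snd_eq[OF rp])
    then show "int_T M (\<lambda>x. v x \<bullet> w x) = int_T M (\<lambda>x. R_perp_part_T M k (fst ?I) x \<bullet> w x)"
      using P.ip_l2_proj[OF vc w] by (simp add: P.ip_def int_T_def)
  qed
qed

text \<open>The normal component of \<open>v\<close> already has degree \<open>k\<close>, so the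
  face components are exact. In the divergence the volume component meets only gradients from
  \<open>G_T (int k - 1)\<close>, for which the projection is harmless.\<close>

lemma I_div_T_poly:
  assumes v: "v \<in> vpolys k"
  shows "I_div_T M k v \<in> X_div_T M k" "P_div_T M k (I_div_T M k v) = v"
    "F \<in> faces M \<Longrightarrow> snd (I_div_T M k v) F = restr F (\<lambda>x. v x \<bullet> fnormal M F)"
proof -
  let ?I = "I_div_T M k v"
  have vc: "cont_ext_on T v" by (rule cont_ext_on_vpolys[OF v])
  interpret P: l2_space "vol_measure M" T "G_T_perp M k" by (rule l2_parts_T)
  interpret R: l2_space "vol_measure M" T "G_T (int k - 1)" by (rule l2_parts_T)
  interpret ds: direct_sum "G_T (int k - 1)" "G_T_perp M k" by (rule direct_sum_G_T)
  let ?r = "l2_proj (vol_measure M) (G_T (int k - 1)) v" and ?p = "l2_proj (vol_measure M) (G_T_perp M k) v"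
  have rp: "?r \<in> G_T (int k - 1)" "?p \<in> G_T_perp M k" by (rule R.l2_proj_in[OF vc], rule P.l2_proj_in[OF vc])
  have f: "fst ?I = ?r + ?p" by (simp add: I_div_T_def)
  have vn: "restr F (\<lambda>x. v x \<bullet> fnormal M F) \<in> polys_on k F" for F by (rule polys_onI[OF vpolys_inner_const[OF v]])
  show s: "snd ?I F = restr F (\<lambda>x. v x \<bullet> fnormal M F)" if "F \<in> faces M" for F
    using l2_space.l2_proj_id[OF l2_polys_on_F[OF that] vn] that by (simp add: I_div_T_def)
  show I: "?I \<in> X_div_T M k"
  proof -
    have "fst ?I \<in> dsum (G_T (int k - 1)) (G_T_perp M k)" unfolding f dsum_def using rp by blast
    moreover have "snd ?I F \<in> polys_on k F" if "F \<in> faces M" for F unfolding s[OF that] by (rule vn)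
    ultimately show ?thesis
      unfolding X_div_T_def mem_Times_iff polys_family_def by (simp add: I_div_T_def)
  qed
  have sF: "int_F M F (\<lambda>x. snd ?I F x * q x) = int_F M F (\<lambda>x. q x * (v x \<bullet> fnormal M F))" if F: "F \<in> faces M" for F q
    unfolding int_F_def s[OF F]
    by (rule flat_measure.integral_cong[OF flat_measure_face(1)[OF F]]) (simp add: restr_def)
  have green: "int_T M (\<lambda>x. dvg v x * q x) = - int_T M (\<lambda>x. v x \<bullet> grad q x)
      + (\<Sum>F\<in>faces M. omega_TF M F * int_F M F (\<lambda>x. snd ?I F x * q x))" if q: "q \<in> polys l" for q l
    using green_grad[OF q v] sF by (simp add: mult.commute[of "dvg v _"] inner_commute)
  have dv: "divergence M k ?I = dvg v"
  proof (rule divergence_props(4)[OF I])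
    show "dvg v \<in> polys k" by (rule polys_mono[OF dvg_polys[OF v]]) simp
    fix q assume q: "q \<in> polys k"
    have gq: "grad q \<in> G_T (int k - 1)" using q by (simp add: G_T_def)
    have "int_T M (\<lambda>x. b x \<bullet> grad q x) = 0" if "b \<in> G_T_perp M k" for b
      using that gq G_T_mono[of "int k - 1" k] by (auto simp: G_T_perp_def l2_compl_def int_T_def)
    then have "int_T M (\<lambda>x. fst ?I x \<bullet> grad q x) = int_T M (\<lambda>x. v x \<bullet> grad q x)"
      unfolding f by (rule l2_proj_sum_test[OF l2_parts_T(3,4) vc gq])
    then show "int_T M (\<lambda>x. dvg v x * q x) = - int_T M (\<lambda>x. fst ?I x \<bullet> grad q x)
        + (\<Sum>F\<in>faces M. omega_TF M F * int_F M F (\<lambda>x. snd ?I F x * q x))"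
      using green[OF q] by simp
  qed
  show "P_div_T M k ?I = v"
  proof (rule P_div_T_props(5)[OF I v])
    fix q assume q: "q \<in> polys (int k + 1)"
    show "int_T M (\<lambda>x. v x \<bullet> grad q x) = - int_T M (\<lambda>x. divergence M k ?I x * q x)
        + (\<Sum>F\<in>faces M. omega_TF M F * int_F M F (\<lambda>x. snd ?I F x * q x))"
      unfolding dv using green[OF q] by simp
  next
    fix w assume w: "w \<in> G_T_perp M k"
    have "G_perp_part_T M k (fst ?I) = ?p" unfolding G_perp_part_T_def f by (rule ds.dsum_snd_eq[OF rp])
    then show "int_T M (\<lambda>x. v x \<bullet> w x) = int_T M (\<lambda>x. G_perp_part_T M k (fst ?I) x \<bullet> w x)"
      using P.ip_l2_proj[OF vc w] by (simp add: P.ip_def int_T_def)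
  qed
qed

end

context polyhedron_with_trace
begin

text \<open>The volume component enters only through products with \<open>dvg v\<close> of degree
  \<open>k - 1\<close>, where projecting \<open>q\<close> makes no difference, and the trace
  reproduces \<open>q\<close> on each face. The gradient and then the potential follow from the same
  Green formula with tests of degree \<open>k\<close> and \<open>k + 2\<close>.\<close>

lemma P_grad_T_I_grad_T:
  assumes q: "q \<in> polys (int k + 1)"
  shows "P_grad_T M k \<gamma> (I_grad_T M k q) = q"
proof -
  let ?I = "I_grad_T M k q"
  have I: "?I \<in> X_grad_T M k" by (rule I_grad_T_poly(2)[OF q])
  have \<gamma>: "int_F M F (\<lambda>x. \<gamma> F (grad_to_face F ?I) x * (v x \<bullet> fnormal M F)) = int_F M F (\<lambda>x. q x * (v x \<bullet> fnormal M F))"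
    if F: "F \<in> faces M" for F v
    unfolding int_F_def I_grad_T_poly(3)[OF q F] trace_props(3)[OF F q]
    by (rule flat_measure.integral_cong[OF flat_measure_face(1)[OF F]]) (simp add: restr_def)
  have fg: "full_gradient M k \<gamma> ?I = grad q"
  proof (rule full_gradient_props(3)[OF I])
    show "grad q \<in> vpolys k" using grad_vpolys[OF q] by simp
    fix v assume v: "v \<in> vpolys k"
    interpret l2_space "vol_measure M" T "polys (int k - 1)" by (rule l2_polys)
    have "ip (l2_proj (vol_measure M) (polys (int k - 1)) q) (dvg v) = ip q (dvg v)"
      by (rule ip_l2_proj[OF cont_ext_on_polys[OF q] dvg_polys[OF v]])
    then have "int_T M (\<lambda>x. fst ?I x * dvg v x) = int_T M (\<lambda>x. q x * dvg v x)"
      by (simp add: ip_def int_T_def I_grad_T_def)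
    then show "int_T M (\<lambda>x. grad q x \<bullet> v x) = - int_T M (\<lambda>x. fst ?I x * dvg v x)
        + (\<Sum>F\<in>faces M. omega_TF M F * int_F M F (\<lambda>x. \<gamma> F (grad_to_face F ?I) x * (v x \<bullet> fnormal M F)))"
      using green_grad[OF q v] \<gamma> by simp
  qed
  show ?thesis
  proof (rule P_grad_T_props(3)[OF I q])
    fix v assume v: "v \<in> vpolys (int k + 2)"
    show "int_T M (\<lambda>x. q x * dvg v x) = - int_T M (\<lambda>x. full_gradient M k \<gamma> ?I x \<bullet> v x)
        + (\<Sum>F\<in>faces M. omega_TF M F * int_F M F (\<lambda>x. \<gamma> F (grad_to_face F ?I) x * (v x \<bullet> fnormal M F)))"
      unfolding fg green_grad[OF q v] using \<gamma> by simp
  qed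
qed

end

section \<open>The discrete inner products\<close>

lemma lin_on_cmult_fun: "lin_on S f \<Longrightarrow> lin_on S (\<lambda>x. c * f x :: real)"
  unfolding lin_on_def by (simp add: algebra_simps)

text \<open>Stating definiteness for \<open>B x x \<le> 0\<close> gives strict positivity by
  contradiction, without a separate nonnegativity claim; linearity in the second argument follows
  from symmetry.\<close>

lemma pos_def_form_onI:
  assumes X: "subspace X" and lin: "\<And>z. z \<in> X \<Longrightarrow> lin_on X (\<lambda>x. B x z)"
    and sym: "\<And>x y. x \<in> X \<Longrightarrow> y \<in> X \<Longrightarrow> B x y = B y x"
    and pos: "\<And>x. x \<in> X \<Longrightarrow> B x x \<le> 0 \<Longrightarrow> x = 0"
  shows "pos_def_form_on X B"
  unfolding pos_def_form_on_def
proof (intro conjI ballI allI impI)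
  fix x y z a b assume xyz: "x \<in> X" "y \<in> X" "z \<in> X"
  show l: "B (a *\<^sub>R x + b *\<^sub>R y) z = a * B x z + b * B y z"
    using lin_onD[OF lin[OF xyz(3)] xyz(1,2)] by simp
  show "B z (a *\<^sub>R x + b *\<^sub>R y) = a * B z x + b * B z y"
    by (simp only: sym[OF xyz(3) subspace_lin_comb[OF X xyz(1,2)]] l sym[OF xyz(3,1)] sym[OF xyz(3,2)])
next
  fix x y assume "x \<in> X" "y \<in> X"
  then show "B x y = B y x" by (rule sym)
next
  fix x assume x: "x \<in> X" "x \<noteq> 0"
  have "\<not> B x x \<le> 0" using pos[OF x(1)] x(2) by blast
  then show "0 < B x x" by linarith
qed

lemma (in flat_measure) square_integral_eq_0:
  fixes f :: "pt \<Rightarrow> 'b::real_inner"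
  assumes f: "cont_ext_on X f" and le: "(\<integral>x. f x \<bullet> f x \<partial>\<mu>) \<le> 0" and x: "x \<in> X"
  shows "f x = 0"
proof -
  have "0 \<le> (\<integral>x. f x \<bullet> f x \<partial>\<mu>)" by (rule integral_nonneg) (rule inner_ge_zero)
  then have "(\<integral>x. f x \<bullet> f x \<partial>\<mu>) = 0" using le by (rule antisym[rotated])
  then have "f x \<bullet> f x = 0" by (rule integral_nonneg_eq_0[OF cont_ext_on_inner[OF f f] inner_ge_zero _ x])
  then show ?thesis by simp
qed

lemma (in l2_space) eq_0I: "f \<in> S \<Longrightarrow> (\<And>x. x \<in> X \<Longrightarrow> f x = 0) \<Longrightarrow> f = 0"
  using zero_S unfolding zero_fun_def by blast

section \<open>Curl and divergence forms\<close>

context polyhedron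
begin

text \<open>The weights must be positive for the face and edge terms to control the corresponding
  components.\<close>

lemma diameter_pos: "0 < diameter T"
proof -
  obtain x where x: "x \<in> T" using T_props(1) by blast
  obtain r where r: "r > 0" "ball x r \<subseteq> T" using openE[OF T_props(3) x] by blast
  let ?y = "x + (r / 2) *\<^sub>R axis 1 1"
  have n: "dist x ?y = r / 2" using r(1) by (simp add: dist_norm)
  then have "?y \<in> T" using r by auto
  then have "dist x ?y \<le> diameter T" using diameter_bounded_bound[OF T_props(4) x] by blast
  then show ?thesis using n r(1) by simp
qed

lemma square_sum_nonneg:
  "0 \<le> int_T M (\<lambda>x. f x \<bullet> f x)"
  "F \<in> faces M \<Longrightarrow> 0 \<le> int_F M F (\<lambda>x. g x \<bullet> g x)"
  "E \<in> edges M \<Longrightarrow> 0 \<le> int_E M E (\<lambda>x. h x \<bullet> h x)"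
  unfolding int_T_def int_F_def int_E_def
  by (rule flat_measure.integral_nonneg[OF flat_measure_cell(1) inner_ge_zero],
      erule flat_measure.integral_nonneg[OF flat_measure_face(1) inner_ge_zero],
      erule flat_measure.integral_nonneg[OF flat_measure_edge(1) inner_ge_zero])

lemma square_integral_eq_0:
  "cont_ext_on T f \<Longrightarrow> int_T M (\<lambda>x. f x \<bullet> f x) \<le> 0 \<Longrightarrow> x \<in> T \<Longrightarrow> f x = 0"
  "F \<in> faces M \<Longrightarrow> cont_ext_on F g \<Longrightarrow> int_F M F (\<lambda>x. g x \<bullet> g x) \<le> 0 \<Longrightarrow> x \<in> F \<Longrightarrow> g x = 0"
  "E \<in> edges M \<Longrightarrow> cont_ext_on E h \<Longrightarrow> int_E M E (\<lambda>x. h x \<bullet> h x) \<le> 0 \<Longrightarrow> x \<in> E \<Longrightarrow> h x = 0"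
  unfolding int_T_def int_F_def int_E_def
  by (erule (2) flat_measure.square_integral_eq_0[OF flat_measure_cell(1)],
      frule flat_measure_face(1), erule (3) flat_measure.square_integral_eq_0,
      frule flat_measure_edge(1), erule (3) flat_measure.square_integral_eq_0)

lemma weighted_sum_nonpos:
  fixes c :: real
  assumes "finite I" "0 < c" "\<And>i. i \<in> I \<Longrightarrow> 0 \<le> f i" "(\<Sum>i\<in>I. c * f i) \<le> 0" "i \<in> I"
  shows "f i \<le> 0"
proof -
  have "c * f i \<le> (\<Sum>i\<in>I. c * f i)" by (rule member_le_sum) (use assms in auto)
  then have "c * f i \<le> 0" using assms(4) by simp
  then show ?thesis using assms(2) by (simp add: mult_le_0_iff)
qed

lemma weighted_sum_nonneg: "0 < (c :: real) \<Longrightarrow> (\<And>i. i \<in> I \<Longrightarrow> 0 \<le> f i) \<Longrightarrow> 0 \<le> (\<Sum>i\<in>I. c * f i)"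
  by (intro sum_nonneg mult_nonneg_nonneg) auto

lemma polys_c_zero:
  assumes q: "q \<in> polys_c l \<E>" and 0: "\<And>E x. E \<in> \<E> \<Longrightarrow> x \<in> E \<Longrightarrow> q x = 0"
  shows "q = 0"
proof
  fix x
  show "q x = 0 x"
  proof (cases "x \<in> skeleton \<E>")
    case True
    then obtain E where E: "E \<in> \<E>" "x \<in> closure E" by (auto simp: skeleton_def)
    have "closure E \<subseteq> skeleton \<E>" using E by (auto simp: skeleton_def)
    then have "continuous_on (closure E) q" using q continuous_on_subset by (auto simp: polys_c_def)
    then have "q x = 0" by (rule continuous_constant_on_closure[OF _ 0[OF E(1)] E(2)])
    then show ?thesis by simp
  qed (use q in \<open>simp add: polys_c_def\<close>)
qed

lemma X_grad_T_cont:
  assumes "q \<in> X_grad_T M k"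
  shows "fst q \<in> polys (int k - 1)" "cont_ext_on T (fst q)"
    "F \<in> faces M \<Longrightarrow> fst (snd q) F \<in> polys_on (int k - 1) F" "F \<in> faces M \<Longrightarrow> cont_ext_on F (fst (snd q) F)"
    "F \<notin> faces M \<Longrightarrow> fst (snd q) F = 0"
    "snd (snd q) \<in> polys_c (int k + 1) (edges M)" "E \<in> edges M \<Longrightarrow> cont_ext_on E (snd (snd q))"
proof -
  show 1: "fst q \<in> polys (int k - 1)" using assms by (simp add: X_grad_T_def mem_Times_iff)
  then show "cont_ext_on T (fst q)" by (rule cont_ext_on_polys)
  show 2: "fst (snd q) F \<in> polys_on (int k - 1) F" if "F \<in> faces M" for F
    using assms that by (simp add: X_grad_T_def mem_Times_iff polys_family_def)
  then show "cont_ext_on F (fst (snd q) F)" if "F \<in> faces M" using that polys_on_cont by blast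
  show "fst (snd q) F = 0" if "F \<notin> faces M"
    using assms that by (simp add: X_grad_T_def mem_Times_iff polys_family_def)
  show 3: "snd (snd q) \<in> polys_c (int k + 1) (edges M)" using assms by (simp add: X_grad_T_def mem_Times_iff)
  show "cont_ext_on E (snd (snd q))" if "E \<in> edges M"
  proof -
    have "cont_ext_on E (restr E (snd (snd q)))" using 3 that by (intro polys_on_cont) (auto simp: polys_c_def)
    then show ?thesis by (subst cont_ext_on_cong[where g = "restr E (snd (snd q))"]) (auto simp: restr_def)
  qed
qed

lemma restr_zero_extension: "f \<in> polys_on l X \<Longrightarrow> (\<And>x. x \<in> X \<Longrightarrow> f x = 0) \<Longrightarrow> f = 0"
  using polys_on_zero by (fastforce simp: fun_eq_iff)

lemma lin_on_I_curl_T: "lin_on (vpolys k) (I_curl_T M k)"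
proof -
  have perp: "l2_space (area_measure M F) F (R_F_perp M k F)" if F: "F \<in> faces M" for F
    unfolding R_F_perp_def
    by (rule l2_space.l2_space_subspace[OF l2_tpolys_on[OF F]
          l2_space.subspace_l2_compl[OF l2_tpolys_on[OF F] R_F_subset_tpolys_on[OF F]]])
      (auto simp: l2_compl_def)
  have R: "l2_space (area_measure M F) F (R_F M l F)" if F: "F \<in> faces M" for F l
    by (rule l2_space.l2_space_subspace[OF l2_tpolys_on[OF F] subspace_R_F R_F_subset_tpolys_on[OF F]])
  have linn: "linear (\<lambda>v. v \<bullet> n)" for n :: pt by (rule linearI) (simp_all add: inner_add_left)
  have lt: "lin_on (vpolys k) (\<lambda>v. restr E (\<lambda>x. v x \<bullet> etangent M E))" for E
    by (rule lin_on_comp[OF lin_on_pointwise[OF lin_on_id linn] lin_on_restr subset_UNIV])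
  show ?thesis unfolding I_curl_T_def[abs_def]
    by (intro lin_on_Pair lin_on_family lin_on_add_fun lin_on_l2_proj[OF l2_parts_T(1)] lin_on_l2_proj[OF l2_parts_T(2)]
        lin_on_l2_proj[OF R] lin_on_l2_proj[OF perp] lin_on_l2_proj[OF l2_polys_on_E] lin_on_id lt
        tangential_trace_props cont_ext_on_vpolys cont_ext_on_restr cont_ext_on_polys[OF vpolys_inner_const])
qed

lemma delta_curl_props:
  shows "lin_on (X_curl_T M k) (delta_curl M k)" "v \<in> X_curl_T M k \<Longrightarrow> delta_curl M k v \<in> X_curl_T M k"
    "v \<in> X_curl_T M k \<Longrightarrow> P_curl_T M k v = 0 \<Longrightarrow> delta_curl M k v = - v"
proof -
  have P: "P_curl_T M k ` X_curl_T M k \<subseteq> vpolys k" using P_curl_T_props(2) by blast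
  show "lin_on (X_curl_T M k) (delta_curl M k)"
    unfolding delta_curl_def[abs_def]
    by (rule lin_on_diff_fun[OF lin_on_comp[OF P_curl_T_props(1) lin_on_I_curl_T P] lin_on_id])
  show "delta_curl M k v \<in> X_curl_T M k" if "v \<in> X_curl_T M k"
    unfolding delta_curl_def
    by (rule subspace_diff[OF subspace_X_curl_T I_curl_T_poly(1)[OF P_curl_T_props(2)[OF that]] that])
  show "delta_curl M k v = - v" if "v \<in> X_curl_T M k" "P_curl_T M k v = 0"
    unfolding delta_curl_def that(2) lin_on_0[OF lin_on_I_curl_T subspace_vpolys] by simp
qed

text \<open>The two face parts viewed as functions of the whole discrete element, so that their
  linearity on \<open>X_curl_T M k\<close> can be composed with
  \<open>delta_curl M k\<close>.\<close>

definition curl_face_parts :: "nat \<Rightarrow> pt set \<Rightarrow> curl_T_dofs \<Rightarrow> (pt \<Rightarrow> pt) \<times> (pt \<Rightarrow> pt)" where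
  "curl_face_parts k F v = (R_part_F M k F (fst (snd v) F), R_perp_part_F M k F (fst (snd v) F))"

lemma curl_face_parts_props:
  assumes F: "F \<in> faces M"
  shows "lin_on (X_curl_T M k) (\<lambda>v. fst (curl_face_parts k F v))" "lin_on (X_curl_T M k) (\<lambda>v. snd (curl_face_parts k F v))"
    "v \<in> X_curl_T M k \<Longrightarrow> fst (curl_face_parts k F v) \<in> R_F M (int k - 1) F"
    "v \<in> X_curl_T M k \<Longrightarrow> snd (curl_face_parts k F v) \<in> R_F_perp M k F"
    "v \<in> X_curl_T M k \<Longrightarrow> fst (curl_face_parts k F v) + snd (curl_face_parts k F v) = fst (snd v) F"
    "v \<in> X_curl_T M k \<Longrightarrow> cont_ext_on F (fst (curl_face_parts k F v))"
    "v \<in> X_curl_T M k \<Longrightarrow> cont_ext_on F (snd (curl_face_parts k F v))"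
proof -
  interpret direct_sum "R_F M (int k - 1) F" "R_F_perp M k F" by (rule direct_sum_F[OF F])
  have f: "(\<lambda>v. fst (snd v) F) ` X_curl_T M k \<subseteq> dsum (R_F M (int k - 1) F) (R_F_perp M k F)"
    using F by (auto simp: X_curl_T_def)
  have l: "lin_on (X_curl_T M k) (\<lambda>v. fst (snd v) F)" by (rule lin_on_apply[OF lin_on_fst'[OF lin_on_snd]])
  show "lin_on (X_curl_T M k) (\<lambda>v. fst (curl_face_parts k F v))" "lin_on (X_curl_T M k) (\<lambda>v. snd (curl_face_parts k F v))"
    unfolding curl_face_parts_def fst_conv snd_conv R_part_F_def R_perp_part_F_def
    by (rule lin_on_comp[OF l lin_on_dsum_fst f], rule lin_on_comp[OF l lin_on_dsum_snd f])
  show 1: "fst (curl_face_parts k F v) \<in> R_F M (int k - 1) F" and 2: "snd (curl_face_parts k F v) \<in> R_F_perp M k F"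
    and "fst (curl_face_parts k F v) + snd (curl_face_parts k F v) = fst (snd v) F" if v: "v \<in> X_curl_T M k" for v
  proof -
    have "fst (snd v) F \<in> dsum (R_F M (int k - 1) F) (R_F_perp M k F)" by (rule subsetD[OF f imageI[OF v]])
    note d = dsum_fst_in[OF this] dsum_snd_in[OF this] dsum_fst_snd[OF this]
    show "fst (curl_face_parts k F v) \<in> R_F M (int k - 1) F" "snd (curl_face_parts k F v) \<in> R_F_perp M k F"
      "fst (curl_face_parts k F v) + snd (curl_face_parts k F v) = fst (snd v) F"
      unfolding curl_face_parts_def fst_conv snd_conv R_part_F_def R_perp_part_F_def by (rule d(1), rule d(2), rule d(3))
  qed
  show "cont_ext_on F (fst (curl_face_parts k F v))" if "v \<in> X_curl_T M k" by (rule R_F_cont[OF F 1[OF that]])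
  show "cont_ext_on F (snd (curl_face_parts k F v))" if "v \<in> X_curl_T M k" by (rule R_F_perp_cont[OF F 2[OF that]])
qed

lemma form_curl_eq:
  "form_curl M k v w = int_T M (\<lambda>x. P_curl_T M k v x \<bullet> P_curl_T M k w x)
     + int_T M (\<lambda>x. R_part_T M k (fst (delta_curl M k v)) x \<bullet> R_part_T M k (fst (delta_curl M k w)) x)
     + (\<Sum>F\<in>faces M. diameter T * int_F M F (\<lambda>x.
          fst (curl_face_parts k F (delta_curl M k v)) x \<bullet> fst (curl_face_parts k F (delta_curl M k w)) x
          + snd (curl_face_parts k F (delta_curl M k v)) x \<bullet> snd (curl_face_parts k F (delta_curl M k w)) x))
     + (\<Sum>E\<in>edges M. (diameter T)\<^sup>2 * int_E M E (\<lambda>x. snd (snd (delta_curl M k v)) E x \<bullet> snd (snd (delta_curl M k w)) E x))"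
  by (simp add: form_curl_def Let_def case_prod_unfold curl_face_parts_def)

lemma pos_def_form_curl: "pos_def_form_on (X_curl_T M k) (form_curl M k)"
proof (rule pos_def_form_onI[OF subspace_X_curl_T])
  let ?X = "X_curl_T M k" and ?\<delta> = "delta_curl M k"
  note \<delta> = delta_curl_props[where k = k]
  have \<delta>X: "?\<delta> ` ?X \<subseteq> ?X" using \<delta>(2) by blast
  have Pc: "cont_ext_on T (P_curl_T M k v)" if "v \<in> ?X" for v by (rule cont_ext_on_vpolys[OF P_curl_T_props(2)[OF that]])
  have Rc: "cont_ext_on T (R_part_T M k (fst v))" if "v \<in> ?X" for v
    using R_part_T_props(3)[OF that] R_T_subset cont_ext_on_vpolys by blast
  have Eo: "snd (snd v) E \<in> polys_on k E" if "v \<in> ?X" "E \<in> edges M" for v E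
    using that by (simp add: X_curl_T_def mem_Times_iff polys_family_def)
  have Ec: "cont_ext_on E (snd (snd v) E)" if "v \<in> ?X" "E \<in> edges M" for v E by (rule polys_on_cont[OF Eo[OF that]])
  note fm = flat_measure_cell(1) flat_measure_face(1) flat_measure_edge(1)
  show "lin_on ?X (\<lambda>v. form_curl M k v w)" if w: "w \<in> ?X" for w
  proof -
    have l1: "lin_on ?X (\<lambda>v. int_T M (\<lambda>x. P_curl_T M k v x \<bullet> P_curl_T M k w x))"
      unfolding int_T_def by (intro flat_measure.lin_on_integral_left[OF fm(1)] P_curl_T_props(1) Pc w)
    have l2: "lin_on ?X (\<lambda>v. int_T M (\<lambda>x. R_part_T M k (fst v) x \<bullet> R_part_T M k (fst (?\<delta> w)) x))"
      unfolding int_T_def by (intro flat_measure.lin_on_integral_left[OF fm(1)] R_part_T_props(1) Rc \<delta>(2) w)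
    have l3: "lin_on ?X (\<lambda>v. int_F M F (\<lambda>x. fst (curl_face_parts k F v) x \<bullet> fst (curl_face_parts k F (?\<delta> w)) x
          + snd (curl_face_parts k F v) x \<bullet> snd (curl_face_parts k F (?\<delta> w)) x))" if F: "F \<in> faces M" for F
    proof -
      have "lin_on ?X (\<lambda>v. int_F M F (\<lambda>x. fst (curl_face_parts k F v) x \<bullet> fst (curl_face_parts k F (?\<delta> w)) x)
          + int_F M F (\<lambda>x. snd (curl_face_parts k F v) x \<bullet> snd (curl_face_parts k F (?\<delta> w)) x))"
        unfolding int_F_def
        by (intro lin_on_add_fun flat_measure.lin_on_integral_left[OF fm(2)[OF F]] curl_face_parts_props[OF F] \<delta>(2) w)
      moreover have "int_F M F (\<lambda>x. fst (curl_face_parts k F v) x \<bullet> fst (curl_face_parts k F (?\<delta> w)) x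
          + snd (curl_face_parts k F v) x \<bullet> snd (curl_face_parts k F (?\<delta> w)) x)
        = int_F M F (\<lambda>x. fst (curl_face_parts k F v) x \<bullet> fst (curl_face_parts k F (?\<delta> w)) x)
          + int_F M F (\<lambda>x. snd (curl_face_parts k F v) x \<bullet> snd (curl_face_parts k F (?\<delta> w)) x)" if "v \<in> ?X" for v
        unfolding int_F_def
        by (intro flat_measure.integral_add[OF fm(2)[OF F]] cont_ext_on_inner curl_face_parts_props[OF F] \<delta>(2) w that)
      ultimately show ?thesis
        unfolding lin_on_def using subspace_lin_comb[OF subspace_X_curl_T] by simp
    qed
    have l4: "lin_on ?X (\<lambda>v. int_E M E (\<lambda>x. snd (snd v) E x \<bullet> snd (snd (?\<delta> w)) E x))" if E: "E \<in> edges M" for E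
      unfolding int_E_def
      by (intro flat_measure.lin_on_integral_left[OF fm(3)[OF E]] lin_on_apply[OF lin_on_snd'[OF lin_on_snd]] Ec \<delta>(2) w E)
    show ?thesis unfolding form_curl_eq
      by (intro lin_on_add_fun l1 lin_on_comp[OF \<delta>(1) l2 \<delta>X] lin_on_sum_fun lin_on_cmult_fun
          lin_on_comp[OF \<delta>(1) l3 \<delta>X] lin_on_comp[OF \<delta>(1) l4 \<delta>X])
  qed
  show "form_curl M k v w = form_curl M k w v" for v w
    unfolding form_curl_eq by (simp only: inner_commute)
  fix v assume v: "v \<in> ?X" and le: "form_curl M k v v \<le> 0"
  let ?f = "\<lambda>F. int_F M F (\<lambda>x. fst (curl_face_parts k F (?\<delta> v)) x \<bullet> fst (curl_face_parts k F (?\<delta> v)) x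
          + snd (curl_face_parts k F (?\<delta> v)) x \<bullet> snd (curl_face_parts k F (?\<delta> v)) x)"
  let ?e = "\<lambda>E. int_E M E (\<lambda>x. snd (snd (?\<delta> v)) E x \<bullet> snd (snd (?\<delta> v)) E x)"
  have feq: "?f F = int_F M F (\<lambda>x. fst (curl_face_parts k F (?\<delta> v)) x \<bullet> fst (curl_face_parts k F (?\<delta> v)) x)
      + int_F M F (\<lambda>x. snd (curl_face_parts k F (?\<delta> v)) x \<bullet> snd (curl_face_parts k F (?\<delta> v)) x)" if F: "F \<in> faces M" for F
    unfolding int_F_def
    by (intro flat_measure.integral_add[OF fm(2)[OF F]] cont_ext_on_inner curl_face_parts_props[OF F] \<delta>(2) v)
  have f0: "0 \<le> ?f F" if "F \<in> faces M" for F unfolding feq[OF that] by (intro add_nonneg_nonneg square_sum_nonneg(2) that)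
  have e0: "0 \<le> ?e E" if "E \<in> edges M" for E by (rule square_sum_nonneg(3)[OF that])
  have s3: "0 \<le> (\<Sum>F\<in>faces M. diameter T * ?f F)" by (rule weighted_sum_nonneg[OF diameter_pos f0])
  have s4: "0 \<le> (\<Sum>E\<in>edges M. (diameter T)\<^sup>2 * ?e E)"
    by (rule weighted_sum_nonneg[OF zero_less_power[OF diameter_pos] e0])
  note nn = square_sum_nonneg(1)[of "P_curl_T M k v"] square_sum_nonneg(1)[of "R_part_T M k (fst (?\<delta> v))"] s3 s4
  have z1: "int_T M (\<lambda>x. P_curl_T M k v x \<bullet> P_curl_T M k v x) \<le> 0"
    and z2: "int_T M (\<lambda>x. R_part_T M k (fst (?\<delta> v)) x \<bullet> R_part_T M k (fst (?\<delta> v)) x) \<le> 0"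
    and z3: "(\<Sum>F\<in>faces M. diameter T * ?f F) \<le> 0" and z4: "(\<Sum>E\<in>edges M. (diameter T)\<^sup>2 * ?e E) \<le> 0"
    using le nn unfolding form_curl_eq by linarith+
  have P0: "P_curl_T M k v = 0"
    by (rule l2_space.eq_0I[OF l2_vpolys P_curl_T_props(2)[OF v] square_integral_eq_0(1)[OF Pc[OF v] z1]])
  \<comment> \<open>From here on the penalised terms measure \<open>- v\<close> itself.\<close>
  have \<delta>v: "?\<delta> v = - v" by (rule \<delta>(3)[OF v P0])
  have neg: "- v \<in> ?X" by (rule subspace_neg[OF subspace_X_curl_T v])
  have part: "R_part_T M k (fst (- v)) = 0"
    by (rule l2_space.eq_0I[OF l2_parts_T(1) R_part_T_props(3)[OF neg] square_integral_eq_0(1)[OF Rc[OF neg] z2[unfolded \<delta>v]]])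
  \<comment> \<open>The form has no volume penalty for this component. It is its own test in the
    second relation of the potential, whose left side is now zero.\<close>
  have perp: "R_perp_part_T M k (fst v) = 0"
  proof (rule l2_space.ip_eq_0[OF l2_parts_T(2) R_part_T_props(4)[OF v]])
    show "l2_space.ip (vol_measure M) (R_perp_part_T M k (fst v)) (R_perp_part_T M k (fst v)) = 0"
      using P_curl_T_props(3)[OF v R_part_T_props(4)[OF v]]
      by (simp add: P0 l2_space.ip_def[OF l2_parts_T(2)] int_T_def)
  qed
  have "R_part_T M k (fst v) = 0"
  proof -
    have "R_part_T M k (fst ((-1) *\<^sub>R v)) = (-1) *\<^sub>R R_part_T M k (fst v)"
      by (rule lin_on_scale[OF R_part_T_props(1) v])
    then show ?thesis using part by simp
  qed
  then have v1: "fst v = 0" using R_part_T_props(5)[OF v] perp by simp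
  have v2: "fst (snd v) = 0"
  proof
    fix F
    show "fst (snd v) F = 0 F"
    proof (cases "F \<in> faces M")
      case F: True
      have "?f F \<le> 0" by (rule weighted_sum_nonpos[OF fin_F diameter_pos f0 z3 F])
      then have le: "int_F M F (\<lambda>x. fst (curl_face_parts k F (- v)) x \<bullet> fst (curl_face_parts k F (- v)) x) \<le> 0"
        "int_F M F (\<lambda>x. snd (curl_face_parts k F (- v)) x \<bullet> snd (curl_face_parts k F (- v)) x) \<le> 0"
        using feq[OF F] square_sum_nonneg(2)[OF F, of "fst (curl_face_parts k F (- v))"]
          square_sum_nonneg(2)[OF F, of "snd (curl_face_parts k F (- v))"] unfolding \<delta>v by linarith+
      note p = curl_face_parts_props[OF F]
      have "fst (curl_face_parts k F (- v)) x = 0" "snd (curl_face_parts k F (- v)) x = 0" if x: "x \<in> F" for x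
        using square_integral_eq_0(2)[OF F p(6)[OF neg] le(1) x] square_integral_eq_0(2)[OF F p(7)[OF neg] le(2) x] by auto
      then have "(fst (curl_face_parts k F (- v)) + snd (curl_face_parts k F (- v))) x = 0" if "x \<in> F" for x
        using that by simp
      then have on: "fst (snd v) F x = 0" if "x \<in> F" for x using that unfolding p(5)[OF neg] by simp
      \<comment> \<open>Membership in a space of zero extensions turns vanishing on \<open>F\<close>
        into equality with 0 everywhere.\<close>
      have "fst (snd v) F \<in> tpolys_on M k F"
        unfolding p(5)[OF v, symmetric]
        by (intro subspace_add[OF subspace_tpolys_on])
          (use p(3,4)[OF v] R_F_subset_tpolys_on[OF F, of k] R_F_mono[of "int k - 1" k] in
            \<open>auto simp: R_F_perp_def l2_compl_def\<close>)
      then have "fst (snd v) F = 0" by (rule l2_space.eq_0I[OF l2_tpolys_on[OF F] _ on])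
      then show ?thesis by simp
    qed (use v in \<open>simp add: X_curl_T_def mem_Times_iff\<close>)
  qed
  have v3: "snd (snd v) = 0"
  proof
    fix E
    show "snd (snd v) E = 0 E"
    proof (cases "E \<in> edges M")
      case E: True
      have "?e E \<le> 0" by (rule weighted_sum_nonpos[OF fin_E zero_less_power[OF diameter_pos] e0 z4 E])
      then have le: "int_E M E (\<lambda>x. snd (snd (- v)) E x \<bullet> snd (snd (- v)) E x) \<le> 0" unfolding \<delta>v .
      have "snd (snd v) E x = 0" if "x \<in> E" for x
        using square_integral_eq_0(3)[OF E Ec[OF neg E] le that] by simp
      then show ?thesis using restr_zero_extension[OF Eo[OF v E]] by simp
    qed (use v in \<open>simp add: X_curl_T_def mem_Times_iff polys_family_def\<close>)
  qed
  show "v = 0" using v1 v2 v3 by (simp add: prod_eq_iff)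
qed

lemma form_curl_consistent:
  assumes "v \<in> vpolys k" "w \<in> vpolys k"
  shows "form_curl M k (I_curl_T M k v) (I_curl_T M k w) = int_T M (\<lambda>x. v x \<bullet> w x)"
proof -
  have 0: "0 \<in> X_curl_T M k" by (rule subspace_0[OF subspace_X_curl_T])
  have \<delta>: "delta_curl M k (I_curl_T M k v) = 0" unfolding delta_curl_def I_curl_T_poly(3)[OF assms(1)] by simp
  have "R_part_T M k (fst (0 :: curl_T_dofs)) = 0" by (rule lin_on_0[OF R_part_T_props(1) subspace_X_curl_T])
  moreover have "fst (curl_face_parts k F 0) = 0" "snd (curl_face_parts k F 0) = 0" if F: "F \<in> faces M" for F
    by (rule lin_on_0[OF curl_face_parts_props(1)[OF F] subspace_X_curl_T],
        rule lin_on_0[OF curl_face_parts_props(2)[OF F] subspace_X_curl_T])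
  ultimately show ?thesis
    unfolding form_curl_eq \<delta> I_curl_T_poly(3)[OF assms(1)] I_curl_T_poly(3)[OF assms(2)]
    by (simp add: int_T_def int_F_def int_E_def)
qed

lemma form_div_eq:
  "form_div M k v w = int_T M (\<lambda>x. P_div_T M k v x \<bullet> P_div_T M k w x)
     + (\<Sum>F\<in>faces M. diameter T * int_F M F (\<lambda>x. delta_div M k v F x \<bullet> delta_div M k w F x))"
  by (simp add: form_div_def)

lemma pos_def_form_div: "pos_def_form_on (X_div_T M k) (form_div M k)"
proof (rule pos_def_form_onI[OF subspace_X_div_T])
  let ?X = "X_div_T M k"
  have Pc: "cont_ext_on A (P_div_T M k v)" if "v \<in> ?X" for v A by (rule cont_ext_on_vpolys[OF P_div_T_props(2)[OF that]])
  have linn: "linear (\<lambda>v. v \<bullet> n)" for n :: pt by (rule linearI) (simp_all add: inner_add_left)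
  have dl: "lin_on ?X (\<lambda>v. delta_div M k v F)" if F: "F \<in> faces M" for F
  proof -
    have "lin_on ?X (\<lambda>v. (\<lambda>x. P_div_T M k v x \<bullet> fnormal M F) - snd v F)"
      by (intro lin_on_diff_fun lin_on_pointwise[OF P_div_T_props(1) linn] face_comp_props(1)[OF F])
    then show ?thesis by (simp add: delta_div_def[abs_def] fun_diff_def)
  qed
  have dc: "cont_ext_on F (delta_div M k v F)" if "v \<in> ?X" "F \<in> faces M" for v F
    unfolding delta_div_def[abs_def]
    by (intro cont_ext_on_diff cont_ext_on_inner Pc cont_ext_on_const face_comp_props(2)[where k = k] that)
  show "lin_on ?X (\<lambda>v. form_div M k v w)" if w: "w \<in> ?X" for w
    unfolding form_div_eq int_T_def int_F_def
    by (intro lin_on_add_fun lin_on_sum_fun lin_on_cmult_fun flat_measure.lin_on_integral_left[OF flat_measure_cell(1)]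
        flat_measure.lin_on_integral_left[OF flat_measure_face(1)] P_div_T_props(1) dl Pc dc w)
  show "form_div M k v w = form_div M k w v" for v w
    unfolding form_div_eq by (simp only: inner_commute)
  fix v assume v: "v \<in> ?X" and le: "form_div M k v v \<le> 0"
  have f0: "0 \<le> int_F M F (\<lambda>x. delta_div M k v F x \<bullet> delta_div M k v F x)" if "F \<in> faces M" for F
    by (rule square_sum_nonneg(2)[OF that])
  have s2: "0 \<le> (\<Sum>F\<in>faces M. diameter T * int_F M F (\<lambda>x. delta_div M k v F x \<bullet> delta_div M k v F x))"
    by (rule weighted_sum_nonneg[OF diameter_pos f0])
  have z1: "int_T M (\<lambda>x. P_div_T M k v x \<bullet> P_div_T M k v x) \<le> 0"
    and z2: "(\<Sum>F\<in>faces M. diameter T * int_F M F (\<lambda>x. delta_div M k v F x \<bullet> delta_div M k v F x)) \<le> 0"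
    using le square_sum_nonneg(1)[of "P_div_T M k v"] s2 unfolding form_div_eq by linarith+
  have P0: "P_div_T M k v = 0"
    by (rule l2_space.eq_0I[OF l2_vpolys P_div_T_props(2)[OF v] square_integral_eq_0(1)[OF Pc[OF v] z1]])
  have v2: "snd v F = 0" for F
  proof (cases "F \<in> faces M")
    case F: True
    have "int_F M F (\<lambda>x. delta_div M k v F x \<bullet> delta_div M k v F x) \<le> 0"
      by (rule weighted_sum_nonpos[OF fin_F diameter_pos f0 z2 F])
    then have "delta_div M k v F x = 0" if "x \<in> F" for x by (rule square_integral_eq_0(2)[OF F dc[OF v F] _ that])
    then have "snd v F x = 0" if "x \<in> F" for x using that by (simp add: delta_div_def P0)
    moreover have "snd v F \<in> polys_on k F" using v F by (simp add: X_div_T_def mem_Times_iff polys_family_def)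
    ultimately show ?thesis using restr_zero_extension by blast
  qed (use v in \<open>simp add: X_div_T_def mem_Times_iff polys_family_def\<close>)
  have perp: "G_perp_part_T M k (fst v) = 0"
  proof (rule l2_space.ip_eq_0[OF l2_parts_T(4) G_part_T_props(2)[OF v]])
    show "l2_space.ip (vol_measure M) (G_perp_part_T M k (fst v)) (G_perp_part_T M k (fst v)) = 0"
      using P_div_T_props(4)[OF v G_part_T_props(2)[OF v]]
      by (simp add: P0 l2_space.ip_def[OF l2_parts_T(4)] int_T_def)
  qed
  \<comment> \<open>With the complement component gone, the volume component is a pure
    gradient.\<close>
  obtain g where g: "g \<in> G_T (int k - 1)" "g = fst v" using G_part_T_props(3)[OF v] perp by auto
  interpret T: flat_measure "vol_measure M" T by (rule flat_measure_cell(1))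
  interpret P: l2_space "vol_measure M" T "polys (int k + 1)" by (rule l2_polys)
  let ?D = "divergence M k v"
  have D: "?D \<in> polys k" by (rule divergence_props(2)[OF v])
  have D': "?D \<in> polys (int k + 1)" by (rule polys_mono[OF D]) simp
  \<comment> \<open>The potential may be tested with zero-mean functions only. Testing the
    divergence with the constant 1, whose gradient vanishes, shows that \<open>?D\<close> is one of
    them.\<close>
  have D1: "int_T M ?D = 0"
  proof -
    have one: "(\<lambda>x. 1) \<in> polys k" by simp
    have "grad (\<lambda>x. 1) = (\<lambda>x. 0)" by (auto simp: fun_eq_iff vec_eq_iff grad_comp)
    then show ?thesis using divergence_props(3)[OF v one] by (simp add: v2 int_T_def int_F_def)
  qed
  have "int_T M (\<lambda>x. ?D x * ?D x) = 0"
    using P_div_T_props(3)[OF v D' D1] by (simp add: P0 v2 int_T_def int_F_def)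
  then have D0: "?D = 0" using P.ip_eq_0[OF D'] by (simp add: P.ip_def int_T_def)
  have "fst v = 0"
  proof -
    \<comment> \<open>A gradient in \<open>G_T (int k - 1)\<close> has a potential of degree
      \<open>k\<close>, which is exactly a test of \<open>divergence\<close>.\<close>
    obtain q where q: "q \<in> polys k" "g = grad q" using g(1) by (auto simp: G_T_def)
    have "int_T M (\<lambda>x. fst v x \<bullet> grad q x) = 0"
      using divergence_props(3)[OF v q(1)] by (simp add: D0 v2 int_T_def int_F_def)
    then have "l2_space.ip (vol_measure M) g g = 0"
      unfolding l2_space.ip_def[OF l2_parts_T(3)] using g(2) q(2) by (simp add: int_T_def)
    then show ?thesis using l2_space.ip_eq_0[OF l2_parts_T(3) g(1)] g(2) by simp
  qed
  then show "v = 0" using v2 by (simp add: prod_eq_iff fun_eq_iff)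
qed

lemma form_div_consistent:
  assumes "v \<in> vpolys k" "w \<in> vpolys k"
  shows "form_div M k (I_div_T M k v) (I_div_T M k w) = int_T M (\<lambda>x. v x \<bullet> w x)"
proof -
  have "int_F M F (\<lambda>x. delta_div M k (I_div_T M k v) F x \<bullet> delta_div M k (I_div_T M k w) F x) = int_F M F (\<lambda>x. 0)"
    if F: "F \<in> faces M" for F
    unfolding int_F_def
    by (rule flat_measure.integral_cong[OF flat_measure_face(1)[OF F]])
      (simp add: delta_div_def I_div_T_poly(2)[OF assms(1)] I_div_T_poly(3)[OF assms(1) F] restr_def)
  then show ?thesis
    unfolding form_div_eq I_div_T_poly(2)[OF assms(1)] I_div_T_poly(2)[OF assms(2)] by (simp add: int_F_def)
qed

end

section \<open>The gradient form\<close>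

context polyhedron_with_trace
begin

lemma delta_grad_props:
  shows "lin_on (X_grad_T M k) (delta_grad M k \<gamma>)" "q \<in> X_grad_T M k \<Longrightarrow> delta_grad M k \<gamma> q \<in> X_grad_T M k"
    "q \<in> X_grad_T M k \<Longrightarrow> P_grad_T M k \<gamma> q = 0 \<Longrightarrow> delta_grad M k \<gamma> q = - q"
proof -
  have P: "P_grad_T M k \<gamma> ` X_grad_T M k \<subseteq> polys (int k + 1)" using P_grad_T_props(2) by blast
  show "lin_on (X_grad_T M k) (delta_grad M k \<gamma>)"
    unfolding delta_grad_def[abs_def]
    by (rule lin_on_diff_fun[OF lin_on_comp[OF P_grad_T_props(1) lin_on_I_grad_T P] lin_on_id])
  show "delta_grad M k \<gamma> q \<in> X_grad_T M k" if "q \<in> X_grad_T M k"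
    unfolding delta_grad_def
    by (rule subspace_diff[OF subspace_X_grad_T I_grad_T_poly(2)[OF P_grad_T_props(2)[OF that]] that])
  show "delta_grad M k \<gamma> q = - q" if "q \<in> X_grad_T M k" "P_grad_T M k \<gamma> q = 0"
    unfolding delta_grad_def that(2) lin_on_0[OF lin_on_I_grad_T subspace_polys] by simp
qed

lemma form_grad_eq:
  "form_grad M k \<gamma> q r = int_T M (\<lambda>x. P_grad_T M k \<gamma> q x \<bullet> P_grad_T M k \<gamma> r x)
     + int_T M (\<lambda>x. fst (delta_grad M k \<gamma> q) x \<bullet> fst (delta_grad M k \<gamma> r) x)
     + (\<Sum>F\<in>faces M. diameter T * int_F M F (\<lambda>x. fst (snd (delta_grad M k \<gamma> q)) F x \<bullet> fst (snd (delta_grad M k \<gamma> r)) F x))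
     + (\<Sum>E\<in>edges M. (diameter T)\<^sup>2 * int_E M E (\<lambda>x. snd (snd (delta_grad M k \<gamma> q)) x \<bullet> snd (snd (delta_grad M k \<gamma> r)) x))"
  by (simp add: form_grad_def Let_def case_prod_unfold)

lemma pos_def_form_grad: "pos_def_form_on (X_grad_T M k) (form_grad M k \<gamma>)"
proof (rule pos_def_form_onI[OF subspace_X_grad_T])
  let ?X = "X_grad_T M k" and ?\<delta> = "delta_grad M k \<gamma>"
  note \<delta> = delta_grad_props
  have \<delta>X: "?\<delta> ` ?X \<subseteq> ?X" using \<delta>(2) by blast
  have Pc: "cont_ext_on T (P_grad_T M k \<gamma> v)" if "v \<in> ?X" for v by (rule cont_ext_on_polys[OF P_grad_T_props(2)[OF that]])
  note fm = flat_measure_cell(1) flat_measure_face(1) flat_measure_edge(1)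
  show "lin_on ?X (\<lambda>q. form_grad M k \<gamma> q r)" if r: "r \<in> ?X" for r
  proof -
    note c = X_grad_T_cont[OF \<delta>(2)[OF r]]
    have l1: "lin_on ?X (\<lambda>q. int_T M (\<lambda>x. P_grad_T M k \<gamma> q x \<bullet> P_grad_T M k \<gamma> r x))"
      unfolding int_T_def by (intro flat_measure.lin_on_integral_left[OF fm(1)] P_grad_T_props(1) Pc r)
    have l2: "lin_on ?X (\<lambda>q. int_T M (\<lambda>x. fst q x \<bullet> fst (?\<delta> r) x))"
      unfolding int_T_def by (intro flat_measure.lin_on_integral_left[OF fm(1)] lin_on_fst X_grad_T_cont(2)[where k = k] c(2))
    have l3: "lin_on ?X (\<lambda>q. int_F M F (\<lambda>x. fst (snd q) F x \<bullet> fst (snd (?\<delta> r)) F x))" if F: "F \<in> faces M" for F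
      unfolding int_F_def
      by (intro flat_measure.lin_on_integral_left[OF fm(2)[OF F]] lin_on_apply[OF lin_on_fst'[OF lin_on_snd]] X_grad_T_cont(4)[where k = k] c(4) F)
    have l4: "lin_on ?X (\<lambda>q. int_E M E (\<lambda>x. snd (snd q) x \<bullet> snd (snd (?\<delta> r)) x))" if E: "E \<in> edges M" for E
      unfolding int_E_def
      by (intro flat_measure.lin_on_integral_left[OF fm(3)[OF E]] lin_on_snd'[OF lin_on_snd] X_grad_T_cont(7)[where k = k] c(7) E)
    show ?thesis unfolding form_grad_eq
      by (intro lin_on_add_fun l1 lin_on_comp[OF \<delta>(1) l2 \<delta>X] lin_on_sum_fun lin_on_cmult_fun
          lin_on_comp[OF \<delta>(1) l3 \<delta>X] lin_on_comp[OF \<delta>(1) l4 \<delta>X])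
  qed
  show "form_grad M k \<gamma> v w = form_grad M k \<gamma> w v" for v w
    unfolding form_grad_eq by (simp only: inner_commute)
  fix q assume q: "q \<in> ?X" and le: "form_grad M k \<gamma> q q \<le> 0"
  let ?f = "\<lambda>F. int_F M F (\<lambda>x. fst (snd (?\<delta> q)) F x \<bullet> fst (snd (?\<delta> q)) F x)"
  let ?e = "\<lambda>E. int_E M E (\<lambda>x. snd (snd (?\<delta> q)) x \<bullet> snd (snd (?\<delta> q)) x)"
  have f0: "0 \<le> ?f F" if "F \<in> faces M" for F by (rule square_sum_nonneg(2)[OF that])
  have e0: "0 \<le> ?e E" if "E \<in> edges M" for E by (rule square_sum_nonneg(3)[OF that])
  have s3: "0 \<le> (\<Sum>F\<in>faces M. diameter T * ?f F)" by (rule weighted_sum_nonneg[OF diameter_pos f0])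
  have s4: "0 \<le> (\<Sum>E\<in>edges M. (diameter T)\<^sup>2 * ?e E)"
    by (rule weighted_sum_nonneg[OF zero_less_power[OF diameter_pos] e0])
  note nn = square_sum_nonneg(1)[of "P_grad_T M k \<gamma> q"] square_sum_nonneg(1)[of "fst (?\<delta> q)"] s3 s4
  have z1: "int_T M (\<lambda>x. P_grad_T M k \<gamma> q x \<bullet> P_grad_T M k \<gamma> q x) \<le> 0"
    and z2: "int_T M (\<lambda>x. fst (?\<delta> q) x \<bullet> fst (?\<delta> q) x) \<le> 0"
    and z3: "(\<Sum>F\<in>faces M. diameter T * ?f F) \<le> 0" and z4: "(\<Sum>E\<in>edges M. (diameter T)\<^sup>2 * ?e E) \<le> 0"
    using le nn unfolding form_grad_eq by linarith+
  have P0: "P_grad_T M k \<gamma> q = 0"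
    by (rule l2_space.eq_0I[OF l2_polys P_grad_T_props(2)[OF q] square_integral_eq_0(1)[OF Pc[OF q] z1]])
  have \<delta>q: "?\<delta> q = - q" by (rule \<delta>(3)[OF q P0])
  have neg: "- q \<in> ?X" by (rule subspace_neg[OF subspace_X_grad_T q])
  note c = X_grad_T_cont[OF neg]
  have "fst (- q) = 0"
    by (rule l2_space.eq_0I[OF l2_polys c(1) square_integral_eq_0(1)[OF c(2) z2[unfolded \<delta>q]]])
  then have q1: "fst q = 0" by simp
  have q2: "fst (snd (- q)) F = 0" for F
  proof (cases "F \<in> faces M")
    case F: True
    have "?f F \<le> 0" by (rule weighted_sum_nonpos[OF fin_F diameter_pos f0 z3 F])
    then have "fst (snd (- q)) F x = 0" if "x \<in> F" for x
      unfolding \<delta>q by (rule square_integral_eq_0(2)[OF F c(4)[OF F] _ that])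
    then show ?thesis using restr_zero_extension[OF c(3)[OF F]] by blast
  next
    case False
    then show ?thesis by (rule c(5))
  qed
  have "snd (snd (- q)) = 0"
  \<comment> \<open>The edge integrals control \<open>q\<close> on the open edges only; continuity
    of the skeleton component carries the zero to the vertices.\<close>
  proof (rule polys_c_zero[OF c(6)])
    fix E x assume E: "E \<in> edges M" "x \<in> E"
    have "?e E \<le> 0" by (rule weighted_sum_nonpos[OF fin_E zero_less_power[OF diameter_pos] e0 z4 E(1)])
    then show "snd (snd (- q)) x = 0" unfolding \<delta>q by (rule square_integral_eq_0(3)[OF E(1) c(7)[OF E(1)] _ E(2)])
  qed
  then have q3: "snd (snd q) = 0" by simp
  have "fst (snd q) = 0" using q2 by (auto simp: fun_eq_iff)
  then show "q = 0" using q1 q3 by (simp add: prod_eq_iff)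
qed

lemma form_grad_consistent:
  assumes "q \<in> polys (int k + 1)" "r \<in> polys (int k + 1)"
  shows "form_grad M k \<gamma> (I_grad_T M k q) (I_grad_T M k r) = int_T M (\<lambda>x. q x * r x)"
proof -
  have \<delta>: "delta_grad M k \<gamma> (I_grad_T M k q) = 0" unfolding delta_grad_def P_grad_T_I_grad_T[OF assms(1)] by simp
  show ?thesis
    unfolding form_grad_eq \<delta> P_grad_T_I_grad_T[OF assms(1)] P_grad_T_I_grad_T[OF assms(2)]
    by (simp add: int_T_def int_F_def int_E_def)
qed

end

theorem lemma29:
  fixes M :: polyhedral_cell and k :: nat
    and \<gamma> :: "pt set \<Rightarrow> grad_F_dofs \<Rightarrow> pt \<Rightarrow> real"
  assumes "is_polyhedron M" and "scalar_trace M k \<gamma>"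
  shows "pos_def_form_on (X_grad_T M k) (form_grad M k \<gamma>) \<and>
         pos_def_form_on (X_curl_T M k) (form_curl M k) \<and>
         pos_def_form_on (X_div_T M k) (form_div M k) \<and>
         (\<forall>q\<in>polys (int k + 1). \<forall>r\<in>polys (int k + 1).
           form_grad M k \<gamma> (I_grad_T M k q) (I_grad_T M k r) = int_T M (\<lambda>x. q x * r x)) \<and>
         (\<forall>v\<in>vpolys k. \<forall>w\<in>vpolys k.
           form_curl M k (I_curl_T M k v) (I_curl_T M k w) = int_T M (\<lambda>x. v x \<bullet> w x)) \<and>
         (\<forall>v\<in>vpolys k. \<forall>w\<in>vpolys k.
           form_div M k (I_div_T M k v) (I_div_T M k w) = int_T M (\<lambda>x. v x \<bullet> w x))"
proof -
  interpret polyhedron_with_trace M k \<gamma> by unfold_locales (rule assms)+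
  show ?thesis
    by (intro conjI ballI pos_def_form_grad pos_def_form_curl pos_def_form_div)
      (erule (1) form_grad_consistent, erule (1) form_curl_consistent, erule (1) form_div_consistent)
qed

end
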